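(* Let $p>2$ be a prime, $D<0$ an odd fundamental discriminant with $p\mid D$, $K=\mathbb{Q}(\sqrt D)$, and let $\tilde{O}$ be the order attached to $D$, $p$ and the auxiliary data described in the context. Let $\mathfrak{a}$ be an ideal of $O_K$ in the class $\mathcal{A}\in\mathcal{I}(O_K)$. Then $$g_{\mathcal{A}}^{(p^2)}=\frac1{2u_D^2}\sum_{[\mathfrak{b}]\in\mathcal{I}(O_K)}\phi([\tilde{O}\mathfrak{b}],[\tilde{O}\mathfrak{a}\mathfrak{b}]),$$ where $g_{\mathcal{A}}^{(p^2)}=\sum_{m\ge0}b_{\mathcal{A}}(m)e^{2\pi imz}$ with $$b_{\mathcal{A}}(m)=\frac{1-\varepsilon_D(p^2\eta)}{2}\cdot\frac{h(D)}{u_D}\,r_{\mathcal{A}}(m)+\sum_{\mathrm{gen}[\mathfrak{r}]\in Q}\ \sum_{1\le n\le|D|m/p^2}\delta(n)\,r_{\mathcal{A}}(m|D|-p^2n)\,R_{\mathrm{gen}[\mathcal{A}\mathfrak{r}]}(n).$$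
   Context: $O_K$ is the ring of integers of $K$, $\mathcal{I}(O_K)$ its class group, $h(D)$ the class number, $u_D=\tfrac12\#O_K^\times$, $\varepsilon_D(n)=\left(\frac{D}{n}\right)$, $\eta=\gcd(p^2,D)=p$ (so $\varepsilon_D(p^2\eta)=0$). Put $p^*=\left(\frac{-1}{p}\right)p$ and $D=p^*D_0$. $\delta(n)=2^t$ with $t$ the number of prime factors of $\gcd(n,D_0)$. For $n\ge1$, $r_{\mathcal{A}}(n)$ is the number of integral ideals of norm $n$ in the class $\mathcal{A}$, and $r_{\mathcal{A}}(0)=\frac1{2u_D}$. The genus of an ideal or class is its coset modulo squares in the class group; $R_{\mathrm{gen}[\mathfrak{c}]}(n)$ is the number of integral ideals of norm $n$ in that genus; $Q$ is the set of genera $\mathrm{gen}[\mathfrak{r}]$ of ideals $\mathfrak{r}$ of norm $\equiv-p^2\pmod{D_0}$. Fix a prime $q>0$ with $q\nmid2D$, $\left(\frac{-q}{p}\right)=-1$, and $q\equiv-1\pmod{D_0}$ (then $q$ splits in $K$), and an ideal $\mathfrak{q}$ of $O_K$ of norm $q$. Let $B=K+Kj$ with $j^2=-q$, $jk=\bar kj$ for $k\in K$; this is a quaternion algebra ramified exactly at $p$ and $\infty$, with reduced norm $N$. Let $\mathfrak{D}_0$ and $\mathfrak{p}_K$ be the ideals of $O_K$ of norm $|D_0|$ and $p$. Then $$\tilde{O}=\{\alpha+\beta j:\alpha\in\mathfrak{D}_0^{-1},\ \beta\in\mathfrak{D}_0^{-1}\mathfrak{p}_K\mathfrak{q}^{-1},\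 \alpha-q\beta\in O_K\}$$ is an order, of index $p$ in a maximal order of $B$. The norm $N(\mathfrak{c})$ of a lattice $\mathfrak{c}\subset B$ is the positive rational gcd of the $N(x)$, $x\in\mathfrak{c}$. A left $\tilde{O}$-ideal is a lattice $\mathfrak{c}\subset B$ with $\mathfrak{c}_\ell=\tilde{O}_\ell x_\ell$, $x_\ell\in B_\ell^\times$, for every prime $\ell$; classes are modulo right multiplication by $B^\times$. For an ideal $\mathfrak{b}$ of $O_K$, $\tilde{O}\mathfrak{b}$ is the left $\tilde{O}$-ideal generated by $\mathfrak{b}$. For left $\tilde{O}$-ideals $\mathfrak{c},\mathfrak{d}$, $$\phi([\mathfrak{c}],[\mathfrak{d}])=\tfrac12\sum_{x\in\mathfrak{c}^{-1}\mathfrak{d}}e^{2\pi iz\,N(x)/N(\mathfrak{c}^{-1}\mathfrak{d})},\qquad \mathfrak{c}^{-1}=N(\mathfrak{c})^{-1}\bar{\mathfrak{c}}.$$ *)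

theory Defs
  imports
    "HOL-Analysis.Analysis"
    "HOL-Algebra.QuotRing"
    "HOL-Number_Theory.Number_Theory"
    "HOL-Computational_Algebra.Squarefree"
    "HOL-Computational_Algebra.Group_Closure"
begin

section \<open>Arithmetic of the discriminant\<close>

definition fundamental_discriminant :: "int \<Rightarrow> bool" where
  "fundamental_discriminant D \<longleftrightarrow> D \<noteq> 1 \<and>
     (([D = 1] (mod 4) \<and> squarefree D) \<or>
      (4 dvd D \<and> (D div 4) mod 4 \<in> {2, 3} \<and> squarefree (D div 4)))"

definition kronecker_prime :: "int \<Rightarrow> nat \<Rightarrow> int" where
  "kronecker_prime D l =
     (if l = 2 then (if even D then 0 else if D mod 8 \<in> {1, 7} then 1 else - 1)
      else Legendre D (int l))"

text \<open>The Kronecker symbol $(D/n)$ for $n \ge 1$.\<close>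

definition kronecker :: "int \<Rightarrow> nat \<Rightarrow> int" where
  "kronecker D n = (\<Prod>l\<in>#prime_factorization n. kronecker_prime D l)"

definition p_star :: "nat \<Rightarrow> int" where
  "p_star p = Legendre (- 1) (int p) * int p"

text \<open>The integer $D_0$ with $D = p^* D_0$; it may have either sign.\<close>

definition D_zero :: "int \<Rightarrow> nat \<Rightarrow> int" where
  "D_zero D p = D div p_star p"

definition delta :: "int \<Rightarrow> nat \<Rightarrow> nat \<Rightarrow> nat" where
  "delta D p n = 2 ^ card (prime_factors (gcd (int n) (D_zero D p)))"


section \<open>The quadratic field and its ideals\<close>

text \<open>$K = \mathbb{Q}(\sqrt D)$ is realised inside the complex numbers; for $D < 0$ its
  nontrivial automorphism is the restriction of \<^const>\<open>cnj\<close>.\<close>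

definition quad_field :: "int \<Rightarrow> complex set" where
  "quad_field D = {of_rat a + of_rat b * csqrt (of_int D) | a b. True}"

definition O_K :: "int \<Rightarrow> complex ring" where
  "O_K D = \<lparr>carrier = {x \<in> quad_field D. algebraic_int x},
     mult = (*), one = 1, zero = 0, add = (+)\<rparr>"

definition unit_half :: "int \<Rightarrow> real" where
  "unit_half D = real (card (Units (O_K D))) / 2"

definition nonzero_ideal :: "int \<Rightarrow> complex set \<Rightarrow> bool" where
  "nonzero_ideal D I \<longleftrightarrow> ideal I (O_K D) \<and> I \<noteq> {0}"

definition ideal_norm :: "int \<Rightarrow> complex set \<Rightarrow> nat" where
  "ideal_norm D I = Coset.order (O_K D Quot I)"

definition fractional_ideal :: "int \<Rightarrow> complex set \<Rightarrow> bool" where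
  "fractional_ideal D I \<longleftrightarrow> I \<subseteq> quad_field D \<and>
     (\<exists>d \<in> carrier (O_K D). d \<noteq> 0 \<and> nonzero_ideal D ((\<lambda>x. d * x) ` I))"

definition ideal_group :: "int \<Rightarrow> complex set monoid" where
  "ideal_group D = \<lparr>carrier = {I. fractional_ideal D I},
     mult = (\<lambda>I J. group_closure {x * y | x y. x \<in> I \<and> y \<in> J}),
     one = carrier (O_K D)\<rparr>"

definition principal_ideals :: "int \<Rightarrow> complex set set" where
  "principal_ideals D =
     {(\<lambda>x. k * x) ` carrier (O_K D) | k. k \<in> quad_field D \<and> k \<noteq> 0}"

definition class_group :: "int \<Rightarrow> complex set set monoid" where
  "class_group D = ideal_group D Mod principal_ideals D"

definition ideal_class :: "int \<Rightarrow> complex set \<Rightarrow> complex set set" where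
  "ideal_class D I = principal_ideals D #>\<^bsub>ideal_group D\<^esub> I"

definition class_number :: "int \<Rightarrow> nat" where
  "class_number D = Coset.order (class_group D)"

definition class_squares :: "int \<Rightarrow> complex set set set" where
  "class_squares D = {C \<otimes>\<^bsub>class_group D\<^esub> C | C. C \<in> carrier (class_group D)}"

definition genus :: "int \<Rightarrow> complex set set \<Rightarrow> complex set set set" where
  "genus D C = class_squares D #>\<^bsub>class_group D\<^esub> C"

definition num_ideals :: "int \<Rightarrow> complex set set \<Rightarrow> nat \<Rightarrow> real" where
  "num_ideals D A n = (if n = 0 then 1 / (2 * unit_half D)
     else real (card {I. nonzero_ideal D I \<and> ideal_norm D I = n \<and> ideal_class D I = A}))"

definition num_ideals_genus :: "int \<Rightarrow> complex set set set \<Rightarrow> nat \<Rightarrow> nat" where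
  "num_ideals_genus D G n = card {I. nonzero_ideal D I \<and> ideal_norm D I = n \<and> ideal_class D I \<in> G}"

definition genera_Q :: "int \<Rightarrow> nat \<Rightarrow> complex set set set set" where
  "genera_Q D p = {genus D (ideal_class D R) | R.
     nonzero_ideal D R \<and> [int (ideal_norm D R) = - (int p ^ 2)] (mod D_zero D p)}"

text \<open>If $G = \mathrm{gen}[\mathfrak{r}]$, then the left coset \<open>A <# G\<close> is
  $\mathrm{gen}[\mathcal{A}\mathfrak{r}]$.\<close>

definition b_coeff :: "int \<Rightarrow> nat \<Rightarrow> complex set set \<Rightarrow> nat \<Rightarrow> real" where
  "b_coeff D p A m =
     (let \<eta> = nat (gcd (int p ^ 2) D) in
      (1 - of_int (kronecker D (p ^ 2 * \<eta>))) / 2 * (real (class_number D) / unit_half D) * num_ideals D A m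
      + (\<Sum>G\<in>genera_Q D p. \<Sum>n | 1 \<le> n \<and> real n \<le> real_of_int \<bar>D\<bar> * real m / real p ^ 2.
           real (delta D p n) * num_ideals D A (m * nat \<bar>D\<bar> - p ^ 2 * n)
             * real (num_ideals_genus D (A <#\<^bsub>class_group D\<^esub> G) n)))"

definition g_series :: "int \<Rightarrow> nat \<Rightarrow> complex set set \<Rightarrow> complex \<Rightarrow> complex" where
  "g_series D p A z = (\<Sum>m. of_real (b_coeff D p A m) * exp (2 * of_real pi * \<i> * of_nat m * z))"


section \<open>The quaternion algebra and its lattices\<close>

text \<open>The pair $(\alpha, \beta)$ stands for $\alpha + \beta j$, where $j^2 = -q$ and
  $j k = \bar k j$ for $k \in K$.\<close>

definition quat_alg :: "int \<Rightarrow> nat \<Rightarrow> (complex \<times> complex) ring" where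
  "quat_alg D q = \<lparr>carrier = quad_field D \<times> quad_field D,
     mult = (\<lambda>(a, b) (c, d). (a * c - of_nat q * b * cnj d, a * d + b * cnj c)),
     one = (1, 0), zero = (0, 0), add = (+)\<rparr>"

definition quat_conj :: "complex \<times> complex \<Rightarrow> complex \<times> complex" where
  "quat_conj = (\<lambda>(a, b). (cnj a, - b))"

text \<open>$N(\alpha + \beta j) = \alpha\bar\alpha + q\beta\bar\beta$.\<close>

definition reduced_norm :: "nat \<Rightarrow> complex \<times> complex \<Rightarrow> real" where
  "reduced_norm q = (\<lambda>(a, b). (cmod a)\<^sup>2 + real q * (cmod b)\<^sup>2)"

definition lattice_mult ::
    "int \<Rightarrow> nat \<Rightarrow> (complex \<times> complex) set \<Rightarrow> (complex \<times> complex) set \<Rightarrow> (complex \<times> complex) set" where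
  "lattice_mult D q X Y =
     group_closure {x \<otimes>\<^bsub>quat_alg D q\<^esub> y | x y. x \<in> X \<and> y \<in> Y}"

text \<open>The positive rational gcd of the reduced norms: the positive rational number that divides
  all of them and is divisible by every positive rational number dividing all of them, where
  divisibility means that the quotient is an integer.\<close>

definition lattice_norm :: "nat \<Rightarrow> (complex \<times> complex) set \<Rightarrow> real" where
  "lattice_norm q X = (THE t. t \<in> \<rat> \<and> t > 0 \<and> (\<forall>x\<in>X. reduced_norm q x / t \<in> \<int>) \<and>
     (\<forall>s\<in>\<rat>. s > 0 \<and> (\<forall>x\<in>X. reduced_norm q x / s \<in> \<int>) \<longrightarrow> t / s \<in> \<int>))"

definition lattice_inv :: "nat \<Rightarrow> (complex \<times> complex) set \<Rightarrow> (complex \<times> complex) set" where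
  "lattice_inv q X = (\<lambda>x. inverse (lattice_norm q X) *\<^sub>R quat_conj x) ` X"

definition O_tilde :: "int \<Rightarrow> nat \<Rightarrow> complex set \<Rightarrow> complex set \<Rightarrow> complex set \<Rightarrow> (complex \<times> complex) set" where
  "O_tilde D q D\<^sub>0_ideal p_ideal q_ideal =
     {(\<alpha>, \<beta>). \<alpha> \<in> inv\<^bsub>ideal_group D\<^esub> D\<^sub>0_ideal \<and>
        \<beta> \<in> inv\<^bsub>ideal_group D\<^esub> D\<^sub>0_ideal \<otimes>\<^bsub>ideal_group D\<^esub> p_ideal
               \<otimes>\<^bsub>ideal_group D\<^esub> inv\<^bsub>ideal_group D\<^esub> q_ideal \<and>
        \<alpha> - of_nat q * \<beta> \<in> carrier (O_K D)}"

text \<open>The left module over the order \<open>Ot\<close> generated by an ideal of $O_K$.\<close>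

definition extend_ideal :: "int \<Rightarrow> nat \<Rightarrow> (complex \<times> complex) set \<Rightarrow> complex set \<Rightarrow> (complex \<times> complex) set" where
  "extend_ideal D q Ot I = lattice_mult D q Ot ((\<lambda>x. (x, 0)) ` I)"

definition left_class :: "int \<Rightarrow> nat \<Rightarrow> (complex \<times> complex) set \<Rightarrow> (complex \<times> complex) set set" where
  "left_class D q X = {X #>\<^bsub>quat_alg D q\<^esub> y | y. y \<in> Units (quat_alg D q)}"

definition theta :: "int \<Rightarrow> nat \<Rightarrow> (complex \<times> complex) set \<Rightarrow> (complex \<times> complex) set \<Rightarrow> complex \<Rightarrow> complex" where
  "theta D q X Y z =
     (let L = lattice_mult D q (lattice_inv q X) Y in
      1 / 2 * (\<Sum>\<^sub>\<infinity>x\<in>L. exp (2 * of_real pi * \<i> * z * of_real (reduced_norm q x / lattice_norm q L))))"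

text \<open>The value does not depend on the representatives: replacing $\mathfrak{c}, \mathfrak{d}$ by
  $\mathfrak{c}x, \mathfrak{d}y$ turns $L = \mathfrak{c}^{-1}\mathfrak{d}$ into $x^{-1}Ly$.\<close>

definition phi :: "int \<Rightarrow> nat \<Rightarrow> (complex \<times> complex) set set \<Rightarrow> (complex \<times> complex) set set \<Rightarrow> complex \<Rightarrow> complex" where
  "phi D q C C' z = theta D q (SOME X. X \<in> C) (SOME Y. Y \<in> C') z"

end

theory Submission
  imports Defs
begin

text \<open>
  Since $q \equiv -1$ modulo $D_0$, the order $\tilde O$ consists of the elements
  $(x + (p/q) y j)/\sqrt D$ with $x \in \mathfrak{p}_K$, $y \in \bar{\mathfrak{q}}$ and
  $\mathrm{tr}(x) \equiv p\,\mathrm{tr}(y)$ modulo $D_0$. For $\mathfrak{a}$ and $\mathfrak{b}$ of norm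
  coprime to $D_0$, the lattice $\mathfrak{b}^{-1}\tilde O\mathfrak{a}\mathfrak{b}$ has a description of
  the same shape, with $x$ in an ideal of the class of $\bar{\mathfrak{a}}$ up to ramified ideals and
  with $y$ in an ideal whose class varies with $\mathfrak{b}$ through a coset of the squares. Multiplying
  $\mathfrak{b}$ by the ramified ideal of norm $d \mid D_0$ changes the sign of the congruence at the
  primes dividing $d$. The norm form is such that at each prime $l \mid D_0$ one of the two signs holds,
  and both hold exactly when $l$ divides the norm $n$ attached to $y$. So, summed over all $d \mid D_0$,
  a pair $(x, y)$ of the right total norm is counted $\delta(n)$ times, and counting elements of ideals
  by integral ideals yields the products $r_{\mathcal{A}} R_{\mathrm{gen}}$.

  Two facts of genus theory finish the argument. The set $Q$ is the single genus of $\mathfrak{q}$: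
  an ideal whose norm is a square modulo $D_0$, hence by reciprocity modulo $D$, has the class of a
  square, because its norm is the norm of an element of $K$ by Legendre's theorem and Hilbert's
  Theorem 90 applies. And the number of classes of
  order dividing two is the number of divisors of $D_0$, which matches the number of ramified ideals
  averaged over.
\<close>

section \<open>Subgroups generated by products\<close>

text \<open>A single value of phi is not a sum of products of representation numbers, because the
  congruence modulo D_0 ties the traces of x and y together. The products appear only after the sum
  over the classes has been replaced by its average over all translates by ramified ideals of norm d
  dividing D_0, which permute the classes; then the congruence dissolves into the weight delta(n).
  The factor 2^t so introduced, with t the number of primes of D_0, has to leave again: for n = 0 it
  is the weight delta(0), for n > 0 it is the number of classes of order at most two. The prime p is
  kept out of these d because sqrt D makes the ideals of norm d and |D|/d equivalent, and dropping p
  selects one of each such pair. The explicit lattices require norms prime to D_0, so all ideals are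
  first moved inside their classes by scalars, which leave the left classes unchanged. Norms of
  fractional ideals are defined through the product of an ideal with its conjugate; inverses and
  multiplicativity then become formal, and the index is compared with this norm only once, through a
  basis in Hermite form.\<close>

lemma group_closure_subset: "S \<subseteq> group_closure S"
  by (auto intro: group_closure.base)

lemma group_closure_minimal:
  assumes "S \<subseteq> H" "0 \<in> H" "\<And>x y. x \<in> H \<Longrightarrow> y \<in> H \<Longrightarrow> x - y \<in> H"
  shows "group_closure S \<subseteq> H"
proof
  fix x assume "x \<in> group_closure S"
  then show "x \<in> H" by induction (use assms in auto)
qed

lemma group_closure_mono: "S \<subseteq> T \<Longrightarrow> group_closure S \<subseteq> group_closure T"
  by (rule group_closure_minimal) (auto intro: group_closure.base group_closure.diff)

definition biadditive :: "('a::ab_group_add \<Rightarrow> 'b::ab_group_add \<Rightarrow> 'c::ab_group_add) \<Rightarrow> bool" where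
  "biadditive f \<longleftrightarrow> (\<forall>x y z. f (x - y) z = f x z - f y z) \<and> (\<forall>x y z. f x (y - z) = f x y - f x z)"

lemma biadditive_zero:
  assumes "biadditive f" shows "f 0 y = 0" "f x 0 = 0"
  using assms unfolding biadditive_def by (metis diff_self)+

lemma group_closure_products:
  assumes f: "biadditive f" and x: "x \<in> group_closure X" and y: "y \<in> group_closure Y"
  shows "f x y \<in> group_closure {f x y | x y. x \<in> X \<and> y \<in> Y}" (is "_ \<in> group_closure ?S")
proof -
  \<comment> \<open>The inductive set \<open>group_closure\<close> starts from
    \<open>insert 0 X\<close>, so the base cases have to cover 0 as well.\<close>
  have 1: "f x y \<in> group_closure ?S" if "x \<in> insert 0 X" for x
    using y
  proof induction
    case (base y)
    then show ?case using that biadditive_zero[OF f] by (auto intro: group_closure.base)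
  next
    case (diff s t)
    then show ?case using f unfolding biadditive_def by (auto intro: group_closure.diff)
  qed
  show ?thesis using x
  proof induction
    case (base x)
    then show ?case using 1 by blast
  next
    case (diff s t)
    then show ?case using f unfolding biadditive_def by (auto intro: group_closure.diff)
  qed
qed

text \<open>Both sides are the group generated by the triple products. Associativity is asked only
  on the generators and \<open>f\<close> is an arbitrary biadditive map, so one proof serves
  products of ideals and products of quaternion lattices.\<close>

lemma group_closure_assoc:
  assumes f: "biadditive f" and assoc: "\<And>x y z. x \<in> X \<Longrightarrow> y \<in> Y \<Longrightarrow> z \<in> Z \<Longrightarrow> f (f x y) z = f x (f y z)"
  shows "group_closure {f x y | x y. x \<in> group_closure {f x y | x y. x \<in> X \<and> y \<in> Y} \<and> y \<in> Z} =
    group_closure {f x y | x y. x \<in> X \<and> y \<in> group_closure {f x y | x y. x \<in> Y \<and> y \<in> Z}}"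
    (is "?L = ?R")
proof -
  let ?XY = "{f x y | x y. x \<in> X \<and> y \<in> Y}" and ?YZ = "{f x y | x y. x \<in> Y \<and> y \<in> Z}"
  let ?l = "{f x y | x y. x \<in> ?XY \<and> y \<in> Z}" and ?r = "{f x y | x y. x \<in> X \<and> y \<in> ?YZ}"
  have "?l \<subseteq> ?r"
  proof
    fix w assume "w \<in> ?l"
    then obtain x y z where "x \<in> X" "y \<in> Y" "z \<in> Z" "w = f (f x y) z" by blast
    then show "w \<in> ?r" using assoc by blast
  qed
  moreover have "?r \<subseteq> ?l"
  proof
    fix w assume "w \<in> ?r"
    then obtain x y z where xyz: "x \<in> X" "y \<in> Y" "z \<in> Z" "w = f x (f y z)" by blast
    then have "w = f (f x y) z" using assoc by simp
    then show "w \<in> ?l" using xyz by blast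
  qed
  ultimately have 1: "?l = ?r" by blast
  have "f u z \<in> group_closure ?l" if "u \<in> group_closure ?XY" "z \<in> Z" for u z
    using group_closure_products[OF f that(1), of z Z] that(2) by (blast intro: group_closure.base)
  then have "?L \<subseteq> group_closure ?l"
    by (intro group_closure_minimal) (auto intro: group_closure.diff)
  moreover have "group_closure ?l \<subseteq> ?L"
    by (rule group_closure_mono) (use group_closure_subset[of ?XY] in blast)
  moreover have "f x u \<in> group_closure ?r" if "x \<in> X" "u \<in> group_closure ?YZ" for x u
    using group_closure_products[OF f _ that(2), of x X] that(1) by (blast intro: group_closure.base)
  then have "?R \<subseteq> group_closure ?r"
    by (intro group_closure_minimal) (auto intro: group_closure.diff)
  moreover have "group_closure ?r \<subseteq> ?R"
    by (rule group_closure_mono) (use group_closure_subset[of ?YZ] in blast)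
  ultimately show ?thesis unfolding 1 by blast
qed

lemma group_closure_image:
  assumes h: "\<And>x y. h (x - y) = h x - h y"
  shows "group_closure (h ` S) = h ` group_closure S"
proof
  have h0: "h 0 = 0" using h[of 0 0] by simp
  show "group_closure (h ` S) \<subseteq> h ` group_closure S"
  proof (rule group_closure_minimal)
    show "0 \<in> h ` group_closure S" using h0 by (intro image_eqI[of _ _ 0]) auto
    show "x - y \<in> h ` group_closure S" if "x \<in> h ` group_closure S" "y \<in> h ` group_closure S" for x y
      using that by (auto simp flip: h intro!: imageI group_closure.diff)
  qed (auto intro: group_closure.base)
  show "h ` group_closure S \<subseteq> group_closure (h ` S)"
  proof safe
    fix x assume "x \<in> group_closure S"
    then show "h x \<in> group_closure (h ` S)"
      by induction (auto simp: h h0 intro: group_closure.base group_closure.diff)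
  qed
qed


section \<open>Integers of an imaginary quadratic field\<close>

text \<open>The square of the reduced denominator of r divides the squarefree D. In
  \<open>OK_iff\<close> this yields integrality of the sqrt D coordinate of an algebraic
  integer.\<close>

lemma rat_square_int:
  fixes D u :: int and r :: rat
  assumes "squarefree D" "of_int D * r\<^sup>2 = of_int u" shows "r \<in> \<int>"
proof -
  obtain s t where st: "quotient_of r = (s, t)" by force
  have t: "t > 0" "coprime s t" "r = of_int s / of_int t"
    using quotient_of_denom_pos[OF st] quotient_of_coprime[OF st] quotient_of_div[OF st] by auto
  have "of_int D * (of_int s)\<^sup>2 = (of_int u * (of_int t)\<^sup>2 :: rat)"
    using assms(2) t by (simp add: field_simps power_divide)
  then have "of_int (D * s\<^sup>2) = (of_int (u * t\<^sup>2) :: rat)" by simp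
  then have "D * s\<^sup>2 = u * t\<^sup>2" by (simp only: of_int_eq_iff)
  then have "t\<^sup>2 dvd D * s\<^sup>2" by simp
  moreover have "coprime (t\<^sup>2) (s\<^sup>2)" using t by (simp add: coprime_commute)
  ultimately have "t\<^sup>2 dvd D" by (simp add: coprime_dvd_mult_left_iff)
  then have "t dvd 1" using assms(1) unfolding squarefree_def by blast
  then have "t = 1" using t by simp
  then show ?thesis using t by simp
qed

text \<open>Every power of the reduced denominator of r divides d. This is integral closedness of
  the integers, phrased through bounded denominators, which is the form that
  \<open>K_alg_int_denominators\<close> can supply.\<close>

lemma rat_bounded_powers_int:
  fixes r :: rat and d :: int
  assumes "d \<noteq> 0" "\<And>k. of_int d * r ^ k \<in> \<int>" shows "r \<in> \<int>"
proof -
  obtain s t where st: "quotient_of r = (s, t)" by force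
  have t: "t > 0" "coprime s t" "r = of_int s / of_int t"
    using quotient_of_denom_pos[OF st] quotient_of_coprime[OF st] quotient_of_div[OF st] by auto
  have dv: "t ^ k dvd d" for k
  proof -
    obtain u where "of_int d * r ^ k = of_int u" using assms(2)[of k] by (auto elim!: Ints_cases)
    then have "of_int d * of_int s ^ k = (of_int u * of_int t ^ k :: rat)"
      using t by (simp add: field_simps power_divide)
    then have "of_int (d * s ^ k) = (of_int (u * t ^ k) :: rat)" by simp
    then have "d * s ^ k = u * t ^ k" by (simp only: of_int_eq_iff)
    then have "t ^ k dvd d * s ^ k" by simp
    moreover have "coprime (t ^ k) (s ^ k)" using t by (simp add: coprime_commute)
    ultimately show ?thesis by (simp add: coprime_dvd_mult_left_iff)
  qed
  have "t = 1"
  proof (rule ccontr)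
    assume "t \<noteq> 1"
    then have "t \<ge> 2" using t by simp
    \<comment> \<open>The exponent |d| is large enough because 2^n > n.\<close>
    define k where "k = nat \<bar>d\<bar>"
    have "\<bar>d\<bar> < 2 ^ k" unfolding k_def using of_nat_less_two_power[of "nat \<bar>d\<bar>", where 'a=int] by simp
    also have "2 ^ k \<le> t ^ k" using \<open>t \<ge> 2\<close> by (intro power_mono) auto
    also have "t ^ k \<le> \<bar>d\<bar>" using dvd_imp_le_int[OF assms(1) dv[of k]] t by simp
    finally show False by simp
  qed
  then show ?thesis using t by simp
qed

lemma of_real_of_rat: "of_real (of_rat r) = (of_rat r :: 'a::{field_char_0,real_field})"
  by (cases r) (simp add: of_rat_rat)

locale imag_quad =
  fixes D :: int
  assumes D_neg: "D < 0" and D_odd: "odd D" and D_fund: "fundamental_discriminant D"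
begin

lemma D_mod4: "[D = 1] (mod 4)" and D_sqf: "squarefree D"
proof -
  have "\<not> 4 dvd D" using D_odd by presburger
  then show "[D = 1] (mod 4)" "squarefree D"
    using D_fund unfolding fundamental_discriminant_def by auto
qed

lemma D_le: "D \<le> -3"
  using D_mod4 D_neg D_odd unfolding cong_def by presburger

definition rt :: complex where "rt = csqrt (of_int D)"

lemma rt_alt: "rt = \<i> * of_real (sqrt (- of_int D))"
proof -
  have "csqrt (- of_real (of_int (-D))) = \<i> * csqrt (of_real (of_int (-D)))"
    using D_neg by (intro csqrt_minus) auto
  then show ?thesis using D_neg by (simp add: rt_def csqrt_of_real_nonneg)
qed

lemma rt_sq: "rt * rt = of_int D" "rt\<^sup>2 = of_int D"
  unfolding rt_def by (simp_all flip: power2_eq_square)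

lemma rt_nz [simp]: "rt \<noteq> 0" using rt_sq D_neg by auto
lemma cnj_rt [simp]: "cnj rt = - rt" by (simp add: rt_alt)
lemma Re_rt [simp]: "Re rt = 0" by (simp add: rt_alt)
lemma Im_rt: "Im rt = sqrt (- of_int D)" by (simp add: rt_alt)
lemma Im_rt_pos: "Im rt > 0" using D_neg by (simp add: Im_rt)
lemma Im_rt_sq: "(Im rt)\<^sup>2 = - of_int D" "Im rt * Im rt = - of_int D"
  using D_neg by (simp_all add: Im_rt)
lemma cmod_rt: "(cmod rt)\<^sup>2 = - of_int D" by (simp add: cmod_power2 Im_rt_sq)

definition K :: "complex set" where "K = quad_field D"

text \<open>Since \<open>rt\<close> is purely imaginary, Re x and Im x / Im rt are the coordinates
  of x in the basis 1, \<open>rt\<close>. Closure properties of K thus reduce to those of the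
  rationals.\<close>

lemma K_iff: "x \<in> K \<longleftrightarrow> Re x \<in> \<rat> \<and> Im x / Im rt \<in> \<rat>"
proof
  assume "x \<in> K"
  then obtain a b where "x = of_rat a + of_rat b * rt"
    by (auto simp: K_def quad_field_def rt_def)
  then have "x = of_real (of_rat a) + of_real (of_rat b) * rt"
    by (simp add: of_real_of_rat)
  then show "Re x \<in> \<rat> \<and> Im x / Im rt \<in> \<rat>" using Im_rt_pos by simp
next
  assume "Re x \<in> \<rat> \<and> Im x / Im rt \<in> \<rat>"
  then obtain a b where ab: "Re x = of_rat a" "Im x / Im rt = of_rat b" by (auto simp: Rats_def)
  have "x = of_real (of_rat a) + of_real (of_rat b) * rt"
    using ab Im_rt_pos by (simp add: complex_eq_iff field_simps)
  then have "x = of_rat a + of_rat b * rt"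
    by (simp add: of_real_of_rat)
  then show "x \<in> K" by (auto simp: K_def quad_field_def rt_def)
qed

lemma K_0 [simp, intro]: "0 \<in> K" and K_1 [simp, intro]: "1 \<in> K"
  and K_rt [simp, intro]: "rt \<in> K" and K_of_int [simp, intro]: "of_int n \<in> K"
  and K_of_nat [simp, intro]: "of_nat m \<in> K"
  using Im_rt_pos by (simp_all add: K_iff)

lemma K_of_real [intro]: "r \<in> \<rat> \<Longrightarrow> of_real r \<in> K"
  by (simp add: K_iff)

lemma K_add [intro]: "x \<in> K \<Longrightarrow> y \<in> K \<Longrightarrow> x + y \<in> K"
  and K_diff [intro]: "x \<in> K \<Longrightarrow> y \<in> K \<Longrightarrow> x - y \<in> K"
  and K_minus [intro]: "x \<in> K \<Longrightarrow> - x \<in> K"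
  and K_cnj [intro]: "x \<in> K \<Longrightarrow> cnj x \<in> K"
  by (simp_all add: K_iff add_divide_distrib diff_divide_distrib)

lemma K_mult [intro]: assumes "x \<in> K" "y \<in> K" shows "x * y \<in> K"
proof -
  have r: "Re (x * y) = Re x * Re y + of_int D * (Im x / Im rt) * (Im y / Im rt)"
    using Im_rt_pos D_neg Im_rt_sq by (simp add: field_simps)
  have i: "Im (x * y) / Im rt = Re x * (Im y / Im rt) + (Im x / Im rt) * Re y"
    using Im_rt_pos by (simp add: field_simps)
  show ?thesis using assms unfolding K_iff r i by (intro conjI Rats_add Rats_mult Rats_of_int) auto
qed

lemma K_Rats_norm: assumes "x \<in> K" shows "(cmod x)\<^sup>2 \<in> \<rat>"
proof -
  have r: "(cmod x)\<^sup>2 = Re x * Re x - of_int D * (Im x / Im rt) * (Im x / Im rt)"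
    using Im_rt_pos D_neg Im_rt_sq unfolding cmod_power2 by (simp add: field_simps power2_eq_square)
  show ?thesis using assms unfolding K_iff r by (intro Rats_diff Rats_mult Rats_of_int) auto
qed

lemma K_inverse [intro]: assumes "x \<in> K" shows "inverse x \<in> K"
proof (cases "x = 0")
  case False
  have "of_real ((cmod x)\<^sup>2) = x * cnj x" by (rule complex_norm_square)
  then have "inverse x = of_real (inverse ((cmod x)\<^sup>2)) * cnj x"
    using False by (simp only: of_real_inverse) simp
  moreover have "of_real (inverse ((cmod x)\<^sup>2)) * cnj x \<in> K"
    using assms by (intro K_mult K_cnj K_of_real Rats_inverse K_Rats_norm)
  ultimately show ?thesis by simp
qed simp

lemma K_divide [intro]: "x \<in> K \<Longrightarrow> y \<in> K \<Longrightarrow> x / y \<in> K"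
  by (simp add: divide_inverse K_mult K_inverse)

definition OK :: "complex set" where "OK = carrier (O_K D)"

text \<open>Half-integral coordinates: u is the trace of \<open>el u v\<close>, and the integers of
  K turn out to be the \<open>el u v\<close> with u + v even, because D = 1 modulo 4.\<close>

definition el :: "int \<Rightarrow> int \<Rightarrow> complex" where "el u v = (of_int u + of_int v * rt) / 2"

lemma Re_el [simp]: "Re (el u v) = of_int u / 2" and Im_el [simp]: "Im (el u v) = of_int v * Im rt / 2"
  by (simp_all add: el_def)

lemma el_inj: "el u v = el u' v' \<longleftrightarrow> u = u' \<and> v = v'"
  using Im_rt_pos by (auto simp: complex_eq_iff)

lemma cmod_el: "4 * (cmod (el u v))\<^sup>2 = of_int (u\<^sup>2 - D * v\<^sup>2)"
  using Im_rt_sq by (simp add: cmod_power2 power_divide power_mult_distrib)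

lemma el_in_K [simp]: "el u v \<in> K"
  using Im_rt_pos by (simp add: K_iff)

lemma quadratic_algebraic_int:
  assumes "2 * Re x \<in> \<int>" "(cmod x)\<^sup>2 \<in> \<int>" shows "algebraic_int x"
proof -
  obtain t n where tn: "2 * Re x = of_int t" "(cmod x)\<^sup>2 = of_int n"
    using assms by (auto elim!: Ints_cases)
  have t: "of_int t = x + cnj x" using tn(1) by (simp add: complex_eq_iff)
  have n: "of_int n = x * cnj x"
    using tn(2) by (metis complex_norm_square of_real_of_int_eq)
  have "poly [:of_int n, - of_int t, 1:] x = 0" by (simp add: t n algebra_simps)
  moreover have "Polynomial.coeff [:of_int n, - of_int t, 1 :: complex:] i \<in> \<int>" for i
    by (auto simp: coeff_pCons split: nat.splits)
  moreover have "lead_coeff [:of_int n, - of_int t, 1 :: complex:] = 1" by simp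
  ultimately show ?thesis by (meson algebraic_int.intros)
qed

end

lemma abs_le_square: "\<bar>u\<bar> \<le> u\<^sup>2" for u :: int
proof (cases "u = 0")
  case False
  then have "\<bar>u\<bar> * 1 \<le> \<bar>u\<bar> * \<bar>u\<bar>" by (intro mult_left_mono) auto
  then show ?thesis by (simp add: power2_eq_square)
qed simp

context imag_quad begin

text \<open>A monic integral equation of degree n expresses x^k for k >= n through lower powers with
  integer coefficients, so a common denominator of 1, x, ..., x^(n-1) serves for all powers.\<close>

lemma K_alg_int_denominators:
  assumes "x \<in> K" "algebraic_int x"
  shows "\<exists>d::int. d \<noteq> 0 \<and> (\<forall>k. \<exists>s t. of_int d * x ^ k = of_int s + of_int t * rt)"
proof -
  define L where "L = {of_int s + of_int t * rt | s t. True}"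
  have L_add: "a + b \<in> L" if "a \<in> L" "b \<in> L" for a b
  proof -
    from that obtain s t s' t' where "a = of_int s + of_int t * rt" "b = of_int s' + of_int t' * rt"
      unfolding L_def by blast
    then have "a + b = of_int (s + s') + of_int (t + t') * rt" by (simp add: algebra_simps)
    then show ?thesis unfolding L_def by blast
  qed
  have L_scale: "of_int n * a \<in> L" if "a \<in> L" for a n
  proof -
    from that obtain s t where "a = of_int s + of_int t * rt" unfolding L_def by blast
    then have "of_int n * a = of_int (n * s) + of_int (n * t) * rt" by (simp add: algebra_simps)
    then show ?thesis unfolding L_def by blast
  qed
  have L_0: "0 \<in> L" unfolding L_def by (rule CollectI, rule exI[of _ 0], rule exI[of _ 0]) simp
  have L_sum: "sum f A \<in> L" if "\<And>i. i \<in> A \<Longrightarrow> f i \<in> L" for f :: "nat \<Rightarrow> complex" and A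
    using that by (induction A rule: infinite_finite_induct) (auto intro: L_0 L_add)
  have denom: "\<exists>d::int. d \<noteq> 0 \<and> of_int d * y \<in> L" if "y \<in> K" for y
  proof -
    from that obtain a b where y: "y = of_rat a + of_rat b * rt"
      by (auto simp: K_def quad_field_def rt_def)
    obtain a1 a2 b1 b2 where "quotient_of a = (a1, a2)" "quotient_of b = (b1, b2)" by force
    then have q: "a2 > 0" "b2 > 0" "a = of_int a1 / of_int a2" "b = of_int b1 / of_int b2"
      using quotient_of_denom_pos quotient_of_div by blast+
    have "of_int (a2 * b2) * y = of_int (a1 * b2) + of_int (b1 * a2) * rt"
      using q(1,2) unfolding y q(3,4) by (simp add: of_rat_divide field_simps)
    then have "of_int (a2 * b2) * y \<in> L" unfolding L_def by blast
    moreover have "a2 * b2 \<noteq> 0" using q(1,2) by simp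
    ultimately show ?thesis by blast
  qed
  obtain P :: "int poly" where P: "poly (map_poly of_int P) x = 0" "lead_coeff P = 1"
    using assms(2) unfolding algebraic_int_altdef_ipoly by blast
  define n where "n = Polynomial.degree P"
  have xpow: "x ^ k \<in> K" for k using assms(1) by (induction k) auto
  have "\<exists>f. \<forall>i. f i \<noteq> (0::int) \<and> of_int (f i) * x ^ i \<in> L"
    using denom[OF xpow] by metis
  then obtain f where f: "\<And>i. f i \<noteq> (0::int)" "\<And>i. of_int (f i) * x ^ i \<in> L" by blast
  define d where "d = (\<Prod>i<n. f i)"
  have d0: "d \<noteq> 0" unfolding d_def using f by simp
  have "of_int d * x ^ k \<in> L" for k
  proof (induction k rule: less_induct)
    case (less k)
    show ?case
    proof (cases "k < n")
      case True
      then have "f k dvd d" unfolding d_def by (intro dvd_prodI) auto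
      then obtain e where "d = e * f k" by (metis dvd_div_mult_self)
      then have "of_int d * x ^ k = of_int e * (of_int (f k) * x ^ k)" by simp
      then show ?thesis using f(2)[of k] L_scale by metis
    next
      case False
      have "0 = (\<Sum>i\<le>n. of_int (Polynomial.coeff P i) * x ^ i)"
        using P(1) unfolding n_def by (simp add: poly_altdef coeff_map_poly degree_map_poly)
      also have "\<dots> = (\<Sum>i<n. of_int (Polynomial.coeff P i) * x ^ i) + x ^ n"
        using P(2) unfolding n_def by (simp flip: lessThan_Suc_atMost)
      finally have xn: "x ^ n = - (\<Sum>i<n. of_int (Polynomial.coeff P i) * x ^ i)" by (simp add: eq_neg_iff_add_eq_0 add.commute)
      have "of_int d * x ^ k = of_int d * (x ^ n * x ^ (k - n))"
        using False by (simp flip: power_add)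
      also have "\<dots> = (\<Sum>i<n. of_int (- Polynomial.coeff P i) * (of_int d * x ^ (k - n + i)))"
        unfolding xn by (simp add: sum_distrib_left sum_distrib_right power_add mult_ac sum_negf)
      also have "\<dots> \<in> L"
        using False by (intro L_sum L_scale less.IH) auto
      finally show ?thesis .
    qed
  qed
  then show ?thesis using d0 unfolding L_def by blast
qed

text \<open>If d clears the denominators of all powers of y, then d^2 N(y)^k is an integer for every
  k, hence so is N(y). The element x + 1 is included because N(x + 1) - N(x) - 1 is the trace of
  x.\<close>

lemma algebraic_int_K_norm:
  assumes "x \<in> K" "algebraic_int x"
  shows "(cmod x)\<^sup>2 \<in> \<int>" "(cmod (x + 1))\<^sup>2 \<in> \<int>"
proof -
  obtain d where d: "d \<noteq> 0" "\<And>k. \<exists>s t. of_int d * x ^ k = of_int s + of_int t * rt"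
    using K_alg_int_denominators[OF assms] by blast
  have int: "(cmod y)\<^sup>2 \<in> \<int>" if yK: "y \<in> K" and y: "\<And>k. \<exists>s t. of_int d * y ^ k = of_int s + of_int t * rt" for y
  proof -
    obtain r where r: "(cmod y)\<^sup>2 = of_rat r" using K_Rats_norm[OF yK] unfolding Rats_def by blast
    have "of_int (d * d) * r ^ k \<in> \<int>" for k
    proof -
      obtain s t where st: "of_int d * y ^ k = of_int s + of_int t * rt" using y by blast
      have "of_rat (of_int (d * d) * r ^ k) = (cmod (of_int d * y ^ k))\<^sup>2"
        using r by (simp add: of_rat_mult of_rat_power norm_mult norm_power power_mult_distrib
          flip: r power_mult power2_eq_square) (simp add: mult.commute power2_eq_square)
      also have "\<dots> = of_int (s * s - D * t * t)"
        unfolding st by (simp add: cmod_power2 power_mult_distrib Im_rt_sq) (simp add: power2_eq_square)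
      finally have "(of_rat (of_int (d * d) * r ^ k) :: real) = of_rat (of_int (s * s - D * t * t))"
        by (simp only: of_rat_of_int_eq)
      then have "of_int (d * d) * r ^ k = of_int (s * s - D * t * t)" by (simp only: of_rat_eq_iff)
      then show ?thesis by (metis Ints_of_int)
    qed
    then have "r \<in> \<int>" using rat_bounded_powers_int[of "d * d"] d(1) by (metis mult_eq_0_iff)
    then show ?thesis unfolding r by (elim Ints_cases) simp
  qed
  show "(cmod x)\<^sup>2 \<in> \<int>" using int assms d by blast
  \<comment> \<open>By the binomial theorem the denominator d of the powers of x also serves for the
    powers of x + 1.\<close>
  have "\<exists>s t. of_int d * (x + 1) ^ k = of_int s + of_int t * rt" for k
  proof -
    obtain f g where fg: "\<And>k. of_int d * x ^ k = of_int (f k) + of_int (g k) * rt"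
      using d(2) by metis
    have "of_int d * (x + 1) ^ k = (\<Sum>i\<le>k. of_nat (k choose i) * (of_int d * x ^ i))"
      by (simp add: binomial_ring sum_distrib_left mult_ac)
    also have "\<dots> = of_int (\<Sum>i\<le>k. int (k choose i) * f i) + of_int (\<Sum>i\<le>k. int (k choose i) * g i) * rt"
      unfolding fg by (simp add: algebra_simps sum.distrib sum_distrib_left sum_distrib_right)
    finally show ?thesis by blast
  qed
  then show "(cmod (x + 1))\<^sup>2 \<in> \<int>"
    by (intro int K_add assms K_1)
qed

lemma el_algebraic_int:
  assumes "even (u + v)" shows "algebraic_int (el u v)"
proof (rule quadratic_algebraic_int)
  have "4 dvd u\<^sup>2 - D * v\<^sup>2"
  proof -
    obtain k where k: "D = 1 + 4 * k" using D_mod4 by (metis cong_iff_lin cong_sym)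
    obtain j where j: "u = 2 * j - v" using assms by (metis add_diff_cancel_right' dvd_def)
    have "u\<^sup>2 - D * v\<^sup>2 = 4 * (j * j - j * v - k * v * v)"
      unfolding k j by (simp add: algebra_simps power2_eq_square)
    then show ?thesis by simp
  qed
  then obtain m where "u\<^sup>2 - D * v\<^sup>2 = 4 * m" by blast
  then have "4 * (cmod (el u v))\<^sup>2 = of_int (4 * m)" using cmod_el by metis
  then have "(cmod (el u v))\<^sup>2 = of_int m" by simp
  then show "(cmod (el u v))\<^sup>2 \<in> \<int>" by simp
qed simp

lemma OK_iff: "x \<in> OK \<longleftrightarrow> (\<exists>u v. even (u + v) \<and> x = el u v)"
proof
  assume "x \<in> OK"
  then have x: "x \<in> K" "algebraic_int x" by (auto simp: OK_def O_K_def K_def)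
  obtain n n' where n: "(cmod x)\<^sup>2 = of_int n" "(cmod (x + 1))\<^sup>2 = of_int n'"
    using algebraic_int_K_norm[OF x] by (auto elim!: Ints_cases)
  have "2 * Re x = (cmod (x + 1))\<^sup>2 - (cmod x)\<^sup>2 - 1"
    unfolding cmod_power2 by (simp add: power2_eq_square algebra_simps)
  also have "\<dots> = of_int (n' - n - 1)" using n by simp
  finally obtain u where u: "2 * Re x = of_int u" by blast
  obtain r where r: "2 * (Im x / Im rt) = of_rat r"
    using x(1) unfolding K_iff by (metis Rats_cases Rats_mult Rats_number_of)
  have Imx: "Im x = of_rat r * Im rt / 2" using r Im_rt_pos by (simp add: field_simps)
  have "of_int D * (of_rat r)\<^sup>2 = (of_int (u * u - 4 * n) :: real)"
  proof -
    have "4 * (cmod x)\<^sup>2 = (2 * Re x)\<^sup>2 + (2 * Im x)\<^sup>2" by (simp add: cmod_power2 algebra_simps)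
    also have "\<dots> = of_int (u * u) - of_int D * (of_rat r)\<^sup>2"
      unfolding u Imx by (simp add: power_mult_distrib Im_rt_sq) (simp add: power2_eq_square)
    finally show ?thesis using n by simp
  qed
  then have "(of_rat (of_int D * r\<^sup>2) :: real) = of_rat (of_int (u * u - 4 * n))"
    by (simp only: of_rat_mult of_rat_power of_rat_of_int_eq)
  then have *: "of_int D * r\<^sup>2 = of_int (u * u - 4 * n)" by (simp only: of_rat_eq_iff)
  then have "r \<in> \<int>" using rat_square_int[OF D_sqf] by blast
  then obtain v where v: "r = of_int v" by (auto elim!: Ints_cases)
  have "of_int (D * v\<^sup>2) = (of_int (u * u - 4 * n) :: rat)" using * v by simp
  then have "D * v\<^sup>2 = u * u - 4 * n" by (simp only: of_int_eq_iff)
  then have "even (u + v)" using D_odd by (metis even_add even_diff even_mult_iff even_numeral even_power pos2)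
  moreover have "x = el u v" using u Imx v by (simp add: complex_eq_iff)
  ultimately show "\<exists>u v. even (u + v) \<and> x = el u v" by blast
qed (auto simp: OK_def O_K_def el_algebraic_int simp flip: K_def)

lemma OK_E: assumes "x \<in> OK" obtains u v where "even (u + v)" "x = el u v"
  using assms OK_iff by auto

lemma el_OK_iff: "el u v \<in> OK \<longleftrightarrow> even (u + v)"
  by (auto simp: OK_iff el_inj)

lemma OK_K: "x \<in> OK \<Longrightarrow> x \<in> K" by (auto simp: OK_iff)

lemma el_add: "el u v + el u' v' = el (u + u') (v + v')"
  and el_diff: "el u v - el u' v' = el (u - u') (v - v')"
  and el_minus: "- el u v = el (- u) (- v)"
  and el_cnj: "cnj (el u v) = el u (- v)"
  and el_of_int: "of_int n = el (2 * n) 0"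
  and el_rt: "rt = el 0 2"
  by (simp_all add: el_def field_simps)

lemma el_mult:
  assumes "even (u + v)" "even (u' + v')"
  obtains s t where "el u v * el u' v' = el s t" "even (s + t)"
    "2 * s = u * u' + D * v * v'" "2 * t = u * v' + v * u'"
proof -
  have e: "even (u * u' + D * v * v')" "even (u * v' + v * u')" using assms D_odd by auto
  then obtain s t where st: "u * u' + D * v * v' = 2 * s" "u * v' + v * u' = 2 * t" by (metis evenE)
  have "4 * (el u v * el u' v') = (of_int u + of_int v * rt) * (of_int u' + of_int v' * rt)"
    by (simp add: el_def)
  also have "\<dots> = of_int (u * u' + D * v * v') + of_int (u * v' + v * u') * rt"
    by (simp add: algebra_simps flip: rt_sq(1))
  also have "\<dots> = 4 * el s t" unfolding st by (simp add: el_def)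
  finally have 1: "el u v * el u' v' = el s t" by simp
  have "2 * (s + t) = (u * u' + D * v * v') + (u * v' + v * u')" using st by simp
  also have "\<dots> = (u + v) * (u' + v') + (D - 1) * v * v'" by (simp add: algebra_simps)
  also have "4 dvd \<dots>"
  proof (rule dvd_add)
    show "4 dvd (u + v) * (u' + v')" using mult_dvd_mono[OF assms] by simp
    have "4 dvd D - 1" using D_mod4 by (simp add: cong_iff_dvd_diff)
    then show "4 dvd (D - 1) * v * v'" by (simp add: mult.assoc)
  qed
  finally have "even (s + t)" by presburger
  then show ?thesis using that 1 st by presburger
qed

lemma OK_add [intro]: "x \<in> OK \<Longrightarrow> y \<in> OK \<Longrightarrow> x + y \<in> OK"
  and OK_diff [intro]: "x \<in> OK \<Longrightarrow> y \<in> OK \<Longrightarrow> x - y \<in> OK"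
  and OK_minus [intro]: "x \<in> OK \<Longrightarrow> - x \<in> OK"
  and OK_cnj [intro]: "x \<in> OK \<Longrightarrow> cnj x \<in> OK"
  and OK_of_int [simp, intro]: "of_int n \<in> OK"
  and OK_rt [simp, intro]: "rt \<in> OK"
  by (auto elim!: OK_E simp: el_add el_diff el_minus el_cnj el_of_int el_rt el_OK_iff)

lemma OK_0 [simp, intro]: "0 \<in> OK" and OK_1 [simp, intro]: "1 \<in> OK"
  and OK_of_nat [simp, intro]: "of_nat m \<in> OK"
  using OK_of_int[of 0] OK_of_int[of 1] OK_of_int[of "int m"] by simp_all

lemma OK_mult [intro]: assumes "x \<in> OK" "y \<in> OK" shows "x * y \<in> OK"
proof -
  obtain u v where "even (u + v)" "x = el u v" using assms by (elim OK_E)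
  moreover obtain u' v' where "even (u' + v')" "y = el u' v'" using assms by (elim OK_E)
  ultimately show ?thesis using el_mult el_OK_iff by metis
qed

section \<open>Trace and norm as integer-valued functions\<close>

definition T :: "complex \<Rightarrow> int" where "T x = \<lfloor>2 * Re x\<rfloor>"

lemma T_el [simp]: "T (el u v) = u" by (simp add: T_def)

lemma T_0 [simp]: "T 0 = 0" by (simp add: T_def)
lemma T_of_int [simp]: "T (of_int n) = 2 * n" using T_el by (simp only: el_of_int)
lemma of_int_T: "x \<in> OK \<Longrightarrow> of_int (T x) = 2 * Re x"
  by (elim OK_E) simp

lemma T_trace: "x \<in> OK \<Longrightarrow> of_int (T x) = x + cnj x"
  using of_int_T by (simp add: complex_eq_iff)

lemma T_add: "x \<in> OK \<Longrightarrow> y \<in> OK \<Longrightarrow> T (x + y) = T x + T y"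
  and T_diff: "x \<in> OK \<Longrightarrow> y \<in> OK \<Longrightarrow> T (x - y) = T x - T y"
  and T_minus: "x \<in> OK \<Longrightarrow> T (- x) = - T x"
  and T_cnj: "T (cnj x) = T x"
  by (auto elim!: OK_E simp: el_add el_diff el_minus) (simp add: T_def)

lemma T_int_mult: "x \<in> OK \<Longrightarrow> T (of_int n * x) = n * T x"
  using of_int_T by (simp add: T_def flip: of_int_mult) (metis floor_of_int mult.left_commute of_int_mult)

text \<open>Since rt^2 = D, half the trace is multiplicative modulo D: it is the reduction of the
  integers of K modulo sqrt D. All trace congruences that cut out the lattices below are propagated
  through this rule.\<close>

lemma T_mult: assumes "x \<in> OK" "y \<in> OK" shows "[2 * T (x * y) = T x * T y] (mod D)"
proof -
  obtain u v where x: "even (u + v)" "x = el u v" using assms by (elim OK_E)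
  moreover obtain u' v' where y: "even (u' + v')" "y = el u' v'" using assms by (elim OK_E)
  obtain s t where st: "el u v * el u' v' = el s t" "2 * s = u * u' + D * v * v'"
    using el_mult[OF x(1) y(1)] by metis
  show ?thesis unfolding x(2) y(2) st(1) T_el st(2)
    by (simp add: cong_iff_dvd_diff algebra_simps)
qed

definition nn :: "complex \<Rightarrow> int" where "nn x = \<lfloor>(cmod x)\<^sup>2\<rfloor>"

lemma of_int_nn: assumes "x \<in> OK" shows "of_int (nn x) = (cmod x)\<^sup>2"
proof -
  have "x \<in> K" "algebraic_int x" using assms by (auto simp: OK_def O_K_def K_def)
  then have "(cmod x)\<^sup>2 \<in> \<int>" by (rule algebraic_int_K_norm)
  then show ?thesis unfolding nn_def by (elim Ints_cases) simp
qed

lemma nn_mult_cnj: "x \<in> OK \<Longrightarrow> of_int (nn x) = x * cnj x"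
  using of_int_nn by (metis complex_norm_square of_real_of_int_eq)

lemma nn_nonneg: "nn x \<ge> 0" unfolding nn_def by simp

lemma nn_pos: "x \<in> OK \<Longrightarrow> x \<noteq> 0 \<Longrightarrow> nn x > 0"
  using of_int_nn by (metis nn_nonneg mult_eq_0_iff less_le of_int_0 nn_mult_cnj complex_cnj_zero_iff)

lemma nn_el: assumes "even (u + v)" shows "4 * nn (el u v) = u\<^sup>2 - D * v\<^sup>2"
proof -
  have "real_of_int (4 * nn (el u v)) = of_int (u\<^sup>2 - D * v\<^sup>2)"
    using of_int_nn[of "el u v"] cmod_el assms by (simp add: el_OK_iff)
  then show ?thesis by (simp only: of_int_eq_iff)
qed

text \<open>From 4 N = u^2 - D v^2. It converts congruences between traces into congruences between
  norms, and so lets the condition defining the order control the reduced norm.\<close>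

lemma nn_cong: assumes "x \<in> OK" shows "[4 * nn x = T x * T x] (mod D)"
  using assms by (elim OK_E) (simp add: nn_el cong_iff_dvd_diff power2_eq_square)

lemma nn_mult: "x \<in> OK \<Longrightarrow> y \<in> OK \<Longrightarrow> nn (x * y) = nn x * nn y"
proof -
  assume "x \<in> OK" "y \<in> OK"
  then have "real_of_int (nn (x * y)) = of_int (nn x * nn y)"
    by (simp add: of_int_nn OK_mult norm_mult power_mult_distrib)
  then show ?thesis by (simp only: of_int_eq_iff)
qed

lemma nn_of_int [simp]: "nn (of_int n) = n\<^sup>2"
  by (simp add: nn_def flip: of_int_power)

lemma OK_of_trace_norm:
  assumes "x \<in> K" "2 * Re x \<in> \<int>" "(cmod x)\<^sup>2 \<in> \<int>" shows "x \<in> OK"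
  using assms quadratic_algebraic_int by (simp add: OK_def O_K_def K_def)

lemma OK_finite_bounded: "finite {x \<in> OK. (cmod x)\<^sup>2 \<le> c}"
proof -
  define B :: int where "B = \<lceil>4 * c\<rceil>"
  have "{x \<in> OK. (cmod x)\<^sup>2 \<le> c} \<subseteq> (\<lambda>(u, v). el u v) ` ({- B..B} \<times> {- B..B})"
  proof safe
    fix x assume x: "x \<in> OK" "(cmod x)\<^sup>2 \<le> c"
    obtain u v where uv: "even (u + v)" "x = el u v" using x(1) by (elim OK_E)
    have "of_int (u\<^sup>2 - D * v\<^sup>2) \<le> 4 * c" using x(2) cmod_el[of u v] uv by simp
    then have "u\<^sup>2 - D * v\<^sup>2 \<le> B" unfolding B_def by (simp add: le_ceiling_iff)
    moreover have "- D * v\<^sup>2 \<ge> v\<^sup>2" using D_le mult_right_mono[of 1 "-D" "v\<^sup>2"] by simp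
    moreover have "\<bar>u\<bar> \<le> u\<^sup>2" "\<bar>v\<bar> \<le> v\<^sup>2" by (rule abs_le_square)+
    moreover have "u\<^sup>2 \<ge> 0" "v\<^sup>2 \<ge> 0" by auto
    ultimately have "\<bar>u\<bar> \<le> B" "\<bar>v\<bar> \<le> B" by linarith+
    then show "x \<in> (\<lambda>(u, v). el u v) ` ({- B..B} \<times> {- B..B})"
      using uv by (intro image_eqI[of _ _ "(u, v)"]) auto
  qed
  then show ?thesis by (rule finite_subset) auto
qed

end

section \<open>Fractional ideals\<close>

lemma int_subgroup_principal:
  fixes H :: "int set"
  assumes "0 \<in> H" "\<And>x y. x \<in> H \<Longrightarrow> y \<in> H \<Longrightarrow> x - y \<in> H"
  obtains g where "g \<ge> 0" "\<And>x. x \<in> H \<longleftrightarrow> g dvd x"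
proof -
  have neg: "- x \<in> H" if "x \<in> H" for x using assms(2)[OF assms(1) that] by simp
  have add: "x + y \<in> H" if "x \<in> H" "y \<in> H" for x y
    using assms(2)[OF that(1) neg[OF that(2)]] by simp
  have mult_nat: "int n * x \<in> H" if "x \<in> H" for n x
    using that by (induction n) (auto simp: algebra_simps intro: add assms)
  have mult: "n * x \<in> H" if "x \<in> H" for n x
    using mult_nat[OF that, of "nat \<bar>n\<bar>"] neg[OF mult_nat[OF that, of "nat \<bar>n\<bar>"]] by (cases "n \<ge> 0") auto
  show ?thesis
  proof (cases "H = {0}")
    case True
    then show ?thesis using that[of 0] by auto
  next
    case False
    then obtain x where "x \<in> H" "x \<noteq> 0" using assms(1) by blast
    then have "\<bar>x\<bar> \<in> H" "\<bar>x\<bar> > 0" using neg by (auto simp: abs_if)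
    then have ex: "\<exists>n::nat. n > 0 \<and> int n \<in> H" by (intro exI[of _ "nat \<bar>x\<bar>"]) auto
    define g where "g = (LEAST n::nat. n > 0 \<and> int n \<in> H)"
    have g: "g > 0" "int g \<in> H" using LeastI_ex[OF ex] unfolding g_def by auto
    have "int g dvd y" if "y \<in> H" for y
    proof -
      have "y mod int g = y - (y div int g) * int g" by (simp add: minus_div_mult_eq_mod)
      then have "y mod int g \<in> H" using assms(2)[OF that mult[OF g(2)]] by simp
      moreover have "0 \<le> y mod int g" "y mod int g < int g" using g by auto
      ultimately have y: "y mod int g \<in> H" "0 \<le> y mod int g" "y mod int g < int g" by blast+
      have "y mod int g = 0"
      proof (rule ccontr)
        assume "y mod int g \<noteq> 0"
        then have "nat (y mod int g) > 0 \<and> int (nat (y mod int g)) \<in> H" using y by simp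
        then have "g \<le> nat (y mod int g)" unfolding g_def by (rule Least_le)
        then show False using y(2,3) by linarith
      qed
      then show ?thesis by (simp add: dvd_eq_mod_eq_0)
    qed
    moreover have "y \<in> H" if "int g dvd y" for y
      using that mult[OF g(2)] by (metis dvd_div_mult_self)
    ultimately show ?thesis by (intro that[of "int g"]) auto
  qed
qed

lemma biadditive_times: "biadditive ((*) :: 'a::comm_ring_1 \<Rightarrow> _)"
  by (simp add: biadditive_def algebra_simps)

section \<open>Products, scalings and conjugates of sets of complex numbers\<close>

definition prd :: "complex set \<Rightarrow> complex set \<Rightarrow> complex set" where
  "prd I J = group_closure {x * y | x y. x \<in> I \<and> y \<in> J}"

definition sc :: "complex \<Rightarrow> complex set \<Rightarrow> complex set" where
  "sc k I = (\<lambda>x. k * x) ` I"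

abbreviation cj :: "complex set \<Rightarrow> complex set" where "cj I \<equiv> cnj ` I"

lemma prd_I: "x \<in> I \<Longrightarrow> y \<in> J \<Longrightarrow> x * y \<in> prd I J"
  unfolding prd_def by (blast intro: group_closure.base)

lemma prd_comm: "prd I J = prd J I"
proof -
  have "{x * y | x y. x \<in> I \<and> y \<in> J} = {x * y | x y. x \<in> J \<and> y \<in> I}"
    by (rule Collect_cong) (metis mult.commute)
  then show ?thesis by (simp add: prd_def)
qed

lemma prd_assoc: "prd (prd I J) L = prd I (prd J L)"
  unfolding prd_def by (rule group_closure_assoc[OF biadditive_times]) (simp add: mult.assoc)

lemma prd_left_comm: "prd I (prd J L) = prd J (prd I L)"
  by (metis prd_assoc prd_comm)

lemmas prd_ac = prd_comm prd_assoc prd_left_comm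

lemma prd_mono: "I \<subseteq> I' \<Longrightarrow> J \<subseteq> J' \<Longrightarrow> prd I J \<subseteq> prd I' J'"
  unfolding prd_def by (rule group_closure_mono) blast

lemma prd_minimal:
  assumes "\<And>x y. x \<in> I \<Longrightarrow> y \<in> J \<Longrightarrow> x * y \<in> H" "0 \<in> H" "\<And>x y. x \<in> H \<Longrightarrow> y \<in> H \<Longrightarrow> x - y \<in> H"
  shows "prd I J \<subseteq> H"
  unfolding prd_def by (rule group_closure_minimal) (use assms in auto)

lemma prd_0: "0 \<in> prd I J" and prd_diff: "x \<in> prd I J \<Longrightarrow> y \<in> prd I J \<Longrightarrow> x - y \<in> prd I J"
  and prd_add: "x \<in> prd I J \<Longrightarrow> y \<in> prd I J \<Longrightarrow> x + y \<in> prd I J"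
  unfolding prd_def by (auto intro: group_closure.diff group_closure_add)

lemma sc_I: "x \<in> I \<Longrightarrow> k * x \<in> sc k I" by (auto simp: sc_def)

lemma sc_prd: "sc k (prd I J) = prd (sc k I) J"
proof -
  have "{x * y | x y. x \<in> sc k I \<and> y \<in> J} = (\<lambda>x. k * x) ` {x * y | x y. x \<in> I \<and> y \<in> J}" (is "?l = ?r")
  proof
    show "?l \<subseteq> ?r" unfolding sc_def by (force simp: mult.assoc)
    show "?r \<subseteq> ?l"
    proof
      fix w assume "w \<in> ?r"
      then obtain x y where "x \<in> I" "y \<in> J" "w = (k * x) * y" by (auto simp: mult.assoc)
      then show "w \<in> ?l" using sc_I by blast
    qed
  qed
  then show ?thesis unfolding prd_def sc_def
    by (simp add: group_closure_image right_diff_distrib)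
qed

lemma prd_sc_right: "prd I (sc k J) = sc k (prd I J)"
  by (metis sc_prd prd_comm)

lemma sc_sc: "sc k (sc l I) = sc (k * l) I"
  by (auto simp: sc_def image_image mult.assoc)

lemma sc_1 [simp]: "sc 1 I = I" by (simp add: sc_def)

lemma sc_mem_iff: "k \<noteq> 0 \<Longrightarrow> x \<in> sc k I \<longleftrightarrow> x / k \<in> I"
  by (auto simp: sc_def image_iff) (metis nonzero_mult_div_cancel_left times_divide_eq_right)

lemma sc_inj: "k \<noteq> 0 \<Longrightarrow> sc k I = sc k J \<Longrightarrow> I = J"
  by (metis sc_sc sc_1 left_inverse)

lemma cj_prd: "cj (prd I J) = prd (cj I) (cj J)"
proof -
  have "{x * y | x y. x \<in> cj I \<and> y \<in> cj J} = cnj ` {x * y | x y. x \<in> I \<and> y \<in> J}" (is "?l = ?r")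
  proof
    show "?l \<subseteq> ?r"
    proof
      fix w assume "w \<in> ?l"
      then obtain x y where "x \<in> I" "y \<in> J" "w = cnj (x * y)" by auto
      then show "w \<in> ?r" by blast
    qed
    show "?r \<subseteq> ?l"
    proof
      fix w assume "w \<in> ?r"
      then obtain x y where "x \<in> I" "y \<in> J" "w = cnj x * cnj y" by auto
      then show "w \<in> ?l" by blast
    qed
  qed
  then show ?thesis unfolding prd_def by (simp add: group_closure_image)
qed

lemma cj_cj [simp]: "cj (cj I) = I" by (simp add: image_image)

lemma cj_sc: "cj (sc k I) = sc (cnj k) (cj I)" by (simp add: sc_def image_image)

lemma cj_mem_iff: "x \<in> cj I \<longleftrightarrow> cnj x \<in> I"
  by (metis complex_cnj_cnj imageE image_eqI)

context imag_quad begin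

lemma cj_OK [simp]: "cj OK = OK" using OK_cnj by (auto simp: cj_mem_iff)

section \<open>Fractional ideals as modules with a common denominator\<close>

definition md :: "complex set \<Rightarrow> bool" where
  "md I \<longleftrightarrow> I \<subseteq> K \<and> 0 \<in> I \<and> (\<forall>x\<in>I. \<forall>y\<in>I. x - y \<in> I) \<and> (\<forall>r\<in>OK. \<forall>x\<in>I. r * x \<in> I)"

definition fr :: "complex set \<Rightarrow> bool" where
  "fr I \<longleftrightarrow> md I \<and> I \<noteq> {0} \<and> (\<exists>d\<in>OK. d \<noteq> 0 \<and> (\<forall>x\<in>I. d * x \<in> OK))"

lemma md_D: assumes "md I"
  shows "I \<subseteq> K" "0 \<in> I" "x \<in> I \<Longrightarrow> y \<in> I \<Longrightarrow> x - y \<in> I" "r \<in> OK \<Longrightarrow> x \<in> I \<Longrightarrow> r * x \<in> I"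
    "x \<in> I \<Longrightarrow> - x \<in> I" "x \<in> I \<Longrightarrow> y \<in> I \<Longrightarrow> x + y \<in> I"
proof -
  show *: "I \<subseteq> K" "0 \<in> I" "\<And>x y. x \<in> I \<Longrightarrow> y \<in> I \<Longrightarrow> x - y \<in> I" "r \<in> OK \<Longrightarrow> x \<in> I \<Longrightarrow> r * x \<in> I"
    using assms unfolding md_def by auto
  show **: "\<And>x. x \<in> I \<Longrightarrow> - x \<in> I" using *(3)[OF *(2)] by simp
  show "x \<in> I \<Longrightarrow> y \<in> I \<Longrightarrow> x + y \<in> I" using *(3)[of x "- y"] **[of y] by simp
qed

lemma fr_md: "fr I \<Longrightarrow> md I" by (simp add: fr_def)

lemma fr_nz: assumes "fr I" obtains x where "x \<in> I" "x \<noteq> 0"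
  using assms md_D(2) unfolding fr_def by blast

lemma cring_OK: "cring (O_K D)"
proof (rule cringI)
  show "abelian_group (O_K D)"
  proof (rule abelian_groupI)
    show "\<exists>y\<in>carrier (O_K D). y \<oplus>\<^bsub>O_K D\<^esub> x = \<zero>\<^bsub>O_K D\<^esub>" if "x \<in> carrier (O_K D)" for x
      using that OK_minus[of x] unfolding OK_def[symmetric] by (auto simp: O_K_def intro: bexI[of _ "- x"])
  qed (use OK_add OK_0 in \<open>auto simp: O_K_def add_ac simp flip: OK_def\<close>,
      (use OK_add OK_0 in \<open>auto simp: OK_def O_K_def\<close>)+)
  show "comm_monoid (O_K D)"
    by unfold_locales (use OK_mult OK_1 in \<open>auto simp: OK_def O_K_def mult_ac\<close>)
qed (auto simp: O_K_def algebra_simps)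

lemma ring_sel [simp]: "carrier (O_K D) = OK" "x \<otimes>\<^bsub>O_K D\<^esub> y = x * y" "\<one>\<^bsub>O_K D\<^esub> = 1"
  "x \<oplus>\<^bsub>O_K D\<^esub> y = x + y" "\<zero>\<^bsub>O_K D\<^esub> = 0"
  by (simp_all add: OK_def) (simp_all add: O_K_def)

lemma a_inv_OK: assumes "x \<in> OK" shows "\<ominus>\<^bsub>O_K D\<^esub> x = - x"
proof -
  interpret cring "O_K D" by (rule cring_OK)
  show ?thesis using assms OK_minus[OF assms] minus_equality[of "- x" x] by simp
qed

lemma ideal_iff: "ideal I (O_K D) \<longleftrightarrow> md I \<and> I \<subseteq> OK"
proof
  interpret R: cring "O_K D" by (rule cring_OK)
  assume "ideal I (O_K D)"
  then interpret ideal I "O_K D" .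
  have sub: "I \<subseteq> OK" using a_subset by simp
  have d: "x - y \<in> I" if "x \<in> I" "y \<in> I" for x y
  proof -
    have "\<ominus>\<^bsub>O_K D\<^esub> y = - y" using that sub by (intro a_inv_OK) auto
    then show ?thesis using a_closed[OF that(1) a_inv_closed[OF that(2)]] by simp
  qed
  have z: "0 \<in> I" using zero_closed by simp
  have r: "r * x \<in> I" if "r \<in> OK" "x \<in> I" for r x using I_l_closed[OF that(2), of r] that by simp
  have k: "I \<subseteq> K" using sub OK_K by blast
  show "md I \<and> I \<subseteq> OK" unfolding md_def by (intro conjI ballI sub d z r k)
next
  interpret R: cring "O_K D" by (rule cring_OK)
  assume I: "md I \<and> I \<subseteq> OK"
  then have m: "md I" by simp
  note m = md_D[OF m]
  show "ideal I (O_K D)"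
  proof (rule idealI)
    show "ring (O_K D)" by (rule R.ring_axioms)
    show "subgroup I (add_monoid (O_K D))"
    proof (rule group.subgroupI[OF R.a_group])
      show "inv\<^bsub>add_monoid (O_K D)\<^esub> a \<in> I" if "a \<in> I" for a
        using m(5)[OF that] that I a_inv_OK[of a] by (simp add: a_inv_def subset_iff)
      show "a \<otimes>\<^bsub>add_monoid (O_K D)\<^esub> b \<in> I" if "a \<in> I" "b \<in> I" for a b
        using m(6)[OF that] by simp
    qed (use I m(2) in auto)
    show "x \<otimes>\<^bsub>O_K D\<^esub> a \<in> I" "a \<otimes>\<^bsub>O_K D\<^esub> x \<in> I" if "a \<in> I" "x \<in> carrier (O_K D)" for a x
      using m(4)[of x a] that by (simp_all add: mult.commute)
  qed
qed

text \<open>A denominator d may be replaced by its norm, a multiple of d.\<close>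

lemma fr_of_int_denom:
  assumes "fr I" obtains n :: int where "n > 0" "\<forall>x\<in>I. of_int n * x \<in> OK"
proof -
  obtain d where d: "d \<in> OK" "d \<noteq> 0" "\<forall>x\<in>I. d * x \<in> OK" using assms unfolding fr_def by blast
  have "of_int (nn d) * x \<in> OK" if "x \<in> I" for x
  proof -
    have "of_int (nn d) * x = cnj d * (d * x)" using nn_mult_cnj[OF d(1)] by (simp add: mult_ac)
    also have "\<dots> \<in> OK" using d that by blast
    finally show ?thesis .
  qed
  then show ?thesis using that nn_pos d by blast
qed

lemma md_sc: "md I \<Longrightarrow> k \<in> K \<Longrightarrow> md (sc k I)"
  unfolding md_def sc_def by (auto simp: mult.left_commute intro!: imageI simp flip: right_diff_distrib)

lemma sc_eq_0: "k \<noteq> 0 \<Longrightarrow> sc k I = {0} \<longleftrightarrow> I = {0}"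
  by (metis image_empty image_insert mult_zero_right sc_def sc_inj)

lemma nonzero_ideal_iff: "nonzero_ideal D I \<longleftrightarrow> fr I \<and> I \<subseteq> OK"
  unfolding nonzero_ideal_def ideal_iff fr_def using OK_1 by (metis mult_1 subsetD zero_neq_one)

lemma fr_sc: assumes "fr I" "k \<in> K" "k \<noteq> 0" shows "fr (sc k I)"
proof -
  obtain n where n: "n > 0" "\<forall>x\<in>I. of_int n * x \<in> OK" using fr_of_int_denom[OF assms(1)] .
  obtain a b where ab: "k = of_rat a + of_rat b * rt"
    using assms(2) by (auto simp: K_def quad_field_def rt_def)
  obtain a1 a2 b1 b2 where "quotient_of a = (a1, a2)" "quotient_of b = (b1, b2)" by force
  then have q: "a2 > 0" "b2 > 0" "a = of_int a1 / of_int a2" "b = of_int b1 / of_int b2"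
    using quotient_of_denom_pos quotient_of_div by blast+
  have "of_int (a2 * b2) * k = of_int (a1 * b2) + of_int (b1 * a2) * rt"
    using q(1,2) unfolding ab q(3,4) by (simp add: of_rat_divide field_simps)
  then have ok: "of_int (a2 * b2) * k \<in> OK" by (simp only: OK_add OK_mult OK_of_int OK_rt)
  have "of_int (a2 * b2 * n) * y \<in> OK" if y: "y \<in> sc k I" for y
  proof -
    obtain x where "x \<in> I" "y = k * x" using y by (auto simp: sc_def)
    then have "of_int (a2 * b2 * n) * y = (of_int (a2 * b2) * k) * (of_int n * x)" by simp
    then show ?thesis using ok n \<open>x \<in> I\<close> by (metis OK_mult)
  qed
  moreover have "of_int (a2 * b2 * n) \<noteq> (0::complex)" using q n by simp
  ultimately show ?thesis using assms md_sc sc_eq_0 unfolding fr_def by (meson OK_of_int)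
qed

lemma fractional_ideal_iff: "fractional_ideal D I \<longleftrightarrow> fr I"
proof
  assume "fr I"
  then obtain d where d: "d \<in> OK" "d \<noteq> 0" "\<forall>x\<in>I. d * x \<in> OK" unfolding fr_def by blast
  then have "nonzero_ideal D (sc d I)" using fr_sc[OF \<open>fr I\<close>] OK_K unfolding nonzero_ideal_iff
    by (auto simp: sc_def)
  then show "fractional_ideal D I" using d \<open>fr I\<close> md_D(1)
    unfolding fractional_ideal_def sc_def by (auto simp: fr_def simp flip: K_def)
next
  assume "fractional_ideal D I"
  then obtain d where d: "I \<subseteq> K" "d \<in> OK" "d \<noteq> 0" "nonzero_ideal D (sc d I)"
    unfolding fractional_ideal_def sc_def K_def by auto
  then have "fr (sc (inverse d) (sc d I))" by (intro fr_sc[of "sc d I"]) (use OK_K in \<open>auto simp: nonzero_ideal_iff\<close>)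
  then show "fr I" using d by (simp add: sc_sc)
qed

lemma md_OK [simp]: "md OK" unfolding md_def using OK_K by auto

lemma fr_OK [simp]: "fr OK"
proof -
  have "OK \<noteq> {0}" using OK_1 by (metis singletonD zero_neq_one)
  moreover have "\<forall>x\<in>OK. 1 * x \<in> OK" by simp
  ultimately show ?thesis unfolding fr_def using md_OK by (blast intro: OK_1 one_neq_zero)
qed

lemma fr_cj: assumes "fr I" shows "fr (cj I)"
proof -
  obtain n where n: "n > 0" "\<forall>x\<in>I. of_int n * x \<in> OK" using fr_of_int_denom[OF assms(1)] .
  have I: "md I" using assms fr_md by auto
  have "md (cj I)" unfolding md_def
  proof (intro conjI ballI)
    show "cj I \<subseteq> K" using md_D(1)[OF I] by auto
    show "x - y \<in> cj I" if "x \<in> cj I" "y \<in> cj I" for x y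
      using that md_D(3)[OF I] by (simp add: cj_mem_iff)
    show "r * x \<in> cj I" if "r \<in> OK" "x \<in> cj I" for r x
      using that md_D(4)[OF I] by (simp add: cj_mem_iff OK_cnj)
  qed (use md_D(2)[OF I] in \<open>simp add: cj_mem_iff\<close>)
  moreover have "of_int n * x \<in> OK" if "x \<in> cj I" for x
  proof -
    have "of_int n * cnj x \<in> OK" using n that by (simp add: cj_mem_iff)
    then show ?thesis using OK_cnj by fastforce
  qed
  moreover have "cj I \<noteq> {0}" using assms unfolding fr_def by (metis cj_cj complex_cnj_zero image_empty image_insert)
  ultimately show ?thesis unfolding fr_def using n by (auto intro!: bexI[of _ "of_int n"])
qed

lemma fr_prd: assumes "fr I" "fr J" shows "fr (prd I J)"
proof -
  obtain n where n: "n > 0" "\<forall>x\<in>I. of_int n * x \<in> OK" using fr_of_int_denom[OF assms(1)] .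
  obtain m where m: "m > 0" "\<forall>x\<in>J. of_int m * x \<in> OK" using fr_of_int_denom[OF assms(2)] .
  have I: "md I" "md J" using assms fr_md by auto
  have "md (prd I J)" unfolding md_def
  proof (intro conjI ballI)
    show "prd I J \<subseteq> K" using md_D(1)[OF I(1)] md_D(1)[OF I(2)] by (intro prd_minimal) auto
    show "r * x \<in> prd I J" if "r \<in> OK" "x \<in> prd I J" for r x
    proof -
      have "r * x \<in> sc r (prd I J)" using that by (intro sc_I)
      also have "\<dots> = prd (sc r I) J" by (rule sc_prd)
      also have "\<dots> \<subseteq> prd I J" using md_D(4)[OF I(1)] that(1) by (intro prd_mono) (auto simp: sc_def)
      finally show ?thesis .
    qed
  qed (auto intro: prd_0 prd_diff)
  moreover obtain x where x: "x \<in> I" "x \<noteq> 0" using fr_nz[OF assms(1)] .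
  obtain y where y: "y \<in> J" "y \<noteq> 0" using fr_nz[OF assms(2)] .
  have "x * y \<in> prd I J" "x * y \<noteq> 0" using x y by (auto intro: prd_I)
  then have "prd I J \<noteq> {0}" by blast
  moreover have "prd I J \<subseteq> {x. of_int (n * m) * x \<in> OK}"
  proof (rule prd_minimal)
    show "x * y \<in> {x. of_int (n * m) * x \<in> OK}" if "x \<in> I" "y \<in> J" for x y
    proof -
      have "of_int (n * m) * (x * y) = (of_int n * x) * (of_int m * y)" by simp
      also have "\<dots> \<in> OK" using n m that by blast
      finally show ?thesis by simp
    qed
  qed (auto simp: right_diff_distrib)
  ultimately show ?thesis unfolding fr_def using n m
    by (intro conjI bexI[of _ "of_int (n * m)"]) auto
qed

lemma prd_OK: assumes "md I" shows "prd OK I = I"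
proof
  show "prd OK I \<subseteq> I" by (rule prd_minimal) (use md_D[OF assms] in auto)
  show "I \<subseteq> prd OK I" using prd_I[of 1 OK] by fastforce
qed

lemma sc_OK_subset: assumes "md I" "x \<in> I" shows "sc x OK \<subseteq> I"
  using md_D(4)[OF assms(1)] assms(2) unfolding sc_def by (auto simp: mult.commute)

text \<open>The number g generates the group of integers contained in the product of I and its
  conjugate. That group contains the norms from I and the traces of all x cnj y, so x cnj y / g has
  an integral trace, and its norm (N x / g)(N y / g) is integral too. Hence the product is generated
  by g, and I is invertible.\<close>

lemma integral_norm_exists:
  assumes I: "fr I" "I \<subseteq> OK"
  obtains g :: nat where "g > 0" "prd I (cj I) = sc (of_nat g) OK"
proof -
  have md: "md I" "md (prd I (cj I))" using I fr_md fr_cj fr_prd by auto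
  define H where "H = {n::int. of_int n \<in> prd I (cj I)}"
  obtain g where g: "g \<ge> 0" "\<And>x. x \<in> H \<longleftrightarrow> g dvd x"
    by (rule int_subgroup_principal[of H]) (auto simp: H_def intro: prd_0 prd_diff)
  have nnH: "nn x \<in> H" if "x \<in> I" for x
    using that I prd_I[of x I "cnj x"] unfolding H_def by (auto simp: nn_mult_cnj subset_iff)
  have TH: "T (x * cnj y) \<in> H" if "x \<in> I" "y \<in> I" for x y
  proof -
    have "x * cnj y \<in> OK" using that I by auto
    then have "of_int (T (x * cnj y)) = x * cnj y + y * cnj x" using T_trace by simp
    also have "\<dots> \<in> prd I (cj I)" using that by (intro prd_add prd_I) auto
    finally show ?thesis by (simp add: H_def)
  qed
  obtain x0 where x0: "x0 \<in> I" "x0 \<noteq> 0" using fr_nz[OF I(1)] .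
  then have "g \<noteq> 0" using nnH[OF x0(1)] g(2) nn_pos[of x0] I by auto
  then have g0: "g > 0" using g by simp
  have sub: "x * cnj y / of_int g \<in> OK" if xyI: "x \<in> I" "y \<in> I" for x y
  proof (rule OK_of_trace_norm)
    have xy: "x \<in> OK" "y \<in> OK" using xyI I by auto
    then show "x * cnj y / of_int g \<in> K" using OK_K by auto
    obtain t where t: "T (x * cnj y) = g * t" using TH[OF xyI] g(2) by blast
    have "2 * Re (x * cnj y / of_int g) = of_int (T (x * cnj y)) / of_int g"
      using of_int_T[OF OK_mult[OF xy(1) OK_cnj[OF xy(2)]]] by simp
    then show "2 * Re (x * cnj y / of_int g) \<in> \<int>" unfolding t using g0 by simp
    obtain s r where sr: "nn x = g * s" "nn y = g * r" using nnH xyI g(2) by blast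
    have "(cmod (x * cnj y / of_int g))\<^sup>2 = of_int (nn x) * of_int (nn y) / (of_int g)\<^sup>2"
      using of_int_nn xy g0 by (simp add: norm_mult norm_divide power_mult_distrib power_divide)
    also have "\<dots> = of_int (s * r)" unfolding sr using g0 by (simp add: field_simps power2_eq_square)
    finally show "(cmod (x * cnj y / of_int g))\<^sup>2 \<in> \<int>" by simp
  qed
  have "prd I (cj I) \<subseteq> sc (of_int g) OK"
  proof (rule prd_minimal)
    show "x * y \<in> sc (of_int g) OK" if "x \<in> I" "y \<in> cj I" for x y
      using sub[OF that(1), of "cnj y"] that g0 by (simp add: sc_mem_iff cj_mem_iff)
  qed (use g0 in \<open>auto simp: sc_mem_iff diff_divide_distrib\<close>)
  moreover have "sc (of_int g) OK \<subseteq> prd I (cj I)"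
    using g(2)[of g] md(2) by (intro sc_OK_subset) (auto simp: H_def)
  ultimately have "prd I (cj I) = sc (of_int g) OK" by blast
  then show ?thesis using that[of "nat g"] g0 by (simp add: of_nat_nat)
qed

end

context imag_quad begin

section \<open>Norm and inverse of a fractional ideal\<close>

lemma of_real_OK_iff: "of_real r \<in> OK \<longleftrightarrow> r \<in> \<int>"
proof
  assume "of_real r \<in> OK"
  then obtain u v where uv: "even (u + v)" "of_real r = el u v" by (elim OK_E)
  have "of_int v * Im rt = 0" using arg_cong[OF uv(2), of Im] by simp
  then have "v = 0" using Im_rt_pos by simp
  then obtain w where "u = 2 * w" using uv(1) by auto
  then have "r = of_int w" using arg_cong[OF uv(2), of Re] by simp
  then show "r \<in> \<int>" by simp
qed (auto elim!: Ints_cases)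

lemma sc_real_OK_inj:
  assumes "sc (of_real r) OK = sc (of_real s) OK" "r > 0" "s > 0" shows "r = s"
proof -
  have "of_real r \<in> sc (of_real s) OK" using assms(1) sc_I[of 1 OK] by (metis OK_1 mult_1_right)
  then have 1: "r / s \<in> \<int>" using assms(2,3) of_real_OK_iff[of "r / s"] by (simp add: sc_mem_iff)
  have "of_real s \<in> sc (of_real r) OK" using assms(1) sc_I[of 1 OK] by (metis OK_1 mult_1_right)
  then have 2: "s / r \<in> \<int>" using assms(2,3) of_real_OK_iff[of "s / r"] by (simp add: sc_mem_iff)
  obtain m n where mn: "r / s = of_int m" "s / r = of_int n" using 1 2 by (auto elim!: Ints_cases)
  have pos: "of_int m > (0::real)" "of_int n > (0::real)" using assms by (simp_all flip: mn)
  have "of_int m * of_int n = (r / s) * (s / r)" by (simp only: mn)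
  then have "real_of_int (m * n) = of_int 1" using assms by simp
  then have "m * n = 1" by (simp only: of_int_eq_iff)
  then have "m = 1" using pos by (simp add: zmult_eq_1_iff)
  then show ?thesis using mn assms by simp
qed

text \<open>Reading the norm off from the product of I with its conjugate makes sense for fractional
  ideals and yields multiplicativity and the inverse \<open>iv\<close> at once. Agreement with the
  index is \<open>ideal_norm_eq\<close>.\<close>

definition fnorm :: "complex set \<Rightarrow> real" where
  "fnorm I = (THE r. r > 0 \<and> r \<in> \<rat> \<and> prd I (cj I) = sc (of_real r) OK)"

lemma fnorm_exists: assumes "fr I" shows "\<exists>r. r > 0 \<and> r \<in> \<rat> \<and> prd I (cj I) = sc (of_real r) OK"
proof -
  obtain n where n: "n > 0" "\<forall>x\<in>I. of_int n * x \<in> OK" using fr_of_int_denom[OF assms(1)] .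
  define J where "J = sc (of_int n) I"
  have J: "fr J" "J \<subseteq> OK" unfolding J_def using fr_sc[OF assms] n by (auto simp: sc_def)
  obtain g where g: "g > 0" "prd J (cj J) = sc (of_nat g) OK" using integral_norm_exists[OF J] .
  have "prd I (cj I) = sc (1 / (of_int n)\<^sup>2) (prd J (cj J))"
    unfolding J_def cj_sc prd_sc_right using n(1)
    by (simp add: sc_sc power2_eq_square flip: sc_prd)
  also have "\<dots> = sc (of_real (of_nat g / (of_int n)\<^sup>2)) OK"
    unfolding g by (simp add: sc_sc)
  finally show ?thesis using g n by (intro exI[of _ "real g / (of_int n)\<^sup>2"]) auto
qed

lemma fnorm_eqI:
  assumes "r > 0" "prd I (cj I) = sc (of_real r) OK" "fr I" shows "fnorm I = r"
proof -
  obtain s where s: "s > 0" "s \<in> \<rat>" "prd I (cj I) = sc (of_real s) OK" using fnorm_exists[OF assms(3)] by blast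
  then have "s = r" using assms sc_real_OK_inj[of s r] by simp
  then show ?thesis unfolding fnorm_def using s assms
    by (intro the_equality) (auto intro: sc_real_OK_inj)
qed

lemma fnorm: assumes "fr I"
  shows "fnorm I > 0" "fnorm I \<in> \<rat>" "prd I (cj I) = sc (of_real (fnorm I)) OK"
proof -
  obtain s where s: "s > 0" "s \<in> \<rat>" "prd I (cj I) = sc (of_real s) OK" using fnorm_exists[OF assms] by blast
  have "fnorm I = s" using fnorm_eqI[OF s(1,3) assms] .
  then show "fnorm I > 0" "fnorm I \<in> \<rat>" "prd I (cj I) = sc (of_real (fnorm I)) OK" using s by auto
qed

lemma fnorm_prd: assumes "fr I" "fr J" shows "fnorm (prd I J) = fnorm I * fnorm J"
proof (rule fnorm_eqI)
  have "prd (prd I J) (cj (prd I J)) = prd (prd I (cj I)) (prd J (cj J))"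
    unfolding cj_prd by (simp only: prd_ac)
  also have "\<dots> = sc (of_real (fnorm I)) (sc (of_real (fnorm J)) (prd OK OK))"
    unfolding fnorm(3)[OF assms(1)] fnorm(3)[OF assms(2)]
    by (simp only: prd_sc_right sc_sc mult.commute flip: sc_prd)
  finally show "prd (prd I J) (cj (prd I J)) = sc (of_real (fnorm I * fnorm J)) OK"
    by (simp add: sc_sc prd_OK)
qed (use assms fnorm(1) fr_prd in auto)

lemma fnorm_sc: assumes "fr I" "k \<in> K" "k \<noteq> 0" shows "fnorm (sc k I) = (cmod k)\<^sup>2 * fnorm I"
proof (rule fnorm_eqI)
  have "prd (sc k I) (cj (sc k I)) = sc (k * cnj k) (prd I (cj I))"
    unfolding cj_sc prd_sc_right by (simp add: sc_sc mult.commute flip: sc_prd)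
  then show "prd (sc k I) (cj (sc k I)) = sc (of_real ((cmod k)\<^sup>2 * fnorm I)) OK"
    unfolding fnorm(3)[OF assms(1)] by (simp add: sc_sc flip: complex_norm_square)
qed (use assms fnorm(1) fr_sc in auto)

lemma fnorm_OK [simp]: "fnorm OK = 1"
  by (rule fnorm_eqI) (simp_all add: prd_OK)

lemma fnorm_cj: assumes "fr I" shows "fnorm (cj I) = fnorm I"
  using fnorm[OF assms] fr_cj[OF assms] by (intro fnorm_eqI) (simp_all add: prd_comm)

definition iv :: "complex set \<Rightarrow> complex set" where
  "iv I = sc (of_real (1 / fnorm I)) (cj I)"

lemma fnorm_K: "fr I \<Longrightarrow> of_real (fnorm I) \<in> K" "fr I \<Longrightarrow> of_real (1 / fnorm I) \<in> K"
  using fnorm(2)[of I] by (auto intro!: K_of_real Rats_divide)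

lemma fr_iv: "fr I \<Longrightarrow> fr (iv I)"
  unfolding iv_def using fnorm(1)[of I] fnorm_K[of I] by (intro fr_sc fr_cj) auto

lemma prd_iv: assumes "fr I" shows "prd I (iv I) = OK"
  unfolding iv_def prd_sc_right fnorm(3)[OF assms] using fnorm(1)[OF assms] by (simp add: sc_sc)

lemma idl_sel: "carrier (ideal_group D) = {I. fr I}" "I \<otimes>\<^bsub>ideal_group D\<^esub> J = prd I J" "\<one>\<^bsub>ideal_group D\<^esub> = OK"
  by (auto simp: ideal_group_def fractional_ideal_iff prd_def)

lemma comm_group_ideals: "comm_group (ideal_group D)"
proof (rule comm_groupI; unfold idl_sel mem_Collect_eq)
  show "\<exists>J\<in>{I. fr I}. prd J I = OK" if "fr I" for I
    using fr_iv[OF that] prd_iv[OF that] by (auto simp: prd_comm)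
  show "prd I J = prd J I" for I J by (rule prd_comm)
qed (auto simp: fr_prd prd_assoc prd_OK fr_md)

lemma inv_ideal: assumes "fr I" shows "inv\<^bsub>ideal_group D\<^esub> I = iv I"
proof -
  interpret G: comm_group "ideal_group D" by (rule comm_group_ideals)
  show ?thesis using G.inv_equality[of "iv I" I] fr_iv[OF assms] prd_iv[OF assms] assms
    by (simp add: idl_sel prd_comm)
qed

lemma prd_cancel: assumes "fr I" "fr J" "fr L" "prd I J = prd I L" shows "J = L"
proof -
  have "prd (prd I (iv I)) J = prd (prd I (iv I)) L"
    using assms(4) by (metis prd_assoc prd_comm)
  then show ?thesis using assms by (simp add: prd_iv prd_OK fr_md)
qed

lemma fnorm_iv: assumes "fr I" shows "fnorm (iv I) = 1 / fnorm I"
  using fnorm_prd[OF assms fr_iv[OF assms]] prd_iv[OF assms] fnorm(1)[OF assms]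
  by (simp add: field_simps)

text \<open>The quotient x cnj y / N(I) is an integer of K because N(I) generates the product of I
  with its conjugate. The claims concern its trace, and the quotient itself for y = x.\<close>

lemma norm_over_fnorm: assumes "fr I" "x \<in> I" "y \<in> I"
  shows "2 * Re (x * cnj y) / fnorm I \<in> \<int>" "(cmod x)\<^sup>2 / fnorm I \<in> \<int>"
proof -
  have *: "z * cnj w / of_real (fnorm I) \<in> OK" if "z \<in> I" "w \<in> I" for z w
    using prd_I[OF that(1), of "cnj w" "cj I"] that fnorm[OF assms(1)] by (simp add: sc_mem_iff)
  have "real_of_int (T (x * cnj y / of_real (fnorm I))) = 2 * Re (x * cnj y) / fnorm I"
    using of_int_T[OF *[OF assms(2,3)]] by simp
  then show "2 * Re (x * cnj y) / fnorm I \<in> \<int>" by (metis Ints_of_int)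
  have "of_real ((cmod x)\<^sup>2 / fnorm I) \<in> OK" using *[OF assms(2,2)]
    by (simp only: complex_norm_square of_real_divide)
  then show "(cmod x)\<^sup>2 / fnorm I \<in> \<int>" by (simp only: of_real_OK_iff)
qed

definition om :: complex where "om = el 1 1"

lemma om_OK [simp, intro]: "om \<in> OK" by (simp add: om_def el_OK_iff)
lemma Re_om: "Re om = 1 / 2" by (simp add: om_def)

lemma Ints_div_diff: "x / s \<in> \<int> \<Longrightarrow> y / s \<in> \<int> \<Longrightarrow> (x - y) / s \<in> (\<int> :: real set)"
  and Ints_div_add: "x / s \<in> \<int> \<Longrightarrow> y / s \<in> \<int> \<Longrightarrow> (x + y) / s \<in> (\<int> :: real set)"
  by (auto simp: add_divide_distrib diff_divide_distrib)

text \<open>The elements with trace in $s\mathbb{Z}$ form a group which contains all $x\bar y$ by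
  polarization, hence also $N(I)\omega$, whose trace is $N(I)$.\<close>

lemma fnorm_gcd: assumes "fr I" "\<And>x. x \<in> I \<Longrightarrow> (cmod x)\<^sup>2 / s \<in> \<int>" shows "fnorm I / s \<in> \<int>"
proof -
  have "prd I (cj I) \<subseteq> {z. 2 * Re z / s \<in> \<int>}"
  proof (rule prd_minimal)
    fix x y assume xy: "x \<in> I" "y \<in> cj I"
    then have y: "cnj y \<in> I" by (simp add: cj_mem_iff)
    have "2 * Re (x * y) = (cmod (x + cnj y))\<^sup>2 - (cmod x)\<^sup>2 - (cmod (cnj y))\<^sup>2"
      unfolding cmod_power2 by (simp add: power2_eq_square algebra_simps)
    moreover have "x + cnj y \<in> I" using md_D(6)[OF fr_md[OF assms(1)]] xy y by blast
    ultimately show "x * y \<in> {z. 2 * Re z / s \<in> \<int>}"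
      using assms(2) xy(1) y by (auto simp only: mem_Collect_eq intro!: Ints_div_diff)
  qed (auto simp: right_diff_distrib intro: Ints_div_diff)
  moreover have "of_real (fnorm I) * om \<in> prd I (cj I)"
    unfolding fnorm(3)[OF assms(1)] by (intro sc_I) auto
  ultimately show ?thesis by (auto simp: Re_om)
qed

section \<open>Bases in Hermite form, and the norm as an index\<close>

lemma OK_om: assumes "x \<in> OK" obtains s t where "x = of_int s + of_int t * om"
proof -
  obtain u v where uv: "even (u + v)" "x = el u v" using assms by (elim OK_E)
  obtain w where "u = v + 2 * w" using uv(1) by (metis add_diff_cancel_left' diff_add_eq dvd_def even_add even_diff add.commute)
  then have "x = of_int w + of_int v * om" unfolding uv om_def by (simp add: el_def field_simps)
  then show ?thesis using that by blast
qed

lemma om_coords_inj: "of_int s + of_int t * om = of_int s' + of_int t' * om \<longleftrightarrow> s = s' \<and> t = t'"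
proof
  assume *: "of_int s + of_int t * om = of_int s' + of_int t' * om"
  have "t = t'" using arg_cong[OF *, of Im] Im_rt_pos by (simp add: om_def)
  then show "s = s' \<and> t = t'" using * by simp
qed simp

lemma om_sq: obtains n where "4 * n = 1 - D" "om * om = om - of_int n" "\<And>b. nn (of_int b + om) = b * b + b + n"
proof -
  obtain k where k: "D = 1 + 4 * k" using D_mod4 by (metis cong_iff_lin cong_sym)
  have kD: "(of_int D :: complex) = 1 + 4 * of_int k" using k by simp
  have "4 * (om * om) = (1 + rt) * (1 + rt)" by (simp add: om_def el_def)
  also have "\<dots> = 1 + 2 * rt + of_int D" using rt_sq by (simp add: algebra_simps)
  also have "\<dots> = 4 * (om + of_int k)" by (simp add: kD om_def el_def)
  finally have "om * om = om + of_int k" by (subst (asm) mult_cancel_left) simp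
  then have 1: "om * om = om - of_int (-k)" by simp
  have nnk: "nn (of_int b + om) = b * b + b + (- k)" for b :: int
  proof -
    have "of_int b + om = el (2 * b + 1) 1" unfolding om_def by (simp add: el_of_int el_add)
    then have "4 * nn (of_int b + om) = (2 * b + 1)\<^sup>2 - D" using nn_el[of "2 * b + 1" 1] by simp
    also have "\<dots> = 4 * (b * b + b + (- k))" unfolding k by (simp add: power2_eq_square algebra_simps)
    finally show ?thesis by (simp only: mult_cancel_left) simp
  qed
  show ?thesis using that[of "-k"] 1 k nnk by auto
qed

text \<open>The ideal has the basis c a, c (b + om): the integers in I are the multiples of
  \<open>a0\<close> = c a, and the coefficients of \<open>om\<close> that occur are the multiples of
  c. Stability under multiplication by \<open>om\<close> gives c | a0 and c | b0. The equation for n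
  says that (a, 2b + 1, n) is a binary quadratic form of discriminant D.\<close>

lemma hermite:
  assumes I: "fr I" "I \<subseteq> OK"
  obtains a b c n :: int where "a > 0" "c > 0" "4 * a * n = (2 * b + 1)\<^sup>2 - D"
    "\<And>s t. of_int s + of_int t * om \<in> I \<longleftrightarrow> c dvd t \<and> c * a dvd s - t * b"
proof -
  note m = md_D[OF fr_md[OF I(1)]]
  obtain a0 where a0: "a0 \<ge> 0" "\<And>x. of_int x \<in> I \<longleftrightarrow> a0 dvd x"
    by (rule int_subgroup_principal[of "{x. of_int x \<in> I}"]) (use m in auto)
  obtain c where c: "c \<ge> 0" "\<And>t. (\<exists>s. of_int s + of_int t * om \<in> I) \<longleftrightarrow> c dvd t"
  proof (rule int_subgroup_principal[of "{t. \<exists>s. of_int s + of_int t * om \<in> I}"])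
    show "0 \<in> {t. \<exists>s. of_int s + of_int t * om \<in> I}" using m(2) by (auto intro: exI[of _ 0])
    show "x - y \<in> {t. \<exists>s. of_int s + of_int t * om \<in> I}"
      if xy: "x \<in> {t. \<exists>s. of_int s + of_int t * om \<in> I}" "y \<in> {t. \<exists>s. of_int s + of_int t * om \<in> I}" for x y
    proof -
      obtain s s' where "of_int s + of_int x * om \<in> I" "of_int s' + of_int y * om \<in> I" using xy by auto
      from m(3)[OF this] have "of_int (s - s') + of_int (x - y) * om \<in> I" by (simp add: algebra_simps)
      then show ?thesis by blast
    qed
  qed auto
  obtain x0 where x0: "x0 \<in> I" "x0 \<noteq> 0" using fr_nz[OF I(1)] .
  have "cnj x0 * x0 \<in> I" using m(4)[of "cnj x0" x0] x0 I by auto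
  then have "of_int (nn x0) \<in> I" using nn_mult_cnj[of x0] x0 I by (auto simp: mult.commute)
  then have "a0 \<noteq> 0" using a0(2) nn_pos[of x0] x0 I by auto
  then have a0p: "a0 > 0" using a0 by simp
  have "of_int a0 \<in> I" using a0 by simp
  then have "om * of_int a0 \<in> I" using m(4)[of om] by auto
  then have "\<exists>s. of_int s + of_int a0 * om \<in> I" by (auto intro!: exI[of _ 0] simp: mult.commute)
  then have "c dvd a0" using c by blast
  then obtain a where a: "a0 = c * a" by blast
  have cp: "c > 0" "a > 0" using a a0p c(1) by (auto simp: zero_less_mult_iff)
  obtain b0 where b0: "of_int b0 + of_int c * om \<in> I" using c(2)[of c] by auto
  obtain n0 where n0: "om * om = om - of_int n0" "\<And>b. nn (of_int b + om) = b * b + b + n0" "4 * n0 = 1 - D"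
    using om_sq by metis
  have "om * (of_int b0 + of_int c * om) \<in> I" using m(4)[OF om_OK b0] .
  moreover have "om * (of_int b0 + of_int c * om) = of_int b0 * om + of_int c * (om * om)" by (simp add: algebra_simps)
  also have "\<dots> = of_int (- c * n0) + of_int (b0 + c) * om"
    unfolding n0 by (simp add: algebra_simps)
  ultimately have "c dvd b0 + c" using c by metis
  then have "c dvd b0" by (simp add: dvd_add_left_iff)
  then obtain b where b: "b0 = c * b" by blast
  have mem: "of_int s + of_int t * om \<in> I \<longleftrightarrow> c dvd t \<and> c * a dvd s - t * b" for s t
  proof
    assume st: "of_int s + of_int t * om \<in> I"
    then have "c dvd t" using c by blast
    then obtain y where y: "t = c * y" by blast
    have "of_int y * (of_int b0 + of_int c * om) \<in> I" using m(4)[OF OK_of_int b0] .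
    from m(3)[OF st this] have "of_int (s - y * b0) \<in> I" unfolding y by (simp add: algebra_simps)
    then have "c * a dvd s - y * b0" using a0(2) a by blast
    then show "c dvd t \<and> c * a dvd s - t * b" using \<open>c dvd t\<close> unfolding b y by (simp add: mult_ac)
  next
    assume "c dvd t \<and> c * a dvd s - t * b"
    then obtain y where y: "t = c * y" and d: "c * a dvd s - t * b" by blast
    have 1: "of_int y * (of_int b0 + of_int c * om) \<in> I" using m(4)[OF OK_of_int b0] .
    have 2: "of_int (s - t * b) \<in> I" unfolding a0(2) using a d by simp
    have "of_int (s - t * b) + of_int y * (of_int b0 + of_int c * om) = of_int s + of_int t * om"
      unfolding b y by (simp add: algebra_simps)
    then show "of_int s + of_int t * om \<in> I" using m(6)[OF 2 1] by (simp only:)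
  qed
  \<comment> \<open>The integer c N(b + om) lies in I, hence is a multiple of c a; this produces
    n.\<close>
  have "of_int c * ((of_int b + om) * cnj (of_int b + om)) \<in> I"
    using m(4)[of "cnj (of_int b + om)" "of_int b0 + of_int c * om"] b0 unfolding b
    by (auto simp: algebra_simps OK_add)
  then have "of_int (c * nn (of_int b + om)) \<in> I"
    by (subst of_int_mult, subst nn_mult_cnj) auto
  then have "c * a dvd c * nn (of_int b + om)" unfolding a0(2) a .
  then have "a dvd nn (of_int b + om)" using cp by simp
  then obtain n where n: "nn (of_int b + om) = a * n" by blast
  have "4 * a * n = 4 * (b * b + b + n0)" using n n0(2)[of b] by simp
  also have "\<dots> = (2 * b + 1)\<^sup>2 - D" using n0(3) by (simp add: power2_eq_square algebra_simps)
  finally have "4 * a * n = (2 * b + 1)\<^sup>2 - D" .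
  then show ?thesis using that[OF cp(2,1) _ mem] by blast
qed

text \<open>On the Hermite basis the norm is c^2 a times the form (a, 2b + 1, n). The form is
  primitive, since the square of a common divisor of its coefficients divides the squarefree D; so
  the gcd of the norms is exactly c^2 a.\<close>

lemma fnorm_hermite:
  fixes a b c n :: int
  assumes I: "fr I" "I \<subseteq> OK" and h: "a > 0" "c > 0" "4 * a * n = (2 * b + 1)\<^sup>2 - D"
    "\<And>s t. of_int s + of_int t * om \<in> I \<longleftrightarrow> c dvd t \<and> c * a dvd s - t * b"
  shows "fnorm I = of_int (c\<^sup>2 * a)"
proof -
  have norm: "(cmod (of_int s + of_int t * om))\<^sup>2 = (of_int ((2 * s + t)\<^sup>2 - D * t\<^sup>2)) / 4" for s t
  proof -
    have "of_int s + of_int t * om = el (2 * s + t) t" by (simp add: om_def el_def field_simps)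
    then show ?thesis using cmod_el[of "2 * s + t" t] by simp
  qed
  have "(cmod x)\<^sup>2 / of_int (c\<^sup>2 * a) \<in> \<int>" if x: "x \<in> I" for x
  proof -
    obtain s t where st: "x = of_int s + of_int t * om" using OK_om x I by blast
    then obtain y k where yk: "t = c * y" "s - t * b = c * a * k" using x h(4) by (metis dvdE)
    have s: "s = c * (a * k + y * b)" using yk by (simp add: algebra_simps)
    have "(2 * s + t)\<^sup>2 - D * t\<^sup>2 = c\<^sup>2 * (4 * a * (a * k * k + k * y * (2 * b + 1)) + y\<^sup>2 * ((2 * b + 1)\<^sup>2 - D))"
      unfolding s yk(1) by (simp add: power2_eq_square algebra_simps)
    also have "\<dots> = 4 * (c\<^sup>2 * a * (a * k * k + k * y * (2 * b + 1) + y\<^sup>2 * n))"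
      unfolding h(3)[symmetric] by (simp add: algebra_simps)
    finally have "(cmod x)\<^sup>2 = of_int (c\<^sup>2 * a * (a * k * k + k * y * (2 * b + 1) + y\<^sup>2 * n))"
      unfolding st norm by simp
    then have "(cmod x)\<^sup>2 / of_int (c\<^sup>2 * a) = of_int (a * k * k + k * y * (2 * b + 1) + y\<^sup>2 * n)"
      using h by (simp add: field_simps)
    then show ?thesis by (metis Ints_of_int)
  qed
  then obtain k where k: "fnorm I / of_int (c\<^sup>2 * a) = of_int k" using fnorm_gcd[OF I(1)] by (metis Ints_cases)
  then have f: "fnorm I = of_int (c\<^sup>2 * a * k)" using h by (simp add: field_simps)
  have "0 < real_of_int (c\<^sup>2 * a) * of_int k" using fnorm(1)[OF I(1)] unfolding f by simp
  moreover have "0 < real_of_int (c\<^sup>2 * a)" using h by simp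
  ultimately have kp: "k > 0" using zero_less_mult_pos by fastforce
  \<comment> \<open>The norms of the two basis vectors and the trace pairing between them recover
    the three coefficients of the form.\<close>
  have x: "of_int (c * a) + of_int 0 * om \<in> I" and y: "of_int (c * b) + of_int c * om \<in> I"
    unfolding h(4) by (simp_all add: algebra_simps)
  have "of_int (c\<^sup>2 * a\<^sup>2) / fnorm I \<in> \<int>"
    using norm_over_fnorm(2)[OF I(1) x x] unfolding norm by (simp add: power_mult_distrib)
  moreover have "of_int (c\<^sup>2 * a\<^sup>2) / fnorm I = of_int a / of_int k"
    unfolding f using h kp by (simp add: field_simps power2_eq_square)
  ultimately have 1: "k dvd a" using kp by (simp add: of_int_div_of_int_in_Ints_iff)
  have e: "2 * Re ((of_int (c * a) + of_int 0 * om) * cnj (of_int (c * b) + of_int c * om)) = of_int (c\<^sup>2 * a * (2 * b + 1))"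
    by (simp add: om_def field_simps power2_eq_square)
  have "of_int (c\<^sup>2 * a * (2 * b + 1)) / fnorm I \<in> \<int>"
    using norm_over_fnorm(1)[OF I(1) x y] unfolding e .
  moreover have "of_int (c\<^sup>2 * a * (2 * b + 1)) / fnorm I = of_int (2 * b + 1) / of_int k"
    unfolding f using h kp by (simp add: field_simps)
  ultimately have 2: "k dvd 2 * b + 1" using kp by (simp only: of_int_div_of_int_in_Ints_iff) simp
  have "(2 * (c * b) + c)\<^sup>2 - D * c\<^sup>2 = c\<^sup>2 * ((2 * b + 1)\<^sup>2 - D)"
    by (simp add: power2_eq_square algebra_simps)
  then have "(cmod (of_int (c * b) + of_int c * om))\<^sup>2 = of_int (c\<^sup>2 * a * n)"
    unfolding norm h(3)[symmetric] by simp
  then have "of_int (c\<^sup>2 * a * n) / fnorm I \<in> \<int>"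
    using norm_over_fnorm(2)[OF I(1) y y] by simp
  moreover have "of_int (c\<^sup>2 * a * n) / fnorm I = of_int n / of_int k"
    unfolding f using h kp by (simp add: field_simps)
  ultimately have 3: "k dvd n" using kp by (simp add: of_int_div_of_int_in_Ints_iff)
  have "k\<^sup>2 dvd (2 * b + 1)\<^sup>2 - 4 * a * n"
    using mult_dvd_mono[OF 1 3] mult_dvd_mono[OF 2 2] by (intro dvd_diff) (auto simp: power2_eq_square mult.assoc)
  then have "k\<^sup>2 dvd D" unfolding h(3) by simp
  then have "k dvd 1" using D_sqf unfolding squarefree_def by blast
  then have "k = 1" using kp by simp
  then show ?thesis using f by simp
qed

lemma ideal_coset_eq_iff:
  assumes "ideal I (O_K D)" "x \<in> OK" "y \<in> OK"
  shows "I +>\<^bsub>O_K D\<^esub> x = I +>\<^bsub>O_K D\<^esub> y \<longleftrightarrow> x - y \<in> I"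
proof -
  have m: "md I" using assms(1) ideal_iff by blast
  have set: "I +>\<^bsub>O_K D\<^esub> z = {h + z | h. h \<in> I}" for z by (auto simp: a_r_coset_def')
  show ?thesis
  proof
    assume "I +>\<^bsub>O_K D\<^esub> x = I +>\<^bsub>O_K D\<^esub> y"
    moreover have "x \<in> I +>\<^bsub>O_K D\<^esub> x" unfolding set using md_D(2)[OF m] by force
    ultimately obtain h where "h \<in> I" "x = h + y" unfolding set by auto
    then show "x - y \<in> I" by simp
  next
    assume d: "x - y \<in> I"
    have "h + x \<in> {h + y | h. h \<in> I}" if "h \<in> I" for h
      using md_D(6)[OF m that d] by (intro CollectI exI[of _ "h + (x - y)"]) auto
    moreover have "h + y \<in> {h + x | h. h \<in> I}" if "h \<in> I" for h
      using md_D(3)[OF m that d] by (intro CollectI exI[of _ "h - (x - y)"]) auto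
    ultimately show "I +>\<^bsub>O_K D\<^esub> x = I +>\<^bsub>O_K D\<^esub> y" unfolding set by blast
  qed
qed

text \<open>By the Hermite basis, the elements s + t om with 0 <= s < c a and 0 <= t < c represent
  the quotient, which therefore has c^2 a elements.\<close>

lemma ideal_norm_eq: assumes "nonzero_ideal D I" shows "real (ideal_norm D I) = fnorm I"
proof -
  have I: "fr I" "I \<subseteq> OK" using assms nonzero_ideal_iff by auto
  have id: "ideal I (O_K D)" using I ideal_iff fr_md by auto
  obtain a b c n :: int where h: "a > 0" "c > 0" "4 * a * n = (2 * b + 1)\<^sup>2 - D"
    "\<And>s t. of_int s + of_int t * om \<in> I \<longleftrightarrow> c dvd t \<and> c * a dvd s - t * b"
    using hermite[OF I] by metis
  define f where "f = (\<lambda>(i::int, j::int). I +>\<^bsub>O_K D\<^esub> (of_int i + of_int j * om))"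
  have f_eq: "f (i, j) = f (i', j') \<longleftrightarrow> c dvd j - j' \<and> c * a dvd (i - i') - (j - j') * b" for i j i' j'
  proof -
    have "of_int i + of_int j * om - (of_int i' + of_int j' * om) = of_int (i - i') + of_int (j - j') * om"
      by (simp add: algebra_simps)
    then show ?thesis unfolding f_def h(4)[symmetric]
      by (simp only: prod.case) (subst ideal_coset_eq_iff[OF id], auto simp only: OK_add OK_mult OK_of_int om_OK)
  qed
  have "bij_betw f ({0..<c * a} \<times> {0..<c}) (carrier (O_K D Quot I))"
  proof (rule bij_betw_imageI)
    show "inj_on f ({0..<c * a} \<times> {0..<c})"
    proof (rule inj_onI, clarify)
      fix i j i' j' assume r: "i \<in> {0..<c * a}" "j \<in> {0..<c}" "i' \<in> {0..<c * a}" "j' \<in> {0..<c}"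
        and eq: "f (i, j) = f (i', j')"
      from eq have d: "c dvd j - j'" "c * a dvd (i - i') - (j - j') * b" unfolding f_eq by auto
      have "\<bar>j - j'\<bar> < c" using r by auto
      then have j: "j = j'" using dvd_imp_le_int[of "j - j'" c] d(1) by force
      then have "c * a dvd i - i'" using d(2) by simp
      moreover have "\<bar>i - i'\<bar> < c * a" using r by auto
      ultimately have "i = i'" using dvd_imp_le_int[of "i - i'" "c * a"] by force
      then show "i = i' \<and> j = j'" using j by simp
    qed
    show "f ` ({0..<c * a} \<times> {0..<c}) = carrier (O_K D Quot I)"
    proof
      show "f ` ({0..<c * a} \<times> {0..<c}) \<subseteq> carrier (O_K D Quot I)"
      proof (clarify)
        fix i j
        have "of_int i + of_int j * om \<in> OK" by (intro OK_add OK_mult OK_of_int om_OK)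
        then show "f (i, j) \<in> carrier (O_K D Quot I)"
          by (auto simp: f_def FactRing_def A_RCOSETS_def')
      qed
      show "carrier (O_K D Quot I) \<subseteq> f ` ({0..<c * a} \<times> {0..<c})"
      proof
        fix X assume "X \<in> carrier (O_K D Quot I)"
        then obtain x where x: "x \<in> OK" "X = I +>\<^bsub>O_K D\<^esub> x" by (auto simp: FactRing_def A_RCOSETS_def')
        obtain s t where st: "x = of_int s + of_int t * om" using OK_om x(1) by blast
        define j where "j = t mod c"
        define i where "i = (s - (t - j) * b) mod (c * a)"
        have "f (s, t) = f (i, j)" unfolding f_eq
        proof
          show "c dvd t - j" unfolding j_def by (simp add: mod_eq_dvd_iff)
          have "c * a dvd (s - (t - j) * b) - i" unfolding i_def by (simp add: mod_eq_dvd_iff)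
          then show "c * a dvd s - i - (t - j) * b" by (simp add: algebra_simps)
        qed
        moreover have "i \<in> {0..<c * a}" "j \<in> {0..<c}" using h unfolding i_def j_def by auto
        ultimately show "X \<in> f ` ({0..<c * a} \<times> {0..<c})"
          using x st by (intro image_eqI[of _ _ "(i, j)"]) (auto simp: f_def)
      qed
    qed
  qed
  then have "ideal_norm D I = card ({0..<c * a} \<times> {0..<c})"
    unfolding ideal_norm_def Coset.order_def by (simp add: bij_betw_same_card)
  also have "\<dots> = nat (c\<^sup>2 * a)" using h by (simp add: power2_eq_square nat_mult_distrib)
  finally show ?thesis using fnorm_hermite[OF I h] h by simp
qed

text \<open>Division by the content c leaves an ideal containing b + om. Its norm a comes with D as
  a square modulo a, which is what the genus theory needs.\<close>

lemma primitive_part: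
  assumes I: "fr I" "I \<subseteq> OK"
  obtains a b c n :: int and J where "a > 0" "c > 0" "4 * a * n = (2 * b + 1)\<^sup>2 - D" "I = sc (of_int c) J"
    "fr J" "J \<subseteq> OK" "fnorm J = of_int a" "\<And>s t. of_int s + of_int t * om \<in> J \<longleftrightarrow> a dvd s - t * b"
proof -
  obtain a b c n :: int where h: "a > 0" "c > 0" "4 * a * n = (2 * b + 1)\<^sup>2 - D"
    "\<And>s t. of_int s + of_int t * om \<in> I \<longleftrightarrow> c dvd t \<and> c * a dvd s - t * b"
    using hermite[OF I] by metis
  define J where "J = sc (1 / of_int c) I"
  have IJ: "I = sc (of_int c) J" unfolding J_def using h by (simp add: sc_sc)
  have memI: "of_int s + of_int t * om \<in> J \<longleftrightarrow> of_int (c * s) + of_int (c * t) * om \<in> I" for s t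
    unfolding J_def using h by (simp add: sc_mem_iff algebra_simps)
  have mem: "of_int s + of_int t * om \<in> J \<longleftrightarrow> a dvd s - t * b" for s t
  proof -
    have "c * s - c * t * b = c * (s - t * b)" by (simp add: algebra_simps)
    then show ?thesis unfolding memI h(4) using h by simp
  qed
  have frJ: "fr J" unfolding J_def using h by (intro fr_sc I(1) K_divide) auto
  have J: "J \<subseteq> OK"
  proof
    fix x assume "x \<in> J"
    then have xI: "of_int c * x \<in> I" unfolding IJ by (rule sc_I)
    then obtain s t where st: "of_int c * x = of_int s + of_int t * om" using OK_om I by blast
    then have "c dvd t" "c * a dvd s - t * b" using h(4) xI by auto
    then have "c dvd t" "c dvd s - t * b" using dvd_mult_left by auto
    then have "c dvd (s - t * b) + t * b" by (intro dvd_add) auto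
    then have "c dvd s" by simp
    with \<open>c dvd t\<close> obtain s' t' where "s = c * s'" "t = c * t'" by blast
    then have "of_int c * x = of_int c * (of_int s' + of_int t' * om)" using st by (simp add: algebra_simps)
    then have "x = of_int s' + of_int t' * om" using h by simp
    then show "x \<in> OK" by auto
  qed
  have "(of_int c)\<^sup>2 * fnorm J = of_int (c\<^sup>2 * a)"
    using fnorm_hermite[OF I h] fnorm_sc[OF frJ, of "of_int c"] h unfolding IJ[symmetric] by simp
  then have "fnorm J = of_int a" using h by simp
  then show ?thesis using that[OF h(1,2,3) IJ frJ J _ mem] by blast
qed

end

section \<open>The class group\<close>

context imag_quad begin

definition Kx :: "complex set" where "Kx = {k \<in> K. k \<noteq> 0}"

lemma Kx_mult: "k \<in> Kx \<Longrightarrow> l \<in> Kx \<Longrightarrow> k * l \<in> Kx"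
  and Kx_inverse: "k \<in> Kx \<Longrightarrow> inverse k \<in> Kx"
  and Kx_cnj: "k \<in> Kx \<Longrightarrow> cnj k \<in> Kx"
  by (auto simp: Kx_def)

lemma Kx_1 [simp]: "1 \<in> Kx" by (simp add: Kx_def)

lemma fr_scx: "fr I \<Longrightarrow> k \<in> Kx \<Longrightarrow> fr (sc k I)" by (simp add: fr_sc Kx_def)

lemma principal_eq: "principal_ideals D = {sc k OK | k. k \<in> Kx}"
  unfolding principal_ideals_def sc_def Kx_def K_def OK_def by auto

definition cls :: "complex set \<Rightarrow> complex set set" where "cls I = ideal_class D I"

lemma cls_eq: assumes "fr I" shows "cls I = {sc k I | k. k \<in> Kx}"
proof -
  have "prd (sc k OK) I = sc k I" for k using prd_OK[OF fr_md[OF assms]] by (simp flip: sc_prd)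
  then show ?thesis unfolding cls_def ideal_class_def r_coset_def principal_eq idl_sel by auto
qed

lemma cls_self: "fr I \<Longrightarrow> I \<in> cls I"
  unfolding cls_eq by (auto intro!: exI[of _ 1])

lemma cls_sc: assumes "fr I" "k \<in> Kx" shows "cls (sc k I) = cls I"
proof -
  have 1: "cls (sc k I) \<subseteq> cls I" if "fr I" "k \<in> Kx" for I k
    using that by (auto simp: cls_eq fr_scx sc_sc intro: Kx_mult)
  have "cls (sc (inverse k) (sc k I)) \<subseteq> cls (sc k I)"
    using assms by (intro 1 fr_scx Kx_inverse)
  moreover have "sc (inverse k) (sc k I) = I" using assms by (simp add: sc_sc Kx_def)
  ultimately show ?thesis using 1[OF assms] by simp
qed

lemma cls_eq_iff: assumes "fr I" "fr J" shows "cls I = cls J \<longleftrightarrow> (\<exists>k\<in>Kx. J = sc k I)"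
proof
  assume "cls I = cls J"
  then have "J \<in> cls I" using cls_self[OF assms(2)] by simp
  then show "\<exists>k\<in>Kx. J = sc k I" using assms by (auto simp: cls_eq)
qed (use cls_sc assms in auto)

lemma subgroup_principal: "subgroup (principal_ideals D) (ideal_group D)"
proof -
  interpret G: comm_group "ideal_group D" by (rule comm_group_ideals)
  show ?thesis
  proof (rule G.subgroupI)
    show "principal_ideals D \<subseteq> carrier (ideal_group D)"
      by (auto simp: principal_eq idl_sel fr_scx)
    show "principal_ideals D \<noteq> {}" by (auto simp: principal_eq intro: Kx_1)
    show "inv\<^bsub>ideal_group D\<^esub> I \<in> principal_ideals D" if I: "I \<in> principal_ideals D" for I
    proof -
      obtain k where k: "k \<in> Kx" "I = sc k OK" using I by (auto simp: principal_eq)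
      have "prd (sc (inverse k) OK) (sc k OK) = OK"
        using k by (simp add: prd_sc_right sc_sc prd_OK Kx_def flip: sc_prd)
      then have "inv\<^bsub>ideal_group D\<^esub> I = sc (inverse k) OK"
        using k by (intro G.inv_equality) (auto simp: idl_sel fr_scx Kx_inverse)
      then show ?thesis using k Kx_inverse by (auto simp: principal_eq)
    qed
    show "I \<otimes>\<^bsub>ideal_group D\<^esub> J \<in> principal_ideals D" if IJ: "I \<in> principal_ideals D" "J \<in> principal_ideals D" for I J
    proof -
      obtain k l where k: "k \<in> Kx" "I = sc k OK" "l \<in> Kx" "J = sc l OK" using IJ by (auto simp: principal_eq)
      then have "prd I J = sc (l * k) OK" by (simp add: prd_sc_right sc_sc prd_OK flip: sc_prd)
      then show ?thesis using k Kx_mult by (auto simp: principal_eq idl_sel)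
    qed
  qed
qed

lemma normal_principal: "principal_ideals D \<lhd> ideal_group D"
proof -
  interpret G: comm_group "ideal_group D" by (rule comm_group_ideals)
  show ?thesis using subgroup_principal G.normal_iff_subgroup by blast
qed

lemma comm_group_classes: "comm_group (class_group D)"
  unfolding class_group_def using comm_group.abelian_FactGroup[OF comm_group_ideals] subgroup_principal
  by blast

lemma class_carrier: "carrier (class_group D) = cls ` {I. fr I}"
  unfolding class_group_def carrier_FactGroup cls_def ideal_class_def idl_sel by simp

lemma cls_mult: assumes "fr I" "fr J" shows "cls I \<otimes>\<^bsub>class_group D\<^esub> cls J = cls (prd I J)"
  using normal.rcos_sum[OF normal_principal, of I J] assms
  by (simp add: class_group_def cls_def ideal_class_def idl_sel)

lemma cls_one: "\<one>\<^bsub>class_group D\<^esub> = cls OK"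
  by (auto simp: class_group_def cls_eq principal_eq)

lemma cls_closed [simp]: "fr I \<Longrightarrow> cls I \<in> carrier (class_group D)"
  by (auto simp: class_carrier)

lemma cls_inv: assumes "fr I" shows "inv\<^bsub>class_group D\<^esub> (cls I) = cls (iv I)" "cls (iv I) = cls (cj I)"
proof -
  interpret C: comm_group "class_group D" by (rule comm_group_classes)
  show "inv\<^bsub>class_group D\<^esub> (cls I) = cls (iv I)"
    using assms fr_iv prd_iv by (intro C.inv_equality) (auto simp: cls_mult cls_one prd_comm)
  show "cls (iv I) = cls (cj I)" unfolding iv_def
    using fnorm_K(2)[OF assms] fnorm(1)[OF assms] by (intro cls_sc fr_cj assms) (auto simp: Kx_def)
qed

lemma cls_prd_cong: "fr I \<Longrightarrow> fr I' \<Longrightarrow> fr J \<Longrightarrow> fr J' \<Longrightarrow> cls I = cls I' \<Longrightarrow> cls J = cls J' \<Longrightarrow> cls (prd I J) = cls (prd I' J')"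
  by (metis cls_mult)

subsection \<open>Integral ideals\<close>

text \<open>To contain is to divide. The passage from an element x of I to the integral ideal x I^-1
  underlies all the counting below.\<close>

lemma mem_iff_integral: assumes "fr I" shows "x \<in> I \<longleftrightarrow> sc x (iv I) \<subseteq> OK"
proof
  assume "x \<in> I"
  then show "sc x (iv I) \<subseteq> OK" using prd_I[of x I _ "iv I"] prd_iv[OF assms] by (auto simp: sc_def)
next
  assume a: "sc x (iv I) \<subseteq> OK"
  have "prd (sc x (iv I)) I = sc x OK" using prd_iv[OF assms] by (metis sc_prd prd_comm)
  moreover have "prd (sc x (iv I)) I \<subseteq> prd OK I" using a by (intro prd_mono) auto
  ultimately have "sc x OK \<subseteq> I" using prd_OK[OF fr_md[OF assms]] by simp
  then show "x \<in> I" using sc_I[OF OK_1, of x] by auto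
qed

lemma subset_iff_integral: assumes "fr I" "fr J" shows "J \<subseteq> I \<longleftrightarrow> prd J (iv I) \<subseteq> OK"
proof
  assume "J \<subseteq> I"
  then have "prd J (iv I) \<subseteq> prd I (iv I)" by (intro prd_mono) auto
  then show "prd J (iv I) \<subseteq> OK" using prd_iv[OF assms(1)] by simp
next
  assume a: "prd J (iv I) \<subseteq> OK"
  have "sc x (iv I) \<subseteq> OK" if "x \<in> J" for x
    using a prd_I[OF that, of _ "iv I"] by (auto simp: sc_def)
  then show "J \<subseteq> I" using mem_iff_integral[OF assms(1)] by blast
qed

lemma integral_norm_1: assumes "fr J" "J \<subseteq> OK" "fnorm J = 1" shows "J = OK"
proof -
  have "cj J \<subseteq> OK" using assms(2) OK_cnj by auto
  then have "prd J (cj J) \<subseteq> prd J OK" by (intro prd_mono) auto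
  then have "OK \<subseteq> J" using fnorm(3)[OF assms(1)] assms(3) prd_OK[OF fr_md[OF assms(1)]] by (simp add: prd_comm)
  then show ?thesis using assms(2) by auto
qed

text \<open>The integral ideal J I^-1 has norm 1, so it is \<open>OK\<close>.\<close>

lemma subset_same_norm: assumes "fr I" "fr J" "J \<subseteq> I" "fnorm J = fnorm I" shows "J = I"
proof -
  have "prd J (iv I) = OK"
    using assms fr_iv fr_prd fnorm_prd fnorm_iv fnorm(1)[OF assms(1)] subset_iff_integral
    by (intro integral_norm_1) auto
  then have "prd I (prd J (iv I)) = prd I OK" by simp
  moreover have "prd I (prd J (iv I)) = prd (prd I (iv I)) J" by (simp only: prd_ac)
  ultimately show ?thesis using prd_iv[OF assms(1)] prd_OK fr_md assms by (metis prd_comm)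
qed

lemma iv_iv: assumes "fr I" shows "iv (iv I) = I"
proof (rule prd_cancel)
  show "prd (iv I) (iv (iv I)) = prd (iv I) I" using prd_iv assms fr_iv by (metis prd_comm)
qed (use assms fr_iv in auto)

lemma norm_mem_integral: assumes "fr I" "I \<subseteq> OK" shows "of_real (fnorm I) \<in> I"
proof -
  have "sc (of_real (fnorm I)) (iv I) = cj I" unfolding iv_def using fnorm(1)[OF assms(1)] by (simp add: sc_sc)
  then show ?thesis using mem_iff_integral[OF assms(1)] assms(2) by auto
qed

section \<open>Finiteness: ideals of bounded norm and ideal classes\<close>

definition ideals_of_norm :: "complex set set \<Rightarrow> nat \<Rightarrow> complex set set" where
  "ideals_of_norm C n = {I. fr I \<and> I \<subseteq> OK \<and> fnorm I = real n \<and> cls I = C}"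

lemma ideals_of_norm_eq: "{I. nonzero_ideal D I \<and> ideal_norm D I = n \<and> ideal_class D I = C} = ideals_of_norm C n"
proof -
  have "ideal_norm D I = n \<longleftrightarrow> fnorm I = real n" if "nonzero_ideal D I" for I
    using ideal_norm_eq[OF that] by (metis of_nat_eq_iff)
  then show ?thesis unfolding ideals_of_norm_def cls_def using nonzero_ideal_iff by auto
qed

text \<open>An ideal is determined by its Hermite data a, c and b modulo a, and the norm c^2 a
  bounds all three.\<close>

lemma finite_bounded_norm: "finite {I. fr I \<and> I \<subseteq> OK \<and> fnorm I \<le> real M}"
proof -
  define S where "S = (\<lambda>(a, b, c). {of_int s + of_int t * om | s t. (c::int) dvd t \<and> c * a dvd s - t * b})"
  have "{I. fr I \<and> I \<subseteq> OK \<and> fnorm I \<le> real M} \<subseteq> S ` ({0..int M} \<times> {0..int M} \<times> {0..int M})"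
  proof
    fix I assume "I \<in> {I. fr I \<and> I \<subseteq> OK \<and> fnorm I \<le> real M}"
    then have I: "fr I" "I \<subseteq> OK" "fnorm I \<le> real M" by auto
    obtain a b c n :: int where h: "a > 0" "c > 0" "4 * a * n = (2 * b + 1)\<^sup>2 - D"
      "\<And>s t. of_int s + of_int t * om \<in> I \<longleftrightarrow> c dvd t \<and> c * a dvd s - t * b"
      using hermite[OF I(1,2)] by metis
    have "real_of_int (c\<^sup>2 * a) \<le> of_int (int M)" using fnorm_hermite[OF I(1,2) h] I(3) by simp
    then have "c\<^sup>2 * a \<le> int M" by (simp only: of_int_le_iff)
    moreover have "a * 1 \<le> a * c\<^sup>2" "c * 1 \<le> c * (c * a)" using h by (auto intro!: mult_left_mono simp: int_one_le_iff_zero_less)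
    ultimately have le: "a \<le> int M" "c \<le> int M" by (auto simp: power2_eq_square mult_ac)
    have eq: "c dvd t \<and> c * a dvd s - t * b \<longleftrightarrow> c dvd t \<and> c * a dvd s - t * (b mod a)" for s t
    proof -
      have "c * a dvd s - t * b \<longleftrightarrow> c * a dvd s - t * (b mod a)" if "c dvd t"
      proof -
        have "a dvd b - b mod a" by (simp add: mod_eq_dvd_iff[symmetric])
        then have "c * a dvd t * (b - b mod a)" using that by (rule mult_dvd_mono[rotated])
        moreover have "s - t * (b mod a) = (s - t * b) + t * (b - b mod a)" by (simp add: algebra_simps)
        ultimately show ?thesis by (metis dvd_add_left_iff)
      qed
      then show ?thesis by blast
    qed
    have "x \<in> I \<longleftrightarrow> x \<in> S (a, b mod a, c)" for x
    proof
      assume "x \<in> I"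
      then obtain s t where "x = of_int s + of_int t * om" using OK_om I by blast
      then show "x \<in> S (a, b mod a, c)" using \<open>x \<in> I\<close> h(4) eq unfolding S_def by auto
    qed (use h(4) eq in \<open>auto simp: S_def\<close>)
    then have "I = S (a, b mod a, c)" by blast
    moreover have "b mod a \<in> {0..int M}" using pos_mod_bound[OF h(1), of b] pos_mod_sign[OF h(1), of b] le(1) by simp
    ultimately show "I \<in> S ` ({0..int M} \<times> {0..int M} \<times> {0..int M})"
      using le h by (intro image_eqI[of _ _ "(a, b mod a, c)"]) auto
  qed
  then show ?thesis by (rule finite_subset) auto
qed

lemma finite_ideals_of_norm: "finite (ideals_of_norm C n)"
  by (rule finite_subset[OF _ finite_bounded_norm[of n]]) (auto simp: ideals_of_norm_def)

text \<open>A pigeonhole argument in the role of Minkowski's bound: with k the integer part of sqrt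
  N(I) there are (k + 1)^2 > N(I) elements i + j om with 0 <= i, j <= k, so two of them agree modulo
  I. The constant 3 - D is a crude bound for the norm of their difference, coming from 4 N(s + t om)
  = 4 s^2 + 4 s t + (1 - D) t^2.\<close>

lemma small_element:
  assumes I: "fr I" "I \<subseteq> OK"
  obtains x where "x \<in> I" "x \<noteq> 0" "(cmod x)\<^sup>2 \<le> (3 - of_int D) * fnorm I"
proof -
  have id: "ideal I (O_K D)" "nonzero_ideal D I" using I ideal_iff nonzero_ideal_iff fr_md by auto
  define N where "N = ideal_norm D I"
  have N: "real N = fnorm I" unfolding N_def by (rule ideal_norm_eq[OF id(2)])
  define k where "k = nat \<lfloor>sqrt (real N)\<rfloor>"
  have k: "real k \<le> sqrt N" "sqrt N < real k + 1" unfolding k_def by (auto simp: of_nat_nat)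
  have k2: "(real k)\<^sup>2 \<le> N" using power_mono[OF k(1), of 2] by simp
  have "real N < (real k + 1)\<^sup>2" using power_strict_mono[OF k(2), of 2] by simp
  also have "\<dots> = real ((k + 1)\<^sup>2)" by (simp add: add.commute)
  finally have lt: "N < (k + 1)\<^sup>2" by (simp only: of_nat_less_iff)
  define f where "f = (\<lambda>(i::nat, j::nat). I +>\<^bsub>O_K D\<^esub> (of_nat i + of_nat j * om))"
  have Npos: "N > 0" using N fnorm(1)[OF I(1)] by simp
  have card: "card (carrier (O_K D Quot I)) = N" unfolding N_def ideal_norm_def Coset.order_def ..
  have fin: "finite (carrier (O_K D Quot I))" using card Npos card.infinite by fastforce
  have okk: "of_nat i + of_nat j * om \<in> OK" for i j by (intro OK_add OK_mult OK_of_nat om_OK)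
  have "f ` ({0..k} \<times> {0..k}) \<subseteq> carrier (O_K D Quot I)"
    using okk by (auto simp: f_def FactRing_def A_RCOSETS_def')
  then have "card (f ` ({0..k} \<times> {0..k})) \<le> N" using card fin card_mono by metis
  also have "N < card ({0..k} \<times> {0..k})" using lt by (simp add: power2_eq_square)
  finally have "\<not> inj_on f ({0..k} \<times> {0..k})" by (rule pigeonhole)
  then obtain i j i' j' where ij: "i \<le> k" "j \<le> k" "i' \<le> k" "j' \<le> k" "(i, j) \<noteq> (i', j')" "f (i, j) = f (i', j')"
    unfolding inj_on_def by auto
  define s where "s = int i - int i'"
  define t where "t = int j - int j'"
  define x where "x = of_int s + of_int t * om"
  have "of_nat i + of_nat j * om - (of_nat i' + of_nat j' * om) \<in> I"
    using ij(6) ideal_coset_eq_iff[OF id(1) okk okk] unfolding f_def by simp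
  then have "x \<in> I" unfolding x_def s_def t_def by (simp add: algebra_simps)
  moreover have "x \<noteq> 0" using om_coords_inj[of s t 0 0] ij(5) unfolding x_def s_def t_def by auto
  moreover have "(cmod x)\<^sup>2 \<le> (3 - of_int D) * fnorm I"
  proof -
    have "x = el (2 * s + t) t" unfolding x_def by (simp add: om_def el_def field_simps)
    then have "4 * (cmod x)\<^sup>2 = of_int ((2 * s + t)\<^sup>2 - D * t\<^sup>2)" using cmod_el by simp
    also have "\<dots> = of_int (4 * s\<^sup>2 + 4 * s * t + (1 - D) * t\<^sup>2)" by (simp add: power2_eq_square algebra_simps)
    finally have eq: "4 * (cmod x)\<^sup>2 = of_int (4 * s\<^sup>2 + 4 * s * t + (1 - D) * t\<^sup>2)" .
    have st: "\<bar>s\<bar> \<le> int k" "\<bar>t\<bar> \<le> int k" using ij unfolding s_def t_def by auto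
    have s2: "s\<^sup>2 \<le> (int k)\<^sup>2" "t\<^sup>2 \<le> (int k)\<^sup>2" using st by (simp_all add: abs_le_square_iff[symmetric])
    have "2 * (s * t) \<le> s\<^sup>2 + t\<^sup>2" using zero_le_power2[of "s - t"] unfolding power2_diff by linarith
    moreover have "(1 - D) * t\<^sup>2 \<le> (1 - D) * (int k)\<^sup>2" using s2 D_neg by (intro mult_left_mono) auto
    ultimately have "4 * s\<^sup>2 + 4 * s * t + (1 - D) * t\<^sup>2 \<le> (9 - D) * (int k)\<^sup>2"
      using s2 by (simp add: algebra_simps)
    also have "\<dots> \<le> 4 * (3 - D) * (int k)\<^sup>2" using D_neg by (intro mult_right_mono) auto
    finally have "4 * (cmod x)\<^sup>2 \<le> of_int (4 * (3 - D) * (int k)\<^sup>2)" unfolding eq by (simp only: of_int_le_iff)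
    then have "4 * (cmod x)\<^sup>2 \<le> 4 * ((3 - of_int D) * (real k)\<^sup>2)" by (simp add: algebra_simps)
    then have "(cmod x)\<^sup>2 \<le> (3 - of_int D) * (real k)\<^sup>2" by simp
    also have "\<dots> \<le> (3 - of_int D) * real N" using k2 D_neg by (intro mult_left_mono) auto
    finally show ?thesis using N by simp
  qed
  ultimately show ?thesis using that by blast
qed

lemma integral_rep: assumes "fr I" obtains n :: int where "n > 0" "fr (sc (of_int n) I)" "sc (of_int n) I \<subseteq> OK" "cls (sc (of_int n) I) = cls I"
proof -
  obtain n where n: "n > 0" "\<forall>x\<in>I. of_int n * x \<in> OK" using fr_of_int_denom[OF assms(1)] .
  then show ?thesis using that[of n] cls_sc[OF assms] fr_scx[OF assms] by (auto simp: Kx_def sc_def)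
qed

text \<open>Multiplying I^-1 by a short element of I gives an integral ideal of norm at most 3 - D,
  and the inverse of that ideal lies in the class of I.\<close>

lemma finite_classes: "finite (carrier (class_group D))"
proof -
  define M where "M = nat (3 - D)"
  have "carrier (class_group D) \<subseteq> (\<lambda>J. cls (iv J)) ` {I. fr I \<and> I \<subseteq> OK \<and> fnorm I \<le> real M}"
  proof
    fix C assume "C \<in> carrier (class_group D)"
    then obtain I0 where I0: "fr I0" "C = cls I0" unfolding class_carrier by auto
    obtain n :: int where n: "n > 0" "fr (sc (of_int n) I0)" "sc (of_int n) I0 \<subseteq> OK" "cls (sc (of_int n) I0) = C"
      using integral_rep[OF I0(1)] I0(2) by metis
    define I where "I = sc (of_int n) I0"
    have I: "fr I" "I \<subseteq> OK" "cls I = C" using n unfolding I_def by auto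
    obtain x where x: "x \<in> I" "x \<noteq> 0" "(cmod x)\<^sup>2 \<le> (3 - of_int D) * fnorm I" using small_element[OF I(1,2)] .
    define J where "J = sc x (iv I)"
    have xK: "x \<in> Kx" using x I OK_K by (auto simp: Kx_def)
    have J: "fr J" "J \<subseteq> OK" unfolding J_def using fr_scx[OF fr_iv[OF I(1)] xK] mem_iff_integral[OF I(1)] x by auto
    have "fnorm J = (cmod x)\<^sup>2 / fnorm I" unfolding J_def using fnorm_sc[OF fr_iv[OF I(1)], of x] fnorm_iv[OF I(1)] xK
      by (simp add: Kx_def)
    also have "\<dots> \<le> 3 - of_int D" using x(3) fnorm(1)[OF I(1)] by (simp add: field_simps)
    finally have "fnorm J \<le> real M" unfolding M_def using D_neg by simp
    moreover have "cls (iv J) = C"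
    proof -
      have "cls J = cls (iv I)" unfolding J_def by (rule cls_sc[OF fr_iv[OF I(1)] xK])
      then have "cls (iv J) = cls (iv (iv I))" using cls_inv(1) J(1) fr_iv[OF I(1)] by metis
      then show ?thesis using iv_iv I by simp
    qed
    ultimately show "C \<in> (\<lambda>J. cls (iv J)) ` {I. fr I \<and> I \<subseteq> OK \<and> fnorm I \<le> real M}" using J by auto
  qed
  then show ?thesis using finite_bounded_norm finite_subset by blast
qed

subsection \<open>Ideals of norm coprime to a given number in a class\<close>

text \<open>The binary quadratic form N(x) / N(I) attached to I. On I its values are integers, so
  there the floor changes only the type.\<close>

definition fq :: "complex set \<Rightarrow> complex \<Rightarrow> int" where "fq I x = \<lfloor>(cmod x)\<^sup>2 / fnorm I\<rfloor>"

lemma fq_eq: assumes "fr I" "x \<in> I" shows "of_int (fq I x) = (cmod x)\<^sup>2 / fnorm I"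
  using norm_over_fnorm(2)[OF assms(1) assms(2) assms(2)] unfolding fq_def by (auto elim!: Ints_cases)

lemma fq_combine: assumes I: "fr I" "x \<in> I" "y \<in> I"
  obtains t where "\<And>r s. fq I (of_int r * x + of_int s * y) = r\<^sup>2 * fq I x + r * s * t + s\<^sup>2 * fq I y"
proof -
  obtain t where t: "2 * Re (x * cnj y) / fnorm I = of_int t"
    using norm_over_fnorm(1)[OF I] by (auto elim!: Ints_cases)
  have "fq I (of_int r * x + of_int s * y) = r\<^sup>2 * fq I x + r * s * t + s\<^sup>2 * fq I y" for r s
  proof -
    have mem: "of_int r * x + of_int s * y \<in> I" using md_D(4,6)[OF fr_md[OF I(1)]] I by blast
    have "(cmod (of_int r * x + of_int s * y))\<^sup>2 = (of_int r)\<^sup>2 * (cmod x)\<^sup>2 + of_int (r * s) * (2 * Re (x * cnj y)) + (of_int s)\<^sup>2 * (cmod y)\<^sup>2"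
      unfolding cmod_power2 by (simp add: power2_eq_square algebra_simps)
    then have "(cmod (of_int r * x + of_int s * y))\<^sup>2 / fnorm I = (of_int r)\<^sup>2 * ((cmod x)\<^sup>2 / fnorm I)
      + of_int (r * s) * (2 * Re (x * cnj y) / fnorm I) + (of_int s)\<^sup>2 * ((cmod y)\<^sup>2 / fnorm I)"
      by (simp only: add_divide_distrib times_divide_eq_right)
    then have "real_of_int (fq I (of_int r * x + of_int s * y)) = of_int (r\<^sup>2 * fq I x + r * s * t + s\<^sup>2 * fq I y)"
      unfolding t using fq_eq[OF I(1) mem] fq_eq[OF I(1,2)] fq_eq[OF I(1,3)] by simp
    then show ?thesis by (simp only: of_int_eq_iff)
  qed
  then show ?thesis using that by blast
qed

text \<open>Otherwise l N(I) would divide every norm from I, against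
  \<open>fnorm_gcd\<close>.\<close>

lemma fq_not_dvd: assumes "fr I" "prime (l::int)" obtains x where "x \<in> I" "\<not> l dvd fq I x"
proof -
  have "\<exists>x\<in>I. \<not> l dvd fq I x"
  proof (rule ccontr)
    assume "\<not> ?thesis"
    then have d: "l dvd fq I x" if "x \<in> I" for x using that by blast
    have l: "l > 1" using assms(2) prime_gt_1_int by blast
    have "(cmod x)\<^sup>2 / (of_int l * fnorm I) \<in> \<int>" if xI: "x \<in> I" for x
    proof -
      obtain k where k: "fq I x = l * k" using d[OF xI] ..
      have "(cmod x)\<^sup>2 / (of_int l * fnorm I) = of_int (fq I x) / of_int l"
        unfolding fq_eq[OF assms(1) xI] by simp
      also have "\<dots> = of_int k" unfolding k using l by simp
      finally show ?thesis by simp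
    qed
    then have "fnorm I / (of_int l * fnorm I) \<in> \<int>" by (rule fnorm_gcd[OF assms(1)])
    then have "of_int 1 / real_of_int l \<in> \<int>" using fnorm(1)[OF assms(1)] by simp
    then have "l dvd 1" using l by (simp only: of_int_div_of_int_in_Ints_iff) auto
    then show False using l by auto
  qed
  then show ?thesis using that by blast
qed

text \<open>The primes are added one at a time. At l x + m y, with m the product of the earlier
  primes, the form is m^2 times its value at y modulo the new prime l, and l^2 times its value at x
  modulo each earlier prime.\<close>

lemma fq_coprime_primes:
  assumes "fr I" "finite S" "\<And>l. l \<in> S \<Longrightarrow> prime (l::int)"
  shows "\<exists>x\<in>I. \<forall>l\<in>S. \<not> l dvd fq I x"
  using assms(2,3)
proof (induction S rule: finite_induct)
  case empty
  then show ?case using md_D(2)[OF fr_md[OF assms(1)]] by auto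
next
  case (insert l S)
  then obtain x where x: "x \<in> I" "\<And>r. r \<in> S \<Longrightarrow> \<not> r dvd fq I x" by auto
  obtain y where y: "y \<in> I" "\<not> l dvd fq I y" using fq_not_dvd[OF assms(1), of l] insert by auto
  define m where "m = \<Prod>S"
  obtain t where t: "\<And>r s. fq I (of_int r * x + of_int s * y) = r\<^sup>2 * fq I x + r * s * t + s\<^sup>2 * fq I y"
    using fq_combine[OF assms(1) x(1) y(1)] by metis
  have lp: "prime l" using insert by simp
  have lm: "\<not> l dvd m"
  proof
    assume "l dvd m"
    then obtain r where r: "r \<in> S" "l dvd r" unfolding m_def using prime_dvd_prod_iff[OF insert(1) lp, of id] by auto
    then have "l = r" using lp insert.prems by (metis insertCI primes_dvd_imp_eq)
    then show False using r insert by auto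
  qed
  have "\<not> r dvd fq I (of_int l * x + of_int m * y)" if r: "r \<in> insert l S" for r
  proof (cases "r = l")
    case True
    have "\<not> l dvd m\<^sup>2 * fq I y" using lp lm y(2) by (simp add: prime_dvd_mult_iff prime_dvd_power_iff)
    moreover have "l dvd l\<^sup>2 * fq I x + l * m * t" by (simp add: power2_eq_square)
    ultimately show ?thesis unfolding t True by (simp add: dvd_add_right_iff)
  next
    case False
    then have rS: "r \<in> S" using r by simp
    have rp: "prime r" using insert.prems rS by simp
    have "\<not> r dvd l" using rp lp False primes_dvd_imp_eq by blast
    then have "\<not> r dvd l\<^sup>2 * fq I x" using rp x(2)[OF rS] by (simp add: prime_dvd_mult_iff prime_dvd_power_iff)
    moreover have "id r dvd prod id S" by (rule dvd_prodI[OF insert(1) rS])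
    then have "r dvd m" unfolding m_def by simp
    then have "r dvd l * m * t + m\<^sup>2 * fq I y" by (simp add: power2_eq_square)
    ultimately show ?thesis unfolding t by (simp add: dvd_add_left_iff add.assoc)
  qed
  moreover have "of_int l * x + of_int m * y \<in> I"
    by (intro md_D(6)[OF fr_md[OF assms(1)]] md_D(4)[OF fr_md[OF assms(1)]] OK_of_int x(1) y(1))
  ultimately show ?case by blast
qed

text \<open>At an x in I^-1 where the form of I^-1 is prime to m, its value is the norm of the
  integral ideal x I. The scalar x is recorded because \<open>principal_genus\<close> uses it to
  compare the two norms.\<close>

lemma coprime_rep:
  assumes "fr I" "m \<noteq> (0::int)"
  obtains J g where "fr J" "J \<subseteq> OK" "cls J = cls I" "g > 0" "fnorm J = of_int g" "coprime g m"
    "\<exists>x\<in>iv I. J = sc x I \<and> x \<in> Kx"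
proof -
  define I' where "I' = iv I"
  have I': "fr I'" "iv I' = I" unfolding I'_def using assms fr_iv iv_iv by auto
  \<comment> \<open>The prime 2 is added so that the value, and with it x, is nonzero even when m is
    a unit.\<close>
  have "\<exists>x\<in>I'. \<forall>l\<in>insert 2 (prime_factors m). \<not> l dvd fq I' x"
    by (rule fq_coprime_primes[OF I'(1)]) (auto simp: in_prime_factors_iff)
  then obtain x where x: "x \<in> I'" "\<And>l. l \<in> prime_factors m \<Longrightarrow> \<not> l dvd fq I' x" "\<not> 2 dvd fq I' x" by auto
  have co: "coprime (fq I' x) m"
  proof (rule ccontr)
    assume "\<not> ?thesis"
    then have "gcd (fq I' x) m \<noteq> 0" "\<not> is_unit (gcd (fq I' x) m)" using assms(2) by (auto simp: coprime_iff_gcd_eq_1)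
    then obtain l where "prime l" "l dvd gcd (fq I' x) m" using prime_divisor_exists by blast
    then show False using x(2)[of l] assms(2) by (auto simp: in_prime_factors_iff)
  qed
  have x0: "x \<noteq> 0" using x(3) by (auto simp: fq_def)
  have xK: "x \<in> Kx" using x(1) x0 md_D(1)[OF fr_md[OF I'(1)]] by (auto simp: Kx_def)
  define J where "J = sc x I"
  have J: "fr J" "J \<subseteq> OK" "cls J = cls I" unfolding J_def
    using fr_scx[OF assms(1) xK] cls_sc[OF assms(1) xK] mem_iff_integral[OF I'(1), of x] x(1) I'(2) by auto
  have "fnorm J = (cmod x)\<^sup>2 * fnorm I" unfolding J_def using fnorm_sc[OF assms(1)] xK by (simp add: Kx_def)
  also have "\<dots> = of_int (fq I' x)" unfolding fq_eq[OF I'(1) x(1)] using fnorm_iv[OF assms(1)] by (simp add: I'_def)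
  finally have f: "fnorm J = of_int (fq I' x)" .
  then have "fq I' x > 0" using fnorm(1)[OF J(1)] by simp
  then show ?thesis using that[OF J _ f co] x(1) xK J_def I'_def by blast
qed

subsection \<open>Elements of an ideal and integral ideals in the inverse class\<close>

text \<open>The norm of a unit is a positive integer dividing 1, and conversely the conjugate
  inverts an element of norm 1.\<close>

lemma Units_OK: "Units (O_K D) = {x \<in> OK. cmod x = 1}"
proof -
  have "x \<in> OK \<and> (\<exists>y\<in>OK. y * x = 1 \<and> x * y = 1) \<longleftrightarrow> x \<in> OK \<and> cmod x = 1" for x
  proof safe
    fix y assume xy: "x \<in> OK" "y \<in> OK" "x * y = 1"
    then have "nn x * nn y = 1" using nn_mult[of x y] nn_of_int[of 1] by simp
    then have "nn x = 1" using nn_nonneg[of x] nn_nonneg[of y] by (simp add: zmult_eq_1_iff)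
    then have "(cmod x)\<^sup>2 = 1" using of_int_nn[OF xy(1)] by simp
    then show "cmod x = 1" using power2_eq_imp_eq[of "cmod x" 1] by simp
  next
    assume x: "x \<in> OK" "cmod x = 1"
    then have "x * cnj x = 1" using complex_norm_square[of x] by simp
    then show "\<exists>y\<in>OK. y * x = 1 \<and> x * y = 1" using OK_cnj[OF x(1)]
      by (intro bexI[of _ "cnj x"] conjI) (simp_all add: mult.commute)
  qed
  then show ?thesis unfolding Units_def ring_sel by (intro Collect_cong) auto
qed

text \<open>This is 2 u_D, kept as a natural number.\<close>

definition wu :: nat where "wu = card {x \<in> OK. cmod x = 1}"

lemma wu_unit_half: "unit_half D = real wu / 2"
  unfolding unit_half_def Units_OK wu_def ..

lemma finite_units: "finite {x \<in> OK. cmod x = 1}"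
  by (rule finite_subset[OF _ OK_finite_bounded[of 1]]) auto

lemma wu_pos: "wu > 0"
  unfolding wu_def using finite_units by (auto simp: card_gt_0_iff intro!: exI[of _ 1])

lemma finite_ideal_elements: assumes "fr I" shows "finite {x \<in> I. (cmod x)\<^sup>2 \<le> c}"
proof -
  obtain n where n: "n > 0" "\<forall>x\<in>I. of_int n * x \<in> OK" using fr_of_int_denom[OF assms(1)] .
  have "(\<lambda>x. of_int n * x) ` {x \<in> I. (cmod x)\<^sup>2 \<le> c} \<subseteq> {x \<in> OK. (cmod x)\<^sup>2 \<le> (of_int n)\<^sup>2 * c}"
    using n by (auto simp: norm_mult power_mult_distrib intro!: mult_left_mono)
  then have "finite ((\<lambda>x. of_int n * x) ` {x \<in> I. (cmod x)\<^sup>2 \<le> c})" using OK_finite_bounded finite_subset by blast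
  moreover have "inj_on (\<lambda>x. of_int n * x :: complex) {x \<in> I. (cmod x)\<^sup>2 \<le> c}" using n by (intro inj_onI) auto
  ultimately show ?thesis by (rule finite_imageD)
qed

lemma sc_OK_eq_iff: assumes "x \<in> Kx" "y \<in> Kx" shows "sc x OK = sc y OK \<longleftrightarrow> (\<exists>u\<in>OK. cmod u = 1 \<and> y = u * x)"
proof
  assume eq: "sc x OK = sc y OK"
  have nz: "x \<noteq> 0" "y \<noteq> 0" using assms by (auto simp: Kx_def)
  have "y \<in> sc x OK" "x \<in> sc y OK" using eq sc_I[OF OK_1, of x] sc_I[OF OK_1, of y] by auto
  then have u: "y / x \<in> OK" "x / y \<in> OK" using nz by (auto simp: sc_mem_iff)
  have "y / x \<in> Units (O_K D)" using u nz by (auto simp: Units_def intro!: bexI[of _ "x / y"])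
  then show "\<exists>u\<in>OK. cmod u = 1 \<and> y = u * x" using nz u unfolding Units_OK by (intro bexI[of _ "y / x"]) auto
next
  assume "\<exists>u\<in>OK. cmod u = 1 \<and> y = u * x"
  then obtain u where u: "u \<in> OK" "cmod u = 1" "y = u * x" by blast
  then have uu: "u * cnj u = 1" using complex_norm_square[of u] by simp
  have "sc u OK = OK"
  proof
    show "sc u OK \<subseteq> OK" using u by (auto simp: sc_def)
    show "OK \<subseteq> sc u OK"
    proof
      fix z assume "z \<in> OK"
      moreover have "z = u * (cnj u * z)" using uu by (simp flip: mult.assoc)
      ultimately show "z \<in> sc u OK" using u(1) sc_I by (metis OK_cnj OK_mult)
    qed
  qed
  then show "sc x OK = sc y OK" unfolding u by (metis sc_sc mult.commute)
qed

text \<open>Sending x to x I^-1 maps the elements of norm n N(I) onto the integral ideals of norm n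
  in the class of I^-1, and the fibres are the orbits of the units.\<close>

lemma card_elements:
  assumes I: "fr I" and n: "n > 0"
  shows "card {x \<in> I. (cmod x)\<^sup>2 = real n * fnorm I} = wu * card (ideals_of_norm (cls (iv I)) n)"
proof -
  let ?E = "{x \<in> I. (cmod x)\<^sup>2 = real n * fnorm I}"
  define \<Phi> where "\<Phi> = (\<lambda>x. sc x (iv I))"
  have Ep: "x \<in> Kx" if "x \<in> ?E" for x
    using that md_D(1)[OF fr_md[OF I]] n fnorm(1)[OF I] by (auto simp: Kx_def)
  have im: "\<Phi> ` ?E = ideals_of_norm (cls (iv I)) n"
  proof
    show "\<Phi> ` ?E \<subseteq> ideals_of_norm (cls (iv I)) n"
    proof
      fix J assume "J \<in> \<Phi> ` ?E"
      then obtain x where x: "x \<in> ?E" "J = sc x (iv I)" unfolding \<Phi>_def by auto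
      have xK: "x \<in> Kx" by (rule Ep[OF x(1)])
      have "fnorm J = real n" unfolding x(2) using fnorm_sc[OF fr_iv[OF I], of x] xK x(1) fnorm_iv[OF I] fnorm(1)[OF I]
        by (simp add: Kx_def)
      then show "J \<in> ideals_of_norm (cls (iv I)) n" unfolding ideals_of_norm_def
        using fr_scx[OF fr_iv[OF I] xK] cls_sc[OF fr_iv[OF I] xK] mem_iff_integral[OF I] x by auto
    qed
    show "ideals_of_norm (cls (iv I)) n \<subseteq> \<Phi> ` ?E"
    proof
      fix J assume "J \<in> ideals_of_norm (cls (iv I)) n"
      then have J: "fr J" "J \<subseteq> OK" "fnorm J = real n" "cls (iv I) = cls J" unfolding ideals_of_norm_def by auto
      then obtain x where x: "x \<in> Kx" "J = sc x (iv I)" using cls_eq_iff[OF fr_iv[OF I] J(1)] by auto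
      have "x \<in> I" using mem_iff_integral[OF I] J(2) x(2) by simp
      moreover have "(cmod x)\<^sup>2 = real n * fnorm I"
        using J(3) fnorm_sc[OF fr_iv[OF I], of x] x fnorm_iv[OF I] fnorm(1)[OF I] by (simp add: Kx_def field_simps)
      ultimately show "J \<in> \<Phi> ` ?E" unfolding \<Phi>_def using x by auto
    qed
  qed
  have fin: "finite ?E" by (rule finite_subset[OF _ finite_ideal_elements[OF I, of "real n * fnorm I"]]) auto
  have "card (?E \<inter> \<Phi> -` {J}) = wu" if J: "J \<in> \<Phi> ` ?E" for J
  proof -
    obtain x where x: "x \<in> ?E" "J = \<Phi> x" using J by auto
    have *: "\<Phi> y = \<Phi> x \<longleftrightarrow> (\<exists>u\<in>OK. cmod u = 1 \<and> y = u * x)" if "y \<in> Kx" for y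
    proof -
      have "prd (sc z OK) (iv I) = sc z (iv I)" for z using prd_OK[OF fr_md[OF fr_iv[OF I]]] by (simp flip: sc_prd)
      then have "sc y (iv I) = sc x (iv I) \<longleftrightarrow> sc x OK = sc y OK"
        using prd_cancel[OF fr_iv[OF I], of "sc x OK" "sc y OK"] fr_scx[OF fr_OK] Ep[OF x(1)] that by (metis prd_comm)
      then show ?thesis unfolding \<Phi>_def using sc_OK_eq_iff[OF Ep[OF x(1)] that] by simp
    qed
    have "?E \<inter> \<Phi> -` {J} = (\<lambda>u. u * x) ` {u \<in> OK. cmod u = 1}" (is "?l = ?r")
    proof
      show "?l \<subseteq> ?r" using * Ep x(2) by fastforce
      show "?r \<subseteq> ?l"
      proof
        fix y assume "y \<in> ?r"
        then obtain u where u: "u \<in> OK" "cmod u = 1" "y = u * x" by auto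
        then have y: "y \<in> ?E" using x md_D(4)[OF fr_md[OF I]] by (auto simp: norm_mult)
        then show "y \<in> ?l" using *[OF Ep[OF y]] u x(2) by auto
      qed
    qed
    moreover have "inj_on (\<lambda>u. u * x) {u \<in> OK. cmod u = 1}" using Ep[OF x(1)] by (intro inj_onI) (auto simp: Kx_def)
    ultimately show ?thesis unfolding wu_def by (simp add: card_image)
  qed
  then have "card ?E = (\<Sum>J\<in>\<Phi> ` ?E. wu)" using sum.image_gen[OF fin, of "\<lambda>_. 1::nat" \<Phi>]
    by (simp add: vimage_def Int_def conj_commute)
  then show ?thesis unfolding im by (simp add: mult.commute)
qed

end

section \<open>Ramified ideals\<close>

lemma squarefree_dvd_square:
  fixes n t :: int assumes "squarefree n" "n dvd t\<^sup>2" shows "n dvd t"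
proof -
  have n0: "n \<noteq> 0" using assms(1) by auto
  define g where "g = gcd n t"
  have g0: "g \<noteq> 0" using n0 by (simp add: g_def)
  obtain m s where ms: "n = g * m" "t = g * s" "coprime m s"
    using gcd_coprime_exists[of n t] n0 unfolding g_def by (metis gcd_eq_0_iff mult.commute)
  have "g * m dvd g * (g * s\<^sup>2)" using assms(2) unfolding ms by (simp add: power2_eq_square mult_ac)
  then have "m dvd g * s\<^sup>2" using g0 by simp
  then have "m dvd g" using ms(3) by (simp add: coprime_dvd_mult_left_iff)
  then have "m\<^sup>2 dvd n" unfolding ms by (simp add: power2_eq_square)
  then have "m dvd 1" using assms(1) unfolding squarefree_def by blast
  then have "m dvd s" by (rule dvd_trans) simp
  then show ?thesis unfolding ms by simp
qed

lemma squarefree_coprime_factors: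
  fixes a b :: int assumes "squarefree (a * b)" shows "coprime a b"
proof -
  have "(gcd a b)\<^sup>2 dvd a * b" by (simp add: power2_eq_square mult_dvd_mono)
  then have "gcd a b dvd 1" using assms unfolding squarefree_def by blast
  then show ?thesis by (simp add: coprime_iff_gcd_eq_1)
qed

lemma squarefree_prod_prime_factors:
  fixes d :: int assumes "squarefree d" "d > 0" shows "\<Prod>(prime_factors d) = d"
proof -
  have "(\<Prod>p\<in>prime_factors d. p ^ multiplicity p d) = d"
    using prod_prime_factors[of d] assms by simp
  moreover have "multiplicity p d = 1" if "p \<in> prime_factors d" for p
    using squarefree_factorial_semiring'[of d] assms that by auto
  ultimately show ?thesis by (simp cong: prod.cong)
qed

context imag_quad begin

text \<open>For a positive divisor d of D this is the unique ideal of norm d, the product of the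
  ramified primes over d. Describing it through the trace turns membership into a
  congruence.\<close>

definition dd :: "int \<Rightarrow> complex set" where "dd d = {x \<in> OK. d dvd T x}"

lemma dvd_D_odd: assumes "d dvd D" shows "odd d" "coprime d 2"
proof -
  show "odd d" using assms D_odd by (metis dvd_trans)
  then show "coprime d 2" by simp
qed

lemma dvd_D_sqf: "d dvd D \<Longrightarrow> squarefree d" using D_sqf squarefree_mono by blast

lemma dvd_T_mult: assumes "d dvd D" "x \<in> OK" "y \<in> OK" shows "[2 * T (x * y) = T x * T y] (mod d)"
  using T_mult[OF assms(2,3)] assms(1) cong_dvd_modulus by blast

lemma dd_OK: "dd d \<subseteq> OK" by (auto simp: dd_def)

lemma dd_md: assumes "d dvd D" shows "md (dd d)"
  unfolding md_def
proof (intro conjI ballI)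
  show "dd d \<subseteq> K" using dd_OK OK_K by blast
  show "0 \<in> dd d" by (simp add: dd_def)
  show "x - y \<in> dd d" if "x \<in> dd d" "y \<in> dd d" for x y
    using that by (auto simp: dd_def T_diff)
  show "r * x \<in> dd d" if "r \<in> OK" "x \<in> dd d" for r x
  proof -
    have x: "x \<in> OK" "d dvd T x" using that by (auto simp: dd_def)
    have "d dvd 2 * T (r * x)" using dvd_T_mult[OF assms that(1) x(1)] x(2) by (simp add: cong_dvd_iff)
    then have "d dvd T (r * x)" using dvd_D_odd(2)[OF assms] by (simp add: coprime_dvd_mult_right_iff)
    then show ?thesis using that x by (auto simp: dd_def)
  qed
qed

lemma dd_fr: assumes "d dvd D" shows "fr (dd d)"
proof -
  have "d \<noteq> 0" using assms D_neg by auto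
  moreover have "of_int d \<in> dd d" by (simp add: dd_def)
  ultimately have "dd d \<noteq> {0}" by force
  then show ?thesis unfolding fr_def using dd_md[OF assms] dd_OK by (auto intro!: bexI[of _ 1])
qed

lemma cj_dd [simp]: "cj (dd d) = dd d"
  by (auto simp: dd_def cj_mem_iff T_cnj)

text \<open>Modulo d one has 4 N = T^2, and d is odd and squarefree.\<close>

lemma nn_dvd_iff: assumes "d dvd D" "x \<in> OK" shows "d dvd nn x \<longleftrightarrow> d dvd T x"
proof -
  have "[4 * nn x = T x * T x] (mod d)" using nn_cong[OF assms(2)] assms(1) cong_dvd_modulus by blast
  then have "d dvd 4 * nn x \<longleftrightarrow> d dvd T x * T x" by (rule cong_dvd_iff)
  moreover have "coprime d 4" using dvd_D_odd(2)[OF assms(1)] coprime_mult_right_iff[of d 2 2] by simp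
  then have "d dvd 4 * nn x \<longleftrightarrow> d dvd nn x" by (simp add: coprime_dvd_mult_right_iff)
  moreover have "d dvd T x * T x \<longleftrightarrow> d dvd T x"
    using squarefree_dvd_square[OF dvd_D_sqf[OF assms(1)], of "T x"]
    unfolding power2_eq_square by (blast intro: dvd_mult)
  ultimately show ?thesis by blast
qed

text \<open>All norms from \<open>dd d\<close> are multiples of d, so its norm is d k. The elements
  d and \<open>el d 1\<close>, of norms d^2 and d (d - D/d) / 4, show that k divides both d and D/d;
  then k^2 divides D, and k = 1.\<close>

lemma dd_norm: assumes "d dvd D" "d > 0" shows "fnorm (dd d) = of_int d"
proof -
  have "(cmod x)\<^sup>2 / of_int d \<in> \<int>" if x: "x \<in> dd d" for x
  proof -
    have "x \<in> OK" "d dvd nn x" using x nn_dvd_iff[OF assms(1)] by (auto simp: dd_def)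
    then show ?thesis using of_int_nn[of x] by (metis of_int_divide_in_Ints)
  qed
  then obtain k where k: "fnorm (dd d) / of_int d = of_int k" using fnorm_gcd[OF dd_fr[OF assms(1)]] by (metis Ints_cases)
  then have f: "fnorm (dd d) = of_int (d * k)" using assms by (simp add: field_simps)
  have "0 < real_of_int d * of_int k" using fnorm(1)[OF dd_fr[OF assms(1)]] unfolding f by simp
  then have kp: "k > 0" using zero_less_mult_pos[of "real_of_int d" "of_int k"] assms by simp
  have x: "of_int d \<in> dd d" by (simp add: dd_def)
  have "(cmod (of_int d :: complex))\<^sup>2 / fnorm (dd d) = of_int d / of_int k"
    unfolding f using assms kp by (simp add: field_simps power2_eq_square)
  then have "of_int d / real_of_int k \<in> \<int>" using norm_over_fnorm(2)[OF dd_fr[OF assms(1)] x x] by simp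
  then have 1: "k dvd d" using kp by (simp add: of_int_div_of_int_in_Ints_iff)
  obtain m where m: "D = d * m" using assms(1) ..
  have od: "odd d" "odd m" using m D_odd by auto
  have y: "el d 1 \<in> dd d" using od by (simp add: dd_def el_OK_iff)
  have "4 * (cmod (el d 1))\<^sup>2 = of_int (d * (d - m))" using cmod_el[of d 1] m by (simp add: power2_eq_square algebra_simps)
  then have "4 * (cmod (el d 1))\<^sup>2 / fnorm (dd d) = of_int (d - m) / of_int k"
    unfolding f using assms kp by (simp add: field_simps)
  moreover have "4 * (cmod (el d 1))\<^sup>2 / fnorm (dd d) \<in> \<int>"
    using Ints_mult[OF Ints_numeral norm_over_fnorm(2)[OF dd_fr[OF assms(1)] y y], of "num.Bit0 (num.Bit0 num.One)"] by simp
  ultimately have "of_int (d - m) / real_of_int k \<in> \<int>" by simp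
  then have "k dvd d - m" using kp by (simp only: of_int_div_of_int_in_Ints_iff) auto
  then have "k dvd m" using 1 by (metis dvd_diff_right_iff dvd_diff_commute)
  then have "k\<^sup>2 dvd D" unfolding m using 1 by (simp add: power2_eq_square mult_dvd_mono)
  then have "k dvd 1" using D_sqf unfolding squarefree_def by blast
  then show ?thesis using f kp by simp
qed

text \<open>Norms of elements of I are multiples of N(I), hence of d, and \<open>nn_dvd_iff\<close>
  carries this over to traces.\<close>

lemma dd_superset:
  assumes "d dvd D" "fr I" "I \<subseteq> OK" "fnorm I = of_int g" "d dvd g" shows "I \<subseteq> dd d"
proof
  fix x assume x: "x \<in> I"
  have xO: "x \<in> OK" using x assms by auto
  have "real_of_int (nn x) / of_int g \<in> \<int>" using norm_over_fnorm(2)[OF assms(2) x x] of_int_nn[OF xO] assms(4) by simp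
  then have "g dvd nn x" using fnorm(1)[OF assms(2)] assms(4) by (simp add: of_int_div_of_int_in_Ints_iff)
  then have "d dvd nn x" using assms(5) by (rule dvd_trans[rotated])
  then show "x \<in> dd d" using xO nn_dvd_iff[OF assms(1) xO] by (simp add: dd_def)
qed

lemma dd_unique: assumes "d dvd D" "d > 0" "fr I" "I \<subseteq> OK" "fnorm I = of_int d" shows "I = dd d"
  using subset_same_norm[OF dd_fr[OF assms(1)] assms(3) dd_superset[OF assms(1,3,4,5)]] assms dd_norm by simp

lemma prd_OK_subset: "I \<subseteq> OK \<Longrightarrow> J \<subseteq> OK \<Longrightarrow> prd I J \<subseteq> OK"
  by (rule prd_minimal) auto

lemma dd_mult: assumes "d * e dvd D" "d > 0" "e > 0" shows "prd (dd d) (dd e) = dd (d * e)"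
proof (rule dd_unique)
  have "d dvd D" "e dvd D" using assms by (auto dest: dvd_mult_left dvd_mult_right)
  then show "fr (prd (dd d) (dd e))" "fnorm (prd (dd d) (dd e)) = of_int (d * e)"
    using dd_fr dd_norm assms fr_prd fnorm_prd by auto
qed (use assms dd_OK prd_OK_subset in auto)

lemma dd_square: assumes "d dvd D" "d > 0" shows "prd (dd d) (dd d) = sc (of_int d) OK"
  using fnorm(3)[OF dd_fr[OF assms(1)]] dd_norm[OF assms] by simp

lemma rt_Kx: "rt \<in> Kx" by (simp add: Kx_def)

lemma dd_D: "dd (- D) = sc rt OK"
proof -
  have "sc rt OK \<subseteq> OK" by (auto simp: sc_def)
  moreover have "fnorm (sc rt OK) = of_int (- D)" using fnorm_sc[OF fr_OK, of rt] by (simp add: cmod_rt)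
  ultimately show ?thesis using dd_unique[of "- D" "sc rt OK"] fr_scx[OF fr_OK rt_Kx] D_neg by simp
qed

lemma cls_prd_sc_OK: assumes "fr I" "k \<in> Kx" shows "cls (prd (sc k OK) I) = cls I"
  using cls_sc[OF assms] prd_OK[OF fr_md[OF assms(1)]] by (simp flip: sc_prd)

lemma dd_cls_square: assumes "d dvd D" "d > 0" "fr I" shows "cls (prd (dd d) (prd (dd d) I)) = cls I"
  using cls_prd_sc_OK[OF assms(3), of "of_int d"] dd_square[OF assms(1,2)] assms(2) by (simp add: Kx_def flip: prd_assoc)

text \<open>Multiplication by \<open>dd d\<close> is a bijection between the two sets of ideals: an
  integral ideal whose norm is a multiple of d lies in \<open>dd d\<close> and can be divided by
  it.\<close>

lemma card_ideals_ramified: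
  assumes "d dvd D" "d > 0" "fr I"
  shows "card (ideals_of_norm (cls (prd (dd d) I)) (nat d * n)) = card (ideals_of_norm (cls I) n)"
proof -
  note d = dd_fr[OF assms(1)]
  have inj: "inj_on (prd (dd d)) (ideals_of_norm (cls I) n)"
    by (intro inj_onI, rule prd_cancel[OF d]) (auto simp: ideals_of_norm_def)
  have "prd (dd d) ` ideals_of_norm (cls I) n = ideals_of_norm (cls (prd (dd d) I)) (nat d * n)"
  proof
    show "prd (dd d) ` ideals_of_norm (cls I) n \<subseteq> ideals_of_norm (cls (prd (dd d) I)) (nat d * n)"
    proof
      fix L assume "L \<in> prd (dd d) ` ideals_of_norm (cls I) n"
      then obtain J where J: "L = prd (dd d) J" "fr J" "J \<subseteq> OK" "fnorm J = real n" "cls J = cls I"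
        by (auto simp: ideals_of_norm_def)
      have "fnorm L = real (nat d * n)" unfolding J(1) using fnorm_prd[OF d J(2)] dd_norm[OF assms(1,2)] J(4) assms(2) by simp
      moreover have "cls L = cls (prd (dd d) I)" unfolding J(1) by (rule cls_prd_cong[OF d d J(2) assms(3) refl J(5)])
      ultimately show "L \<in> ideals_of_norm (cls (prd (dd d) I)) (nat d * n)"
        using fr_prd[OF d J(2)] prd_OK_subset[OF dd_OK J(3)] J(1) by (simp add: ideals_of_norm_def)
    qed
    show "ideals_of_norm (cls (prd (dd d) I)) (nat d * n) \<subseteq> prd (dd d) ` ideals_of_norm (cls I) n"
    proof
      fix J assume "J \<in> ideals_of_norm (cls (prd (dd d) I)) (nat d * n)"
      then have J: "fr J" "J \<subseteq> OK" "fnorm J = of_int (d * int n)" "cls J = cls (prd (dd d) I)"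
        using assms(2) by (auto simp: ideals_of_norm_def)
      define L where "L = prd J (iv (dd d))"
      have L: "fr L" unfolding L_def using J d fr_prd fr_iv by blast
      have "J \<subseteq> dd d" by (rule dd_superset[OF assms(1) J(1,2,3)]) simp
      then have LO: "L \<subseteq> OK" unfolding L_def using subset_iff_integral[OF d J(1)] by simp
      have "prd (dd d) L = prd (prd (dd d) (iv (dd d))) J" unfolding L_def by (simp only: prd_ac)
      also have "\<dots> = J" using prd_iv[OF d] prd_OK[OF fr_md[OF J(1)]] by simp
      finally have pL: "prd (dd d) L = J" .
      then have "of_int d * fnorm L = of_int d * real n" using fnorm_prd[OF d L] dd_norm[OF assms(1,2)] J(3) by auto
      then have nL: "fnorm L = real n" using assms(2) by auto
      have "cls (prd (dd d) (prd (dd d) L)) = cls (prd (dd d) (prd (dd d) I))"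
        unfolding pL by (rule cls_prd_cong) (use d J assms fr_prd in auto)
      then have "cls L = cls I" using dd_cls_square[OF assms(1,2)] L assms(3) by simp
      then show "J \<in> prd (dd d) ` ideals_of_norm (cls I) n" using pL L LO nL by (auto simp: ideals_of_norm_def)
    qed
  qed
  then show ?thesis using card_image[OF inj] by simp
qed

lemma card_ideals_cj: assumes "fr I" shows "card (ideals_of_norm (cls (cj I)) n) = card (ideals_of_norm (cls I) n)"
proof -
  have cc: "cls (cj J) = cls (cj I)" if "fr I" "fr J" "cls J = cls I" for I J
    using that cls_inv by metis
  have sub: "cj ` ideals_of_norm (cls I) n \<subseteq> ideals_of_norm (cls (cj I)) n" if "fr I" for I
  proof
    fix L assume "L \<in> cj ` ideals_of_norm (cls I) n"
    then obtain J where J: "L = cj J" "fr J" "J \<subseteq> OK" "fnorm J = real n" "cls J = cls I" by (auto simp: ideals_of_norm_def)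
    then show "L \<in> ideals_of_norm (cls (cj I)) n" using fr_cj fnorm_cj cc[OF that J(2,5)] OK_cnj
      by (auto simp: ideals_of_norm_def)
  qed
  have "ideals_of_norm (cls (cj I)) n \<subseteq> cj ` ideals_of_norm (cls I) n"
  proof
    fix L assume "L \<in> ideals_of_norm (cls (cj I)) n"
    then have "cj L \<in> ideals_of_norm (cls I) n" using sub[OF fr_cj[OF assms]] by auto
    then show "L \<in> cj ` ideals_of_norm (cls I) n" by (intro image_eqI[of _ _ "cj L"]) auto
  qed
  then have "cj ` ideals_of_norm (cls I) n = ideals_of_norm (cls (cj I)) n" using sub[OF assms] by blast
  moreover have "inj_on cj (ideals_of_norm (cls I) n)" by (intro inj_onI) (metis cj_cj)
  ultimately show ?thesis using card_image by metis
qed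

text \<open>The ideal of norm |D| is generated by sqrt D, so multiplication by it keeps the class.
  This turns r_A(m |D|), which occurs in the term n = 0, into r_A(m).\<close>

lemma card_ideals_times_D: assumes "fr I" shows "card (ideals_of_norm (cls I) (nat (- D) * n)) = card (ideals_of_norm (cls I) n)"
  using card_ideals_ramified[of "- D" I n] dd_D cls_prd_sc_OK[OF assms rt_Kx] assms D_neg by simp

subsection \<open>Classes of order two\<close>

lemma hilbert90:
  assumes "\<gamma> \<in> K" "cmod \<gamma> = 1" obtains \<delta> where "\<delta> \<in> Kx" "\<gamma> = \<delta> / cnj \<delta>"
proof (cases "\<gamma> = -1")
  \<comment> \<open>Here 1 + \<gamma> vanishes, and sqrt D takes its place.\<close>
  case True
  then show ?thesis using that[of rt] rt_Kx by simp
next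
  case False
  have "\<gamma> * cnj \<gamma> = 1" using assms(2) complex_norm_square[of \<gamma>] by simp
  then have "\<gamma> * cnj (1 + \<gamma>) = 1 + \<gamma>" by (simp add: algebra_simps)
  moreover have nz: "1 + \<gamma> \<noteq> 0"
  proof
    assume "1 + \<gamma> = 0"
    then have "\<gamma> = - 1" by (simp add: add_eq_0_iff)
    then show False using False by simp
  qed
  moreover from nz have "cnj (1 + \<gamma>) \<noteq> 0" by (simp only: complex_cnj_zero_iff) simp
  ultimately have "\<gamma> = (1 + \<gamma>) / cnj (1 + \<gamma>)" by (simp only: eq_divide_eq) simp
  moreover have "1 + \<gamma> \<in> Kx" using assms nz by (auto simp: Kx_def)
  ultimately show ?thesis using that by blast
qed

text \<open>If I^2 is generated by k, then I = \<gamma> cnj I with \<gamma> = k / N(I) of norm 1,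
  and Hilbert 90 gives a multiple of I that is stable under conjugation. The primitive part of such
  an ideal contains b + om and its conjugate, hence 2b + 1; so its norm a divides 2b + 1 and
  therefore D.\<close>

lemma ambiguous_class:
  assumes "fr I" "cls (prd I I) = cls OK"
  obtains d where "d > 0" "d dvd D" "cls I = cls (dd d)"
proof -
  obtain k where k: "k \<in> Kx" "prd I I = sc k OK" using cls_eq_iff[OF fr_OK fr_prd[OF assms(1,1)]] assms(2) by auto
  define N where "N = fnorm I"
  have N: "N > 0" "of_real N \<in> Kx" unfolding N_def using fnorm(1)[OF assms(1)] fnorm_K(1)[OF assms(1)] by (auto simp: Kx_def)
  define \<gamma> where "\<gamma> = k / of_real N"
  have \<gamma>K: "\<gamma> \<in> Kx" unfolding \<gamma>_def using k N by (auto simp: Kx_def)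
  have "prd I I = sc \<gamma> (prd I (cj I))" unfolding fnorm(3)[OF assms(1)] N_def[symmetric] k(2) \<gamma>_def using N by (simp add: sc_sc)
  then have "prd I I = prd I (sc \<gamma> (cj I))" by (simp add: prd_sc_right)
  then have Ieq: "I = sc \<gamma> (cj I)" using prd_cancel[OF assms(1,1) fr_scx[OF fr_cj[OF assms(1)] \<gamma>K]] by blast
  have "fnorm I = (cmod \<gamma>)\<^sup>2 * fnorm I"
    using fnorm_sc[OF fr_cj[OF assms(1)], of \<gamma>] \<gamma>K fnorm_cj[OF assms(1)] Ieq by (simp add: Kx_def)
  then have "(cmod \<gamma>)\<^sup>2 = 1" using fnorm(1)[OF assms(1)] by simp
  then have "cmod \<gamma> = 1" using power2_eq_imp_eq[of "cmod \<gamma>" 1] by simp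
  then obtain \<delta> where \<delta>: "\<delta> \<in> Kx" "\<gamma> = \<delta> / cnj \<delta>" using hilbert90 \<gamma>K by (auto simp: Kx_def)
  define J where "J = sc (inverse \<delta>) I"
  have J: "fr J" "cls J = cls I" unfolding J_def using fr_scx cls_sc assms(1) Kx_inverse[OF \<delta>(1)] by auto
  have \<delta>0: "\<delta> \<noteq> 0" using \<delta>(1) by (simp add: Kx_def)
  have "J = sc (inverse \<delta>) (sc \<gamma> (cj I))" unfolding J_def using Ieq by simp
  also have "\<dots> = sc (inverse (cnj \<delta>)) (cj I)" unfolding \<delta>(2) using \<delta>0 by (simp add: sc_sc field_simps)
  also have "\<dots> = cj J" unfolding J_def by (simp add: cj_sc)
  finally have cJ: "cj J = J" ..
  obtain n :: int where n: "n > 0" "fr (sc (of_int n) J)" "sc (of_int n) J \<subseteq> OK" "cls (sc (of_int n) J) = cls J"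
    using integral_rep[OF J(1)] by metis
  obtain a b c m :: int and L where L: "a > 0" "c > 0" "4 * a * m = (2 * b + 1)\<^sup>2 - D" "sc (of_int n) J = sc (of_int c) L"
    "fr L" "L \<subseteq> OK" "fnorm L = of_int a" "\<And>s t. of_int s + of_int t * om \<in> L \<longleftrightarrow> a dvd s - t * b"
    using primitive_part[OF n(2,3)] by metis
  have "cj (sc (of_int c) L) = sc (of_int c) L" unfolding L(4)[symmetric] by (simp add: cj_sc cJ)
  then have "sc (of_int c) (cj L) = sc (of_int c) L" by (simp add: cj_sc)
  from sc_inj[OF _ this] have cL: "cj L = L" using L(2) by simp
  have "of_int b + of_int 1 * om \<in> L" unfolding L(8) by simp
  then have bL: "of_int b + om \<in> L" by simp
  then have "cnj (of_int b + om) \<in> L" using cL cj_mem_iff[of "cnj (of_int b + om)" L] by simp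
  then have "of_int b + om + cnj (of_int b + om) \<in> L" using md_D(6)[OF fr_md[OF L(5)] bL] by blast
  moreover have "of_int b + om + cnj (of_int b + om) = of_int (2 * b + 1) + of_int 0 * om"
    by (simp add: om_def el_def complex_eq_iff)
  ultimately have "a dvd 2 * b + 1" using L(8)[of "2 * b + 1" 0] by simp
  then have "a dvd (2 * b + 1)\<^sup>2 - 4 * a * m" by (auto simp: power2_eq_square)
  then have aD: "a dvd D" unfolding L(3) by simp
  have "cls (dd a) = cls L" using dd_unique[OF aD L(1,5,6,7)] by simp
  also have "\<dots> = cls (sc (of_int c) L)" using L(2) cls_sc[OF L(5), of "of_int c"] by (simp add: Kx_def)
  also have "\<dots> = cls I" using L(4) n(4) J(2) by simp
  finally show ?thesis using that L(1) aD by metis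
qed

text \<open>Equality of the classes produces an element x of norm d e whose trace is divisible by d
  and by e. After division by g = gcd d e this becomes f u'^2 + k' g y^2 = 4 with f = (d/g)(e/g),
  where k' >= 3 because p divides it, and f = 1 follows. Keeping p out of d and e excludes the
  relation between the ideals of norm d and |D|/d.\<close>

lemma dd_class_inj:
  assumes p: "D = - (p * E)" "p \<ge> 3" and d: "d > 0" "d dvd E" and e: "e > 0" "e dvd E"
    and eq: "cls (dd d) = cls (dd e)"
  shows "d = e"
proof -
  have dD: "d dvd D" "e dvd D" using d e p by auto
  obtain k where k: "k \<in> Kx" "dd e = sc k (dd d)" using cls_eq_iff[OF dd_fr[OF dD(1)] dd_fr[OF dD(2)]] eq by auto
  define x where "x = k * of_int d"
  have "x \<in> sc k (dd d)" unfolding x_def by (intro sc_I) (simp add: dd_def)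
  then have xe: "x \<in> OK" "e dvd T x" unfolding k(2)[symmetric] by (auto simp: dd_def)
  have "of_int e = (cmod k)\<^sup>2 * of_int d"
    using dd_norm[OF dD(2) e(1)] k fnorm_sc[OF dd_fr[OF dD(1)], of k] dd_norm[OF dD(1) d(1)] by (simp add: Kx_def)
  then have "(cmod x)\<^sup>2 = of_int (d * e)" unfolding x_def by (simp add: norm_mult power_mult_distrib power2_eq_square)
  then have nx: "nn x = d * e" using of_int_nn[OF xe(1)] by (metis of_int_eq_iff)
  have xd: "d dvd T x" using nn_dvd_iff[OF dD(1) xe(1)] nx by simp
  obtain u v where uv: "even (u + v)" "x = el u v" using xe(1) by (elim OK_E)
  have uv4: "4 * (d * e) = u\<^sup>2 + p * E * v\<^sup>2" using nn_el[OF uv(1)] nx uv(2) p by simp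
  define g where "g = gcd d e"
  have g: "g > 0" using d by (simp add: g_def)
  obtain d' e' where de: "d = d' * g" "e = e' * g" "coprime d' e'"
    using gcd_coprime_exists[of d e] g unfolding g_def by auto
  define f where "f = d' * e'"
  have pos: "d' > 0" "e' > 0" "f > 0" using de d e g by (auto simp: f_def zero_less_mult_iff)
  have "lcm d e = g * f" unfolding de f_def using de(3) g by (simp add: lcm_mult_right lcm_coprime[of e' d'] coprime_commute abs_mult abs_of_pos[OF pos(1)] abs_of_pos[OF pos(2)] mult_ac)
  then have "g * f dvd u" "g * f dvd E" using xd xe(2) uv(2) d(2) e(2) by (metis T_el lcm_least)+
  then obtain u' w where u': "u = g * f * u'" "E = g * f * w" by blast
  have "E > 0" using p D_neg by (metis neg_less_0_iff_less zero_less_mult_pos less_le_trans zero_less_numeral)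
  then have w: "w > 0" using u' g pos zero_less_mult_pos[of "g * f" w] by simp
  define k' where "k' = p * w"
  have k': "k' \<ge> 3" using p(2) w mult_mono[of 3 p 1 w] by (simp add: k'_def)
  have Dk: "D = - (g * f * k')" unfolding p u'(2) k'_def by (simp add: mult_ac)
  have "g * f * (4 * g) = g * f * (g * f * u'\<^sup>2 + k' * v\<^sup>2)"
    using uv4 unfolding u' de k'_def f_def by (simp add: power2_eq_square algebra_simps)
  then have eq1: "4 * g = g * f * u'\<^sup>2 + k' * v\<^sup>2" using g pos by simp
  have "squarefree (g * (f * k'))" using D_sqf Dk by (simp add: mult.assoc)
  then have gk: "coprime g k'" "squarefree g" using squarefree_coprime_factors squarefree_multD(1) by fastforce+
  have "g dvd 4 * g - g * f * u'\<^sup>2" by (simp add: mult.assoc)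
  then have "g dvd k' * v\<^sup>2" using eq1 by simp
  then have "g dvd v\<^sup>2" using gk(1) by (simp add: coprime_dvd_mult_right_iff)
  then have "g dvd v" by (rule squarefree_dvd_square[OF gk(2)])
  then obtain y where y: "v = g * y" ..
  have "g * 4 = g * (f * u'\<^sup>2 + k' * g * y\<^sup>2)" using eq1 unfolding y by (simp add: power2_eq_square algebra_simps)
  then have eq2: "f * u'\<^sup>2 + k' * g * y\<^sup>2 = 4" using g by simp
  have oddf: "odd f" using D_odd Dk by auto
  \<comment> \<open>If y = 0, the odd number f divides 4. Otherwise f u'^2 <= 1, and u' = 0 would
    make the odd number k' g equal to 4.\<close>
  have "f = 1"
  proof (cases "y = 0")
    case True
    then have "f dvd 4" using eq2 by (metis add.right_neutral dvd_triv_left mult_zero_right zero_power2)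
    then have "f dvd 2\<^sup>2" by simp
    moreover have "coprime f 2" using oddf by simp
    then have "coprime f (2\<^sup>2)" by (rule iffD2[OF coprime_power_right_iff disjI1])
    ultimately have "f dvd 1" by (meson coprime_common_divisor dvd_refl)
    then show ?thesis using pos by simp
  next
    case False
    then have "y\<^sup>2 \<ge> 1" by (simp add: int_one_le_iff_zero_less)
    have "k' * g \<ge> 3" using k' g mult_mono[of 3 k' 1 g] by simp
    then have "k' * g * y\<^sup>2 \<ge> 3" using \<open>y\<^sup>2 \<ge> 1\<close> mult_mono[of 3 "k' * g" 1 "y\<^sup>2"] by simp
    then have le1: "f * u'\<^sup>2 \<le> 1" using eq2 by simp
    have "u' \<noteq> 0"
    proof
      assume "u' = 0"
      then have y4: "k' * g * y\<^sup>2 = 4" using eq2 by simp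
      have o: "odd (k' * g)" using D_odd Dk by auto
      have "y\<^sup>2 \<le> 1"
      proof (rule ccontr)
        assume "\<not> y\<^sup>2 \<le> 1"
        then have "k' * g * y\<^sup>2 \<ge> 3 * 2" using \<open>k' * g \<ge> 3\<close> by (intro mult_mono) auto
        then show False using y4 by simp
      qed
      then have "y\<^sup>2 = 1" using \<open>y\<^sup>2 \<ge> 1\<close> by simp
      then have "k' * g = 4" using y4 by simp
      then show False using o by (metis even_numeral)
    qed
    then have "u'\<^sup>2 \<ge> 1" by (simp add: int_one_le_iff_zero_less)
    then have "f * 1 \<le> f * u'\<^sup>2" using pos by (intro mult_left_mono) auto
    then have "f \<le> 1" using le1 by linarith
    then show ?thesis using pos by simp
  qed
  then have "d' = 1" "e' = 1" using pos by (auto simp: f_def zmult_eq_1_iff)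
  then show ?thesis using de by simp
qed

text \<open>Sets of primes index the positive divisors of E. For surjectivity, a divisor d of D that
  is a multiple of p is exchanged for |D|/d: the two ideals multiply to the one generated by sqrt D,
  and both have classes of order at most two, so the classes agree.\<close>

lemma two_torsion_classes:
  assumes p: "D = - (p * E)" "p \<ge> 3" "prime p"
  shows "bij_betw (\<lambda>S. cls (dd (\<Prod>S))) (Pow (prime_factors E)) {C \<in> carrier (class_group D). C \<otimes>\<^bsub>class_group D\<^esub> C = \<one>\<^bsub>class_group D\<^esub>}"
proof -
  have E: "E > 0" using p D_neg by (metis neg_less_0_iff_less zero_less_mult_pos less_le_trans zero_less_numeral)
  have sqE: "squarefree E" using dvd_D_sqf[of E] p by simp
  have prodE: "\<Prod>S > 0" "\<Prod>S dvd E" if "S \<subseteq> prime_factors E" for S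
  proof -
    show "\<Prod>S > 0" using that by (intro prod_pos) (meson in_prime_factors_imp_prime prime_gt_0_int subsetD)
    have "\<Prod>S dvd \<Prod>(prime_factors E)" using that by (intro prod_dvd_prod_subset) auto
    then show "\<Prod>S dvd E" using squarefree_prod_prime_factors[OF sqE E] by simp
  qed
  have inj0: "S = S'" if "S \<subseteq> prime_factors E" "S' \<subseteq> prime_factors E" "\<Prod>S = \<Prod>S'" for S S'
  proof -
    have *: "S = {l. prime l \<and> l dvd \<Prod>S}" if S: "S \<subseteq> prime_factors E" for S
    proof
      have fin: "finite S" using S finite_subset by auto
      show "S \<subseteq> {l. prime l \<and> l dvd \<Prod>S}"
        using S dvd_prodI[OF fin, of _ id] by (auto simp: in_prime_factors_iff)
      show "{l. prime l \<and> l dvd \<Prod>S} \<subseteq> S"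
      proof safe
        fix l assume l: "prime l" "l dvd \<Prod>S"
        then obtain r where r: "r \<in> S" "l dvd r" using prime_dvd_prod_iff[OF fin l(1), of id] by auto
        then have "l = r" using l(1) S by (meson in_prime_factors_imp_prime primes_dvd_imp_eq subsetD)
        then show "l \<in> S" using r by simp
      qed
    qed
    show ?thesis using *[OF that(1)] *[OF that(2)] that(3) by simp
  qed
  show ?thesis
  proof (rule bij_betw_imageI)
    show "inj_on (\<lambda>S. cls (dd (\<Prod>S))) (Pow (prime_factors E))"
      using dd_class_inj[OF p(1,2)] prodE inj0 by (intro inj_onI) (metis PowD)
    show "(\<lambda>S. cls (dd (\<Prod>S))) ` Pow (prime_factors E) = {C \<in> carrier (class_group D). C \<otimes>\<^bsub>class_group D\<^esub> C = \<one>\<^bsub>class_group D\<^esub>}"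
    proof
      show "(\<lambda>S. cls (dd (\<Prod>S))) ` Pow (prime_factors E) \<subseteq> {C \<in> carrier (class_group D). C \<otimes>\<^bsub>class_group D\<^esub> C = \<one>\<^bsub>class_group D\<^esub>}"
      proof (rule image_subsetI, rule CollectI, rule conjI)
        fix S assume "S \<in> Pow (prime_factors E)"
        then have S: "S \<subseteq> prime_factors E" by simp
        have d: "\<Prod>S dvd D" "\<Prod>S > 0" using prodE[OF S] p by auto
        show "cls (dd (\<Prod>S)) \<in> carrier (class_group D)" using dd_fr[OF d(1)] by simp
      next
        fix S assume "S \<in> Pow (prime_factors E)"
        then have S: "S \<subseteq> prime_factors E" by simp
        have d: "\<Prod>S dvd D" "\<Prod>S > 0" using prodE[OF S] p by auto
        have "cls (sc (of_int (\<Prod>S)) OK) = cls OK" using d(2) by (intro cls_sc) (auto simp: Kx_def simp del: of_int_prod)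
        then show "cls (dd (\<Prod>S)) \<otimes>\<^bsub>class_group D\<^esub> cls (dd (\<Prod>S)) = \<one>\<^bsub>class_group D\<^esub>"
          using cls_mult[OF dd_fr[OF d(1)] dd_fr[OF d(1)]] dd_square[OF d] by (simp add: cls_one)
      qed
      show "{C \<in> carrier (class_group D). C \<otimes>\<^bsub>class_group D\<^esub> C = \<one>\<^bsub>class_group D\<^esub>} \<subseteq> (\<lambda>S. cls (dd (\<Prod>S))) ` Pow (prime_factors E)"
      proof
        fix C assume "C \<in> {C \<in> carrier (class_group D). C \<otimes>\<^bsub>class_group D\<^esub> C = \<one>\<^bsub>class_group D\<^esub>}"
        then have C: "C \<in> carrier (class_group D)" "C \<otimes>\<^bsub>class_group D\<^esub> C = \<one>\<^bsub>class_group D\<^esub>" by auto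
        then obtain I where I: "fr I" "C = cls I" by (auto simp: class_carrier)
        then have "cls (prd I I) = cls OK" using C(2) cls_mult[OF I(1,1)] by (simp add: cls_one)
        then obtain d where d: "d > 0" "d dvd D" "cls I = cls (dd d)" using ambiguous_class[OF I(1)] by blast
        have "\<exists>e. e > 0 \<and> e dvd E \<and> cls (dd d) = cls (dd e)"
        proof (cases "p dvd d")
          case False
          then have "coprime d p" using p(3) by (meson coprime_commute prime_imp_coprime)
          moreover have "d dvd p * E" using d(2) p(1) by simp
          ultimately have "d dvd E" by (simp add: coprime_dvd_mult_right_iff)
          then show ?thesis using d by blast
        next
          case True
          then obtain d1 where d1: "d = p * d1" ..
          obtain e where e: "- D = d * e" using d(2) by (metis dvd_def dvd_minus_iff)
          have epos: "e > 0" using e d(1) D_neg by (metis neg_0_less_iff_less zero_less_mult_pos)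
          have "p * E = p * (d1 * e)" using e p(1) d1 by (simp add: mult_ac)
          then have "e dvd E" using p(2) by simp
          have eD: "e dvd D" using \<open>e dvd E\<close> p by simp
          have "prd (dd d) (dd e) = sc rt OK" using dd_mult[of d e] d(1) epos e dd_D by (metis dvd_minus_iff dvd_refl)
          then have "cls (prd (dd e) (prd (dd e) (dd d))) = cls (prd (dd e) (sc rt OK))" by (simp add: prd_comm)
          then have "cls (dd d) = cls (dd e)" using dd_cls_square[OF eD epos dd_fr[OF d(2)]]
              cls_prd_sc_OK[OF dd_fr[OF eD] rt_Kx] by (simp add: prd_comm)
          then show ?thesis using epos \<open>e dvd E\<close> by blast
        qed
        then obtain e where e: "e > 0" "e dvd E" "cls (dd d) = cls (dd e)" by blast
        have "\<Prod>(prime_factors e) = e" using e squarefree_mono[OF e(2) sqE] by (intro squarefree_prod_prime_factors) auto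
        moreover have "prime_factors e \<subseteq> prime_factors E" using e E by (intro dvd_prime_factors) auto
        ultimately show "C \<in> (\<lambda>S. cls (dd (\<Prod>S))) ` Pow (prime_factors E)"
          using I d e by (intro image_eqI[of _ _ "prime_factors e"]) auto
      qed
    qed
  qed
qed

end

section \<open>The principal genus theorem\<close>

lemma Legendre_1_iff: "Legendre a p = 1 \<longleftrightarrow> \<not> [a = 0] (mod p) \<and> QuadRes p a"
  by (simp add: Legendre_def)

text \<open>Elements of {-1, 0, 1} are separated modulo p > 2, so identities between symbols can be
  verified with Euler's criterion.\<close>

lemma Legendre_small_cong_eq:
  assumes "[a = b] (mod int p)" "p > 2" "a \<in> {-1, 0, 1}" "b \<in> {-1, 0, 1}" shows "a = b"
proof -
  have "int p dvd a - b" using assms(1) by (simp add: cong_iff_dvd_diff)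
  moreover have "\<bar>a - b\<bar> \<le> 2" using assms(3,4) by auto
  ultimately show ?thesis using assms(2) dvd_imp_le_int[of "a - b" "int p"] by fastforce
qed

lemma Legendre_range: "Legendre a p \<in> {-1, 0, 1}" by (auto simp: Legendre_def)

lemma Legendre_mult:
  assumes "prime p" "p > 2" shows "Legendre (a * b) (int p) = Legendre a (int p) * Legendre b (int p)"
proof (rule Legendre_small_cong_eq[OF _ assms(2)])
  have "[Legendre (a * b) (int p) = (a * b) ^ ((p - 1) div 2)] (mod int p)" by (rule euler_criterion[OF assms])
  moreover have "[Legendre a (int p) * Legendre b (int p) = a ^ ((p - 1) div 2) * b ^ ((p - 1) div 2)] (mod int p)"
    by (intro cong_mult euler_criterion assms)
  ultimately show "[Legendre (a * b) (int p) = Legendre a (int p) * Legendre b (int p)] (mod int p)"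
    unfolding power_mult_distrib by (meson cong_sym cong_trans)
  show "Legendre a (int p) * Legendre b (int p) \<in> {-1, 0, 1}"
    using Legendre_range[of a "int p"] Legendre_range[of b "int p"] by auto
qed (rule Legendre_range)

lemma Legendre_minus_1:
  assumes "prime p" "p > 2" shows "Legendre (-1) (int p) = (-1) ^ ((p - 1) div 2)"
proof (rule Legendre_small_cong_eq[OF euler_criterion[OF assms] assms(2) Legendre_range])
  show "(-1 :: int) ^ ((p - 1) div 2) \<in> {-1, 0, 1}" by (cases "even ((p - 1) div 2)") auto
qed

lemma Legendre_square_factor:
  assumes "prime p" "p > 2" "\<not> int p dvd c" shows "Legendre (c\<^sup>2 * a) (int p) = Legendre a (int p)"
proof -
  have "Legendre (c\<^sup>2) (int p) = 1"
    using assms prime_dvd_power_iff[of "int p" 2 c] by (auto simp: Legendre_1_iff QuadRes_def cong_0_iff intro: exI[of _ c])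
  then show ?thesis using Legendre_mult[OF assms(1,2)] by simp
qed

lemma Legendre_prod:
  assumes "prime p" "p > 2" "finite S" shows "Legendre (\<Prod>i\<in>S. f i) (int p) = (\<Prod>i\<in>S. Legendre (f i) (int p))"
  using assms(3)
proof (induction S rule: finite_induct)
  case empty
  have "\<not> [1 = 0] (mod int p)" using assms(2) by (simp add: cong_0_iff)
  then show ?case by (auto simp: Legendre_def QuadRes_def intro: exI[of _ 1])
qed (simp add: Legendre_mult[OF assms(1,2)])

lemma p_star_mod4: assumes "prime l" "l > 2" shows "[p_star l = 1] (mod 4)"
proof -
  have "odd l" using assms prime_odd_nat by blast
  then obtain k where k: "l = 2 * k + 1" using oddE by blast
  then have "p_star l = (-1) ^ k * (2 * int k + 1)" unfolding p_star_def Legendre_minus_1[OF assms] by simp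
  moreover have "[(-1) ^ k * (2 * int k + 1) = 1] (mod 4)"
  proof (cases "even k")
    case True
    then obtain j where "k = 2 * j" by blast
    then show ?thesis by (simp add: cong_iff_dvd_diff)
  next
    case False
    then obtain j where j: "k = 2 * j + 1" using oddE by blast
    have "(-1) ^ k * (2 * int k + 1) - 1 = 4 * (- int j - 1)" unfolding j by simp
    then show ?thesis by (metis cong_iff_dvd_diff dvd_triv_left)
  qed
  ultimately show ?thesis by simp
qed

text \<open>Passing from l to \<open>p_star l\<close> absorbs the sign of the quadratic reciprocity
  law.\<close>

lemma p_star_reciprocity:
  assumes l: "prime l" "l > 2" and r: "prime r" "r > 2" and ne: "l \<noteq> r"
  shows "Legendre (p_star l) (int r) = Legendre (int r) (int l)"
proof -
  have rl: "Legendre (int r) (int l) \<noteq> 0"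
    using l r ne primes_dvd_imp_eq[of l r] by (auto simp: Legendre_def cong_0_iff)
  then have rl2: "Legendre (int r) (int l) * Legendre (int r) (int l) = 1"
    using Legendre_range[of "int r" "int l"] by auto
  have m1: "Legendre (Legendre (-1) (int l)) (int r) = (-1) ^ ((l - 1) div 2 * ((r - 1) div 2))"
  proof (cases "even ((l - 1) div 2)")
    case True
    have "\<not> [1 = 0] (mod int r)" using r(2) by (simp add: cong_0_iff)
    then have "Legendre 1 (int r) = 1" by (auto simp: Legendre_def QuadRes_def intro: exI[of _ 1])
    then show ?thesis using True by (simp add: Legendre_minus_1[OF l])
  next
    case False
    then show ?thesis by (simp add: Legendre_minus_1[OF l] Legendre_minus_1[OF r] power_mult)
  qed
  have "Legendre (p_star l) (int r) = (-1) ^ ((l - 1) div 2 * ((r - 1) div 2)) * Legendre (int l) (int r)"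
    unfolding p_star_def Legendre_mult[OF r] m1 ..
  also have "\<dots> = Legendre (int l) (int r) * Legendre (int l) (int r) * Legendre (int r) (int l)"
    using Quadratic_Reciprocity[OF l r ne] by (simp add: mult_ac)
  also have "Legendre (int l) (int r) * Legendre (int l) (int r) = 1"
  proof -
    have "Legendre (int l) (int r) \<noteq> 0"
      using l r ne primes_dvd_imp_eq[of r l] by (auto simp: Legendre_def cong_0_iff)
    then show ?thesis using Legendre_range[of "int l" "int r"] by auto
  qed
  finally show ?thesis by simp
qed

lemma square_mod_prod_primes:
  fixes a :: int
  assumes "finite S" "\<And>l. l \<in> S \<Longrightarrow> prime l" "\<And>l. l \<in> S \<Longrightarrow> QuadRes (int l) a"
  shows "\<exists>c. [c\<^sup>2 = a] (mod int (\<Prod>S))"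
  using assms
proof (induction S rule: finite_induct)
  case (insert l S)
  obtain c where c: "[c\<^sup>2 = a] (mod int (\<Prod>S))" using insert by auto
  obtain d where d: "[d\<^sup>2 = a] (mod int l)" using insert.prems(2)[of l] by (auto simp: QuadRes_def)
  have "coprime l s" if "s \<in> S" for s
    using that insert by (metis insert_iff primes_coprime)
  then have cop: "coprime l (\<Prod>S)" by (intro prod_coprime_right) auto
  then have "coprime (int l) (int (\<Prod>S))" by (simp only: coprime_int_iff)
  then obtain x where x: "[x = d] (mod int l)" "[x = c] (mod int (\<Prod>S))"
    using binary_chinese_remainder_int by blast
  have "[x\<^sup>2 = a] (mod int l)" "[x\<^sup>2 = a] (mod int (\<Prod>S))"
    using cong_trans[OF cong_pow[OF x(1)] d] cong_trans[OF cong_pow[OF x(2)] c] by auto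
  then have "[x\<^sup>2 = a] (mod (int l * int (\<Prod>S)))" using \<open>coprime (int l) _\<close> by (rule coprime_cong_mult)
  then show ?case using insert(1,2) by auto
qed auto

context imag_quad begin

section \<open>The product formula for the genus characters\<close>

lemma D_prime_factors:
  "\<Prod>(prime_factors (nat (- D))) = nat (- D)" "\<And>l. l \<in> prime_factors (nat (- D)) \<Longrightarrow> prime l \<and> l > 2 \<and> int l dvd D"
proof -
  have sq: "squarefree (nat (- D))" unfolding squarefree_def
  proof (intro allI impI)
    fix x :: nat assume "x\<^sup>2 dvd nat (- D)"
    then have "int (x\<^sup>2) dvd int (nat (- D))" by (simp only: int_dvd_int_iff)
    then have "(int x)\<^sup>2 dvd D" using D_neg by simp
    then have "int x dvd 1" using D_sqf unfolding squarefree_def by blast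
    then show "x dvd 1" by simp
  qed
  have "(\<Prod>p\<in>prime_factors (nat (- D)). p ^ multiplicity p (nat (- D))) = nat (- D)"
    using prod_prime_factors[of "nat (- D)"] D_neg by simp
  moreover have "multiplicity p (nat (- D)) = 1" if "p \<in> prime_factors (nat (- D))" for p
    using squarefree_factorial_semiring'[of "nat (- D)"] sq D_neg that by auto
  ultimately show "\<Prod>(prime_factors (nat (- D))) = nat (- D)" by (simp cong: prod.cong)
  fix l assume l: "l \<in> prime_factors (nat (- D))"
  then have pl: "prime l" "l dvd nat (- D)" by auto
  then have "int l dvd int (nat (- D))" by (simp only: int_dvd_int_iff)
  then have d: "int l dvd D" using D_neg by simp
  then have "l \<noteq> 2" using D_odd by auto
  then show "prime l \<and> l > 2 \<and> int l dvd D" using pl d prime_ge_2_nat[of l] by simp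
qed

text \<open>Both sides have absolute value |D| and are 1 modulo 4, which fixes the sign.\<close>

lemma D_prod_p_star: "D = (\<Prod>l\<in>prime_factors (nat (- D)). p_star l)"
proof -
  let ?S = "prime_factors (nat (- D))"
  let ?P = "\<Prod>l\<in>?S. p_star l"
  have "\<bar>p_star l\<bar> = int l" if "l \<in> ?S" for l
    using Legendre_minus_1[of l] D_prime_factors(2)[OF that] by (simp add: p_star_def abs_mult power_abs)
  then have "\<bar>?P\<bar> = int (\<Prod>?S)" by (simp add: abs_prod)
  also have "\<dots> = - D" using D_prime_factors(1) D_neg by simp
  finally have abs: "\<bar>?P\<bar> = - D" .
  have "[?P = (\<Prod>l\<in>?S. 1)] (mod 4)" by (rule cong_prod) (use p_star_mod4 D_prime_factors(2) in auto)
  then have P4: "[?P = 1] (mod 4)" by simp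
  show ?thesis
  proof (rule ccontr)
    assume "D \<noteq> ?P"
    then have "?P = - D" using abs by (auto simp: abs_if split: if_splits)
    then have "[- D = 1] (mod 4)" using P4 by simp
    then have "[- D + D = 1 + 1] (mod 4)" using D_mod4 by (rule cong_add)
    then show False by (simp add: cong_def)
  qed
qed

lemma Legendre_product_formula:
  assumes "prime r" "r > 2" "\<not> int r dvd D" "QuadRes (int r) D"
  shows "(\<Prod>l\<in>prime_factors (nat (- D)). Legendre (int r) (int l)) = 1"
proof -
  have "1 = Legendre D (int r)" using assms by (simp add: Legendre_def cong_0_iff)
  also have "\<dots> = (\<Prod>l\<in>prime_factors (nat (- D)). Legendre (p_star l) (int r))"
    by (subst D_prod_p_star) (rule Legendre_prod[OF assms(1,2)], simp)
  also have "\<dots> = (\<Prod>l\<in>prime_factors (nat (- D)). Legendre (int r) (int l))"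
  proof (rule prod.cong[OF refl])
    fix l assume "l \<in> prime_factors (nat (- D))"
    then have l: "prime l" "l > 2" "int l dvd D" using D_prime_factors(2) by auto
    then show "Legendre (p_star l) (int r) = Legendre (int r) (int l)"
      using assms by (intro p_star_reciprocity) auto
  qed
  finally show ?thesis ..
qed

text \<open>D is a square modulo each prime r dividing a, so (D/r) = 1 is the product of the (r/l)
  over l dividing D. This single relation among the genus characters yields the character at p from
  those at the primes of D_0.\<close>

lemma Legendre_product_formula_general:
  assumes "a > 0" "odd a" "coprime (int a) D" "[B\<^sup>2 = D] (mod int a)"
  shows "(\<Prod>l\<in>prime_factors (nat (- D)). Legendre (int a) (int l)) = 1"
  using assms
proof (induction a rule: prime_divisors_induct)
  case zero then show ?case by simp
next
  case (unit x)
  then have "x = 1" by simp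
  moreover have "Legendre 1 (int l) = 1" if "l \<in> prime_factors (nat (- D))" for l
  proof -
    have "\<not> [1 = 0] (mod int l)" using D_prime_factors(2)[OF that] by (simp add: cong_0_iff)
    then show ?thesis by (auto simp: Legendre_def QuadRes_def intro: exI[of _ 1])
  qed
  ultimately show ?case by simp
next
  case (factor r x)
  have r2: "r > 2" using factor.hyps factor.prems prime_ge_2_nat[of r] by (cases "r = 2") auto
  have x: "x > 0" "odd x" "coprime (int x) D" using factor.prems by auto
  have dv: "int r dvd B\<^sup>2 - D" "int x dvd B\<^sup>2 - D" using factor.prems(4) unfolding cong_iff_dvd_diff
    by (auto dest: dvd_mult_left dvd_mult_right)
  have rD: "\<not> int r dvd D"
  proof
    assume "int r dvd D"
    moreover have "coprime (int r) D" using factor.prems by simp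
    ultimately have "int r dvd 1" by (meson coprime_common_divisor dvd_refl)
    then show False using r2 by simp
  qed
  have "QuadRes (int r) D" using dv(1) unfolding QuadRes_def cong_iff_dvd_diff by blast
  then have 1: "(\<Prod>l\<in>prime_factors (nat (- D)). Legendre (int r) (int l)) = 1"
    using Legendre_product_formula[OF factor.hyps r2 rD] by blast
  have 2: "(\<Prod>l\<in>prime_factors (nat (- D)). Legendre (int x) (int l)) = 1"
    using factor.IH[OF x] dv(2) by (simp add: cong_iff_dvd_diff)
  have "(\<Prod>l\<in>prime_factors (nat (- D)). Legendre (int (r * x)) (int l)) =
    (\<Prod>l\<in>prime_factors (nat (- D)). Legendre (int r) (int l) * Legendre (int x) (int l))"
    by (rule prod.cong[OF refl]) (use Legendre_mult D_prime_factors(2) in auto)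
  also have "\<dots> = 1" using 1 2 by (simp add: prod.distrib)
  finally show ?case .
qed

section \<open>Norms of elements, and ideals in square classes\<close>

lemma D_not_square: "- D \<noteq> w\<^sup>2"
proof
  assume "- D = w\<^sup>2"
  then have "w\<^sup>2 dvd D" by (metis dvd_minus_iff dvd_refl)
  then have "w dvd 1" using D_sqf unfolding squarefree_def by blast
  then have "\<bar>w\<bar> = 1" by simp
  then have "w\<^sup>2 = 1" by (metis one_power2 power2_abs)
  then show False using \<open>- D = w\<^sup>2\<close> D_le by simp
qed

text \<open>Legendre's theorem by the pigeonhole principle: a small vector of the lattice on which
  $x^2 + |D| y^2 - a z^2$ is divisible by $a|D|$ takes one of the values $0$ or $a|D|$ there, and
  both exhibit $a$ as a norm.\<close>

lemma norm_of_element: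
  fixes a B c :: int
  assumes a: "a > 0" "coprime a D" "[B\<^sup>2 = D] (mod a)" "[c\<^sup>2 = a] (mod D)"
  obtains \<gamma> where "\<gamma> \<in> Kx" "(cmod \<gamma>)\<^sup>2 = of_int a"
proof -
  define m where "m = - D"
  have m: "m \<ge> 3" using D_le by (simp add: m_def)
  define fs where "fs = (\<lambda>n::int. nat \<lfloor>sqrt (of_int n)\<rfloor>)"
  have fs1: "(int (fs n))\<^sup>2 \<le> n" and fs2: "n < (int (fs n) + 1)\<^sup>2" if "n \<ge> 0" for n
  proof -
    have k: "real (fs n) \<le> sqrt n" "sqrt n < real (fs n) + 1" unfolding fs_def using that by (auto simp: of_nat_nat)
    have "(real (fs n))\<^sup>2 \<le> of_int n" using power_mono[OF k(1), of 2] that by simp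
    then have "real_of_int ((int (fs n))\<^sup>2) \<le> of_int n" by simp
    then show "(int (fs n))\<^sup>2 \<le> n" by (simp only: of_int_le_iff)
    have "of_int n < (real (fs n) + 1)\<^sup>2" using power_strict_mono[OF k(2), of 2] that by simp
    then have "of_int n < real_of_int ((int (fs n) + 1)\<^sup>2)" by simp
    then show "n < (int (fs n) + 1)\<^sup>2" by (simp only: of_int_less_iff)
  qed
  \<comment> \<open>A box of side lengths sqrt(a m), sqrt a, sqrt m, rounded down, still holds more
    than a m lattice points, while \<open>f\<close> takes at most a m values.\<close>
  define X where "X = fs (a * m)" define Y where "Y = fs a" define Z where "Z = fs m"
  have am: "a * m > 0" using a m by simp
  note bX = fs1[of "a * m"] fs2[of "a * m"] and bY = fs1[of a] fs2[of a] and bZ = fs1[of m] fs2[of m]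
  let ?A = "{0..X} \<times> {0..Y} \<times> {0..Z}"
  let ?R = "{0..<a} \<times> {0..<m}"
  define f where "f = (\<lambda>(x::nat, y::nat, z::nat). ((int x - B * int y) mod a, (int x - c * int z) mod m))"
  have "f ` ?A \<subseteq> ?R" using a m by (auto simp: f_def)
  then have "card (f ` ?A) \<le> card ?R" by (intro card_mono) auto
  also have "card ?R = nat (a * m)" using a m by (simp add: nat_mult_distrib)
  also have "nat (a * m) < card ?A"
  proof -
    have "(a * m)\<^sup>2 < ((int X + 1) * (int Y + 1) * (int Z + 1))\<^sup>2"
    proof -
      have "(a * m)\<^sup>2 = (a * m) * (a * m)" by (simp add: power2_eq_square)
      also have "\<dots> < (int X + 1)\<^sup>2 * ((int Y + 1)\<^sup>2 * (int Z + 1)\<^sup>2)"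
        using bX(2) bY(2) bZ(2) a m am unfolding X_def Y_def Z_def by (intro mult_strict_mono) auto
      finally show ?thesis by (simp add: power_mult_distrib mult_ac)
    qed
    then have "a * m < (int X + 1) * (int Y + 1) * (int Z + 1)" by (rule power2_less_imp_less) auto
    also have "\<dots> = int (card ?A)" by (simp add: algebra_simps)
    finally show ?thesis using am by (simp add: nat_less_iff)
  qed
  finally have "\<not> inj_on f ?A" by (rule pigeonhole)
  then obtain x0 y0 z0 x1 y1 z1 where t: "(x0, y0, z0) \<in> ?A" "(x1, y1, z1) \<in> ?A" "(x0, y0, z0) \<noteq> (x1, y1, z1)"
    "f (x0, y0, z0) = f (x1, y1, z1)"
    unfolding inj_on_def by (auto simp del: atLeastAtMost_iff)
  define x where "x = int x0 - int x1" define y where "y = int y0 - int y1" define z where "z = int z0 - int z1"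
  have sq: "w\<^sup>2 \<le> (int W)\<^sup>2" if "w = int w0 - int w1" "w0 \<le> W" "w1 \<le> W" for w w0 w1 W
    using that by (simp add: abs_le_square_iff[symmetric])
  have "x\<^sup>2 \<le> (int X)\<^sup>2" "y\<^sup>2 \<le> (int Y)\<^sup>2" "z\<^sup>2 \<le> (int Z)\<^sup>2" using t(1,2) by (auto intro!: sq simp: x_def y_def z_def)
  then have bd: "x\<^sup>2 \<le> a * m" "y\<^sup>2 \<le> a" "z\<^sup>2 \<le> m" using bX(1) bY(1) bZ(1) a m am unfolding X_def Y_def Z_def by auto
  have nz: "x \<noteq> 0 \<or> y \<noteq> 0 \<or> z \<noteq> 0" using t(3) by (auto simp: x_def y_def z_def)
  have "a dvd (int x0 - B * int y0) - (int x1 - B * int y1)" "m dvd (int x0 - c * int z0) - (int x1 - c * int z1)"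
    using t(4) unfolding f_def by (auto simp: mod_eq_dvd_iff)
  then have dv: "a dvd x - B * y" "m dvd x - c * z" unfolding x_def y_def z_def by (simp_all add: algebra_simps)
  define F where "F = x\<^sup>2 + m * y\<^sup>2 - a * z\<^sup>2"
  have "a dvd (x - B * y) * (x + B * y) + (B\<^sup>2 - D) * y\<^sup>2 - a * z\<^sup>2"
    using a(3) unfolding cong_iff_dvd_diff by (intro dvd_diff dvd_add dvd_mult2[OF dv(1)] dvd_triv_left) (rule dvd_mult2)
  also have "\<dots> = F" by (simp add: F_def m_def power2_eq_square algebra_simps)
  finally have aF: "a dvd F" .
  have "m dvd (x - c * z) * (x + c * z) + (c\<^sup>2 - a) * z\<^sup>2 + m * y\<^sup>2"
    using a(4) unfolding cong_iff_dvd_diff m_def[symmetric]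
    by (intro dvd_add dvd_mult2[OF dv(2)] dvd_triv_left) (simp add: m_def)
  also have "\<dots> = F" by (simp add: F_def power2_eq_square algebra_simps)
  finally have "m dvd F" .
  then have "a * m dvd F" using aF a(2) by (intro divides_mult) (auto simp: m_def)
  then obtain k where k: "F = a * m * k" ..
  have my: "m * y\<^sup>2 \<le> m * a" and az: "a * z\<^sup>2 \<le> a * m" using bd a m by (auto intro!: mult_left_mono)
  have az0: "a * z\<^sup>2 \<ge> 0" using a(1) by simp
  have "m * a = a * m" by simp
  then have "F \<le> a * m * 2" unfolding F_def using bd(1) my az0 by linarith
  then have k2: "k \<le> 2" using k am by (simp add: mult_le_cancel_left)
  have my0: "m * y\<^sup>2 \<ge> 0" using m by simp
  have "F \<ge> a * m * (- 1)" unfolding F_def using az my0 zero_le_power2[of x] by linarith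
  then have k1: "k \<ge> - 1" using k am mult_le_cancel_left[of "a * m" "-1" k] by simp
  have elnorm: "(cmod (of_int s + of_int t * rt))\<^sup>2 = of_int (s\<^sup>2 + m * t\<^sup>2)" for s t
    using Im_rt_sq by (simp add: cmod_power2 power_mult_distrib m_def)
  have elK: "of_int s + of_int t * rt \<in> K" for s t by auto
  \<comment> \<open>The extreme values -1 and 2 of k force z^2 = m, respectively x^2 = a m and y^2 =
    a. Either makes |D| a square.\<close>
  have "k \<noteq> -1"
  proof
    assume "k = -1"
    then have F: "x\<^sup>2 + m * y\<^sup>2 + (a * m - a * z\<^sup>2) = 0" using k unfolding F_def by simp
    then have "a * m - a * z\<^sup>2 = 0" using az my0 zero_le_power2[of x] by linarith
    then have "a * m = a * z\<^sup>2" by simp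
    then have "m = z\<^sup>2" using a(1) by simp
    then show False using D_not_square[of z] by (simp add: m_def)
  qed
  moreover have "k \<noteq> 2"
  proof
    assume "k = 2"
    then have F: "(a * m - x\<^sup>2) + (m * a - m * y\<^sup>2) + a * z\<^sup>2 = 0" using k unfolding F_def by (simp add: algebra_simps)
    moreover have "a * z\<^sup>2 \<ge> 0" using a(1) by simp
    ultimately have "x\<^sup>2 = a * m" "m * y\<^sup>2 = m * a" using bd(1) my by linarith+
    then have e: "x\<^sup>2 = m * y\<^sup>2" "y\<^sup>2 = a" using m by auto
    then have "y\<^sup>2 dvd x\<^sup>2" by simp
    then have "y dvd x" by (simp add: pow_divides_pow_iff)
    then obtain w where "x = y * w" ..
    then have "y\<^sup>2 * w\<^sup>2 = y\<^sup>2 * m" using e by (simp add: power_mult_distrib mult.commute)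
    then have "m = w\<^sup>2" using e(2) a(1) by auto
    then show False using D_not_square[of w] by (simp add: m_def)
  qed
  ultimately have "k = 0 \<or> k = 1" using k1 k2 by linarith
  then show ?thesis
  proof
    assume "k = 0"
    then have F: "x\<^sup>2 + m * y\<^sup>2 = a * z\<^sup>2" using k unfolding F_def by simp
    have z0: "z \<noteq> 0"
    proof
      assume "z = 0"
      then have "x\<^sup>2 + m * y\<^sup>2 = 0" using F by simp
      then have "x\<^sup>2 = 0 \<and> m * y\<^sup>2 = 0" using my0 zero_le_power2[of x] by linarith
      then show False using nz \<open>z = 0\<close> m by auto
    qed
    define \<gamma> where "\<gamma> = (of_int x + of_int y * rt) / of_int z"
    have "(cmod \<gamma>)\<^sup>2 = of_int a" unfolding \<gamma>_def norm_divide power_divide elnorm F using z0 by simp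
    moreover have "\<gamma> \<in> K" unfolding \<gamma>_def using elK by auto
    moreover from \<open>(cmod \<gamma>)\<^sup>2 = of_int a\<close> have "\<gamma> \<noteq> 0" using a(1) by auto
    ultimately show ?thesis using that[of \<gamma>] by (simp add: Kx_def)
  next
    assume "k = 1"
    then have F: "x\<^sup>2 + m * y\<^sup>2 = a * (z\<^sup>2 + m * 1\<^sup>2)" using k unfolding F_def by (simp add: algebra_simps)
    have z0: "z\<^sup>2 + m * 1\<^sup>2 > 0" using m by (simp add: add_nonneg_pos)
    define \<gamma> where "\<gamma> = (of_int x + of_int y * rt) / (of_int z + of_int 1 * rt)"
    have "(cmod \<gamma>)\<^sup>2 = of_int a" unfolding \<gamma>_def norm_divide power_divide elnorm F of_int_mult using z0
      by (simp only: of_int_0_eq_iff nonzero_mult_div_cancel_right)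
    moreover have "\<gamma> \<in> K" unfolding \<gamma>_def using elK by blast
    moreover from \<open>(cmod \<gamma>)\<^sup>2 = of_int a\<close> have "\<gamma> \<noteq> 0" using a(1) by auto
    ultimately show ?thesis using that[of \<gamma>] by (simp add: Kx_def)
  qed
qed

text \<open>Hilbert's Theorem 90 for ideals: $H\bar H = O$ gives $H\,\overline{O + H} = O + H$.\<close>

lemma norm_one_square_class:
  assumes "fr H" "fnorm H = 1" obtains B where "fr B" "cls H = cls (prd B B)"
proof -
  have H: "md H" using assms fr_md by auto
  have HH: "prd H (cj H) = OK" using fnorm(3)[OF assms(1)] assms(2) by simp
  define B where "B = {x + y | x y. x \<in> OK \<and> y \<in> H}"
  have BI: "x + y \<in> B" if "x \<in> OK" "y \<in> H" for x y using that B_def by blast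
  have OB: "OK \<subseteq> B" using BI[OF _ md_D(2)[OF H]] by auto
  have HB: "H \<subseteq> B" using BI[OF OK_0] by auto
  have mB: "md B" unfolding md_def
  proof (intro conjI ballI)
    show "B \<subseteq> K" unfolding B_def using md_D(1)[OF H] OK_K by blast
    show "0 \<in> B" using OB by auto
    show "u - v \<in> B" if "u \<in> B" "v \<in> B" for u v
    proof -
      obtain x y x' y' where xy: "u = x + y" "v = x' + y'" "x \<in> OK" "y \<in> H" "x' \<in> OK" "y' \<in> H"
        using \<open>u \<in> B\<close> \<open>v \<in> B\<close> unfolding B_def by blast
      have "u - v = (x - x') + (y - y')" using xy by simp
      then show ?thesis using BI[OF OK_diff[OF xy(3,5)] md_D(3)[OF H xy(4,6)]] by simp
    qed
    show "r * u \<in> B" if "r \<in> OK" "u \<in> B" for r u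
    proof -
      obtain x y where xy: "u = x + y" "x \<in> OK" "y \<in> H" using \<open>u \<in> B\<close> unfolding B_def by blast
      have "r * u = r * x + r * y" using xy by (simp add: algebra_simps)
      then show ?thesis using BI[OF OK_mult[OF that(1) xy(2)] md_D(4)[OF H that(1) xy(3)]] by simp
    qed
  qed
  have frB: "fr B"
  proof -
    obtain n where n: "n > 0" "\<forall>x\<in>H. of_int n * x \<in> OK" using fr_of_int_denom[OF assms(1)] .
    have "of_int n * u \<in> OK" if u: "u \<in> B" for u
    proof -
      obtain x y where xy: "u = x + y" "x \<in> OK" "y \<in> H" using u unfolding B_def by blast
      have "of_int n * u = of_int n * x + of_int n * y" using xy by (simp add: algebra_simps)
      then show ?thesis using n xy OK_mult[OF OK_of_int xy(2)] by auto
    qed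
    moreover have "1 \<in> B" using OB by auto
    then have "B \<noteq> {0}" by auto
    ultimately show ?thesis unfolding fr_def using mB n(1) by (intro conjI bexI[of _ "of_int n"]) auto
  qed
  have "prd H (cj B) = B"
  proof
    show "prd H (cj B) \<subseteq> B"
    proof (rule prd_minimal)
      fix h w assume h: "h \<in> H" "w \<in> cj B"
      then obtain x y where xy: "cnj w = x + y" "x \<in> OK" "y \<in> H" unfolding cj_mem_iff B_def by blast
      then have w: "w = cnj x + cnj y" by (metis complex_cnj_add complex_cnj_cnj)
      have "h * w = h * cnj y + cnj x * h" unfolding w by (simp add: algebra_simps)
      moreover have "h * cnj y \<in> OK" using prd_I[of h H "cnj y" "cj H"] HH h xy by auto
      moreover have "cnj x * h \<in> H" using md_D(4)[OF H OK_cnj[OF xy(2)] h(1)] .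
      ultimately show "h * w \<in> B" using BI by simp
    qed (use md_D(2,3)[OF mB] in auto)
    have "H \<subseteq> prd H (cj B)" using prd_I[of _ H 1 "cj B"] OB by (auto simp: cj_mem_iff)
    moreover have "OK \<subseteq> prd H (cj B)" unfolding HH[symmetric] using HB by (intro prd_mono) auto
    ultimately have sub: "H \<subseteq> prd H (cj B)" "OK \<subseteq> prd H (cj B)" by simp_all
    show "B \<subseteq> prd H (cj B)"
    proof
      fix u assume "u \<in> B"
      then obtain x y where "u = x + y" "x \<in> OK" "y \<in> H" unfolding B_def by blast
      then show "u \<in> prd H (cj B)" using sub by (auto intro!: prd_add)
    qed
  qed
  \<comment> \<open>So H is B divided by its conjugate, and the inverse of that conjugate has the
    class of B.\<close>
  then have "prd (prd H (cj B)) (iv (cj B)) = prd B (iv (cj B))" by simp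
  then have "H = prd B (iv (cj B))" unfolding prd_assoc prd_iv[OF fr_cj[OF frB]] prd_comm[of H OK] prd_OK[OF H] .
  moreover have "cls (prd B (iv (cj B))) = cls (prd B B)"
    using cls_inv(2)[OF fr_cj[OF frB]] by (intro cls_prd_cong frB fr_iv fr_cj) auto
  ultimately show ?thesis using that[OF frB] by simp
qed

text \<open>Since g need not be prime to 2 D, the class is first moved to a primitive ideal L whose
  norm a is. The scalar used comes from an element y of the conjugate of I with N(y) = g k^2 a. As 4
  N(y) = T(y)^2 modulo l, the property of g of being a square modulo each prime l of E passes to a.
  The product formula then supplies the prime p.\<close>

theorem principal_genus:
  fixes g c p E :: int
  assumes p: "D = - (p * E)" "p \<ge> 3" "prime p" and I: "fr I" "I \<subseteq> OK" "fnorm I = of_int g" "coprime g E" "[g = c\<^sup>2] (mod E)"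
  obtains B where "fr B" "cls I = cls (prd B B)"
proof -
  have E: "E > 0" using p D_neg by (metis neg_less_0_iff_less zero_less_mult_pos less_le_trans zero_less_numeral)
  obtain J g' where J: "fr J" "J \<subseteq> OK" "cls J = cls I" "g' > 0" "fnorm J = of_int g'" "coprime g' (2 * D)"
    "\<exists>x\<in>iv I. J = sc x I \<and> x \<in> Kx"
    using coprime_rep[OF I(1), of "2 * D"] D_neg by auto
  obtain x where x: "x \<in> iv I" "J = sc x I" "x \<in> Kx" using J(7) by blast
  have g0: "g > 0" using fnorm(1)[OF I(1)] I(3) by simp
  obtain y where y: "y \<in> cj I" "x = of_real (1 / fnorm I) * y" using x(1) unfolding iv_def sc_def by blast
  have yO: "y \<in> OK" using y I(2) OK_cnj by auto
  have "of_int g' = (cmod x)\<^sup>2 * of_int g" using J(5) fnorm_sc[OF I(1), of x] x(2,3) I(3) by (simp add: Kx_def)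
  also have "(cmod x)\<^sup>2 = of_int (nn y) / (of_int g)\<^sup>2"
    unfolding y(2) I(3) using of_int_nn[OF yO] by (simp add: norm_mult norm_divide power_divide)
  finally have "real_of_int (nn y) = of_int (g * g')" using g0 by (simp add: field_simps power2_eq_square)
  then have gg: "nn y = g * g'" by (simp only: of_int_eq_iff)
  obtain a b k n :: int and L where L: "a > 0" "k > 0" "4 * a * n = (2 * b + 1)\<^sup>2 - D" "J = sc (of_int k) L"
    "fr L" "L \<subseteq> OK" "fnorm L = of_int a"
    using primitive_part[OF J(1,2)] by metis
  have "of_int g' = (of_int k)\<^sup>2 * real_of_int a" using J(5) L(4,7) fnorm_sc[OF L(5), of "of_int k"] L(2) by simp
  then have "real_of_int g' = of_int (k\<^sup>2 * a)" by simp
  then have ga: "g' = k\<^sup>2 * a" by (simp only: of_int_eq_iff)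
  have clsL: "cls L = cls I" using L(2,4) cls_sc[OF L(5), of "of_int k"] J(3) by (simp add: Kx_def)
  have aD: "coprime a D" "odd a" "coprime k D" using J(6) unfolding ga by (auto simp: coprime_commute)
  have leg: "Legendre a (int l) = 1" if l: "prime l" "int l dvd E" for l
  proof -
    have lD: "int l dvd D" using l(2) p by simp
    have l2: "l > 2" using dvd_D_odd(1)[OF lD] l(1) prime_ge_2_nat[of l] by (cases "l = 2") auto
    have nd: "\<not> int l dvd z" if "coprime z E" for z
    proof
      assume "int l dvd z"
      then have "int l dvd 1" using that l(2) by (meson coprime_common_divisor)
      then show False using l2 by simp
    qed
    have co: "\<not> int l dvd g" "\<not> int l dvd a" "\<not> int l dvd k"
      using nd[OF I(4)] nd[of a] nd[of k] aD p by auto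
    have gc: "[g = c\<^sup>2] (mod int l)" using I(5) l(2) cong_dvd_modulus by blast
    then have ndc: "\<not> int l dvd c" using co(1) by (metis cong_dvd_iff dvd_power dvd_trans pos2)
    have "[4 * nn y = T y * T y] (mod int l)" using nn_cong[OF yO] lD cong_dvd_modulus by blast
    then have e1: "[4 * (g * (k\<^sup>2 * a)) = T y * T y] (mod int l)" unfolding gg ga .
    have "[4 * (g * (k\<^sup>2 * a)) = 4 * (c\<^sup>2 * (k\<^sup>2 * a))] (mod int l)" by (intro cong_mult gc cong_refl)
    then have "[4 * (c\<^sup>2 * (k\<^sup>2 * a)) = T y * T y] (mod int l)" using e1 by (meson cong_sym cong_trans)
    then have e2: "[(2 * c * k)\<^sup>2 * a = (T y)\<^sup>2] (mod int l)" by (simp add: power2_eq_square mult_ac)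
    have "\<not> int l dvd 2" using l2 by (auto dest: zdvd_imp_le)
    then have nd2: "\<not> int l dvd 2 * c * k" using ndc co(3) l(1) by (simp add: prime_dvd_mult_iff)
    have "\<not> int l dvd (2 * c * k)\<^sup>2 * a" using nd2 co(2) l(1) by (simp add: prime_dvd_mult_iff prime_dvd_power_iff)
    then have "Legendre ((2 * c * k)\<^sup>2 * a) (int l) = 1"
      using e2 unfolding Legendre_1_iff QuadRes_def cong_0_iff by (meson cong_sym)
    then show ?thesis using Legendre_square_factor[OF l(1) l2 nd2] by simp
  qed
  have prod1: "(\<Prod>l\<in>prime_factors (nat (- D)). Legendre a (int l)) = 1"
    using Legendre_product_formula_general[of "nat a" "2 * b + 1"] L(1,3) aD
    by (simp add: cong_iff_dvd_diff mult.assoc[symmetric] even_nat_iff) (metis dvd_def mult.assoc mult.commute)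
  define P where "P = nat p"
  have P: "prime P" "int P = p" using p by (auto simp: P_def)
  have Pin: "P \<in> prime_factors (nat (- D))"
  proof -
    have "int P dvd int (nat (- D))" using P p D_neg by simp
    then show ?thesis using P(1) D_neg by (simp add: in_prime_factors_iff int_dvd_int_iff[symmetric] del: int_dvd_int_iff)
  qed
  have others: "Legendre a (int l) = 1" if l: "l \<in> prime_factors (nat (- D))" "l \<noteq> P" for l
  proof (rule leg)
    have l': "prime l" "int l dvd D" using D_prime_factors(2)[OF l(1)] by auto
    then show "prime l" by blast
    have "int l dvd p * E" using l' p(1) by simp
    moreover have "\<not> int l dvd p" using l(2) l'(1) P by (metis int_dvd_int_iff primes_dvd_imp_eq)
    ultimately show "int l dvd E" using l'(1) by (simp add: prime_dvd_mult_iff)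
  qed
  have "(\<Prod>l\<in>prime_factors (nat (- D)). Legendre a (int l)) = Legendre a (int P) * (\<Prod>l\<in>prime_factors (nat (- D)) - {P}. Legendre a (int l))"
    using Pin by (intro prod.remove) auto
  also have "(\<Prod>l\<in>prime_factors (nat (- D)) - {P}. Legendre a (int l)) = 1" using others by (intro prod.neutral) auto
  finally have "Legendre a (int P) = 1" using prod1 by simp
  then have all: "QuadRes (int l) a" if "l \<in> prime_factors (nat (- D))" for l
    using others[OF that] by (cases "l = P") (auto simp: Legendre_1_iff)
  obtain r where "[r\<^sup>2 = a] (mod int (\<Prod>(prime_factors (nat (- D)))))"
    using square_mod_prod_primes[OF _ _ all] D_prime_factors(2) by blast
  then have "[r\<^sup>2 = a] (mod int (nat (- D)))" using D_prime_factors(1) by simp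
  then have r: "[r\<^sup>2 = a] (mod D)" using D_neg by (simp add: cong_iff_dvd_diff)
  have "[(2 * b + 1)\<^sup>2 = D] (mod a)" unfolding cong_iff_dvd_diff using L(3) by (metis dvd_triv_left mult.assoc mult.commute)
  then obtain \<gamma> where \<gamma>: "\<gamma> \<in> Kx" "(cmod \<gamma>)\<^sup>2 = of_int a" using norm_of_element[OF L(1) aD(1) _ r] by blast
  define H where "H = sc (inverse \<gamma>) L"
  have H: "fr H" "cls H = cls I" unfolding H_def using fr_scx[OF L(5)] cls_sc[OF L(5)] Kx_inverse[OF \<gamma>(1)] clsL by auto
  have "fnorm H = 1" unfolding H_def using fnorm_sc[OF L(5), of "inverse \<gamma>"] Kx_inverse[OF \<gamma>(1)] L(1,7) \<gamma>(2)
    by (simp add: Kx_def norm_inverse power_inverse)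
  then obtain B where "fr B" "cls H = cls (prd B B)" using norm_one_square_class[OF H(1)] by blast
  then show ?thesis using that H(2) by simp
qed

end

section \<open>Quaternions\<close>

definition qm :: "nat \<Rightarrow> complex \<times> complex \<Rightarrow> complex \<times> complex \<Rightarrow> complex \<times> complex" where
  "qm q = (\<lambda>(a, b) (c, d). (a * c - of_nat q * b * cnj d, a * d + b * cnj c))"

lemma qm_simp [simp]: "qm q (a, b) (c, d) = (a * c - of_nat q * b * cnj d, a * d + b * cnj c)"
  by (simp add: qm_def)

lemma qm_assoc: "qm q (qm q x y) z = qm q x (qm q y z)"
  by (cases x; cases y; cases z) (simp add: algebra_simps)

lemma biadditive_qm: "biadditive (qm q)"
  by (auto simp: biadditive_def algebra_simps)

lemma quat_conj_simp [simp]: "quat_conj (a, b) = (cnj a, - b)"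
  by (simp add: quat_conj_def)

lemma quat_conj_qm: "quat_conj (qm q x y) = qm q (quat_conj y) (quat_conj x)"
  by (cases x; cases y) (simp add: algebra_simps)

lemma quat_conj_diff: "quat_conj (x - y) = quat_conj x - quat_conj y"
  by (cases x; cases y) simp

lemma reduced_norm_simp [simp]: "reduced_norm q (a, b) = (cmod a)\<^sup>2 + real q * (cmod b)\<^sup>2"
  by (simp add: reduced_norm_def)

lemma reduced_norm_qm: "reduced_norm q (qm q x y) = reduced_norm q x * reduced_norm q y"
proof -
  obtain a b c d where xy: "x = (a, b)" "y = (c, d)" by (cases x; cases y) auto
  have "complex_of_real (reduced_norm q (qm q x y)) = of_real (reduced_norm q x * reduced_norm q y)"
    unfolding xy by (simp add: complex_norm_square algebra_simps flip: of_real_power)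
  then show ?thesis by (simp only: of_real_eq_iff)
qed

lemma reduced_norm_conj [simp]: "reduced_norm q (quat_conj x) = reduced_norm q x"
  by (cases x) simp

lemma reduced_norm_scaleR: "reduced_norm q (r *\<^sub>R x) = r\<^sup>2 * reduced_norm q x"
  by (cases x) (simp add: power_mult_distrib algebra_simps)

definition lmul :: "nat \<Rightarrow> (complex \<times> complex) set \<Rightarrow> (complex \<times> complex) set \<Rightarrow> (complex \<times> complex) set" where
  "lmul q X Y = group_closure {qm q x y | x y. x \<in> X \<and> y \<in> Y}"

lemma lattice_mult_eq: "lattice_mult D q X Y = lmul q X Y"
  by (simp add: lattice_mult_def lmul_def quat_alg_def qm_def)

lemma lmul_assoc: "lmul q (lmul q X Y) Z = lmul q X (lmul q Y Z)"
  unfolding lmul_def by (rule group_closure_assoc[OF biadditive_qm]) (simp add: qm_assoc)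

lemma lmul_I: "x \<in> X \<Longrightarrow> y \<in> Y \<Longrightarrow> qm q x y \<in> lmul q X Y"
  unfolding lmul_def by (blast intro: group_closure.base)

lemma lmul_minimal:
  assumes "\<And>x y. x \<in> X \<Longrightarrow> y \<in> Y \<Longrightarrow> qm q x y \<in> H" "0 \<in> H" "\<And>x y. x \<in> H \<Longrightarrow> y \<in> H \<Longrightarrow> x - y \<in> H"
  shows "lmul q X Y \<subseteq> H"
  unfolding lmul_def by (rule group_closure_minimal) (use assms in auto)

lemma lmul_0: "0 \<in> lmul q X Y" and lmul_diff: "x \<in> lmul q X Y \<Longrightarrow> y \<in> lmul q X Y \<Longrightarrow> x - y \<in> lmul q X Y"
  and lmul_add: "x \<in> lmul q X Y \<Longrightarrow> y \<in> lmul q X Y \<Longrightarrow> x + y \<in> lmul q X Y"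
  unfolding lmul_def by (auto intro: group_closure.diff group_closure_add)

lemma lmul_image:
  assumes h: "\<And>x y. h (x - y) = h x - h y" and fg: "\<And>x y. x \<in> X \<Longrightarrow> y \<in> Y \<Longrightarrow> qm q (f x) (g y) = h (qm q x y)"
  shows "lmul q (f ` X) (g ` Y) = h ` lmul q X Y"
proof -
  have "{qm q x y | x y. x \<in> f ` X \<and> y \<in> g ` Y} = h ` {qm q x y | x y. x \<in> X \<and> y \<in> Y}" (is "?l = ?r")
  proof
    show "?l \<subseteq> ?r"
    proof
      fix w assume "w \<in> ?l"
      then obtain x y where "x \<in> X" "y \<in> Y" "w = qm q (f x) (g y)" by blast
      then show "w \<in> ?r" using fg by blast
    qed
    show "?r \<subseteq> ?l"
    proof
      fix w assume "w \<in> ?r"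
      then obtain x y where xy: "x \<in> X" "y \<in> Y" "w = h (qm q x y)" by blast
      then have "w = qm q (f x) (g y)" using fg by simp
      then show "w \<in> ?l" using xy by blast
    qed
  qed
  then show ?thesis unfolding lmul_def using group_closure_image[of h, OF h] by simp
qed

lemma conj_lmul: "quat_conj ` lmul q X Y = lmul q (quat_conj ` Y) (quat_conj ` X)"
proof -
  have "{qm q x y | x y. x \<in> quat_conj ` Y \<and> y \<in> quat_conj ` X} = quat_conj ` {qm q x y | x y. x \<in> X \<and> y \<in> Y}" (is "?l = ?r")
  proof
    show "?l \<subseteq> ?r"
    proof
      fix w assume "w \<in> ?l"
      then obtain x y where "x \<in> X" "y \<in> Y" "w = qm q (quat_conj y) (quat_conj x)" by blast
      then show "w \<in> ?r" unfolding quat_conj_qm[symmetric] by blast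
    qed
    show "?r \<subseteq> ?l"
    proof
      fix w assume "w \<in> ?r"
      then obtain x y where xy: "x \<in> X" "y \<in> Y" "w = quat_conj (qm q x y)" by blast
      then show "w \<in> ?l" unfolding quat_conj_qm by blast
    qed
  qed
  then show ?thesis unfolding lmul_def by (simp add: group_closure_image quat_conj_diff)
qed

subsection \<open>Norms of lattices\<close>

text \<open>The property by which \<open>lattice_norm\<close> is selected. As a predicate it can be
  transported along maps first and evaluated afterwards.\<close>

definition has_norm :: "nat \<Rightarrow> (complex \<times> complex) set \<Rightarrow> real \<Rightarrow> bool" where
  "has_norm q X t \<longleftrightarrow> t \<in> \<rat> \<and> t > 0 \<and> (\<forall>x\<in>X. reduced_norm q x / t \<in> \<int>) \<and>
     (\<forall>s\<in>\<rat>. s > 0 \<and> (\<forall>x\<in>X. reduced_norm q x / s \<in> \<int>) \<longrightarrow> t / s \<in> \<int>)"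

lemma pos_Ints_inverse_eq:
  fixes t s :: real
  assumes "t > 0" "s > 0" "t / s \<in> \<int>" "s / t \<in> \<int>" shows "t = s"
proof -
  obtain m n where mn: "t / s = of_int m" "s / t = of_int n" using assms by (auto elim!: Ints_cases)
  have pos: "of_int m > (0::real)" using assms by (simp flip: mn)
  have "of_int m * of_int n = (t / s) * (s / t)" by (simp only: mn)
  then have "real_of_int (m * n) = of_int 1" using assms by simp
  then have "m * n = 1" by (simp only: of_int_eq_iff)
  then have "m = 1" using pos by (simp add: zmult_eq_1_iff)
  then show ?thesis using mn assms by simp
qed

lemma has_norm_unique: assumes "has_norm q X t" "has_norm q X s" shows "t = s"
  using assms unfolding has_norm_def by (intro pos_Ints_inverse_eq) auto

lemma lattice_norm_eqI: assumes "has_norm q X t" shows "lattice_norm q X = t"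
proof -
  have "lattice_norm q X = (THE t. has_norm q X t)" unfolding lattice_norm_def has_norm_def ..
  also have "\<dots> = t" using assms has_norm_unique by blast
  finally show ?thesis .
qed

lemma has_norm_image:
  assumes "has_norm q X t" "c \<in> \<rat>" "c > 0" "\<And>x. x \<in> X \<Longrightarrow> reduced_norm q (f x) = c * reduced_norm q x"
  shows "has_norm q (f ` X) (c * t)"
  unfolding has_norm_def
proof (intro conjI ballI impI)
  have X: "t \<in> \<rat>" "t > 0" "\<And>x. x \<in> X \<Longrightarrow> reduced_norm q x / t \<in> \<int>"
    "\<And>s. s \<in> \<rat> \<Longrightarrow> s > 0 \<Longrightarrow> (\<And>x. x \<in> X \<Longrightarrow> reduced_norm q x / s \<in> \<int>) \<Longrightarrow> t / s \<in> \<int>"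
    using assms(1) unfolding has_norm_def by auto
  show "c * t \<in> \<rat>" "c * t > 0" using X assms by auto
  show "reduced_norm q y / (c * t) \<in> \<int>" if "y \<in> f ` X" for y
    using that X(3) assms by auto
  show "c * t / s \<in> \<int>" if s: "s \<in> \<rat>" "s > 0 \<and> (\<forall>x\<in>f ` X. reduced_norm q x / s \<in> \<int>)" for s
  proof -
    have "t / (s / c) \<in> \<int>"
    proof (rule X(4))
      show "reduced_norm q x / (s / c) \<in> \<int>" if x: "x \<in> X" for x
      proof -
        have "reduced_norm q (f x) / s \<in> \<int>" using s(2) x by blast
        then show ?thesis using assms(4)[OF x] by (simp add: mult.commute)
      qed
    qed (use s assms in auto)
    then show ?thesis by (simp add: mult.commute)
  qed
qed

text \<open>All reduced norms are integer multiples of s0, and the group of integers that they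
  generate is principal. For the left ideals bare existence is enough, since their norm cancels in
  \<open>theta\<close>.\<close>

lemma has_norm_exists:
  assumes s0: "s0 \<in> \<rat>" "s0 > 0" "\<And>x. x \<in> X \<Longrightarrow> reduced_norm q x / s0 \<in> \<int>"
    and x0: "x0 \<in> X" "reduced_norm q x0 \<noteq> 0"
  shows "\<exists>t. has_norm q X t"
proof -
  define H where "H = {n::int. \<exists>x\<in>X. reduced_norm q x / s0 = of_int n}"
  obtain g where g: "g \<ge> 0" "\<And>n. n \<in> group_closure H \<longleftrightarrow> g dvd n"
    by (rule int_subgroup_principal[of "group_closure H"]) (auto intro: group_closure.diff)
  have sub: "H \<subseteq> group_closure H" by (rule group_closure_subset)
  have repr: "\<exists>n\<in>H. reduced_norm q x = s0 * of_int n" if x: "x \<in> X" for x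
  proof -
    obtain n where "reduced_norm q x / s0 = of_int n" using s0(3)[OF x] by (elim Ints_cases)
    then show ?thesis using x s0(2) by (intro bexI[of _ n]) (auto simp: H_def field_simps)
  qed
  obtain n0 where "n0 \<in> H" "reduced_norm q x0 = s0 * of_int n0" using repr[OF x0(1)] by blast
  then have "n0 \<noteq> 0" "g dvd n0" using x0(2) g(2) sub by auto
  then have g0: "g > 0" using g(1) by (cases "g = 0") auto
  have "has_norm q X (of_int g * s0)" unfolding has_norm_def
  proof (intro conjI ballI impI)
    show "reduced_norm q x / (of_int g * s0) \<in> \<int>" if x: "x \<in> X" for x
    proof -
      obtain n where n: "n \<in> H" "reduced_norm q x = s0 * of_int n" using repr[OF x] by blast
      then obtain k where k: "n = g * k" using g(2) sub by blast
      have "reduced_norm q x / (of_int g * s0) = of_int k" unfolding n(2) k using g0 s0(2) by simp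
      then show ?thesis by simp
    qed
    show "of_int g * s0 / s \<in> \<int>" if s: "s \<in> \<rat>" "s > 0 \<and> (\<forall>x\<in>X. reduced_norm q x / s \<in> \<int>)" for s
    proof -
      have "group_closure H \<subseteq> {n. of_int n * s0 / s \<in> \<int>}"
      proof (rule group_closure_minimal)
        show "H \<subseteq> {n. of_int n * s0 / s \<in> \<int>}"
        proof
          fix n assume "n \<in> H"
          then obtain x where x: "x \<in> X" "reduced_norm q x / s0 = of_int n" unfolding H_def by blast
          then have "of_int n * s0 / s = reduced_norm q x / s" using s0(2) by (simp add: field_simps)
          then show "n \<in> {n. of_int n * s0 / s \<in> \<int>}" using s(2) x(1) by simp
        qed
        show "x - y \<in> {n. of_int n * s0 / s \<in> \<int>}"
          if "x \<in> {n. of_int n * s0 / s \<in> \<int>}" "y \<in> {n. of_int n * s0 / s \<in> \<int>}" for x y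
          using that by (simp add: left_diff_distrib diff_divide_distrib)
      qed simp
      moreover have "g \<in> group_closure H" using g(2) by simp
      ultimately show ?thesis by blast
    qed
  qed (use g0 s0 in auto)
  then show ?thesis by blast
qed

subsection \<open>Theta series\<close>

text \<open>Separating the sum from its normalization t lets a rescaling of the lattice be tracked
  by a rescaling of t.\<close>

definition tsum :: "nat \<Rightarrow> (complex \<times> complex) set \<Rightarrow> real \<Rightarrow> complex \<Rightarrow> complex" where
  "tsum q S t z = 1 / 2 * (\<Sum>\<^sub>\<infinity>x\<in>S. exp (2 * of_real pi * \<i> * z * of_real (reduced_norm q x / t)))"

lemma tsum_image:
  assumes "inj_on f S" "c > 0" "\<And>x. x \<in> S \<Longrightarrow> reduced_norm q (f x) = c * reduced_norm q x"
  shows "tsum q (f ` S) (c * t) z = tsum q S t z"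
proof -
  have "(\<Sum>\<^sub>\<infinity>x\<in>f ` S. exp (2 * of_real pi * \<i> * z * of_real (reduced_norm q x / (c * t)))) =
    (\<Sum>\<^sub>\<infinity>x\<in>S. exp (2 * of_real pi * \<i> * z * of_real (reduced_norm q (f x) / (c * t))))"
    using infsum_reindex[OF assms(1)] by (simp add: o_def)
  also have "\<dots> = (\<Sum>\<^sub>\<infinity>x\<in>S. exp (2 * of_real pi * \<i> * z * of_real (reduced_norm q x / t)))"
  proof (rule infsum_cong)
    fix x assume "x \<in> S"
    then have "reduced_norm q (f x) / (c * t) = reduced_norm q x / t" using assms(2,3) by simp
    then show "exp (2 * of_real pi * \<i> * z * of_real (reduced_norm q (f x) / (c * t))) =
      exp (2 * of_real pi * \<i> * z * of_real (reduced_norm q x / t))" by (simp only:)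
  qed
  finally show ?thesis unfolding tsum_def by simp
qed

text \<open>The scalar in the inverse lattice multiplies the reduced norms and the norm of the
  lattice by the same factor and drops out, so the conjugate lattice can take the place of the
  inverse.\<close>

lemma theta_eq:
  assumes "has_norm q X t" "has_norm q (lmul q (quat_conj ` X) Y) s"
  shows "theta D q X Y z = tsum q (lmul q (quat_conj ` X) Y) s z"
proof -
  let ?L = "lmul q (quat_conj ` X) Y"
  have t: "t > 0" "t \<in> \<rat>" using assms(1) unfolding has_norm_def by auto
  define r where "r = inverse t"
  have r: "r > 0" "r \<in> \<rat>" using t unfolding r_def by auto
  have "lattice_inv q X = (\<lambda>x. r *\<^sub>R x) ` quat_conj ` X"
    unfolding lattice_inv_def lattice_norm_eqI[OF assms(1)] r_def by (simp add: image_image)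
  moreover have "lmul q ((\<lambda>x. r *\<^sub>R x) ` quat_conj ` X) ((\<lambda>x. x) ` Y) = (\<lambda>x. r *\<^sub>R x) ` ?L"
  proof (rule lmul_image)
    fix x y show "qm q (r *\<^sub>R x) y = r *\<^sub>R qm q x y"
      by (cases x; cases y) (simp add: scaleR_conv_of_real algebra_simps)
  qed (simp add: scaleR_right_diff_distrib)
  ultimately have L: "lattice_mult D q (lattice_inv q X) Y = (\<lambda>x. r *\<^sub>R x) ` ?L"
    by (simp add: lattice_mult_eq)
  have n: "has_norm q ((\<lambda>x. r *\<^sub>R x) ` ?L) (r\<^sup>2 * s)"
    using assms(2) r by (intro has_norm_image) (auto simp: reduced_norm_scaleR)
  have "theta D q X Y z = tsum q ((\<lambda>x. r *\<^sub>R x) ` ?L) (r\<^sup>2 * s) z"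
    unfolding theta_def L Let_def lattice_norm_eqI[OF n] tsum_def ..
  also have "\<dots> = tsum q ?L s z"
    using r by (intro tsum_image) (auto simp: reduced_norm_scaleR inj_on_def)
  finally show ?thesis .
qed

locale quat = imag_quad D for D :: int +
  fixes q :: nat
  assumes q_pos: "q > 0"
begin

lemma qalg_sel [simp]: "carrier (quat_alg D q) = K \<times> K" "x \<otimes>\<^bsub>quat_alg D q\<^esub> y = qm q x y" "\<one>\<^bsub>quat_alg D q\<^esub> = (1, 0)"
  by (simp_all add: quat_alg_def K_def qm_def)

lemma qm_1: "qm q (1, 0) x = x" "qm q x (1, 0) = x" by (cases x; simp)+

lemma qm_closed: "x \<in> K \<times> K \<Longrightarrow> y \<in> K \<times> K \<Longrightarrow> qm q x y \<in> K \<times> K"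
  by (auto intro!: K_diff K_mult K_add K_cnj)

lemma monoid_qalg: "Group.monoid (quat_alg D q)"
  by (rule monoidI) (auto simp del: qm_simp simp: qm_closed qm_assoc qm_1 simp flip: mem_Times_iff intro: qm_closed)

lemma reduced_norm_Rats: "x \<in> K \<times> K \<Longrightarrow> reduced_norm q x \<in> \<rat>"
  using K_Rats_norm by auto

lemma reduced_norm_nonneg: "reduced_norm q x \<ge> 0"
  by (cases x) simp

lemma unit_norm: assumes "u \<in> Units (quat_alg D q)" shows "reduced_norm q u > 0" "reduced_norm q u \<in> \<rat>"
proof -
  obtain v where v: "u \<in> K \<times> K" "qm q u v = (1, 0)" using assms unfolding Units_def by auto
  have "reduced_norm q u * reduced_norm q v = 1" using v(2) reduced_norm_qm[of q u v] by simp
  then have "reduced_norm q u \<noteq> 0" by auto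
  then show "reduced_norm q u > 0" using reduced_norm_nonneg[of u] by linarith
  show "reduced_norm q u \<in> \<rat>" using reduced_norm_Rats v by blast
qed

lemma unit_inverse: assumes "u \<in> Units (quat_alg D q)"
  obtains v where "v \<in> Units (quat_alg D q)" "qm q u v = (1, 0)" "qm q v u = (1, 0)"
  using assms unfolding Units_def by auto

lemma r_coset_qalg: "X #>\<^bsub>quat_alg D q\<^esub> y = (\<lambda>x. qm q x y) ` X"
  by (auto simp: r_coset_def)

lemma left_class_eq: "left_class D q X = {(\<lambda>x. qm q x u) ` X | u. u \<in> Units (quat_alg D q)}"
  unfolding left_class_def r_coset_qalg ..

lemma left_class_self: "X \<in> left_class D q X"
proof -
  interpret M: Group.monoid "quat_alg D q" by (rule monoid_qalg)
  have "(1, 0) \<in> Units (quat_alg D q)" using M.Units_one_closed by simp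
  moreover have "X = (\<lambda>x. qm q x (1, 0)) ` X" by (simp add: qm_1 del: qm_simp)
  ultimately show ?thesis unfolding left_class_eq by blast
qed

lemma left_class_translate: assumes "u \<in> Units (quat_alg D q)"
  shows "left_class D q ((\<lambda>x. qm q x u) ` X) = left_class D q X"
proof -
  interpret M: Group.monoid "quat_alg D q" by (rule monoid_qalg)
  have mult: "qm q u v \<in> Units (quat_alg D q)" if "u \<in> Units (quat_alg D q)" "v \<in> Units (quat_alg D q)" for u v
    using M.Units_m_closed[OF that] by simp
  have sub: "left_class D q ((\<lambda>x. qm q x u) ` X) \<subseteq> left_class D q X" if u: "u \<in> Units (quat_alg D q)" for u X
  proof
    fix Y assume "Y \<in> left_class D q ((\<lambda>x. qm q x u) ` X)"
    then obtain v where v: "v \<in> Units (quat_alg D q)" "Y = (\<lambda>x. qm q x v) ` (\<lambda>x. qm q x u) ` X"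
      unfolding left_class_eq by blast
    have "Y = (\<lambda>x. qm q x (qm q u v)) ` X" unfolding v(2) image_image qm_assoc ..
    then show "Y \<in> left_class D q X" using mult[OF u v(1)] unfolding left_class_eq by blast
  qed
  obtain v where v: "v \<in> Units (quat_alg D q)" "qm q u v = (1, 0)" using unit_inverse[OF assms] by metis
  have "(\<lambda>x. qm q x v) ` (\<lambda>x. qm q x u) ` X = X"
    unfolding image_image qm_assoc v(2) qm_1 by simp
  then have "left_class D q X \<subseteq> left_class D q ((\<lambda>x. qm q x u) ` X)" using sub[OF v(1), of "(\<lambda>x. qm q x u) ` X"] by simp
  then show ?thesis using sub[OF assms] by blast
qed

text \<open>The representatives picked by SOME are translates of X by u and of Y by v, which turns L
  into conj(u) L v. All reduced norms and the norm of the lattice are thereby multiplied by N(u)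
  N(v).\<close>

lemma phi_eq:
  assumes X: "has_norm q X t" and L: "has_norm q (lmul q (quat_conj ` X) Y) s"
  shows "phi D q (left_class D q X) (left_class D q Y) z = tsum q (lmul q (quat_conj ` X) Y) s z"
proof -
  let ?L = "lmul q (quat_conj ` X) Y"
  have "(SOME X'. X' \<in> left_class D q X) \<in> left_class D q X" by (rule someI[where x = X]) (rule left_class_self)
  then obtain u where u: "u \<in> Units (quat_alg D q)" "(SOME X'. X' \<in> left_class D q X) = (\<lambda>x. qm q x u) ` X"
    unfolding left_class_eq by blast
  have "(SOME Y'. Y' \<in> left_class D q Y) \<in> left_class D q Y" by (rule someI[where x = Y]) (rule left_class_self)
  then obtain v where v: "v \<in> Units (quat_alg D q)" "(SOME Y'. Y' \<in> left_class D q Y) = (\<lambda>x. qm q x v) ` Y"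
    unfolding left_class_eq by blast
  note nu = unit_norm[OF u(1)] and nv = unit_norm[OF v(1)]
  define h where "h = (\<lambda>x. qm q (qm q (quat_conj u) x) v)"
  have X': "has_norm q ((\<lambda>x. qm q x u) ` X) (reduced_norm q u * t)"
    using nu X by (intro has_norm_image) (auto simp: reduced_norm_qm mult.commute)
  have c: "quat_conj ` (\<lambda>x. qm q x u) ` X = (\<lambda>x. qm q (quat_conj u) x) ` quat_conj ` X"
    by (simp add: image_image quat_conj_qm)
  have L': "lmul q (quat_conj ` (\<lambda>x. qm q x u) ` X) ((\<lambda>x. qm q x v) ` Y) = h ` ?L"
    unfolding c
  proof (rule lmul_image)
    show "h (x - y) = h x - h y" for x y
      using biadditive_qm[of q] unfolding h_def biadditive_def by metis
    show "qm q (qm q (quat_conj u) x) (qm q y v) = h (qm q x y)" for x y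
      unfolding h_def by (simp only: qm_assoc)
  qed
  have hn: "reduced_norm q (h x) = reduced_norm q u * reduced_norm q v * reduced_norm q x" for x
    by (simp add: h_def reduced_norm_qm mult_ac)
  have nL': "has_norm q (h ` ?L) (reduced_norm q u * reduced_norm q v * s)"
    using nu nv L hn by (intro has_norm_image) auto
  have inj: "inj_on h ?L"
  proof -
    obtain u' where u': "qm q u u' = (1, 0)" "qm q u' u = (1, 0)" using unit_inverse[OF u(1)] by metis
    obtain v' where v': "qm q v v' = (1, 0)" using unit_inverse[OF v(1)] by metis
    have cu: "qm q (quat_conj u') (quat_conj u) = (1, 0)" using u'(1) by (metis quat_conj_qm quat_conj_simp complex_cnj_one neg_0_equal_iff_equal)
    have "qm q (qm q (quat_conj u') (h x)) v' = x" for x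
    proof -
      have "qm q (qm q (quat_conj u') (h x)) v' = qm q (qm q (qm q (quat_conj u') (quat_conj u)) x) (qm q v v')"
        unfolding h_def by (simp only: qm_assoc)
      then show ?thesis unfolding cu v' qm_1 .
    qed
    then show ?thesis by (metis inj_onI)
  qed
  have "phi D q (left_class D q X) (left_class D q Y) z = theta D q ((\<lambda>x. qm q x u) ` X) ((\<lambda>x. qm q x v) ` Y) z"
    unfolding phi_def u(2) v(2) ..
  also have "\<dots> = tsum q (h ` ?L) (reduced_norm q u * reduced_norm q v * s) z"
    using theta_eq[OF X', of "(\<lambda>x. qm q x v) ` Y"] nL' unfolding L' by blast
  also have "\<dots> = tsum q ?L s z"
    using nu nv hn inj by (intro tsum_image) auto
  finally show ?thesis .
qed

definition emb :: "complex set \<Rightarrow> (complex \<times> complex) set" where "emb I = (\<lambda>x. (x, 0)) ` I"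

lemma extend_ideal_eq: "extend_ideal D q X I = lmul q X (emb I)"
  by (simp add: extend_ideal_def lattice_mult_eq emb_def)

lemma Kx_Units: assumes "k \<in> Kx" shows "(k, 0) \<in> Units (quat_alg D q)"
proof -
  have "(k, 0) \<in> K \<times> K" "(inverse k, 0) \<in> K \<times> K" "qm q (k, 0) (inverse k, 0) = (1, 0)" "qm q (inverse k, 0) (k, 0) = (1, 0)"
    using assms by (auto simp: Kx_def)
  then show ?thesis unfolding Units_def by (auto simp del: qm_simp)
qed

text \<open>A scalar of K acts from the right as a unit of the quaternion algebra; hence the left
  class of the extended ideal depends only on the ideal class.\<close>

lemma left_class_extend_sc: assumes "k \<in> Kx"
  shows "left_class D q (extend_ideal D q X (sc k I)) = left_class D q (extend_ideal D q X I)"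
proof -
  have e: "emb (sc k I) = (\<lambda>x. qm q x (k, 0)) ` emb I"
    by (simp add: emb_def sc_def image_image mult.commute)
  have "lmul q ((\<lambda>x. x) ` X) ((\<lambda>x. qm q x (k, 0)) ` emb I) = (\<lambda>x. qm q x (k, 0)) ` lmul q X (emb I)"
  proof (rule lmul_image)
    show "qm q (x - y) (k, 0) = qm q x (k, 0) - qm q y (k, 0)" for x y
      using biadditive_qm[of q] unfolding biadditive_def by metis
    show "qm q x (qm q y (k, 0)) = qm q (qm q x y) (k, 0)" for x y
      by (simp only: qm_assoc)
  qed
  then have "extend_ideal D q X (sc k I) = (\<lambda>x. qm q x (k, 0)) ` extend_ideal D q X I"
    unfolding extend_ideal_eq e by simp
  then show ?thesis using left_class_translate[OF Kx_Units[OF assms]] by metis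
qed

end

section \<open>The order and its ideals\<close>

text \<open>Here E stands for |D_0|, which removes the sign of D_0 from all congruences, and Q is
  the auxiliary ideal of norm q.\<close>

locale quat_order = quat D q for D :: int and q :: nat +
  fixes p E :: int and Q :: "complex set"
  assumes D_pE: "D = - (p * E)" and p_ge: "p \<ge> 3" and p_prime: "prime p"
    and q_E: "E dvd int q + 1" and q_D: "coprime (int q) D"
    and Q: "fr Q" "Q \<subseteq> OK" "fnorm Q = real q"
begin

lemma E_pos: "E > 0"
  using D_pE p_ge D_neg by (metis neg_less_0_iff_less zero_less_mult_pos less_le_trans zero_less_numeral)

lemma dvd_D: "p dvd D" "E dvd D" "D dvd p * E" using D_pE by auto

lemma p_pos: "p > 0" using p_ge by simp

lemma p_E: "coprime p E" using D_sqf D_pE squarefree_coprime_factors[of p E] by simp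

lemma coprimes: "coprime E 2" "coprime E (int q)" "coprime p 2"
  using dvd_D_odd(2) dvd_D q_D coprime_divisors[OF _ dvd_D(2), of "int q" "int q"] by (auto simp: coprime_commute)

lemma E_q: "coprime E (2 * int q)" using coprimes by simp

lemma T_rt: "T rt = 0" using T_el[of 0 2] by (simp only: el_rt[symmetric])

section \<open>The order in the coordinates x, y\<close>

definition pr :: "complex \<Rightarrow> complex \<Rightarrow> complex \<times> complex" where
  "pr x y = (x / rt, of_int p * y / (of_nat q * rt))"

lemma pr_diff: "pr x y - pr x' y' = pr (x - x') (y - y')"
  and pr_add: "pr x y + pr x' y' = pr (x + x') (y + y')"
  and pr_0: "pr 0 0 = 0"
  by (simp_all add: pr_def diff_divide_distrib add_divide_distrib right_diff_distrib distrib_left zero_prod_def)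

lemma pr_inj: "pr x y = pr x' y' \<longleftrightarrow> x = x' \<and> y = y'"
  using q_pos p_pos by (auto simp: pr_def)

lemma pr_scale: "r *\<^sub>R pr x y = pr (of_real r * x) (of_real r * y)"
  by (simp add: pr_def scaleR_conv_of_real)

lemma reduced_norm_pr: "reduced_norm q (pr x y) = ((cmod x)\<^sup>2 + (of_int p)\<^sup>2 * (cmod y)\<^sup>2 / real q) / of_int (- D)"
proof -
  have 1: "(cmod (of_int p * y / (of_nat q * rt)))\<^sup>2 = (of_int p)\<^sup>2 * (cmod y)\<^sup>2 / ((real q)\<^sup>2 * of_int (- D))"
    by (simp add: norm_divide norm_mult power_divide power_mult_distrib cmod_rt)
  have 2: "(cmod (x / rt))\<^sup>2 = (cmod x)\<^sup>2 / of_int (- D)"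
    by (simp add: norm_divide power_divide cmod_rt)
  show ?thesis unfolding pr_def reduced_norm_simp 1 2 using q_pos D_neg
    by (simp add: field_simps power2_eq_square)
qed

lemma qm_pr: "qm q (pr x y) (pr x' y') = pr ((x * x' + (of_int p)\<^sup>2 * (y * cnj y' / of_nat q)) / rt) ((x * y' - y * cnj x') / rt)"
  using q_pos by (simp add: pr_def field_simps power2_eq_square)

lemma qm_pr_emb: "qm q (c, 0) (qm q (pr x y) (k, 0)) = pr (c * x * k) (c * y * cnj k)"
  by (simp add: pr_def mult_ac)

text \<open>The modulus e carries the congruence with the minus sign, d the one with the plus sign.
  The order itself is the case e = E, d = 1; for the lattices between its ideals one has e d =
  E.\<close>

definition Mset :: "complex set \<Rightarrow> complex set \<Rightarrow> int \<Rightarrow> int \<Rightarrow> (complex \<times> complex) set" where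
  "Mset I J e d = {pr x y | x y. x \<in> I \<and> y \<in> J \<and> e dvd T x - p * T y \<and> d dvd T x + p * T y}"

lemma Mset_I: "x \<in> I \<Longrightarrow> y \<in> J \<Longrightarrow> e dvd T x - p * T y \<Longrightarrow> d dvd T x + p * T y \<Longrightarrow> pr x y \<in> Mset I J e d"
  unfolding Mset_def by blast

lemma Mset_diff:
  assumes IJ: "md I" "md J" "I \<subseteq> OK" "J \<subseteq> OK" and uv: "u \<in> Mset I J e d" "v \<in> Mset I J e d"
  shows "u - v \<in> Mset I J e d"
proof -
  obtain x y where u: "u = pr x y" "x \<in> I" "y \<in> J" "e dvd T x - p * T y" "d dvd T x + p * T y"
    using uv(1) unfolding Mset_def by blast
  obtain x' y' where v: "v = pr x' y'" "x' \<in> I" "y' \<in> J" "e dvd T x' - p * T y'" "d dvd T x' + p * T y'"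
    using uv(2) unfolding Mset_def by blast
  have T: "T (x - x') = T x - T x'" "T (y - y') = T y - T y'"
    using u v IJ by (auto intro!: T_diff)
  have "e dvd (T x - p * T y) - (T x' - p * T y')" "d dvd (T x + p * T y) - (T x' + p * T y')"
    using u v by (auto intro: dvd_diff)
  then show ?thesis unfolding u(1) v(1) pr_diff
    using md_D(3)[OF IJ(1) u(2) v(2)] md_D(3)[OF IJ(2) u(3) v(3)]
    by (intro Mset_I) (auto simp: T algebra_simps)
qed

lemma Mset_0: "0 \<in> I \<Longrightarrow> 0 \<in> J \<Longrightarrow> 0 \<in> Mset I J e d"
  using Mset_I[of 0 I 0 J e d] by (simp add: pr_0)

definition Ot :: "(complex \<times> complex) set" where "Ot = Mset (dd p) (cj Q) E 1"

lemma Ot_I: "x \<in> dd p \<Longrightarrow> y \<in> cj Q \<Longrightarrow> E dvd T x - p * T y \<Longrightarrow> pr x y \<in> Ot"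
  unfolding Ot_def by (rule Mset_I) auto

lemma cjQ: "fr (cj Q)" "cj Q \<subseteq> OK" "md (cj Q)"
  using Q fr_cj OK_cnj fr_md by auto

lemma dd_iv: "iv (dd E) = sc (1 / rt) (dd p)"
proof (rule prd_cancel)
  have "prd (dd E) (dd p) = dd (- D)" using dd_mult[of E p] E_pos p_pos D_pE by (simp add: mult.commute)
  then show "prd (dd E) (iv (dd E)) = prd (dd E) (sc (1 / rt) (dd p))"
    using prd_iv[OF dd_fr[OF dvd_D(2)]] by (simp add: prd_sc_right dd_D sc_sc)
qed (use dd_fr dvd_D fr_iv fr_sc K_divide in auto)

lemma dd_pE: "prd (dd E) (dd p) = sc rt OK"
  using dd_mult[of E p] E_pos p_pos D_pE dd_D by (simp add: mult.commute)

text \<open>As \<open>dd E\<close> and \<open>dd p\<close> multiply to the ideal of sqrt D and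
  \<open>dd p\<close> squares to that of p, the ideals in the definition are multiples of
  \<open>dd p\<close> and of the conjugate of Q. With \<alpha> = x / sqrt D and \<beta> = p y / (q
  sqrt D), the gluing condition places x - p y in the ideal of sqrt D, that is D | T(x - p y).
  Modulo p this holds already because x lies in \<open>dd p\<close>, so the condition modulo E
  remains.\<close>

lemma O_tilde_eq: "O_tilde D q (dd E) (dd p) Q = Ot"
proof -
  have inv: "inv\<^bsub>ideal_group D\<^esub> (dd E) = sc (1 / rt) (dd p)" "inv\<^bsub>ideal_group D\<^esub> Q = sc (1 / of_nat q) (cj Q)"
    using inv_ideal[OF dd_fr[OF dvd_D(2)]] dd_iv inv_ideal[OF Q(1)] Q(3) by (auto simp: iv_def)
  have "prd (prd (sc (1 / rt) (dd p)) (dd p)) (sc (1 / of_nat q) (cj Q)) = sc (of_int p / (of_nat q * rt)) (cj Q)"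
    using dd_square[OF dvd_D(1) p_pos] prd_OK[OF cjQ(3)]
    by (simp add: prd_sc_right sc_sc flip: sc_prd)
  then have eq: "O_tilde D q (dd E) (dd p) Q =
    {(\<alpha>, \<beta>). \<alpha> \<in> sc (1 / rt) (dd p) \<and> \<beta> \<in> sc (of_int p / (of_nat q * rt)) (cj Q) \<and> \<alpha> - of_nat q * \<beta> \<in> OK}"
    unfolding O_tilde_def idl_sel inv ring_sel by simp
  have key: "x / rt - of_nat q * (of_int p * y / (of_nat q * rt)) \<in> OK \<longleftrightarrow> E dvd T x - p * T y"
    if xy: "x \<in> dd p" "y \<in> cj Q" for x y
  proof -
    have ok: "x \<in> OK" "y \<in> OK" "p dvd T x" using xy cjQ by (auto simp: dd_def)
    have "x / rt - of_nat q * (of_int p * y / (of_nat q * rt)) = (x - of_int p * y) / rt"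
      using q_pos by (simp add: field_simps)
    also have "\<dots> \<in> OK \<longleftrightarrow> x - of_int p * y \<in> sc rt OK" by (simp add: sc_mem_iff)
    also have "\<dots> \<longleftrightarrow> - D dvd T (x - of_int p * y)" unfolding dd_D[symmetric] dd_def using ok by auto
    also have "T (x - of_int p * y) = T x - p * T y" using ok by (simp add: T_diff T_int_mult OK_mult)
    also have "- D dvd T x - p * T y \<longleftrightarrow> p * E dvd T x - p * T y" using D_pE by simp
    also have "\<dots> \<longleftrightarrow> E dvd T x - p * T y"
      using ok(3) p_E by (auto intro: divides_mult dest: dvd_mult_right)
    finally show ?thesis .
  qed
  show ?thesis
  proof
    show "O_tilde D q (dd E) (dd p) Q \<subseteq> Ot"
    proof
      fix w assume "w \<in> O_tilde D q (dd E) (dd p) Q"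
      then obtain \<alpha> \<beta> where ab: "w = (\<alpha>, \<beta>)" "\<alpha> \<in> sc (1 / rt) (dd p)"
        "\<beta> \<in> sc (of_int p / (of_nat q * rt)) (cj Q)" "\<alpha> - of_nat q * \<beta> \<in> OK"
        unfolding eq by blast
      obtain x where x: "x \<in> dd p" "\<alpha> = 1 / rt * x" using ab(2) unfolding sc_def by blast
      obtain y where y: "y \<in> cj Q" "\<beta> = of_int p / (of_nat q * rt) * y" using ab(3) unfolding sc_def by blast
      have xy: "x \<in> dd p" "y \<in> cj Q" "w = (1 / rt * x, of_int p / (of_nat q * rt) * y)"
        "1 / rt * x - of_nat q * (of_int p / (of_nat q * rt) * y) \<in> OK"
        using ab x y by auto
      have "w = pr x y" using xy(3) by (simp add: pr_def)
      moreover have "E dvd T x - p * T y" using key[OF xy(1,2)] xy(4) by simp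
      ultimately show "w \<in> Ot" using xy Ot_I by simp
    qed
    show "Ot \<subseteq> O_tilde D q (dd E) (dd p) Q"
    proof
      fix w assume "w \<in> Ot"
      then obtain x y where xy: "x \<in> dd p" "y \<in> cj Q" "w = pr x y" "E dvd T x - p * T y"
        unfolding Ot_def Mset_def by auto
      have "x / rt - of_nat q * (of_int p * y / (of_nat q * rt)) \<in> OK" using key[OF xy(1,2)] xy(4) by simp
      moreover have "x / rt \<in> sc (1 / rt) (dd p)" using sc_I[OF xy(1), of "1 / rt"] by simp
      moreover have "of_int p * y / (of_nat q * rt) \<in> sc (of_int p / (of_nat q * rt)) (cj Q)"
        using sc_I[OF xy(2), of "of_int p / (of_nat q * rt)"] by simp
      ultimately show "w \<in> O_tilde D q (dd E) (dd p) Q" unfolding eq xy(3) pr_def by blast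
    qed
  qed
qed

text \<open>Division by sqrt D exchanges the two coordinates, up to a factor D.\<close>

lemma div_rt: assumes "even (u + v)" "D dvd u"
  obtains u' where "el u v / rt = el v u'" "even (v + u')" "u = D * u'"
proof -
  obtain u' where u: "u = D * u'" using assms(2) ..
  have "el v u' * rt = el u v" unfolding u el_def using rt_sq(1) by (simp add: algebra_simps)
  then have "el u v / rt = el v u'" by (metis nonzero_mult_div_cancel_right rt_nz)
  moreover have "even (v + u')" using assms(1) u D_odd by auto
  ultimately show ?thesis using that u by blast
qed

text \<open>The two numerators in \<open>qm_pr\<close> must be divisible by sqrt D, which means that
  D divides their traces; this and the conditions of \<open>Ot\<close> are checked separately modulo
  p and modulo E. Modulo E the factors 2 and q are units, and q = -1 combines with the congruences
  for the two factors.\<close>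

lemma Ot_mult: assumes "w \<in> Ot" "w' \<in> Ot" shows "qm q w w' \<in> Ot"
proof -
  obtain x y where w: "w = pr x y" "x \<in> dd p" "y \<in> cj Q" "E dvd T x - p * T y"
    using assms(1) unfolding Ot_def Mset_def by auto
  obtain x' y' where w': "w' = pr x' y'" "x' \<in> dd p" "y' \<in> cj Q" "E dvd T x' - p * T y'"
    using assms(2) unfolding Ot_def Mset_def by auto
  have ok: "x \<in> OK" "y \<in> OK" "x' \<in> OK" "y' \<in> OK" using w w' cjQ by (auto simp: dd_def)
  obtain s t where x: "even (s + t)" "x = el s t" using ok(1) by (elim OK_E)
  obtain s' t' where x': "even (s' + t')" "x' = el s' t'" using ok(3) by (elim OK_E)
  obtain r m where y: "even (r + m)" "y = el r m" using ok(2) by (elim OK_E)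
  obtain r' m' where y': "even (r' + m')" "y' = el r' m'" using ok(4) by (elim OK_E)
  have ev: "even (s' + - t')" "even (r' + - m')" using x' y' by auto
  have ps: "p dvd s" "p dvd s'" using w(2) w'(2) x(2) x'(2) by (auto simp: dd_def)
  have Es: "E dvd s - p * r" "E dvd s' - p * r'" using w(4) w'(4) x(2) x'(2) y(2) y'(2) by auto
  obtain s1 t1 where 1: "el s t * el s' t' = el s1 t1" "even (s1 + t1)" "2 * s1 = s * s' + D * t * t'" "2 * t1 = s * t' + t * s'"
    using el_mult[OF x(1) x'(1)] .
  obtain a1 b1 where 2: "el s t * el r' m' = el a1 b1" "even (a1 + b1)" "2 * a1 = s * r' + D * t * m'" "2 * b1 = s * m' + t * r'"
    using el_mult[OF x(1) y'(1)] .
  obtain a2 b2 where 3: "el r m * el s' (- t') = el a2 b2" "even (a2 + b2)" "2 * a2 = r * s' + D * m * (- t')" "2 * b2 = r * (- t') + m * s'"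
    using el_mult[OF y(1) ev(1)] .
  obtain u1 v1 where 4: "el r m * el r' (- m') = el u1 v1" "even (u1 + v1)" "2 * u1 = r * r' + D * m * (- m')" "2 * v1 = r * (- m') + m * r'"
    using el_mult[OF y(1) ev(2)] .
  \<comment> \<open>The product of Q with its conjugate is generated by q, so the division by q
    stays integral.\<close>
  have "y * cnj y' \<in> prd (cj Q) Q" using w(3) w'(3) by (intro prd_I) (simp_all add: cj_mem_iff)
  then have zOK: "y * cnj y' / of_nat q \<in> OK"
    using fnorm(3)[OF Q(1)] Q(3) q_pos by (simp add: prd_comm sc_mem_iff)
  then obtain u0 v0 where z: "even (u0 + v0)" "y * cnj y' / of_nat q = el u0 v0" by (elim OK_E)
  have "el u1 v1 = of_int (int q) * el u0 v0"
    using 4(1) z(2) q_pos y(2) y'(2) by (simp add: el_cnj field_simps)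
  also have "\<dots> = el (int q * u0) (int q * v0)" by (simp add: el_def algebra_simps)
  finally have uv1: "u1 = int q * u0" "v1 = int q * v0" by (simp_all add: el_inj)
  have sumEq: "x * x' + (of_int p)\<^sup>2 * (y * cnj y' / of_nat q) = el (s1 + p\<^sup>2 * u0) (t1 + p\<^sup>2 * v0)"
    unfolding z(2) x(2) x'(2) 1(1) by (simp add: el_def field_simps)
  have difEq: "x * y' - y * cnj x' = el (a1 - a2) (b1 - b2)"
    unfolding x(2) x'(2) y(2) y'(2) el_cnj 2(1) 3(1) by (rule el_diff)
  have ev1: "even (s1 + p\<^sup>2 * u0 + (t1 + p\<^sup>2 * v0))" using 1(2) z(1) by auto
  have ev2: "even (a1 - a2 + (b1 - b2))" using 2(2) 3(2) by auto
  have pD: "p dvd D" "E dvd D" using dvd_D by auto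
  have cancel2: "n dvd k" if "n dvd 2 * k" "n dvd D" for n k
    using that dvd_D_odd(2)[OF that(2)] by (simp add: coprime_dvd_mult_right_iff)
  have cancelE: "E dvd k" if "E dvd 2 * int q * k" for k
    using that E_q by (simp add: coprime_dvd_mult_right_iff mult.assoc)
  have D_dvd: "D dvd k" if "p dvd k" "E dvd k" for k
    using that p_E D_pE by (simp add: divides_mult)
  have D1: "D dvd s1 + p\<^sup>2 * u0"
  proof (rule D_dvd)
    have "p dvd 2 * s1" unfolding 1(3) using ps pD by (intro dvd_add dvd_mult2) auto
    then have "p dvd s1" using cancel2 pD by blast
    then show "p dvd s1 + p\<^sup>2 * u0" by (simp add: power2_eq_square)
    \<comment> \<open>The unit 2 q clears the denominators. What remains is a combination of D, q +
      1 and the two congruences for w and w'.\<close>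
    have "2 * int q * (s1 + p\<^sup>2 * u0) = int q * (2 * s1) + p\<^sup>2 * (2 * u1)" unfolding uv1 by (simp add: algebra_simps)
    also have "\<dots> = D * (int q * t * t' - p\<^sup>2 * m * m') + (int q + 1) * (s * s') - ((s - p * r) * s' + p * r * (s' - p * r'))"
      unfolding 1(3) 4(3) by (simp add: algebra_simps power2_eq_square)
    also have "E dvd \<dots>" by (intro dvd_diff dvd_add dvd_mult2[OF pD(2)] dvd_mult2[OF q_E] dvd_mult2[OF Es(1)] dvd_mult[OF Es(2)])
    finally show "E dvd s1 + p\<^sup>2 * u0" by (rule cancelE)
  qed
  have D2: "D dvd a1 - a2"
  proof (rule D_dvd)
    have *: "2 * (a1 - a2) = s * r' - r * s' + D * (t * m' + m * t')"
      using 2(3) 3(3) by (simp add: algebra_simps)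
    have "p dvd 2 * (a1 - a2)" unfolding * using ps pD by (intro dvd_add dvd_diff) auto
    then show "p dvd a1 - a2" using cancel2 pD by blast
    have "s * r' - r * s' = (s - p * r) * r' - r * (s' - p * r')" by (simp add: algebra_simps)
    then have "E dvd s * r' - r * s'" using Es by simp
    then have "E dvd 2 * (a1 - a2)" unfolding * using pD by (intro dvd_add) auto
    then show "E dvd a1 - a2" using cancel2 pD by blast
  qed
  obtain u' where X: "el (s1 + p\<^sup>2 * u0) (t1 + p\<^sup>2 * v0) / rt = el (t1 + p\<^sup>2 * v0) u'" "even (t1 + p\<^sup>2 * v0 + u')"
    using div_rt[OF ev1 D1] by metis
  obtain v' where Y: "el (a1 - a2) (b1 - b2) / rt = el (b1 - b2) v'" "even (b1 - b2 + v')"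
    using div_rt[OF ev2 D2] by metis
  have eq: "qm q w w' = pr (el (t1 + p\<^sup>2 * v0) u') (el (b1 - b2) v')"
    unfolding w(1) w'(1) qm_pr sumEq difEq X(1) Y(1) ..
  show ?thesis unfolding eq
  proof (rule Ot_I)
    have "p dvd 2 * t1" unfolding 1(4) using ps by (intro dvd_add) auto
    then have "p dvd t1" using cancel2 pD by blast
    then have "p dvd t1 + p\<^sup>2 * v0" by (simp add: power2_eq_square)
    then show "el (t1 + p\<^sup>2 * v0) u' \<in> dd p" using X(2) by (simp add: dd_def el_OK_iff)
    have YOK: "el (b1 - b2) v' \<in> OK" using Y(2) by (simp add: el_OK_iff)
    note m = md_D[OF cjQ(3)]
    have "x * y' - cnj x' * y \<in> cj Q" using ok w w' by (intro m(3) m(4)) auto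
    then have w2: "el (a1 - a2) (b1 - b2) \<in> cj Q" using difEq by (simp add: mult.commute)
    then have "rt * el (a1 - a2) (b1 - b2) \<in> cj Q" by (intro m(4)) auto
    moreover have "rt * el (a1 - a2) (b1 - b2) = of_int D * el (b1 - b2) v'"
      using Y(1) rt_sq(1) by (simp add: field_simps)
    ultimately have DY: "of_int D * el (b1 - b2) v' \<in> cj Q" by simp
    have "of_nat q \<in> cj Q" using norm_mem_integral[OF cjQ(1,2)] fnorm_cj[OF Q(1)] Q(3) by simp
    then have qY: "el (b1 - b2) v' * of_nat q \<in> cj Q" by (intro m(4) YOK)
    \<comment> \<open>Both q times and D times the second coordinate lie in the conjugate of Q; as q
      and D are coprime, the coordinate itself does.\<close>
    obtain f g where fg: "f * int q + g * D = 1" using q_D by (metis bezout_int coprime_iff_gcd_eq_1)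
    have "of_int f * (el (b1 - b2) v' * of_nat q) + of_int g * (of_int D * el (b1 - b2) v') \<in> cj Q"
      by (intro m(6) m(4) OK_of_int DY qY)
    moreover have "of_int f * (el (b1 - b2) v' * of_nat q) + of_int g * (of_int D * el (b1 - b2) v') = of_int (f * int q + g * D) * el (b1 - b2) v'"
      by (simp add: algebra_simps)
    ultimately show "el (b1 - b2) v' \<in> cj Q" unfolding fg by simp
    have "2 * int q * ((t1 + p\<^sup>2 * v0) - p * (b1 - b2)) = int q * (2 * t1) + p\<^sup>2 * (2 * v1) - p * int q * (2 * b1 - 2 * b2)"
      unfolding uv1 by (simp add: algebra_simps)
    also have "\<dots> = (int q + 1) * (s * t' + t * s' - p * (s * m' + t * r' + r * t' - m * s'))
       + (p * m' - t') * (s - p * r) - (t + p * m) * (s' - p * r')"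
      unfolding 1(4) 2(4) 3(4) 4(4) by (simp add: algebra_simps power2_eq_square)
    also have "E dvd \<dots>" by (intro dvd_diff dvd_add dvd_mult2[OF q_E] dvd_mult[OF Es(1)] dvd_mult[OF Es(2)])
    finally show "E dvd T (el (t1 + p\<^sup>2 * v0) u') - p * T (el (b1 - b2) v')" unfolding T_el by (rule cancelE)
  qed
qed

text \<open>Together with \<open>Ot_Ot\<close> this rewrites the product of conj(Ot B) and Ot A as
  cnj B Ot A.\<close>

lemma Ot_conj: "quat_conj ` Ot = Ot"
proof -
  have sub: "quat_conj ` Ot \<subseteq> Ot"
  proof
    fix w assume "w \<in> quat_conj ` Ot"
    then obtain x y where xy: "w = quat_conj (pr x y)" "x \<in> dd p" "y \<in> cj Q" "E dvd T x - p * T y"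
      unfolding Ot_def Mset_def by auto
    have "w = pr (- cnj x) (- y)" unfolding xy(1) pr_def by simp
    moreover have "cnj x \<in> dd p" using xy(2) cj_dd[of p] cj_mem_iff[of "cnj x" "dd p"] by simp
    then have "- cnj x \<in> dd p" using md_D(5)[OF dd_md[OF dvd_D(1)]] by blast
    moreover have "- y \<in> cj Q" using md_D(5)[OF cjQ(3) xy(3)] .
    moreover have Tm: "T (- cnj x) - p * T (- y) = - (T x - p * T y)"
      using xy cjQ(2) by (subst (1 2) T_minus) (auto simp: dd_def T_cnj)
    have "E dvd T (- cnj x) - p * T (- y)" unfolding Tm using xy(4) by (simp only: dvd_minus_iff)
    ultimately show "w \<in> Ot" using Ot_I by simp
  qed
  have "Ot = quat_conj ` quat_conj ` Ot" by (auto simp: image_image quat_conj_def split_beta)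
  then show ?thesis using sub by blast
qed

lemma Ot_diff: "u \<in> Ot \<Longrightarrow> v \<in> Ot \<Longrightarrow> u - v \<in> Ot"
  unfolding Ot_def by (rule Mset_diff[OF dd_md[OF dvd_D(1)] cjQ(3) dd_OK cjQ(2)])

lemma Ot_1: "(1, 0) \<in> Ot"
proof -
  have "pr rt 0 \<in> Ot" using md_D(2)[OF cjQ(3)] by (intro Ot_I) (auto simp: dd_def T_rt)
  then show ?thesis by (simp add: pr_def)
qed

lemma Ot_Ot: "lmul q Ot Ot = Ot"
proof
  show "lmul q Ot Ot \<subseteq> Ot"
    using Ot_diff Ot_diff[OF Ot_1 Ot_1] by (intro lmul_minimal Ot_mult) auto
  show "Ot \<subseteq> lmul q Ot Ot"
  proof
    fix x assume "x \<in> Ot"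
    then have "qm q (1, 0) x \<in> lmul q Ot Ot" by (intro lmul_I Ot_1)
    then show "x \<in> lmul q Ot Ot" by (simp only: qm_1)
  qed
qed

end

context quat_order begin

section \<open>Ramified ideals and the sign of the congruence\<close>

lemma cancel_2: "n dvd 2 * k \<Longrightarrow> n dvd D \<Longrightarrow> n dvd k"
  using dvd_D_odd(2)[of n] by (simp add: coprime_dvd_mult_right_iff)

text \<open>Twice the traces of c k and c cnj k are u r + D v m and u r - D v m, where d divides u
  and r. After division by d they are opposite modulo d and equal modulo D/d: this is the origin of
  the change of sign at the primes dividing d.\<close>

lemma dd_products:
  assumes d: "d dvd D" "d > 0" and c: "c \<in> dd d" "k \<in> dd d"
  obtains w w' where "w \<in> OK" "w' \<in> OK" "c * k = of_int d * w" "c * cnj k = of_int d * w'"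
    "d dvd T w + T w'" "(D div d) dvd T w - T w'" "2 * d * T w = T c * T k + D * (\<lfloor>2 * Im c / Im rt\<rfloor> * \<lfloor>2 * Im k / Im rt\<rfloor>)"
proof -
  have k': "cnj k \<in> dd d" using c(2) cj_dd[of d] cj_mem_iff[of "cnj k" "dd d"] by simp
  have sub: "x * y \<in> sc (of_int d) OK" if "x \<in> dd d" "y \<in> dd d" for x y
    using prd_I[OF that] dd_square[OF d] by simp
  obtain w where w: "w \<in> OK" "c * k = of_int d * w" using sub[OF c] unfolding sc_def by blast
  obtain w' where w': "w' \<in> OK" "c * cnj k = of_int d * w'" using sub[OF c(1) k'] unfolding sc_def by blast
  obtain u v where c2: "even (u + v)" "c = el u v" using c(1) by (auto simp: dd_def elim: OK_E)
  obtain r m where k2: "even (r + m)" "k = el r m" using c(2) by (auto simp: dd_def elim: OK_E)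
  have ev: "even (r + - m)" using k2 by auto
  obtain s t where 1: "el u v * el r m = el s t" "2 * s = u * r + D * v * m" using el_mult[OF c2(1) k2(1)] by metis
  obtain s' t' where 2: "el u v * el r (- m) = el s' t'" "2 * s' = u * r + D * v * (- m)" using el_mult[OF c2(1) ev] by metis
  have dT: "d dvd u" "d dvd r" using c c2 k2 by (auto simp: dd_def)
  have Tw: "d * T w = s" using arg_cong[OF w(2), of T] w(1) 1(1) c2 k2 by (simp add: T_int_mult)
  have Tw': "d * T w' = s'" using arg_cong[OF w'(2), of T] w'(1) 2(1) c2 k2 by (simp add: T_int_mult el_cnj)
  obtain u1 r1 where ur: "u = d * u1" "r = d * r1" using dT by blast
  obtain D1 where D1: "D = d * D1" using d(1) ..
  have "d * (T w + T w') = d * (d * (u1 * r1))" using 1(2) 2(2) unfolding Tw[symmetric] Tw'[symmetric] ur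
    by (simp add: algebra_simps)
  then have s1: "d dvd T w + T w'" using d(2) by simp
  have "2 * (d * (T w - T w')) = 2 * (d * (D1 * (v * m)))" using 1(2) 2(2) unfolding Tw[symmetric] Tw'[symmetric] D1
    by (simp add: algebra_simps)
  then have "T w - T w' = D1 * (v * m)" using d(2) by simp
  then have s2: "(D div d) dvd T w - T w'" using D1 d(2) by simp
  have "2 * d * T w = T c * T k + D * (\<lfloor>2 * Im c / Im rt\<rfloor> * \<lfloor>2 * Im k / Im rt\<rfloor>)"
    using 1(2) Tw Im_rt_pos unfolding c2(2) k2(2) by (simp add: mult_ac)
  then show ?thesis using that w w' s1 s2 by blast
qed

text \<open>The lattices $\mathfrak{b}^{-1}\tilde O\mathfrak{a}\mathfrak{b}$ up to a scalar, where
  $\mathfrak{b} = \mathfrak{b}_0\mathfrak{d}$ with $\mathfrak{b}_0$ coprime to $D_0$ and a ramified ideal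
  $\mathfrak{d}$ of norm $d$: multiplying by $\mathfrak{d}$ flips the sign of the congruence at the primes
  dividing $d$.\<close>

context
  fixes a b :: "complex set" and na nb d e :: int
  assumes ab: "fr a" "a \<subseteq> OK" "fnorm a = of_int na" "coprime na E"
      "fr b" "b \<subseteq> OK" "fnorm b = of_int nb" "coprime nb E"
    and de: "E = e * d" "d > 0" "e > 0"
begin

definition B0 where "B0 = prd b (dd d)"
definition A0 where "A0 = prd a B0"
text \<open>The ideals of x and y that are left once the square of \<open>dd d\<close>, which is the
  scalar d, has been split off. Neither \<open>I1\<close> nor \<open>J1\<close> involves d, so
  vectors belonging to different d can be compared.\<close>

definition I1 where "I1 = prd (dd p) (prd a (prd b (cj b)))"
definition J1 where "J1 = prd (cj Q) (prd (cj a) (prd (cj b) (cj b)))"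

lemma d_dvd: "d dvd D" "e dvd D" "d dvd E" "e dvd E" using de D_pE by auto

lemma D_d: "D = d * (- (p * e))" using de(1) D_pE by (simp add: mult_ac)

lemma e_dvd: "e dvd D div d"
proof -
  have "D div d = - (p * e)" using D_d de(2) by (metis nonzero_mult_div_cancel_left less_irrefl)
  then show ?thesis by simp
qed

lemma nab: "na > 0" "nb > 0" using ab fnorm(1)[of a] fnorm(1)[of b] by auto

lemma frs: "fr a" "fr b" "fr (cj a)" "fr (cj b)" "fr (dd d)" "fr (dd p)" "fr (dd E)" "fr (cj Q)" "fr Q"
  using ab fr_cj dd_fr d_dvd dvd_D Q by auto

lemma frs2: "fr B0" "fr A0" "fr I1" "fr J1" "fr (cj B0)" "fr (cj A0)"
  unfolding B0_def A0_def I1_def J1_def by (intro fr_prd fr_cj frs)+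

lemma subs: "cj a \<subseteq> OK" "cj b \<subseteq> OK" using ab OK_cnj by auto

lemma subs2: "B0 \<subseteq> OK" "A0 \<subseteq> OK" "I1 \<subseteq> OK" "J1 \<subseteq> OK" "B0 \<subseteq> dd d" "A0 \<subseteq> dd d" "I1 \<subseteq> dd p" "J1 \<subseteq> cj Q"
proof -
  show o: "B0 \<subseteq> OK" "A0 \<subseteq> OK" "I1 \<subseteq> OK" "J1 \<subseteq> OK"
    unfolding B0_def A0_def I1_def J1_def by (intro prd_OK_subset ab dd_OK subs cjQ)+
  have "prd b (dd d) \<subseteq> prd OK (dd d)" by (intro prd_mono ab) simp
  then show B: "B0 \<subseteq> dd d" unfolding B0_def using prd_OK[OF fr_md[OF frs(5)]] by simp
  have "prd a B0 \<subseteq> prd OK (dd d)" by (intro prd_mono ab B)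
  then show "A0 \<subseteq> dd d" unfolding A0_def using prd_OK[OF fr_md[OF frs(5)]] by simp
  have "prd (dd p) (prd a (prd b (cj b))) \<subseteq> prd (dd p) OK" by (intro prd_mono prd_OK_subset ab subs) simp
  then show "I1 \<subseteq> dd p" unfolding I1_def using prd_OK[OF fr_md[OF frs(6)]] by (simp add: prd_comm)
  have "prd (cj Q) (prd (cj a) (prd (cj b) (cj b))) \<subseteq> prd (cj Q) OK" by (intro prd_mono prd_OK_subset ab subs) simp
  then show "J1 \<subseteq> cj Q" unfolding J1_def using prd_OK[OF cjQ(3)] by (simp add: prd_comm)
qed

lemma fnorm_I1: "fnorm I1 = of_int (p * (na * nb * nb))"
  unfolding I1_def using frs dd_norm[OF dvd_D(1) p_pos] ab by (simp add: fnorm_prd fr_prd fnorm_cj)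

lemma fnorm_J1: "fnorm J1 = of_int (int q * (na * nb * nb))"
  unfolding J1_def using frs Q ab by (simp add: fnorm_prd fr_prd fnorm_cj)

lemma sc_I1: "prd (cj B0) (prd (dd p) A0) = sc (of_int d) I1"
proof -
  have "prd (cj B0) (prd (dd p) A0) = prd (prd (dd d) (dd d)) I1"
    unfolding B0_def A0_def I1_def cj_prd cj_dd by (simp only: prd_ac)
  then show ?thesis using dd_square[OF d_dvd(1) de(2)] prd_OK[OF fr_md[OF frs2(3)]] by (simp flip: sc_prd)
qed

lemma sc_J1: "prd (cj B0) (prd (cj Q) (cj A0)) = sc (of_int d) J1"
proof -
  have "prd (cj B0) (prd (cj Q) (cj A0)) = prd (prd (dd d) (dd d)) J1"
    unfolding B0_def A0_def J1_def cj_prd cj_dd by (simp only: prd_ac)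
  then show ?thesis using dd_square[OF d_dvd(1) de(2)] prd_OK[OF fr_md[OF frs2(4)]] by (simp flip: sc_prd)
qed

abbreviation "LL \<equiv> lmul q (emb (cj B0)) (lmul q Ot (emb A0))"

lemma LL_basic: "c \<in> cj B0 \<Longrightarrow> k \<in> A0 \<Longrightarrow> pr x y \<in> Ot \<Longrightarrow> pr (c * x * k) (c * y * cnj k) \<in> LL"
  using lmul_I[of "(c, 0)" "emb (cj B0)" "qm q (pr x y) (k, 0)" "lmul q Ot (emb A0)" q] lmul_I[of "pr x y" Ot "(k, 0)" "emb A0" q]
  by (simp only: qm_pr_emb) (simp add: emb_def)

lemma M_md: "md I1" "md J1" using frs2 fr_md by auto

text \<open>On a generator, with c from the conjugate of \<open>B0\<close> and k from
  \<open>A0\<close>, the coordinates become d w x and d w' y with w, w' from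
  \<open>dd_products\<close>. By \<open>T_mult\<close> the traces of w x and w' y then satisfy the
  congruence with its sign kept modulo e and reversed modulo d.\<close>

lemma LL_subset: "LL \<subseteq> (\<lambda>w. of_int d *\<^sub>R w) ` Mset I1 J1 e d"
proof -
  let ?H = "(\<lambda>w. of_int d *\<^sub>R w) ` Mset I1 J1 e d"
  have H0: "0 \<in> ?H" using Mset_0[of I1 J1 e d] md_D(2) M_md by (intro image_eqI[of _ _ 0]) auto
  have Hd: "u - v \<in> ?H" if "u \<in> ?H" "v \<in> ?H" for u v
  proof -
    obtain u1 v1 where uv: "u1 \<in> Mset I1 J1 e d" "v1 \<in> Mset I1 J1 e d" "u = of_int d *\<^sub>R u1" "v = of_int d *\<^sub>R v1"
      using \<open>u \<in> ?H\<close> \<open>v \<in> ?H\<close> by blast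
    have "u - v = of_int d *\<^sub>R (u1 - v1)" using uv by (simp add: scaleR_right_diff_distrib)
    then show ?thesis using Mset_diff[OF M_md subs2(3,4) uv(1,2)] by blast
  qed
  have basic: "pr (c * x * k) (c * y * cnj k) \<in> ?H" if ck: "c \<in> cj B0" "k \<in> A0" and xyO: "pr x y \<in> Ot" for c k x y
  proof -
    have xy: "x \<in> dd p" "y \<in> cj Q" "E dvd T x - p * T y" using xyO unfolding Ot_def Mset_def by (auto simp: pr_inj)
    have xyK: "x \<in> OK" "y \<in> OK" using xy dd_OK cjQ by auto
    have "cj B0 \<subseteq> dd d" using subs2(5) cj_dd[of d] by blast
    then have cd: "c \<in> dd d" "k \<in> dd d" using ck subs2(6) by auto
    obtain w w' where w: "w \<in> OK" "w' \<in> OK" "c * k = of_int d * w" "c * cnj k = of_int d * w'"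
      "d dvd T w + T w'" "(D div d) dvd T w - T w'" using dd_products[OF d_dvd(1) de(2) cd] by metis
    have x1: "c * x * k = of_int d * (w * x)" and y1: "c * y * cnj k = of_int d * (w' * y)"
      using w(3,4) by (simp_all add: algebra_simps)
    have "c * (x * k) \<in> prd (cj B0) (prd (dd p) A0)" using ck xy by (intro prd_I)
    then have "of_int d * (w * x) \<in> sc (of_int d) I1" unfolding sc_I1 x1[symmetric] by (simp add: mult.assoc)
    then have wI: "w * x \<in> I1" using de(2) by (simp add: sc_mem_iff)
    have "c * (y * cnj k) \<in> prd (cj B0) (prd (cj Q) (cj A0))" using ck xy by (intro prd_I) (simp_all add: cj_mem_iff)
    then have "of_int d * (w' * y) \<in> sc (of_int d) J1" unfolding sc_J1 y1[symmetric] by (simp add: mult.assoc)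
    then have wJ: "w' * y \<in> J1" using de(2) by (simp add: sc_mem_iff)
    have Exy: "e dvd T x - p * T y" "d dvd T x - p * T y" using xy(3) d_dvd dvd_trans by auto
    have ew: "e dvd T w - T w'" using w(6) e_dvd dvd_trans by auto
    have T2: "D dvd 2 * T (w * x) - T w * T x" "D dvd 2 * T (w' * y) - T w' * T y"
      using T_mult[OF w(1) xyK(1)] T_mult[OF w(2) xyK(2)] by (auto simp: cong_iff_dvd_diff)
    have "e dvd 2 * (T (w * x) - p * T (w' * y))"
    proof -
      have "2 * (T (w * x) - p * T (w' * y)) = (2 * T (w * x) - T w * T x) - p * (2 * T (w' * y) - T w' * T y)
        + (T w * (T x - p * T y) + p * T y * (T w - T w'))" by (simp add: algebra_simps)
      also have "e dvd \<dots>"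
        by (intro dvd_add dvd_diff dvd_trans[OF d_dvd(2) T2(1)] dvd_mult[OF dvd_trans[OF d_dvd(2) T2(2)]] dvd_mult[OF Exy(1)] dvd_mult[OF ew])
      finally show ?thesis .
    qed
    then have c1: "e dvd T (w * x) - p * T (w' * y)" using d_dvd(2) by (rule cancel_2)
    have "d dvd 2 * (T (w * x) + p * T (w' * y))"
    proof -
      have "2 * (T (w * x) + p * T (w' * y)) = (2 * T (w * x) - T w * T x) + p * (2 * T (w' * y) - T w' * T y)
        + (T w * (T x - p * T y) + p * T y * (T w + T w'))" by (simp add: algebra_simps)
      also have "d dvd \<dots>"
        by (intro dvd_add dvd_trans[OF d_dvd(1) T2(1)] dvd_mult[OF dvd_trans[OF d_dvd(1) T2(2)]] dvd_mult[OF Exy(2)] dvd_mult[OF w(5)])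
      finally show ?thesis .
    qed
    then have c2: "d dvd T (w * x) + p * T (w' * y)" using d_dvd(1) by (rule cancel_2)
    have "pr (c * x * k) (c * y * cnj k) = of_int d *\<^sub>R pr (w * x) (w' * y)" unfolding x1 y1 pr_scale by simp
    then show ?thesis using Mset_I[OF wI wJ c1 c2] by blast
  qed
  show ?thesis
  proof (rule lmul_minimal[OF _ H0 Hd])
    fix u v assume u: "u \<in> emb (cj B0)" and v: "v \<in> lmul q Ot (emb A0)"
    obtain c where c: "c \<in> cj B0" "u = (c, 0)" using u unfolding emb_def by blast
    have "lmul q Ot (emb A0) \<subseteq> {v. qm q u v \<in> ?H}"
    proof (rule lmul_minimal)
      fix s t assume s: "s \<in> Ot" and t: "t \<in> emb A0"
      obtain k where k: "k \<in> A0" "t = (k, 0)" using t unfolding emb_def by blast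
      obtain x y where "s = pr x y" using s unfolding Ot_def Mset_def by blast
      then show "qm q s t \<in> {v. qm q u v \<in> ?H}" using basic[OF c(1) k(1), of x y] s unfolding c(2) k(2) by (simp only: qm_pr_emb mem_Collect_eq)
    next
      show "0 \<in> {v. qm q u v \<in> ?H}" using H0 biadditive_zero(2)[OF biadditive_qm, of q u] by simp
      fix s t assume "s \<in> {v. qm q u v \<in> ?H}" "t \<in> {v. qm q u v \<in> ?H}"
      then have "qm q u s - qm q u t \<in> ?H" using Hd by blast
      moreover have "qm q u s - qm q u t = qm q u (s - t)" using biadditive_qm[of q] unfolding biadditive_def by metis
      ultimately show "s - t \<in> {v. qm q u v \<in> ?H}" by simp
    qed
    then show "qm q u v \<in> ?H" using v by blast
  qed
qed

text \<open>With f n + g E = 1 one has x = f n x + g E x. Both terms lie in the product: x is in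
  \<open>dd E\<close> and n in I for the first, E is in \<open>dd E\<close> and x in I for the
  second.\<close>

lemma coprime_int_dd:
  assumes I: "fr I" "I \<subseteq> OK" and n: "of_int n \<in> I" "coprime n E" and x: "x \<in> I" "E dvd T x"
  shows "x \<in> prd (dd E) I"
proof -
  obtain f g where fg: "f * n + g * E = 1" using n(2) by (metis bezout_int coprime_iff_gcd_eq_1)
  have xd: "x \<in> dd E" using x I by (auto simp: dd_def)
  have m: "md (prd (dd E) I)" using fr_prd[OF frs(7) I(1)] fr_md by blast
  have h1: "x * of_int n \<in> prd (dd E) I" using xd n(1) by (rule prd_I)
  have h2: "of_int E * x \<in> prd (dd E) I" using x(1) by (intro prd_I) (simp_all add: dd_def)
  have "of_int f * (x * of_int n) + of_int g * (of_int E * x) \<in> prd (dd E) I"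
    by (rule md_D(6)[OF m md_D(4)[OF m OK_of_int h1] md_D(4)[OF m OK_of_int h2]])
  moreover have "of_int f * (x * of_int n) + of_int g * (of_int E * x) = of_int (f * n + g * E) * x"
    by (simp add: algebra_simps)
  ultimately show ?thesis unfolding fg by simp
qed

text \<open>The middle factor is taken to be the unit of the algebra, which is
  \<open>pr rt 0\<close>. The rest is the factorization of the ideal of sqrt D into
  \<open>dd E\<close> and \<open>dd p\<close>.\<close>

lemma LL_left: assumes "x \<in> prd (dd E) I1" shows "pr (of_int d * x) 0 \<in> LL"
proof -
  have "prd (cj B0) A0 \<subseteq> {u. pr (rt * u) 0 \<in> LL}"
  proof (rule prd_minimal)
    show "c * k \<in> {u. pr (rt * u) 0 \<in> LL}" if "c \<in> cj B0" "k \<in> A0" for c k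
    proof -
      have "pr rt 0 \<in> Ot" using md_D(2)[OF cjQ(3)] by (intro Ot_I) (auto simp: dd_def T_rt)
      from LL_basic[OF that this] show ?thesis by (simp add: mult_ac)
    qed
    show "0 \<in> {u. pr (rt * u) 0 \<in> LL}" using lmul_0 by (simp add: pr_0)
    show "u - v \<in> {u. pr (rt * u) 0 \<in> LL}" if "u \<in> {u. pr (rt * u) 0 \<in> LL}" "v \<in> {u. pr (rt * u) 0 \<in> LL}" for u v
      using that lmul_diff[of "pr (rt * u) 0" q _ _ "pr (rt * v) 0"] by (simp add: pr_diff right_diff_distrib)
  qed
  moreover have "sc rt (prd (cj B0) A0) = sc (of_int d) (prd (dd E) I1)"
  proof -
    have "sc rt (prd (cj B0) A0) = prd (sc rt OK) (prd (cj B0) A0)"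
      using prd_OK[OF fr_md[OF fr_prd[OF frs2(5,2)]]] by (simp flip: sc_prd)
    also have "\<dots> = prd (dd E) (prd (cj B0) (prd (dd p) A0))" unfolding dd_pE[symmetric] by (simp only: prd_ac)
    also have "\<dots> = sc (of_int d) (prd (dd E) I1)" unfolding sc_I1 by (rule prd_sc_right)
    finally show ?thesis .
  qed
  moreover have "of_int d * x \<in> sc (of_int d) (prd (dd E) I1)" using assms by (rule sc_I)
  ultimately have sub: "prd (cj B0) A0 \<subseteq> {u. pr (rt * u) 0 \<in> LL}" and "of_int d * x \<in> sc rt (prd (cj B0) A0)" by simp_all
  then obtain u where "u \<in> prd (cj B0) A0" "of_int d * x = rt * u" unfolding sc_def by blast
  then show ?thesis using sub by auto
qed

text \<open>The order contains \<open>pr 0 y\<close> for every y in the product of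
  \<open>dd E\<close> and the conjugate of Q, where the congruence holds trivially.\<close>

lemma LL_right: assumes "y \<in> prd (dd E) J1" shows "pr 0 (of_int d * y) \<in> LL"
proof -
  let ?Y = "prd (dd E) (cj Q)"
  have Ysub: "?Y \<subseteq> dd E" "?Y \<subseteq> cj Q"
    using prd_mono[of "dd E" "dd E" "cj Q" OK] prd_mono[of "dd E" OK "cj Q" "cj Q"] cjQ dd_OK prd_OK[OF cjQ(3)] prd_OK[OF fr_md[OF frs(7)]]
    by (auto simp: prd_comm)
  have "prd (cj B0) (prd ?Y (cj A0)) \<subseteq> {v. pr 0 v \<in> LL}"
  proof (rule prd_minimal)
    fix c v assume c: "c \<in> cj B0" and v: "v \<in> prd ?Y (cj A0)"
    have "prd ?Y (cj A0) \<subseteq> {v. pr 0 (c * v) \<in> LL}"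
    proof (rule prd_minimal)
      fix y k assume y: "y \<in> ?Y" and k: "k \<in> cj A0"
      have "pr 0 y \<in> Ot" using y Ysub md_D(2)[OF dd_md[OF dvd_D(1)]] by (intro Ot_I) (auto simp: dd_def)
      then have "pr (c * 0 * cnj k) (c * y * cnj (cnj k)) \<in> LL" using c k by (intro LL_basic) (simp_all add: cj_mem_iff)
      then show "y * k \<in> {v. pr 0 (c * v) \<in> LL}" by (simp add: mult.assoc)
    next
      show "0 \<in> {v. pr 0 (c * v) \<in> LL}" using lmul_0 by (simp add: pr_0)
      show "u - v \<in> {v. pr 0 (c * v) \<in> LL}" if "u \<in> {v. pr 0 (c * v) \<in> LL}" "v \<in> {v. pr 0 (c * v) \<in> LL}" for u v
        using that lmul_diff[of "pr 0 (c * u)" q _ _ "pr 0 (c * v)"] by (simp add: pr_diff right_diff_distrib)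
    qed
    then show "c * v \<in> {v. pr 0 v \<in> LL}" using v by blast
  next
    show "0 \<in> {v. pr 0 v \<in> LL}" using lmul_0 by (simp add: pr_0)
    show "u - v \<in> {v. pr 0 v \<in> LL}" if "u \<in> {v. pr 0 v \<in> LL}" "v \<in> {v. pr 0 v \<in> LL}" for u v
      using that lmul_diff[of "pr 0 u" q _ _ "pr 0 v"] by (simp add: pr_diff)
  qed
  moreover have "prd (cj B0) (prd ?Y (cj A0)) = sc (of_int d) (prd (dd E) J1)"
  proof -
    have "prd (cj B0) (prd ?Y (cj A0)) = prd (dd E) (prd (cj B0) (prd (cj Q) (cj A0)))" by (simp only: prd_ac)
    also have "\<dots> = sc (of_int d) (prd (dd E) J1)" unfolding sc_J1 by (rule prd_sc_right)
    finally show ?thesis .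
  qed
  moreover have "of_int d * y \<in> sc (of_int d) (prd (dd E) J1)" using assms by (rule sc_I)
  ultimately show ?thesis by auto
qed

lemma of_int_norm_mem: "fr I \<Longrightarrow> I \<subseteq> OK \<Longrightarrow> fnorm I = of_int n \<Longrightarrow> of_int n \<in> I"
  using norm_mem_integral[of I] by simp

lemma ints_mem: "of_int na \<in> a" "of_int nb \<in> b" "of_int nb \<in> cj b" "of_int na \<in> cj a" "of_int p \<in> dd p" "of_int (int q) \<in> cj Q"
proof -
  show "of_int na \<in> a" "of_int nb \<in> b" using of_int_norm_mem ab by auto
  show "of_int nb \<in> cj b" "of_int na \<in> cj a" using of_int_norm_mem[OF frs(4) subs(2)] of_int_norm_mem[OF frs(3) subs(1)] ab fnorm_cj by auto
  show "of_int p \<in> dd p" by (simp add: dd_def)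
  show "of_int (int q) \<in> cj Q" by (rule of_int_norm_mem) (use cjQ fnorm_cj[OF Q(1)] Q(3) in auto)
qed

text \<open>A multiple of one special vector of the lattice, whose x-coordinate has a trace prime to
  E, is subtracted to make T(x) divisible by E. The two congruences then force E | T(y) as well, and
  such a pair splits into vectors of \<open>LL_left\<close> and \<open>LL_right\<close>.\<close>

lemma LL_superset: "(\<lambda>w. of_int d *\<^sub>R w) ` Mset I1 J1 e d \<subseteq> LL"
proof
  fix w assume "w \<in> (\<lambda>w. of_int d *\<^sub>R w) ` Mset I1 J1 e d"
  then obtain x y where xy: "w = of_int d *\<^sub>R pr x y" "x \<in> I1" "y \<in> J1" "e dvd T x - p * T y" "d dvd T x + p * T y"
    unfolding Mset_def by blast
  \<comment> \<open>This element of \<open>dd d\<close> has the square d w0 with 2 T(w0) = d - p e,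
    a number prime to E = e d.\<close>
  define c0 where "c0 = el d 1"
  have c0: "c0 \<in> dd d" unfolding c0_def using dvd_D_odd(1)[OF d_dvd(1)] by (simp add: dd_def el_OK_iff)
  obtain w0 w0' where w0: "w0 \<in> OK" "w0' \<in> OK" "c0 * c0 = of_int d * w0" "c0 * cnj c0 = of_int d * w0'"
    "2 * d * T w0 = T c0 * T c0 + D * (\<lfloor>2 * Im c0 / Im rt\<rfloor> * \<lfloor>2 * Im c0 / Im rt\<rfloor>)"
    using dd_products[OF d_dvd(1) de(2) c0 c0] by metis
  have "\<lfloor>2 * Im c0 / Im rt\<rfloor> = 1" "T c0 = d" unfolding c0_def using Im_rt_pos by simp_all
  then have "d * (2 * T w0) = d * d + D" using w0(5) by simp
  also have "\<dots> = d * (d - p * e)" by (subst D_d) (simp add: algebra_simps)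
  finally have "d * (2 * T w0) = d * (d - p * e)" .
  then have Tw0: "2 * T w0 = d - p * e" using de(2) by simp
  have cop: "coprime (T w0) E"
  proof -
    have "squarefree (d * (p * e))" using D_sqf D_pE de(1) by (simp add: mult_ac)
    then have "coprime d (p * e)" by (rule squarefree_coprime_factors)
    then have dpe: "coprime d e" "coprime d (p * e)" by simp_all
    have "coprime (d - p * e) d"
    proof (rule coprimeI)
      fix c assume c: "c dvd d - p * e" "c dvd d"
      then have "c dvd p * e" using dvd_diff[OF c(2,1)] by simp
      then show "is_unit c" using dpe(2) c(2) by (meson coprime_common_divisor)
    qed
    moreover have "coprime (d - p * e) e"
    proof (rule coprimeI)
      fix c assume c: "c dvd d - p * e" "c dvd e"
      then have "c dvd d" using dvd_add[OF c(1) dvd_mult[OF c(2), of p]] by simp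
      then show "is_unit c" using dpe(1) c(2) by (meson coprime_common_divisor)
    qed
    ultimately have "coprime (2 * T w0) E" unfolding Tw0 de(1) by simp
    then show ?thesis by simp
  qed
  \<comment> \<open>The integers \<open>nb\<close> and \<open>na * nb\<close> move c0 into the
    conjugate of \<open>B0\<close> and into \<open>A0\<close>. They are prime to E, so the trace
    stays a unit modulo E.\<close>
  define c where "c = of_int nb * c0"
  define k where "k = of_int na * (of_int nb * c0)"
  have c: "c \<in> cj B0" unfolding c_def B0_def cj_prd cj_dd using c0 ints_mem by (intro prd_I)
  have k: "k \<in> A0" unfolding k_def A0_def B0_def using c0 ints_mem by (intro prd_I)
  \<comment> \<open>The traces are 2 p and -2 q, and 2 p + 2 p q is a multiple of q + 1.\<close>
  have sp: "pr (of_int p) (- of_nat q) \<in> Ot"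
  proof (rule Ot_I)
    show "- of_nat q \<in> cj Q" using md_D(5)[OF cjQ(3) ints_mem(6)] by simp
    have "T (- of_nat q) = - 2 * int q" using T_of_int[of "- int q"] by simp
    then have "T (of_int p) - p * T (- of_nat q) = 2 * p * (int q + 1)" by (simp add: algebra_simps)
    then show "E dvd T (of_int p) - p * T (- of_nat q)" using q_E by simp
  qed (rule ints_mem)
  define N where "N = na * nb * nb"
  define x0 where "x0 = of_int (p * N) * w0"
  define y0 where "y0 = of_int (- (int q * N)) * w0'"
  have x0eq: "c * of_int p * k = of_int d * x0"
    unfolding c_def k_def x0_def N_def using w0(3) by (simp add: algebra_simps)
  have y0eq: "c * (- of_nat q) * cnj k = of_int d * y0"
    unfolding c_def k_def y0_def N_def using w0(4) by (simp add: algebra_simps)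
  have spec: "pr (of_int d * x0) (of_int d * y0) \<in> LL" using LL_basic[OF c k sp] unfolding x0eq y0eq .
  then have "pr (of_int d * x0) (of_int d * y0) \<in> (\<lambda>w. of_int d *\<^sub>R w) ` Mset I1 J1 e d" using LL_subset by blast
  then obtain w1 where w1: "pr (of_int d * x0) (of_int d * y0) = of_int d *\<^sub>R w1" "w1 \<in> Mset I1 J1 e d" by blast
  then obtain x0' y0' where m0: "pr (of_int d * x0) (of_int d * y0) = of_int d *\<^sub>R pr x0' y0'" "x0' \<in> I1" "y0' \<in> J1"
    "e dvd T x0' - p * T y0'" "d dvd T x0' + p * T y0'" unfolding Mset_def by blast
  have "x0' = x0" "y0' = y0" using m0(1) de(2) unfolding pr_scale pr_inj by auto
  note m0 = m0(2-)[unfolded this]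
  have Tx0: "T x0 = p * N * T w0" unfolding x0_def by (rule T_int_mult[OF w0(1)])
  have "coprime (T x0) E" unfolding Tx0 N_def using cop ab p_E by simp
  then obtain f g where fg: "f * T x0 + g * E = 1" by (metis bezout_int coprime_iff_gcd_eq_1)
  \<comment> \<open>The integer f inverts T(x0) modulo E.\<close>
  define t where "t = T x * f"
  define x2 where "x2 = x - of_int t * x0"
  define y2 where "y2 = y - of_int t * y0"
  have mem2: "x2 \<in> I1" "y2 \<in> J1" unfolding x2_def y2_def
    using md_D(3,4)[OF M_md(1)] md_D(3,4)[OF M_md(2)] xy m0 OK_of_int by simp_all
  have Tx2: "T x2 = T x - t * T x0" and Ty2: "T y2 = T y - t * T y0"
    unfolding x2_def y2_def using xy m0 subs2 by (auto simp: T_diff T_int_mult OK_mult subset_iff)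
  have "T x2 = T x * (1 - f * T x0)" unfolding Tx2 t_def by (simp add: algebra_simps)
  also have "1 - f * T x0 = g * E" using fg by simp
  finally have "T x2 = T x * (g * E)" .
  then have Ex2: "E dvd T x2" by simp
  have "T x2 - p * T y2 = (T x - p * T y) - t * (T x0 - p * T y0)" "T x2 + p * T y2 = (T x + p * T y) - t * (T x0 + p * T y0)"
    unfolding Tx2 Ty2 by (simp_all add: algebra_simps)
  then have ed2: "e dvd T x2 - p * T y2" "d dvd T x2 + p * T y2" using xy m0 by simp_all
  have exd: "e dvd T x2" "d dvd T x2" using Ex2 d_dvd dvd_trans by auto
  have "e dvd p * T y2" "d dvd p * T y2" using dvd_diff[OF exd(1) ed2(1)] dvd_diff[OF ed2(2) exd(2)] by simp_all
  moreover have "coprime e d" using squarefree_coprime_factors[of e d] dvd_D_sqf[OF dvd_D(2)] de(1) by simp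
  ultimately have "E dvd p * T y2" unfolding de(1) by (intro divides_mult)
  then have Ey2: "E dvd T y2" using p_E by (simp add: coprime_commute coprime_dvd_mult_right_iff)
  have nI: "of_int (p * (na * nb * nb)) \<in> I1" "coprime (p * (na * nb * nb)) E"
    using of_int_norm_mem[OF frs2(3) subs2(3) fnorm_I1] ab p_E by simp_all
  have nJ: "of_int (int q * (na * nb * nb)) \<in> J1" "coprime (int q * (na * nb * nb)) E"
    using of_int_norm_mem[OF frs2(4) subs2(4) fnorm_J1] ab coprimes by (simp_all add: coprime_commute)
  have L1: "pr (of_int d * x2) 0 \<in> LL" by (intro LL_left coprime_int_dd[OF frs2(3) subs2(3) nI mem2(1) Ex2])
  have L2: "pr 0 (of_int d * y2) \<in> LL" by (intro LL_right coprime_int_dd[OF frs2(4) subs2(4) nJ mem2(2) Ey2])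
  have nat: "pr (of_nat n * (of_int d * x0)) (of_nat n * (of_int d * y0)) \<in> LL" for n
  proof (induction n)
    case 0 then show ?case using lmul_0 by (simp add: pr_0)
  next
    case (Suc n)
    have "pr (of_nat (Suc n) * (of_int d * x0)) (of_nat (Suc n) * (of_int d * y0)) =
      pr (of_nat n * (of_int d * x0)) (of_nat n * (of_int d * y0)) + pr (of_int d * x0) (of_int d * y0)"
      unfolding pr_add by (simp add: algebra_simps)
    then show ?case using lmul_add[OF Suc spec] by simp
  qed
  have "pr (of_int t * (of_int d * x0)) (of_int t * (of_int d * y0)) \<in> LL"
  proof (cases "t \<ge> 0")
    case True
    then show ?thesis using nat[of "nat t"] by (simp add: of_nat_nat)
  next
    case False
    have "0 - pr (of_nat (nat (- t)) * (of_int d * x0)) (of_nat (nat (- t)) * (of_int d * y0)) \<in> LL"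
      by (rule lmul_diff[OF lmul_0 nat])
    then show ?thesis using False unfolding pr_0[symmetric] pr_diff by (simp add: of_nat_nat)
  qed
  from lmul_add[OF this lmul_add[OF L1 L2]]
  have "pr (of_int t * (of_int d * x0) + (of_int d * x2 + 0)) (of_int t * (of_int d * y0) + (0 + of_int d * y2)) \<in> LL"
    unfolding pr_add .
  moreover have "of_int t * (of_int d * x0) + (of_int d * x2 + 0) = of_int d * x" "of_int t * (of_int d * y0) + (0 + of_int d * y2) = of_int d * y"
    unfolding x2_def y2_def by (simp_all add: algebra_simps)
  ultimately show "w \<in> LL" unfolding xy(1) pr_scale by simp
qed

lemma LL_eq: "LL = (\<lambda>w. of_int d *\<^sub>R w) ` Mset I1 J1 e d"
  using LL_subset LL_superset by blast

text \<open>Write N(x) = k p N and N(y) = n q N with N = na nb^2. The product of the two congruences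
  says T(x)^2 = p^2 T(y)^2 modulo E; in terms of norms, with q = -1, this is E | k + p n. The
  reduced norm is N (k + p n) / E.\<close>

lemma Mset_norm:
  assumes "x \<in> I1" "y \<in> J1" "e dvd T x - p * T y" "d dvd T x + p * T y"
  shows "reduced_norm q (pr x y) / of_int (na * nb * nb) \<in> \<int>"
proof -
  define N where "N = na * nb * nb"
  have N: "N > 0" "coprime N E" unfolding N_def using nab ab by auto
  have xO: "x \<in> OK" "y \<in> OK" using assms subs2 by auto
  obtain k where k: "(cmod x)\<^sup>2 / fnorm I1 = of_int k" using norm_over_fnorm(2)[OF frs2(3) assms(1,1)] by (elim Ints_cases)
  obtain n where n: "(cmod y)\<^sup>2 / fnorm J1 = of_int n" using norm_over_fnorm(2)[OF frs2(4) assms(2,2)] by (elim Ints_cases)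
  have pos: "of_int (p * N) > (0::real)" "of_int (int q * N) > (0::real)" using N p_pos q_pos by simp_all
  have "(cmod x)\<^sup>2 = of_int (k * (p * N))" using k pos unfolding fnorm_I1 N_def[symmetric] by (simp only: divide_eq_eq of_int_mult)
  then have nx: "nn x = k * (p * N)" using of_int_nn[OF xO(1)] by (metis of_int_eq_iff)
  have "(cmod y)\<^sup>2 = of_int (n * (int q * N))" using n pos unfolding fnorm_J1 N_def[symmetric] by (simp only: divide_eq_eq of_int_mult)
  then have ny: "nn y = n * (int q * N)" using of_int_nn[OF xO(2)] by (metis of_int_eq_iff)
  have E1: "E dvd (T x - p * T y) * (T x + p * T y)" unfolding de(1) using assms(3,4) by (rule mult_dvd_mono)
  have E2: "E dvd 4 * nn x - T x * T x" "E dvd 4 * nn y - T y * T y"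
    using nn_cong[OF xO(1)] nn_cong[OF xO(2)] dvd_D(2) dvd_trans by (auto simp: cong_iff_dvd_diff)
  have "E dvd (4 * nn x - T x * T x) - p * p * (4 * nn y - T y * T y) + (T x - p * T y) * (T x + p * T y)
    + (int q + 1) * (4 * p * p * n * N)"
    by (rule dvd_add[OF dvd_add[OF dvd_diff[OF E2(1) dvd_mult[OF E2(2)]] E1] dvd_mult2[OF q_E]])
  also have "\<dots> = (2 * 2 * p * N) * (k + p * n)" unfolding nx ny by (simp add: algebra_simps)
  finally have "E dvd (2 * 2 * p * N) * (k + p * n)" .
  moreover have "coprime E 4" using coprimes(1) coprime_mult_right_iff[of E 2 2] by simp
  then have "coprime E (2 * 2 * p * N)" using p_E N(2) by (simp add: coprime_commute)
  ultimately have "E dvd k + p * n" by (simp add: coprime_dvd_mult_right_iff)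
  then obtain j where j: "k + p * n = E * j" ..
  have "reduced_norm q (pr x y) = of_int (p * N * (k + p * n)) / of_int (p * E)"
    unfolding reduced_norm_pr of_int_nn[OF xO(1), symmetric] of_int_nn[OF xO(2), symmetric] nx ny
    using q_pos D_pE by (simp add: power2_eq_square algebra_simps)
  also have "\<dots> = of_int N * of_int j" unfolding j using p_pos E_pos by simp
  finally show ?thesis using N unfolding N_def[symmetric] by simp
qed

text \<open>That no larger number divides all norms is visible on the elements (u, 0) with u in the
  product of a, b and the conjugate of b; by \<open>fnorm_gcd\<close> the gcd of their norms is the
  norm of this ideal.\<close>

lemma has_norm_Mset: "has_norm q (Mset I1 J1 e d) (of_int (na * nb * nb))"
  unfolding has_norm_def
proof (intro conjI ballI impI)
  show "real_of_int (na * nb * nb) > 0" using nab by simp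
  show "reduced_norm q w / of_int (na * nb * nb) \<in> \<int>" if "w \<in> Mset I1 J1 e d" for w
    using that Mset_norm unfolding Mset_def by blast
  fix s assume s: "s \<in> \<rat>" "s > 0 \<and> (\<forall>x\<in>Mset I1 J1 e d. reduced_norm q x / s \<in> \<int>)"
  have fr': "fr (prd a (prd b (cj b)))" using frs by (intro fr_prd)
  have "fnorm (prd a (prd b (cj b))) / s \<in> \<int>"
  proof (rule fnorm_gcd[OF fr'])
    fix u assume u: "u \<in> prd a (prd b (cj b))"
    have uO: "u \<in> OK" using u prd_OK_subset ab subs by (meson subsetD)
    have rtp: "rt \<in> dd p" by (simp add: dd_def T_rt)
    have "rt * u \<in> I1" unfolding I1_def using u rtp by (intro prd_I)
    moreover have "T (rt * u) = 2 * 0 \<or> E dvd T (rt * u)"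
    proof -
      have "rt * u \<in> dd (- D)" unfolding dd_D using uO by (rule sc_I)
      then have "- D dvd T (rt * u)" by (simp add: dd_def)
      then show ?thesis using dvd_D(2) by (meson dvd_minus_iff dvd_trans minus_dvd_iff)
    qed
    then have "E dvd T (rt * u)" by auto
    then have "e dvd T (rt * u) - p * T 0" "d dvd T (rt * u) + p * T 0" using d_dvd dvd_trans by auto
    ultimately have "pr (rt * u) 0 \<in> Mset I1 J1 e d" using md_D(2)[OF M_md(2)] by (intro Mset_I)
    then have "reduced_norm q (pr (rt * u) 0) / s \<in> \<int>" using s by blast
    moreover have "reduced_norm q (pr (rt * u) 0) = (cmod u)\<^sup>2" by (simp add: pr_def)
    ultimately show "(cmod u)\<^sup>2 / s \<in> \<int>" by simp
  qed
  moreover have "fnorm (prd a (prd b (cj b))) = of_int (na * nb * nb)"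
    using frs ab by (simp add: fnorm_prd fr_prd fnorm_cj)
  ultimately show "real_of_int (na * nb * nb) / s \<in> \<int>" by simp
qed auto

text \<open>Existence suffices because this norm cancels in \<open>phi\<close>. The elements are
  \<open>pr x y\<close> with integral x and y, so q |D| clears the denominators of their reduced
  norms.\<close>

lemma has_norm_left_ideal: "\<exists>t. has_norm q (lmul q Ot (emb B0)) t"
proof -
  define s0 where "s0 = 1 / (real q * of_int (- D))"
  obtain k where k: "k \<in> B0" "k \<noteq> 0" using fr_nz[OF frs2(1)] .
  show ?thesis
proof (rule has_norm_exists[of s0 _ q "(k, 0)"])
  show "s0 \<in> \<rat>" "s0 > 0" unfolding s0_def using q_pos D_neg by (auto intro!: Rats_divide divide_pos_pos mult_pos_pos simp: mult_less_0_iff)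
  have "lmul q Ot (emb B0) \<subseteq> {w. \<exists>x\<in>OK. \<exists>y\<in>OK. w = pr x y}"
  proof (rule lmul_minimal)
    fix s t assume s: "s \<in> Ot" and t: "t \<in> emb B0"
    obtain k where k: "k \<in> B0" "t = (k, 0)" using t unfolding emb_def by blast
    obtain x y where xy: "s = pr x y" "x \<in> OK" "y \<in> OK" using s cjQ dd_OK unfolding Ot_def Mset_def by blast
    have kO: "k \<in> OK" using k subs2 by auto
    have "qm q s t = pr (x * k) (y * cnj k)" unfolding xy(1) k(2) by (simp add: pr_def)
    then show "qm q s t \<in> {w. \<exists>x\<in>OK. \<exists>y\<in>OK. w = pr x y}" using xy kO OK_mult OK_cnj by blast
  next
    show "0 \<in> {w. \<exists>x\<in>OK. \<exists>y\<in>OK. w = pr x y}" using pr_0 OK_0 by (metis (mono_tags, lifting) mem_Collect_eq)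
    fix s t assume st: "s \<in> {w. \<exists>x\<in>OK. \<exists>y\<in>OK. w = pr x y}" "t \<in> {w. \<exists>x\<in>OK. \<exists>y\<in>OK. w = pr x y}"
    obtain x y x' y' where xy: "s = pr x y" "t = pr x' y'" "x \<in> OK" "y \<in> OK" "x' \<in> OK" "y' \<in> OK" using st by blast
    then show "s - t \<in> {w. \<exists>x\<in>OK. \<exists>y\<in>OK. w = pr x y}" using OK_diff pr_diff by blast
  qed
  moreover have "reduced_norm q (pr x y) / s0 \<in> \<int>" if xy: "x \<in> OK" "y \<in> OK" for x y
  proof -
    have "reduced_norm q (pr x y) / s0 = of_int (int q * nn x + p\<^sup>2 * nn y)"
      unfolding s0_def reduced_norm_pr of_int_nn[OF xy(1), symmetric] of_int_nn[OF xy(2), symmetric]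
      using q_pos D_neg by (simp add: field_simps)
    then show ?thesis by (metis Ints_of_int)
  qed
  ultimately show "reduced_norm q x / s0 \<in> \<int>" if "x \<in> lmul q Ot (emb B0)" for x using that by blast
  have "qm q (1, 0) (k, 0) \<in> lmul q Ot (emb B0)" using k Ot_1 by (intro lmul_I) (auto simp: emb_def)
  then show "(k, 0) \<in> lmul q Ot (emb B0)" by simp
  show "reduced_norm q (k, 0) \<noteq> 0" using k by simp
qed
qed

text \<open>The lattice collapses to the conjugate of \<open>B0\<close> times \<open>Ot\<close>
  times \<open>A0\<close>, and the scalar d of \<open>LL_eq\<close> cancels against the norm of the
  lattice.\<close>

lemma phi_value:
  "phi D q (left_class D q (extend_ideal D q Ot B0)) (left_class D q (extend_ideal D q Ot A0)) z =
   tsum q (Mset I1 J1 e d) (of_int (na * nb * nb)) z"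
proof -
  obtain t where t: "has_norm q (lmul q Ot (emb B0)) t" using has_norm_left_ideal by blast
  have "quat_conj ` emb B0 = emb (cj B0)" by (simp add: emb_def image_image)
  then have "quat_conj ` lmul q Ot (emb B0) = lmul q (emb (cj B0)) Ot" unfolding conj_lmul Ot_conj by simp
  then have L: "lmul q (quat_conj ` lmul q Ot (emb B0)) (lmul q Ot (emb A0)) = LL"
    by (simp add: lmul_assoc) (metis lmul_assoc Ot_Ot)
  have n: "has_norm q LL ((of_int d)\<^sup>2 * of_int (na * nb * nb))"
    unfolding LL_eq using has_norm_Mset de(2) by (intro has_norm_image) (auto simp: reduced_norm_scaleR)
  have "phi D q (left_class D q (extend_ideal D q Ot B0)) (left_class D q (extend_ideal D q Ot A0)) z =
    tsum q LL ((of_int d)\<^sup>2 * of_int (na * nb * nb)) z"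
    using phi_eq[OF t, of "lmul q Ot (emb A0)"] n unfolding L extend_ideal_eq by blast
  also have "\<dots> = tsum q (Mset I1 J1 e d) (of_int (na * nb * nb)) z"
    unfolding LL_eq using de(2) by (intro tsum_image) (auto simp: reduced_norm_scaleR inj_on_def)
  finally show ?thesis .
qed

end

end

section \<open>Theta series as power series\<close>

lemma summable_int_power: assumes "0 \<le> r" "r < (1::real)" shows "(\<lambda>n::int. r ^ nat \<bar>n\<bar>) summable_on UNIV"
proof -
  have s: "(\<lambda>n::nat. r ^ n) summable_on UNIV"
    using assms by (intro norm_summable_imp_summable_on) (simp add: summable_geometric)
  have "(\<lambda>n::int. r ^ nat \<bar>n\<bar>) summable_on (int ` UNIV)"
    by (subst summable_on_reindex) (auto simp: o_def s)
  moreover have "(\<lambda>n::int. r ^ nat \<bar>n\<bar>) summable_on ((\<lambda>n. - int n) ` UNIV)"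
    by (subst summable_on_reindex) (auto simp: o_def s inj_on_def)
  ultimately have "(\<lambda>n::int. r ^ nat \<bar>n\<bar>) summable_on (int ` UNIV \<union> (\<lambda>n. - int n) ` UNIV)"
    by (rule summable_on_union)
  moreover have "int ` UNIV \<union> (\<lambda>n. - int n) ` UNIV = UNIV"
  proof (intro equalityI subset_UNIV subsetI)
    fix n :: int
    show "n \<in> int ` UNIV \<union> (\<lambda>n. - int n) ` UNIV" by (cases n) (auto intro: image_eqI[of _ _ "Suc _"])
  qed
  ultimately show ?thesis by simp
qed

lemma summable_product_nonneg:
  fixes f :: "'a \<Rightarrow> real" and g :: "'b \<Rightarrow> real"
  assumes "f summable_on A" "g summable_on B" "\<And>x. f x \<ge> 0" "\<And>x. g x \<ge> 0"
  shows "(\<lambda>(x, y). f x * g y) summable_on A \<times> B"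
proof (rule summable_on_SigmaI[where g = "\<lambda>x. f x * infsum g B"])
  fix x
  show "((\<lambda>y. case (x, y) of (x, y) \<Rightarrow> f x * g y) has_sum f x * infsum g B) B"
    using has_sum_cmult_right[OF has_sum_infsum[OF assms(2)], of "f x"] by simp
next
  show "(\<lambda>x. f x * infsum g B) summable_on A" using assms(1) by (rule summable_on_cmult_left)
qed (use assms in auto)

lemma graded_sums:
  fixes F :: "nat \<Rightarrow> complex" and m :: "'a \<Rightarrow> nat"
  assumes s: "(\<lambda>x. F (m x)) summable_on S" and fin: "\<And>k. finite {x \<in> S. m x = k}"
  shows "(\<lambda>k. of_nat (card {x \<in> S. m x = k}) * F k) sums (\<Sum>\<^sub>\<infinity>x\<in>S. F (m x))"
proof -
  let ?B = "\<lambda>k. {x \<in> S. m x = k}"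
  have "((\<lambda>x. F (m x)) has_sum (\<Sum>\<^sub>\<infinity>x\<in>S. F (m x))) S" using s by (rule has_sum_infsum)
  then have "((\<lambda>(k, x). F k) has_sum (\<Sum>\<^sub>\<infinity>x\<in>S. F (m x))) (Sigma UNIV ?B)"
    by (subst has_sum_reindex_bij_witness[where i = "\<lambda>x. (m x, x)" and j = snd and T = S and h = "\<lambda>x. F (m x)"]) auto
  then have "((\<lambda>k. \<Sum>x\<in>?B k. F k) has_sum (\<Sum>\<^sub>\<infinity>x\<in>S. F (m x))) UNIV"
    by (rule has_sum_SigmaD) (use fin in \<open>auto intro: has_sum_finite\<close>)
  then show ?thesis by (intro has_sum_imp_sums) simp
qed

context quat_order begin

lemma exp_norm_nat: "cmod (exp (2 * of_real pi * \<i> * z * of_real t)) = exp (- (2 * pi * Im z * t))"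
  by (simp add: norm_exp_eq_Re)

text \<open>The reduced norm is at least c (|u| + |v| + |u'| + |v'|) with c = 1 / (4 q |D|), since
  |u| <= u^2 for integers. The sum is therefore dominated by a product of four two-sided geometric
  series.\<close>

lemma summable_theta:
  assumes "I \<subseteq> OK" "J \<subseteq> OK" "t > 0" "Im z > 0"
  shows "(\<lambda>w. exp (2 * of_real pi * \<i> * z * of_real (reduced_norm q w / t))) summable_on {pr x y | x y. x \<in> I \<and> y \<in> J}"
proof -
  define c where "c = 1 / (4 * real q * of_int (- D))"
  define r where "r = exp (- (2 * pi * Im z * (c / t)))"
  have c: "c > 0" unfolding c_def using q_pos D_neg by (auto intro!: divide_pos_pos mult_pos_pos simp: mult_less_0_iff)
  have r: "0 \<le> r" "r < 1" unfolding r_def using c assms by simp_all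
  define G where "G = (\<lambda>((u::int, v::int), (u'::int, v'::int)). (r ^ nat \<bar>u\<bar> * r ^ nat \<bar>v\<bar>) * (r ^ nat \<bar>u'\<bar> * r ^ nat \<bar>v'\<bar>))"
  have fG: "(\<lambda>(u::int, v::int). r ^ nat \<bar>u\<bar> * r ^ nat \<bar>v\<bar>) summable_on UNIV \<times> UNIV"
    by (intro summable_product_nonneg summable_int_power r) (use r in auto)
  have "(\<lambda>(x, y). (case x of (u::int, v::int) \<Rightarrow> r ^ nat \<bar>u\<bar> * r ^ nat \<bar>v\<bar>) * (case y of (u::int, v::int) \<Rightarrow> r ^ nat \<bar>u\<bar> * r ^ nat \<bar>v\<bar>))
      summable_on (UNIV \<times> UNIV) \<times> (UNIV \<times> UNIV)"
    by (rule summable_product_nonneg[OF fG fG]) (use r in auto)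
  then have G: "G summable_on UNIV" unfolding G_def by (simp add: case_prod_unfold)
  define V where "V = {((u, v), (u', v')). el u v \<in> I \<and> el u' v' \<in> J}"
  define h where "h = (\<lambda>((u, v), (u', v')). pr (el u v) (el u' v'))"
  have inj: "inj_on h V" unfolding h_def by (intro inj_onI) (auto simp: pr_inj el_inj)
  have im: "h ` V = {pr x y | x y. x \<in> I \<and> y \<in> J}"
  proof
    show "h ` V \<subseteq> {pr x y | x y. x \<in> I \<and> y \<in> J}" unfolding h_def V_def by auto
    show "{pr x y | x y. x \<in> I \<and> y \<in> J} \<subseteq> h ` V"
    proof
      fix w assume "w \<in> {pr x y | x y. x \<in> I \<and> y \<in> J}"
      then obtain x y where w: "w = pr x y" "x \<in> I" "y \<in> J" by blast
      obtain u v where x: "x = el u v" using w assms by (meson OK_E subsetD)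
      obtain u' v' where y: "y = el u' v'" using w assms by (meson OK_E subsetD)
      show "w \<in> h ` V" using w x y by (intro image_eqI[of _ _ "((u, v), (u', v'))"]) (auto simp: h_def V_def)
    qed
  qed
  have bound: "cmod (exp (2 * of_real pi * \<i> * z * of_real (reduced_norm q (h g) / t))) \<le> G g" if "g \<in> V" for g
  proof -
    obtain u v u' v' where g: "g = ((u, v), (u', v'))" by (metis prod.exhaust)
    define k where "k = nat \<bar>u\<bar> + nat \<bar>v\<bar> + (nat \<bar>u'\<bar> + nat \<bar>v'\<bar>)"
    have n: "of_int (\<bar>u\<bar> + \<bar>v\<bar>) \<le> 4 * (cmod (el u v))\<^sup>2" for u v
    proof -
      have "1 * v\<^sup>2 \<le> (- D) * v\<^sup>2" using D_le by (intro mult_right_mono) auto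
      then have "\<bar>u\<bar> + \<bar>v\<bar> \<le> u\<^sup>2 - D * v\<^sup>2" using abs_le_square[of u] abs_le_square[of v] by simp
      then show ?thesis unfolding cmod_el by (simp only: of_int_le_iff)
    qed
    have q1: "real q \<ge> 1" "(of_int p)\<^sup>2 \<ge> (1::real)" using q_pos p_ge by (simp_all add: one_le_power)
    have "c * real k = (of_int (\<bar>u\<bar> + \<bar>v\<bar>) + of_int (\<bar>u'\<bar> + \<bar>v'\<bar>)) / (4 * real q * of_int (- D))"
      unfolding c_def k_def by simp
    also have "\<dots> \<le> (4 * real q * (cmod (el u v))\<^sup>2 + 4 * (of_int p)\<^sup>2 * (cmod (el u' v'))\<^sup>2) / (4 * real q * of_int (- D))"
    proof (rule divide_right_mono)
      have "1 * (4 * (cmod (el u v))\<^sup>2) \<le> real q * (4 * (cmod (el u v))\<^sup>2)" "1 * (4 * (cmod (el u' v'))\<^sup>2) \<le> (of_int p)\<^sup>2 * (4 * (cmod (el u' v'))\<^sup>2)"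
        by (intro mult_right_mono q1, simp)+
      then show "of_int (\<bar>u\<bar> + \<bar>v\<bar>) + of_int (\<bar>u'\<bar> + \<bar>v'\<bar>) \<le> 4 * real q * (cmod (el u v))\<^sup>2 + 4 * (of_int p)\<^sup>2 * (cmod (el u' v'))\<^sup>2"
        using n[of u v] n[of u' v'] by (simp add: mult_ac)
      show "0 \<le> 4 * real q * of_int (- D)" using D_neg by (simp add: mult_nonneg_nonpos)
    qed
    also have "\<dots> = reduced_norm q (h g)" unfolding g h_def prod.case reduced_norm_pr using q_pos D_neg
      by (simp add: field_simps)
    finally have ck: "c * real k \<le> reduced_norm q (h g)" .
    have "2 * pi * Im z * (c / t) * real k = 2 * pi * Im z * ((c * real k) / t)" by simp
    also have "\<dots> \<le> 2 * pi * Im z * (reduced_norm q (h g) / t)"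
      using ck assms by (intro mult_left_mono divide_right_mono) auto
    finally have "exp (- (2 * pi * Im z * (reduced_norm q (h g) / t))) \<le> exp (- (2 * pi * Im z * (c / t)) * real k)" by simp
    also have "\<dots> = r ^ k" unfolding r_def by (simp add: exp_of_nat_mult[symmetric] mult.commute)
    also have "\<dots> = G g" unfolding G_def g k_def by (simp add: power_add)
    finally show ?thesis by (simp only: exp_norm_nat)
  qed
  have "(\<lambda>g. cmod (exp (2 * of_real pi * \<i> * z * of_real (reduced_norm q (h g) / t)))) summable_on V"
    by (rule summable_on_comparison_test[OF summable_on_subset_banach[OF G, of V]]) (use bound in auto)
  then have "(\<lambda>g. exp (2 * of_real pi * \<i> * z * of_real (reduced_norm q (h g) / t))) summable_on V"
    by (rule abs_summable_summable)
  then have "(\<lambda>w. exp (2 * of_real pi * \<i> * z * of_real (reduced_norm q w / t))) summable_on h ` V"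
    using inj by (subst summable_on_reindex) (auto simp: o_def)
  then show ?thesis unfolding im .
qed

lemma finite_bounded_reduced_norm:
  assumes "fr I" "fr J" shows "finite {pr x y | x y. x \<in> I \<and> y \<in> J \<and> reduced_norm q (pr x y) \<le> t}"
proof -
  have "{pr x y | x y. x \<in> I \<and> y \<in> J \<and> reduced_norm q (pr x y) \<le> t} \<subseteq>
    (\<lambda>(x, y). pr x y) ` ({x \<in> I. (cmod x)\<^sup>2 \<le> t * of_int (- D)} \<times> {y \<in> J. (cmod y)\<^sup>2 \<le> t * of_int (- D) * real q})"
  proof
    fix w assume "w \<in> {pr x y | x y. x \<in> I \<and> y \<in> J \<and> reduced_norm q (pr x y) \<le> t}"
    then obtain x y where w: "w = pr x y" "x \<in> I" "y \<in> J" "reduced_norm q (pr x y) \<le> t" by blast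
    have D0: "0 < real_of_int (- D)" using D_neg by simp
    have *: "(cmod x)\<^sup>2 + (of_int p)\<^sup>2 * (cmod y)\<^sup>2 / real q \<le> t * of_int (- D)"
      using w(4) D0 unfolding reduced_norm_pr by (simp only: pos_divide_le_eq)
    have "(cmod x)\<^sup>2 \<ge> 0" "(of_int p)\<^sup>2 * (cmod y)\<^sup>2 / real q \<ge> 0" by simp_all
    then have x: "(cmod x)\<^sup>2 \<le> t * of_int (- D)" and y: "(of_int p)\<^sup>2 * (cmod y)\<^sup>2 / real q \<le> t * of_int (- D)"
      using * by linarith+
    have "(1::real) \<le> (of_int p)\<^sup>2" using p_ge by (simp add: one_le_power)
    then have "1 * (cmod y)\<^sup>2 \<le> (of_int p)\<^sup>2 * (cmod y)\<^sup>2" by (intro mult_right_mono) auto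
    also have "\<dots> \<le> t * of_int (- D) * real q" using y q_pos by (simp add: pos_divide_le_eq)
    finally show "w \<in> (\<lambda>(x, y). pr x y) ` ({x \<in> I. (cmod x)\<^sup>2 \<le> t * of_int (- D)} \<times> {y \<in> J. (cmod y)\<^sup>2 \<le> t * of_int (- D) * real q})"
      using w x by (intro image_eqI[of _ _ "(x, y)"]) auto
  qed
  then show ?thesis by (rule finite_subset) (intro finite_imageI finite_cartesian_product finite_ideal_elements assms)
qed

text \<open>Divided by N, the reduced norms are natural numbers. Grouping the absolutely convergent
  sum by their values gives a power series whose coefficients count lattice vectors.\<close>

lemma tsum_sums:
  assumes IJ: "fr I" "fr J" "I \<subseteq> OK" "J \<subseteq> OK" and S: "S \<subseteq> {pr x y | x y. x \<in> I \<and> y \<in> J}"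
    and N: "N > 0" "\<And>w. w \<in> S \<Longrightarrow> reduced_norm q w / N \<in> \<int>" and z: "Im z > 0"
  shows "(\<lambda>m. of_nat (card {w \<in> S. reduced_norm q w = real m * N}) / 2 * exp (2 * of_real pi * \<i> * of_nat m * z)) sums tsum q S N z"
proof -
  define m where "m = (\<lambda>w. nat \<lfloor>reduced_norm q w / N\<rfloor>)"
  define F where "F = (\<lambda>k::nat. exp (2 * of_real pi * \<i> * z * of_real (real k)))"
  have m: "real (m w) = reduced_norm q w / N" if "w \<in> S" for w
  proof -
    have "reduced_norm q w / N \<ge> 0" using N(1) reduced_norm_nonneg[of w] by simp
    then show ?thesis unfolding m_def using N(2)[OF that] by (auto elim!: Ints_cases)
  qed
  have meq: "{w \<in> S. m w = k} = {w \<in> S. reduced_norm q w = real k * N}" for k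
  proof -
    have "m w = k \<longleftrightarrow> reduced_norm q w = real k * N" if "w \<in> S" for w
    proof -
      have "m w = k \<longleftrightarrow> real (m w) = real k" by simp
      also have "\<dots> \<longleftrightarrow> reduced_norm q w = real k * N" unfolding m[OF that] using N(1) by (simp add: field_simps)
      finally show ?thesis .
    qed
    then show ?thesis by auto
  qed
  have fin: "finite {w \<in> S. m w = k}" for k
  proof -
    have "{w \<in> S. m w = k} \<subseteq> {pr x y | x y. x \<in> I \<and> y \<in> J \<and> reduced_norm q (pr x y) \<le> real k * N}"
      unfolding meq using S by fastforce
    then show ?thesis using finite_bounded_reduced_norm[OF IJ(1,2)] finite_subset by blast
  qed
  have Fm: "F (m w) = exp (2 * of_real pi * \<i> * z * of_real (reduced_norm q w / N))" if "w \<in> S" for w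
    unfolding F_def m[OF that] ..
  have "(\<lambda>w. exp (2 * of_real pi * \<i> * z * of_real (reduced_norm q w / N))) summable_on S"
    using summable_theta[OF IJ(3,4) N(1) z] S by (rule summable_on_subset_banach)
  then have "(\<lambda>w. F (m w)) summable_on S" by (simp only: Fm cong: summable_on_cong)
  from graded_sums[OF this fin]
  have "(\<lambda>k. of_nat (card {w \<in> S. m w = k}) * F k) sums (\<Sum>\<^sub>\<infinity>w\<in>S. F (m w))" .
  moreover have "(\<Sum>\<^sub>\<infinity>w\<in>S. F (m w)) = (\<Sum>\<^sub>\<infinity>w\<in>S. exp (2 * of_real pi * \<i> * z * of_real (reduced_norm q w / N)))"
    by (rule infsum_cong) (rule Fm)
  ultimately have "(\<lambda>k. 1 / 2 * (of_nat (card {w \<in> S. m w = k}) * F k)) sums tsum q S N z"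
    unfolding tsum_def by (intro sums_mult) simp
  then show ?thesis unfolding meq F_def by (simp add: mult_ac)
qed

end

section \<open>Counting lattice vectors by ideals\<close>

lemma prod_primes_dvd:
  fixes n :: int
  assumes "finite S" "\<And>l. l \<in> S \<Longrightarrow> prime l" "\<And>l. l \<in> S \<Longrightarrow> l dvd n" shows "\<Prod>S dvd n"
  using assms
proof (induction S rule: finite_induct)
  case (insert l S)
  have "coprime l s" if "s \<in> S" for s
    using that insert by (metis insert_iff primes_coprime)
  then have "coprime l (\<Prod>S)" by (intro prod_coprime_right) auto
  then show ?case using insert by (simp add: divides_mult)
qed simp

lemma prod_primes_dvd_iff:
  fixes n :: int
  assumes "finite S" "\<And>l. l \<in> S \<Longrightarrow> prime l" shows "\<Prod>S dvd n \<longleftrightarrow> (\<forall>l\<in>S. l dvd n)"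
proof
  assume d: "\<Prod>S dvd n"
  show "\<forall>l\<in>S. l dvd n"
  proof
    fix l assume "l \<in> S"
    then have "id l dvd prod id S" by (rule dvd_prodI[OF assms(1)])
    then show "l dvd n" using d by (simp add: dvd_trans)
  qed
qed (use prod_primes_dvd assms in auto)

text \<open>An admissible S contains the set V of primes that do not divide A, and beyond V only
  primes dividing both numbers, where the choice is free.\<close>

lemma card_sign_patterns:
  fixes P :: "int set" and A B :: int
  assumes P: "finite P" "\<And>l. l \<in> P \<Longrightarrow> prime l" and AB: "\<And>l. l \<in> P \<Longrightarrow> l dvd A \<or> l dvd B"
  shows "card {S \<in> Pow P. \<Prod>(P - S) dvd A \<and> \<Prod>S dvd B} = 2 ^ card {l \<in> P. l dvd A \<and> l dvd B}"
proof -
  define U where "U = {l \<in> P. l dvd A \<and> l dvd B}"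
  define V where "V = {l \<in> P. \<not> l dvd A}"
  have "\<Prod>(P - S) dvd A \<and> \<Prod>S dvd B \<longleftrightarrow> (\<forall>l\<in>P - S. l dvd A) \<and> (\<forall>l\<in>S. l dvd B)" if "S \<subseteq> P" for S
    using prod_primes_dvd_iff[of "P - S" A] prod_primes_dvd_iff[of S B] P that finite_subset[OF that] by auto
  then have "{S \<in> Pow P. \<Prod>(P - S) dvd A \<and> \<Prod>S dvd B} = {S \<in> Pow P. (\<forall>l\<in>P - S. l dvd A) \<and> (\<forall>l\<in>S. l dvd B)}" by auto
  also have "\<dots> = (\<lambda>W. V \<union> W) ` Pow U"
  proof
    show "{S \<in> Pow P. (\<forall>l\<in>P - S. l dvd A) \<and> (\<forall>l\<in>S. l dvd B)} \<subseteq> (\<lambda>W. V \<union> W) ` Pow U"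
    proof
      fix S assume S: "S \<in> {S \<in> Pow P. (\<forall>l\<in>P - S. l dvd A) \<and> (\<forall>l\<in>S. l dvd B)}"
      then have "S = V \<union> (S \<inter> U)" unfolding U_def V_def by blast
      then show "S \<in> (\<lambda>W. V \<union> W) ` Pow U" by blast
    qed
    show "(\<lambda>W. V \<union> W) ` Pow U \<subseteq> {S \<in> Pow P. (\<forall>l\<in>P - S. l dvd A) \<and> (\<forall>l\<in>S. l dvd B)}"
      using AB unfolding U_def V_def by blast
  qed
  also have "card \<dots> = card (Pow U)"
  proof (rule card_image, rule inj_onI)
    have VU: "V \<inter> U = {}" unfolding U_def V_def by blast
    fix W W' assume "W \<in> Pow U" "W' \<in> Pow U" "V \<union> W = V \<union> W'"
    then show "W = W'" using VU by blast
  qed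
  also have "\<dots> = 2 ^ card U" using P(1) by (intro card_Pow) (simp add: U_def)
  finally show ?thesis unfolding U_def .
qed

context quat_order begin

abbreviation "PF \<equiv> prime_factors E"

lemma PF: "finite PF" "l \<in> PF \<Longrightarrow> prime l" "l \<in> PF \<Longrightarrow> l dvd E" "l \<in> PF \<Longrightarrow> l dvd D"
  using dvd_D(2) dvd_trans by (auto simp: in_prime_factors_iff)

lemma PF_prod: assumes "S \<subseteq> PF" shows "\<Prod>S > 0" "E = \<Prod>(PF - S) * \<Prod>S"
proof -
  show "\<Prod>S > 0" using assms PF(2) by (intro prod_pos) (meson prime_gt_0_int subsetD)
  have "\<Prod>PF = E" using squarefree_prod_prime_factors[of E] dvd_D_sqf[OF dvd_D(2)] E_pos by simp
  then show "E = \<Prod>(PF - S) * \<Prod>S" using prod.subset_diff[OF assms PF(1), of id] by simp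
qed

context
  fixes a b :: "complex set" and na nb :: int
  assumes ab: "fr a" "a \<subseteq> OK" "fnorm a = of_int na" "coprime na E"
      "fr b" "b \<subseteq> OK" "fnorm b = of_int nb" "coprime nb E"
begin

text \<open>The ideals \<open>I1\<close> and \<open>J1\<close> do not depend on the splitting E = e
  d, so their properties are drawn from the trivial splitting; \<open>ctxS\<close> gives the
  splitting that belongs to a set of primes.\<close>

lemma ctx: "E = E * 1" "(1::int) > 0" "E > 0" using E_pos by auto

lemma ctxS: assumes "S \<subseteq> PF" shows "E = \<Prod>(PF - S) * \<Prod>S" "\<Prod>S > 0" "\<Prod>(PF - S) > 0"
  using PF_prod[OF assms] PF_prod(1)[of "PF - S"] by auto

abbreviation "Ia \<equiv> I1 a b"
abbreviation "Ja \<equiv> J1 a b"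

lemma IJ: "fr Ia" "fr Ja" "Ia \<subseteq> OK" "Ja \<subseteq> OK"
  using frs2(3,4)[OF ab ctx] subs2(3,4)[OF ab ctx] by auto

definition NN :: int where "NN = na * nb * nb"

lemma NN: "NN > 0" "coprime NN E" unfolding NN_def using nab[OF ab ctx] ab by auto

lemma fnIJ: "fnorm Ia = of_int (p * NN)" "fnorm Ja = of_int (int q * NN)"
  using fnorm_I1[OF ab ctx] fnorm_J1[OF ab ctx] unfolding NN_def by auto

text \<open>Twice the m-th coefficient of the theta series for the ramified ideal whose norm is the
  product of S.\<close>

definition cnt :: "int set \<Rightarrow> nat \<Rightarrow> nat" where
  "cnt S m = card {w \<in> Mset Ia Ja (\<Prod>(PF - S)) (\<Prod>S). reduced_norm q w = real m * of_int NN}"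

definition r1 :: "nat \<Rightarrow> nat" where "r1 n = card {y \<in> Ja. (cmod y)\<^sup>2 = real n * fnorm Ja}"
definition r2 :: "nat \<Rightarrow> nat" where "r2 k = card {x \<in> Ia. (cmod x)\<^sup>2 = real k * fnorm Ia}"

lemma norm_nat: assumes "fr I" "x \<in> I" obtains n :: nat where "(cmod x)\<^sup>2 = real n * fnorm I"
proof -
  have "of_int (fq I x) = (cmod x)\<^sup>2 / fnorm I" by (rule fq_eq[OF assms])
  moreover have "(cmod x)\<^sup>2 / fnorm I \<ge> 0" using fnorm(1)[OF assms(1)] by simp
  ultimately have "(cmod x)\<^sup>2 / fnorm I = real (nat (fq I x))" by simp
  then have "(cmod x)\<^sup>2 = real (nat (fq I x)) * fnorm I" using fnorm(1)[OF assms(1)] by (simp add: field_simps)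
  then show ?thesis using that by blast
qed

text \<open>The reduced norm of the pair is \<open>NN\<close> (k + p n) / E.\<close>

lemma norm_eq_iff:
  assumes x: "(cmod x)\<^sup>2 = real k * fnorm Ia" and y: "(cmod y)\<^sup>2 = real n * fnorm Ja"
  shows "reduced_norm q (pr x y) = real m * of_int NN \<longleftrightarrow> int k + p * int n = E * int m"
proof -
  have "reduced_norm q (pr x y) = of_int (p * NN * (int k + p * int n)) / of_int (p * E)"
    unfolding reduced_norm_pr x y fnIJ using q_pos D_pE by (simp add: power2_eq_square algebra_simps)
  also have "\<dots> = of_int NN * of_int (int k + p * int n) / of_int E" using p_pos by simp
  finally have "reduced_norm q (pr x y) = real m * of_int NN \<longleftrightarrow> of_int NN * of_int (int k + p * int n) / of_int E = of_int (int m) * real_of_int NN"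
    by simp
  also have "\<dots> \<longleftrightarrow> of_int NN * of_int (int k + p * int n) = real_of_int NN * of_int (E * int m)"
    using E_pos by (simp add: field_simps)
  also have "\<dots> \<longleftrightarrow> int k + p * int n = E * int m" using NN(1) by (simp only: mult_cancel_left of_int_eq_iff) simp
  finally show ?thesis .
qed

text \<open>The equation k + p n = E m makes T(x)^2 - p^2 T(y)^2 divisible by every l | E, so l
  divides one of the factors. It divides both exactly when it divides T(y), hence N(y), hence n, as
  l is prime to q and \<open>NN\<close>; then l | T(x) follows from k = E m - p n.\<close>

lemma sign_patterns:
  assumes xy: "x \<in> Ia" "y \<in> Ja" and n: "(cmod y)\<^sup>2 = real n * fnorm Ja" and m: "reduced_norm q (pr x y) = real m * of_int NN"
  shows "card {S \<in> Pow PF. \<Prod>(PF - S) dvd T x - p * T y \<and> \<Prod>S dvd T x + p * T y} = 2 ^ card {l \<in> PF. l dvd int n}"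
proof -
  obtain k where k: "(cmod x)\<^sup>2 = real k * fnorm Ia" using norm_nat[OF IJ(1) xy(1)] .
  have kn: "int k + p * int n = E * int m" by (rule iffD1[OF norm_eq_iff[OF k n] m])
  have O: "x \<in> OK" "y \<in> OK" using xy IJ by auto
  have "real_of_int (nn x) = of_int (int k * (p * NN))" using of_int_nn[OF O(1)] k fnIJ by simp
  then have nx: "nn x = int k * (p * NN)" by (simp only: of_int_eq_iff)
  have "real_of_int (nn y) = of_int (int n * (int q * NN))" using of_int_nn[OF O(2)] n fnIJ by simp
  then have ny: "nn y = int n * (int q * NN)" by (simp only: of_int_eq_iff)
  have nd: "\<not> l dvd z" if "l \<in> PF" "coprime z E" for l z
  proof
    assume "l dvd z"
    then have "l dvd 1" using that PF(3) by (meson coprime_common_divisor)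
    then show False using PF(2)[OF that(1)] by (simp add: not_prime_unit)
  qed
  have nds: "\<not> l dvd 2" "\<not> l dvd p" "\<not> l dvd int q" "\<not> l dvd NN" if "l \<in> PF" for l
    using nd[OF that] coprimes p_E NN(2) by (auto simp: coprime_commute)
  have pl: "prime l" "l dvd D" "l dvd E" if "l \<in> PF" for l using PF that by auto
  have Ty: "l dvd T y \<longleftrightarrow> l dvd int n" if l: "l \<in> PF" for l
    using nn_dvd_iff[OF pl(2)[OF l] O(2)] nds[OF l] pl(1)[OF l] unfolding ny by (simp add: prime_dvd_mult_iff)
  have Tx: "l dvd T x \<longleftrightarrow> l dvd int k" if l: "l \<in> PF" for l
    using nn_dvd_iff[OF pl(2)[OF l] O(1)] nds[OF l] pl(1)[OF l] unfolding nx by (simp add: prime_dvd_mult_iff)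
  have kn2: "l dvd int k" if l: "l \<in> PF" "l dvd int n" for l
  proof -
    have "int k = E * int m - p * int n" using kn by simp
    then show ?thesis using pl(3)[OF l(1)] l(2) by simp
  qed
  have AB: "l dvd T x - p * T y \<or> l dvd T x + p * T y" if l: "l \<in> PF" for l
  proof -
    have c: "l dvd 4 * nn x - T x * T x" "l dvd 4 * nn y - T y * T y" "l dvd int q + 1"
      using nn_cong[OF O(1)] nn_cong[OF O(2)] pl[OF l] q_E dvd_trans by (auto simp: cong_iff_dvd_diff)
    have "(T x - p * T y) * (T x + p * T y) = 4 * p * NN * (int k + p * int n) - (4 * nn x - T x * T x)
        + p * p * (4 * nn y - T y * T y) - (int q + 1) * (4 * p * p * int n * NN)"
      unfolding nx ny by (simp add: algebra_simps)
    also have "l dvd \<dots>" unfolding kn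
      by (rule dvd_diff[OF dvd_add[OF dvd_diff[OF dvd_mult[OF dvd_mult2[OF pl(3)[OF l]]] c(1)] dvd_mult[OF c(2)]] dvd_mult2[OF c(3)]])
    finally show ?thesis using pl(1)[OF l] by (simp add: prime_dvd_mult_iff)
  qed
  have both: "l dvd T x - p * T y \<and> l dvd T x + p * T y \<longleftrightarrow> l dvd int n" if l: "l \<in> PF" for l
  proof
    assume h: "l dvd T x - p * T y \<and> l dvd T x + p * T y"
    have "l dvd (T x + p * T y) - (T x - p * T y)" by (rule dvd_diff[OF conjunct2[OF h] conjunct1[OF h]])
    then have "l dvd 2 * (p * T y)" by (simp add: algebra_simps)
    then have "l dvd T y" using nds[OF l] pl(1)[OF l] by (simp add: prime_dvd_mult_iff)
    then show "l dvd int n" using Ty[OF l] by simp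
  next
    assume ln: "l dvd int n"
    then have "l dvd T x" "l dvd T y" using Tx[OF l] Ty[OF l] kn2[OF l] by auto
    then show "l dvd T x - p * T y \<and> l dvd T x + p * T y" by simp
  qed
  have "{l \<in> PF. l dvd T x - p * T y \<and> l dvd T x + p * T y} = {l \<in> PF. l dvd int n}" using both by blast
  then show ?thesis using card_sign_patterns[OF PF(1,2) AB] by simp
qed

text \<open>Double counting of pairs (x, y) against sets S. Once the congruences are summed away, x
  and y are independent for a given n, and the count becomes a product.\<close>

lemma sum_cnt:
  "(\<Sum>S\<in>Pow PF. real (cnt S m)) =
   (\<Sum>n | p * int n \<le> E * int m. 2 ^ card {l \<in> PF. l dvd int n} * (real (r2 (nat (E * int m - p * int n))) * real (r1 n)))"
proof -
  define W where "W = {(x, y). x \<in> Ia \<and> y \<in> Ja \<and> reduced_norm q (pr x y) = real m * of_int NN}"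
  define co where "co = (\<lambda>S (x, y). \<Prod>(PF - S) dvd T x - p * T y \<and> \<Prod>S dvd T x + p * T y)"
  have finW: "finite W"
  proof -
    have "(\<lambda>(x, y). pr x y) ` W \<subseteq> {pr x y | x y. x \<in> Ia \<and> y \<in> Ja \<and> reduced_norm q (pr x y) \<le> real m * of_int NN}"
    proof
      fix w assume "w \<in> (\<lambda>(x, y). pr x y) ` W"
      then obtain x y where w: "w = pr x y" "(x, y) \<in> W" by force
      show "w \<in> {pr x y | x y. x \<in> Ia \<and> y \<in> Ja \<and> reduced_norm q (pr x y) \<le> real m * of_int NN}"
        using w unfolding W_def by (intro CollectI exI[of _ x] exI[of _ y]) simp
    qed
    then have "finite ((\<lambda>(x, y). pr x y) ` W)" using finite_bounded_reduced_norm[OF IJ(1,2)] finite_subset by blast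
    moreover have "inj_on (\<lambda>(x, y). pr x y) W" by (intro inj_onI) (auto simp: pr_inj)
    ultimately show ?thesis by (rule finite_imageD)
  qed
  have cnt: "cnt S m = card {w \<in> W. co S w}" for S
  proof -
    have "{w \<in> Mset Ia Ja (\<Prod>(PF - S)) (\<Prod>S). reduced_norm q w = real m * of_int NN} = (\<lambda>(x, y). pr x y) ` {w \<in> W. co S w}"
    proof (rule Set.set_eqI)
      fix w
      have "w \<in> (\<lambda>(x, y). pr x y) ` {w \<in> W. co S w} \<longleftrightarrow> (\<exists>x y. w = pr x y \<and> (x, y) \<in> W \<and> co S (x, y))" by force
      then show "w \<in> {w \<in> Mset Ia Ja (\<Prod>(PF - S)) (\<Prod>S). reduced_norm q w = real m * of_int NN} \<longleftrightarrow>
        w \<in> (\<lambda>(x, y). pr x y) ` {w \<in> W. co S w}"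
        unfolding Mset_def W_def co_def by auto
    qed
    moreover have "inj_on (\<lambda>(x, y). pr x y) {w \<in> W. co S w}" by (intro inj_onI) (auto simp: pr_inj)
    ultimately show ?thesis unfolding cnt_def by (simp add: card_image)
  qed
  define nf where "nf = (\<lambda>w::complex \<times> complex. nat (fq Ja (snd w)))"
  have nf: "(cmod y)\<^sup>2 = real n * fnorm Ja \<longleftrightarrow> nf (x, y) = n" if y: "y \<in> Ja" for x y n
  proof -
    obtain k where k: "(cmod y)\<^sup>2 = real k * fnorm Ja" using norm_nat[OF IJ(2) y] .
    have f0: "fnorm Ja > 0" using fnorm(1) IJ by blast
    have "real_of_int (fq Ja y) = of_int (int k)" using fq_eq[OF IJ(2) y] k f0 by simp
    then have "nf (x, y) = k" unfolding nf_def by (simp only: of_int_eq_iff snd_conv nat_int)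
    then show ?thesis using k f0 by auto
  qed
  have "(\<Sum>S\<in>Pow PF. real (cnt S m)) = (\<Sum>S\<in>Pow PF. \<Sum>w\<in>W. if co S w then 1 else 0)"
    unfolding cnt using finW by (intro sum.cong refl) (simp add: sum.If_cases Int_def)
  also have "\<dots> = (\<Sum>w\<in>W. \<Sum>S\<in>Pow PF. if co S w then 1 else 0)" by (rule sum.swap)
  also have "\<dots> = (\<Sum>w\<in>W. real (card {S \<in> Pow PF. co S w}))"
    using PF(1) by (intro sum.cong refl) (simp add: sum.If_cases Int_def)
  also have "\<dots> = (\<Sum>w\<in>W. 2 ^ card {l \<in> PF. l dvd int (nf w)})"
  proof (rule sum.cong[OF refl])
    fix w assume w: "w \<in> W"
    obtain x y where xy: "w = (x, y)" by (cases w)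
    have m: "x \<in> Ia" "y \<in> Ja" "reduced_norm q (pr x y) = real m * of_int NN" using w unfolding xy W_def by auto
    have "(cmod y)\<^sup>2 = real (nf (x, y)) * fnorm Ja" using nf[OF m(2)] by blast
    from sign_patterns[OF m(1,2) this m(3)]
    have "card {S \<in> Pow PF. co S w} = 2 ^ card {l \<in> PF. l dvd int (nf w)}" unfolding co_def xy by simp
    then show "real (card {S \<in> Pow PF. co S w}) = 2 ^ card {l \<in> PF. l dvd int (nf w)}" by simp
  qed
  also have "\<dots> = (\<Sum>n | p * int n \<le> E * int m. \<Sum>w | w \<in> W \<and> nf w = n. 2 ^ card {l \<in> PF. l dvd int (nf w)})"
  proof (rule sum.group[symmetric])
    have "{n. p * int n \<le> E * int m} \<subseteq> {..nat (E * int m)}"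
    proof
      fix n assume "n \<in> {n. p * int n \<le> E * int m}"
      then have "1 * int n \<le> E * int m" using mult_right_mono[of 1 p "int n"] p_pos by simp
      then show "n \<in> {..nat (E * int m)}" by simp
    qed
    then show "finite {n. p * int n \<le> E * int m}" by (rule finite_subset) simp
    show "nf ` W \<subseteq> {n. p * int n \<le> E * int m}"
    proof
      fix n assume "n \<in> nf ` W"
      then obtain x y where xy: "(x, y) \<in> W" "n = nf (x, y)" by auto
      then have m: "x \<in> Ia" "y \<in> Ja" "reduced_norm q (pr x y) = real m * of_int NN" unfolding W_def by auto
      obtain k where k: "(cmod x)\<^sup>2 = real k * fnorm Ia" using norm_nat[OF IJ(1) m(1)] .
      have yn: "(cmod y)\<^sup>2 = real n * fnorm Ja" using nf[OF m(2), of n x] xy(2) by simp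
      have "int k + p * int n = E * int m" by (rule iffD1[OF norm_eq_iff[OF k yn] m(3)])
      then show "n \<in> {n. p * int n \<le> E * int m}" by simp
    qed
  qed (rule finW)
  also have "\<dots> = (\<Sum>n | p * int n \<le> E * int m. 2 ^ card {l \<in> PF. l dvd int n} * (real (r2 (nat (E * int m - p * int n))) * real (r1 n)))"
  proof (rule sum.cong[OF refl])
    fix n assume n: "n \<in> {n. p * int n \<le> E * int m}"
    have eq: "{w. w \<in> W \<and> nf w = n} = {x \<in> Ia. (cmod x)\<^sup>2 = real (nat (E * int m - p * int n)) * fnorm Ia} \<times> {y \<in> Ja. (cmod y)\<^sup>2 = real n * fnorm Ja}"
      (is "?l = ?r")
    proof (rule Set.set_eqI)
      fix w :: "complex \<times> complex"
      obtain x y where xy: "w = (x, y)" by (cases w)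
      show "w \<in> ?l \<longleftrightarrow> w \<in> ?r"
      proof (cases "x \<in> Ia \<and> y \<in> Ja \<and> nf (x, y) = n")
        case True
        then have yn: "(cmod y)\<^sup>2 = real n * fnorm Ja" using nf by blast
        obtain k where k: "(cmod x)\<^sup>2 = real k * fnorm Ia" using norm_nat[OF IJ(1)] True by blast
        have f0: "fnorm Ia > 0" using fnorm(1) IJ by blast
        have "w \<in> ?l \<longleftrightarrow> int k + p * int n = E * int m" using norm_eq_iff[OF k yn] True unfolding xy W_def by simp
        also have "\<dots> \<longleftrightarrow> k = nat (E * int m - p * int n)" using n by auto
        also have "\<dots> \<longleftrightarrow> w \<in> ?r" using True yn k f0 unfolding xy by auto
        finally show ?thesis .
      next
        case False
        then show ?thesis using nf unfolding xy W_def by auto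
      qed
    qed
    have "(\<Sum>w | w \<in> W \<and> nf w = n. (2::real) ^ card {l \<in> PF. l dvd int (nf w)}) = (\<Sum>w | w \<in> W \<and> nf w = n. 2 ^ card {l \<in> PF. l dvd int n})"
      by (rule sum.cong) auto
    also have "\<dots> = 2 ^ card {l \<in> PF. l dvd int n} * real (card {w. w \<in> W \<and> nf w = n})"
      by (simp add: mult.commute)
    also have "real (card {w. w \<in> W \<and> nf w = n}) = real (r2 (nat (E * int m - p * int n))) * real (r1 n)"
      unfolding eq r1_def r2_def by (simp add: card_cartesian_product)
    finally show "(\<Sum>w | w \<in> W \<and> nf w = n. 2 ^ card {l \<in> PF. l dvd int (nf w)}) = 2 ^ card {l \<in> PF. l dvd int n} * (real (r2 (nat (E * int m - p * int n))) * real (r1 n))" .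
  qed
  finally show ?thesis .
qed

lemma card_zero: assumes "fr I" shows "card {x \<in> I. (cmod x)\<^sup>2 = real 0 * fnorm I} = 1"
proof -
  have "{x \<in> I. (cmod x)\<^sup>2 = real 0 * fnorm I} = {0}" using md_D(2)[OF fr_md[OF assms]] by auto
  then show ?thesis by simp
qed

lemma num_ideals_eq: "num_ideals D (cls I) n = (if n = 0 then 1 / real wu else real (card (ideals_of_norm (cls I) n)))"
  unfolding num_ideals_def wu_unit_half ideals_of_norm_eq by simp

lemma cls_bb: "fr I \<Longrightarrow> cls (prd I (prd b (cj b))) = cls I"
  using cls_prd_sc_OK[of I "of_real (fnorm b)"] fnorm[OF ab(5)] fnorm_K(1)[OF ab(5)] by (simp add: prd_comm Kx_def)

text \<open>Elements of \<open>Ia\<close> of relative norm k correspond to ideals of norm k in the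
  class of \<open>dd p\<close> times the conjugate of a. Multiplying by \<open>dd p\<close> trades
  these for norm p k in the class of the conjugate of a, and conjugating leads to the class of a.
  For k = 0 the single zero vector matches the convention r_A(0) = 1 / (2 u_D).\<close>

lemma r2_eq: "real (r2 k) = real wu * num_ideals D (cls a) (nat p * k)"
proof (cases "k = 0")
  case True
  then show ?thesis unfolding r2_def using card_zero[OF IJ(1)] wu_pos by (simp add: num_ideals_eq)
next
  case False
  have fra: "fr a" "fr b" "fr (cj a)" "fr (cj b)" "fr (dd p)" using ab fr_cj dd_fr dvd_D by auto
  have frp: "fr (prd (dd p) (cj a))" using fra fr_prd by blast
  have "cls (iv Ia) = cls (cj Ia)" using cls_inv(2)[OF IJ(1)] .
  also have "cj Ia = prd (prd (dd p) (cj a)) (prd b (cj b))" unfolding I1_def[OF ab ctx] cj_prd cj_dd cj_cj by (simp only: prd_ac)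
  also have "cls \<dots> = cls (prd (dd p) (cj a))" by (rule cls_bb[OF frp])
  finally have c: "cls (iv Ia) = cls (prd (dd p) (cj a))" .
  have "card (ideals_of_norm (cls (prd (dd p) (cj a))) k) = card (ideals_of_norm (cls (prd (dd p) (prd (dd p) (cj a)))) (nat p * k))"
    using card_ideals_ramified[OF dvd_D(1) p_pos frp] by simp
  also have "\<dots> = card (ideals_of_norm (cls (cj a)) (nat p * k))" using dd_cls_square[OF dvd_D(1) p_pos fra(3)] by simp
  also have "\<dots> = card (ideals_of_norm (cls a) (nat p * k))" by (rule card_ideals_cj[OF fra(1)])
  finally show ?thesis unfolding r2_def using card_elements[OF IJ(1), of k] False p_pos c by (simp add: num_ideals_eq)
qed

lemma r1_0: "r1 0 = 1" unfolding r1_def by (rule card_zero[OF IJ(2)])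

text \<open>The class of b enters squared, which is why the sum over all b runs through a
  genus.\<close>

lemma r1_pos: assumes "n > 0" shows "r1 n = wu * card (ideals_of_norm (cls (prd (prd Q a) (prd b b))) n)"
proof -
  have "cls (iv Ja) = cls (cj Ja)" using cls_inv(2)[OF IJ(2)] .
  also have "cj Ja = prd (prd Q a) (prd b b)" unfolding J1_def[OF ab ctx] cj_prd cj_cj by (simp only: prd_ac)
  finally show ?thesis unfolding r1_def using card_elements[OF IJ(2) assms] by simp
qed

lemma phi_sums:
  assumes S: "S \<subseteq> PF" and z: "Im z > 0"
  shows "(\<lambda>m. of_nat (cnt S m) / 2 * exp (2 * of_real pi * \<i> * of_nat m * z)) sums
    phi D q (left_class D q (extend_ideal D q Ot (prd b (dd (\<Prod>S))))) (left_class D q (extend_ideal D q Ot (prd a (prd b (dd (\<Prod>S)))))) z"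
proof -
  note c = ctxS[OF S]
  have M: "Mset Ia Ja (\<Prod>(PF - S)) (\<Prod>S) \<subseteq> {pr x y | x y. x \<in> Ia \<and> y \<in> Ja}" unfolding Mset_def by auto
  have "has_norm q (Mset Ia Ja (\<Prod>(PF - S)) (\<Prod>S)) (of_int NN)" using has_norm_Mset[OF ab c] unfolding NN_def .
  then have N: "real_of_int NN > 0" "\<And>w. w \<in> Mset Ia Ja (\<Prod>(PF - S)) (\<Prod>S) \<Longrightarrow> reduced_norm q w / of_int NN \<in> \<int>"
    unfolding has_norm_def by auto
  from tsum_sums[OF IJ M N z] show ?thesis
    using phi_value[OF ab c, of z] unfolding cnt_def NN_def A0_def[OF ab c] B0_def[OF ab c] by simp
qed

end

end

text \<open>The fibres of the map sending C to h C^2 are cosets of the subgroup of elements of order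
  at most two.\<close>

lemma finite_comm_group_sum_squares:
  fixes G :: "('a, 'b) monoid_scheme" (structure) and g :: "'a \<Rightarrow> real"
  assumes "comm_group G" "finite (carrier G)" "h \<in> carrier G"
  shows "(\<Sum>C\<in>carrier G. g (h \<otimes>\<^bsub>G\<^esub> (C \<otimes>\<^bsub>G\<^esub> C))) =
    real (card {C \<in> carrier G. C \<otimes>\<^bsub>G\<^esub> C = \<one>\<^bsub>G\<^esub>}) * (\<Sum>X\<in>{h \<otimes>\<^bsub>G\<^esub> (C \<otimes>\<^bsub>G\<^esub> C) | C. C \<in> carrier G}. g X)"
proof -
  interpret comm_group G by fact
  define f where "f = (\<lambda>C. h \<otimes> (C \<otimes> C))"
  define T where "T = {C \<in> carrier G. C \<otimes> C = \<one>}"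
  have fib: "card {C \<in> carrier G. f C = X} = card T" if "X \<in> f ` carrier G" for X
  proof -
    obtain C0 where C0: "C0 \<in> carrier G" "X = f C0" using \<open>X \<in> f ` carrier G\<close> by auto
    have sq: "(C0 \<otimes> t) \<otimes> (C0 \<otimes> t) = (C0 \<otimes> C0) \<otimes> (t \<otimes> t)" if "t \<in> carrier G" for t
      using C0 that by (simp add: m_ac)
    have "bij_betw (\<lambda>t. C0 \<otimes> t) T {C \<in> carrier G. f C = X}"
    proof (rule bij_betw_imageI)
      show "inj_on (\<lambda>t. C0 \<otimes> t) T" using C0 by (intro inj_onI) (auto simp: T_def)
      show "(\<lambda>t. C0 \<otimes> t) ` T = {C \<in> carrier G. f C = X}"
      proof
        show "(\<lambda>t. C0 \<otimes> t) ` T \<subseteq> {C \<in> carrier G. f C = X}"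
          using C0 sq by (auto simp: T_def f_def)
        show "{C \<in> carrier G. f C = X} \<subseteq> (\<lambda>t. C0 \<otimes> t) ` T"
        proof
          fix C assume "C \<in> {C \<in> carrier G. f C = X}"
          then have C: "C \<in> carrier G" "f C = f C0" using C0 by auto
          define t where "t = inv C0 \<otimes> C"
          have t: "t \<in> carrier G" "C0 \<otimes> t = C" using C C0 by (simp_all add: t_def m_assoc[symmetric])
          have "C \<otimes> C = C0 \<otimes> C0" using C C0 assms(3) unfolding f_def by simp
          then have "(C0 \<otimes> C0) \<otimes> (t \<otimes> t) = C0 \<otimes> C0" using sq[OF t(1)] t(2) by simp
          then have "t \<otimes> t = \<one>" using C0(1) t(1) by (simp add: m_assoc)
          then show "C \<in> (\<lambda>t. C0 \<otimes> t) ` T" using t unfolding T_def by (intro image_eqI[of _ _ t]) auto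
        qed
      qed
    qed
    then show ?thesis by (simp add: bij_betw_same_card)
  qed
  have "(\<Sum>C\<in>carrier G. g (f C)) = (\<Sum>X\<in>f ` carrier G. \<Sum>C | C \<in> carrier G \<and> f C = X. g (f C))"
    by (rule sum.image_gen[OF assms(2)])
  also have "\<dots> = (\<Sum>X\<in>f ` carrier G. real (card T) * g X)"
  proof (rule sum.cong[OF refl])
    fix X assume X: "X \<in> f ` carrier G"
    have "(\<Sum>C | C \<in> carrier G \<and> f C = X. g (f C)) = (\<Sum>C | C \<in> carrier G \<and> f C = X. g X)"
      by (rule sum.cong) auto
    then show "(\<Sum>C | C \<in> carrier G \<and> f C = X. g (f C)) = real (card T) * g X" using fib[OF X] by simp
  qed
  also have "f ` carrier G = {h \<otimes> (C \<otimes> C) | C. C \<in> carrier G}" unfolding f_def by blast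
  finally show ?thesis unfolding f_def T_def by (simp add: sum_distrib_left)
qed

context quat_order begin

section \<open>Genera and the sum over the class group\<close>

interpretation CG: comm_group "class_group D" by (rule comm_group_classes)

lemma class_squares_subgroup: "subgroup (class_squares D) (class_group D)"
proof (rule CG.subgroupI)
  show "class_squares D \<subseteq> carrier (class_group D)" by (auto simp: class_squares_def)
  show "class_squares D \<noteq> {}" using CG.one_closed by (auto simp: class_squares_def)
  show "inv\<^bsub>class_group D\<^esub> X \<in> class_squares D" if X: "X \<in> class_squares D" for X
  proof -
    obtain C where "C \<in> carrier (class_group D)" "X = C \<otimes>\<^bsub>class_group D\<^esub> C" using X by (auto simp: class_squares_def)
    then show ?thesis unfolding class_squares_def by (auto simp: CG.inv_mult intro!: exI[of _ "inv\<^bsub>class_group D\<^esub> C"])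
  qed
  show "X \<otimes>\<^bsub>class_group D\<^esub> Y \<in> class_squares D" if XY: "X \<in> class_squares D" "Y \<in> class_squares D" for X Y
  proof -
    obtain C C' where "C \<in> carrier (class_group D)" "X = C \<otimes>\<^bsub>class_group D\<^esub> C" "C' \<in> carrier (class_group D)" "Y = C' \<otimes>\<^bsub>class_group D\<^esub> C'"
      using XY by (auto simp: class_squares_def)
    then show ?thesis unfolding class_squares_def by (auto simp: CG.m_ac intro!: exI[of _ "C \<otimes>\<^bsub>class_group D\<^esub> C'"])
  qed
qed

text \<open>For an admissible R the product with the conjugate of Q has norm r q = p^2 modulo E, a
  square prime to E, so \<open>principal_genus\<close> makes its class a square.\<close>

lemma genera_Q_eq:
  fixes pn :: nat
  assumes pn: "p = int pn" and D0: "\<bar>D_zero D pn\<bar> = E"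
  shows "genera_Q D pn = {genus D (cls Q)}"
proof -
  have mod: "[x = y] (mod D_zero D pn) \<longleftrightarrow> [x = y] (mod E)" for x y
    unfolding D0[symmetric] by (simp add: cong_iff_dvd_diff)
  have mem: "genus D (cls R) = genus D (cls Q)" if R: "nonzero_ideal D R" "[int (ideal_norm D R) = - (int pn ^ 2)] (mod D_zero D pn)" for R
  proof -
    have frR: "fr R" "R \<subseteq> OK" using R(1) nonzero_ideal_iff by auto
    define r where "r = int (ideal_norm D R)"
    have nR: "fnorm R = of_int r" unfolding r_def using ideal_norm_eq[OF R(1)] by simp
    have rp: "[r = - (p ^ 2)] (mod E)" using R(2) unfolding mod r_def pn .
    define S where "S = prd R (cj Q)"
    have S: "fr S" "S \<subseteq> OK" "fnorm S = of_int (r * int q)"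
      unfolding S_def using fr_prd[OF frR(1) cjQ(1)] prd_OK_subset[OF frR(2) cjQ(2)] fnorm_prd[OF frR(1) cjQ(1)] fnorm_cj[OF Q(1)] Q(3) nR by auto
    have "[int q = - 1] (mod E)" using q_E by (simp add: cong_iff_dvd_diff)
    then have "[r * int q = - (p ^ 2) * - 1] (mod E)" by (rule cong_mult[OF rp])
    then have sq: "[r * int q = p\<^sup>2] (mod E)" by simp
    then have "coprime (r * int q) E \<longleftrightarrow> coprime (p\<^sup>2) E" by (metis cong_imp_coprime cong_sym)
    then have cop: "coprime (r * int q) E" using p_E by simp
    obtain B where B: "fr B" "cls S = cls (prd B B)" using principal_genus[OF D_pE p_ge p_prime S cop sq] by blast
    have "cls S = cls R \<otimes>\<^bsub>class_group D\<^esub> inv\<^bsub>class_group D\<^esub> (cls Q)"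
      unfolding S_def using cls_mult[OF frR(1) cjQ(1)] cls_inv[OF Q(1)] by simp
    then have "cls R = cls S \<otimes>\<^bsub>class_group D\<^esub> cls Q"
      using CG.inv_solve_right[of "cls S" "cls R" "cls Q"] frR S Q by simp
    then have eq: "cls R = (cls B \<otimes>\<^bsub>class_group D\<^esub> cls B) \<otimes>\<^bsub>class_group D\<^esub> cls Q" using B cls_mult by simp
    have "cls B \<otimes>\<^bsub>class_group D\<^esub> cls B \<in> class_squares D" unfolding class_squares_def using B by auto
    then have "class_squares D #>\<^bsub>class_group D\<^esub> (cls B \<otimes>\<^bsub>class_group D\<^esub> cls B) = class_squares D"
      using subgroup.rcos_const[OF class_squares_subgroup CG.is_group] by blast
    moreover have "class_squares D #>\<^bsub>class_group D\<^esub> cls R =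
      (class_squares D #>\<^bsub>class_group D\<^esub> (cls B \<otimes>\<^bsub>class_group D\<^esub> cls B)) #>\<^bsub>class_group D\<^esub> cls Q"
      unfolding eq using subgroup.subset[OF class_squares_subgroup] B Q by (intro CG.coset_mult_assoc[symmetric]) auto
    ultimately show ?thesis unfolding genus_def by simp
  qed
  have "\<exists>R. nonzero_ideal D R \<and> [int (ideal_norm D R) = - (int pn ^ 2)] (mod D_zero D pn) \<and> cls R = cls Q"
  proof -
    \<comment> \<open>A witness that \<open>genera_Q\<close> is nonempty: the norm is p^2 q = -p^2
      modulo E, and the class is that of Q.\<close>
    define R where "R = sc (of_int p) Q"
    have R: "fr R" "R \<subseteq> OK" "cls R = cls Q" unfolding R_def
      using fr_scx[OF Q(1)] cls_sc[OF Q(1)] p_pos Q(2) by (auto simp: Kx_def sc_def)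
    have nz: "nonzero_ideal D R" using R nonzero_ideal_iff by auto
    have "real (ideal_norm D R) = (of_int p)\<^sup>2 * real q"
      unfolding ideal_norm_eq[OF nz] unfolding R_def using fnorm_sc[OF Q(1), of "of_int p"] p_pos Q(3) by simp
    then have "real_of_int (int (ideal_norm D R)) = of_int (p\<^sup>2 * int q)" by simp
    then have n: "int (ideal_norm D R) = p\<^sup>2 * int q" by (simp only: of_int_eq_iff)
    have "p\<^sup>2 * int q - - (p\<^sup>2) = p\<^sup>2 * (int q + 1)" by (simp add: algebra_simps)
    then have "E dvd p\<^sup>2 * int q - - (p\<^sup>2)" using q_E by simp
    then have "[p\<^sup>2 * int q = - (p\<^sup>2)] (mod E)" by (simp only: cong_iff_dvd_diff)
    then have "[int (ideal_norm D R) = - (p\<^sup>2)] (mod E)" by (simp only: n)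
    then show ?thesis using nz R(3) unfolding mod pn[symmetric] by blast
  qed
  then obtain R where R: "nonzero_ideal D R" "[int (ideal_norm D R) = - (int pn ^ 2)] (mod D_zero D pn)" by blast
  have "genera_Q D pn = {genus D (cls R) | R. nonzero_ideal D R \<and> [int (ideal_norm D R) = - (int pn ^ 2)] (mod D_zero D pn)}"
    unfolding genera_Q_def cls_def ..
  also have "\<dots> = {genus D (cls Q)}" using mem R by blast
  finally show ?thesis .
qed

lemma translated_genus:
  assumes "fr a"
  shows "cls a <#\<^bsub>class_group D\<^esub> genus D (cls Q) = {cls (prd Q a) \<otimes>\<^bsub>class_group D\<^esub> (C \<otimes>\<^bsub>class_group D\<^esub> C) | C. C \<in> carrier (class_group D)}"
proof -
  have "cls a <#\<^bsub>class_group D\<^esub> genus D (cls Q) = {cls a \<otimes>\<^bsub>class_group D\<^esub> ((C \<otimes>\<^bsub>class_group D\<^esub> C) \<otimes>\<^bsub>class_group D\<^esub> cls Q) | C. C \<in> carrier (class_group D)}"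
    unfolding l_coset_def genus_def r_coset_def class_squares_def by blast
  also have "\<dots> = {cls (prd Q a) \<otimes>\<^bsub>class_group D\<^esub> (C \<otimes>\<^bsub>class_group D\<^esub> C) | C. C \<in> carrier (class_group D)}"
  proof -
    have "cls a \<otimes>\<^bsub>class_group D\<^esub> ((C \<otimes>\<^bsub>class_group D\<^esub> C) \<otimes>\<^bsub>class_group D\<^esub> cls Q) = cls (prd Q a) \<otimes>\<^bsub>class_group D\<^esub> (C \<otimes>\<^bsub>class_group D\<^esub> C)"
      if "C \<in> carrier (class_group D)" for C
      using that assms Q cls_closed by (simp add: cls_mult[symmetric] CG.m_ac)
    then show ?thesis by (metis (mono_tags, lifting))
  qed
  finally show ?thesis .
qed

lemma num_ideals_genus_eq:
  assumes "finite G" shows "real (num_ideals_genus D G n) = (\<Sum>X\<in>G. real (card (ideals_of_norm X n)))"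
proof -
  have "{I. nonzero_ideal D I \<and> ideal_norm D I = n \<and> ideal_class D I \<in> G} = (\<Union>X\<in>G. ideals_of_norm X n)"
    unfolding ideals_of_norm_eq[symmetric] by auto
  then have "num_ideals_genus D G n = card (\<Union>X\<in>G. ideals_of_norm X n)" unfolding num_ideals_genus_def by simp
  also have "\<dots> = (\<Sum>X\<in>G. card (ideals_of_norm X n))"
    by (rule card_UN_disjoint) (use assms finite_ideals_of_norm in \<open>auto simp: ideals_of_norm_def\<close>)
  finally show ?thesis by simp
qed

lemma card_two_torsion: "card {C \<in> carrier (class_group D). C \<otimes>\<^bsub>class_group D\<^esub> C = \<one>\<^bsub>class_group D\<^esub>} = 2 ^ card PF"
  using bij_betw_same_card[OF two_torsion_classes[OF D_pE p_ge p_prime]] PF(1) by (simp add: card_Pow)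

lemma delta_eq:
  assumes "\<bar>D_zero D pn\<bar> = E" shows "delta D pn n = 2 ^ card {l \<in> PF. l dvd int n}"
proof -
  have "gcd (int n) (D_zero D pn) = gcd (int n) E" unfolding assms[symmetric] by simp
  moreover have "prime_factors (gcd (int n) E) = {l \<in> PF. l dvd int n}"
    using E_pos by (auto simp: in_prime_factors_iff)
  ultimately show ?thesis unfolding delta_def by simp
qed

text \<open>The factor 2^t has two sources. For n = 0 every prime of E divides n, so it comes from
  the sign patterns, while each of the h classes contributes the single vector y = 0. For n > 0 the
  sign patterns give delta(n), and 2^t is the number of classes of order at most two.\<close>

lemma coefficient_identity:
  fixes pn :: nat and bb :: "complex set set \<Rightarrow> complex set" and nb :: "complex set set \<Rightarrow> int"
  assumes pn: "p = int pn" and D0: "\<bar>D_zero D pn\<bar> = E" and pr: "prime pn" "pn > 2"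
    and a: "fr a" "a \<subseteq> OK" "fnorm a = of_int na" "coprime na E"
    and b: "\<And>C. C \<in> carrier (class_group D) \<Longrightarrow> fr (bb C) \<and> bb C \<subseteq> OK \<and> fnorm (bb C) = of_int (nb C) \<and> coprime (nb C) E \<and> cls (bb C) = C"
  shows "(\<Sum>C\<in>carrier (class_group D). \<Sum>S\<in>Pow PF. real (cnt a (bb C) na (nb C) S m)) =
    2 ^ card PF * (real wu)\<^sup>2 * b_coeff D pn (cls a) m"
proof -
  let ?CG = "carrier (class_group D)"
  let ?N = "{n. p * int n \<le> E * int m}"
  let ?d = "\<lambda>n. (2::real) ^ card {l \<in> PF. l dvd int n}"
  define R where "R = (\<lambda>k. num_ideals D (cls a) k)"
  define G where "G = cls a <#\<^bsub>class_group D\<^esub> genus D (cls Q)"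
  have finN: "finite ?N"
  proof -
    have "?N \<subseteq> {..nat (E * int m)}"
    proof
      fix n assume "n \<in> ?N"
      then have "1 * int n \<le> E * int m" using mult_right_mono[of 1 p "int n"] p_pos by simp
      then show "n \<in> {..nat (E * int m)}" by simp
    qed
    then show ?thesis by (rule finite_subset) simp
  qed
  have Ggen: "G = {cls (prd Q a) \<otimes>\<^bsub>class_group D\<^esub> (C \<otimes>\<^bsub>class_group D\<^esub> C) | C. C \<in> ?CG}"
    unfolding G_def by (rule translated_genus[OF a(1)])
  have finG: "finite G" unfolding Ggen using finite_classes by simp
  have hC: "cls (prd Q a) \<in> ?CG" using fr_prd[OF Q(1) a(1)] by simp
  \<comment> \<open>The factor p from \<open>r2_eq\<close> turns E m - p n into the argument m |D| -
    p^2 n of r_A.\<close>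
  have arg: "nat p * nat (E * int m - p * int n) = m * nat \<bar>D\<bar> - pn ^ 2 * n" if "n \<in> ?N" for n
  proof -
    have "p * (p * int n) \<le> p * (E * int m)" using that p_pos by (intro mult_left_mono) auto
    then have le: "int (pn ^ 2 * n) \<le> int (m * nat \<bar>D\<bar>)" using D_pE p_pos E_pos pn by (simp add: power2_eq_square mult_ac)
    have "int (nat p * nat (E * int m - p * int n)) = p * (E * int m) - p * (p * int n)"
      using that p_pos by (simp add: algebra_simps)
    also have "\<dots> = int (m * nat \<bar>D\<bar>) - int (pn ^ 2 * n)" using D_pE p_pos E_pos pn by (simp add: power2_eq_square mult_ac)
    also have "\<dots> = int (m * nat \<bar>D\<bar> - pn ^ 2 * n)" using le by (simp only: of_nat_diff of_nat_le_iff)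
    finally show ?thesis by (simp only: of_nat_eq_iff)
  qed
  have inner: "(\<Sum>S\<in>Pow PF. real (cnt a (bb C) na (nb C) S m)) =
    (\<Sum>n\<in>?N. ?d n * (real wu * R (m * nat \<bar>D\<bar> - pn ^ 2 * n)) * real (r1 a (bb C) n))" if C: "C \<in> ?CG" for C
  proof -
    note b' = b[OF C, THEN conjunct1] b[OF C, THEN conjunct2, THEN conjunct1] b[OF C, THEN conjunct2, THEN conjunct2, THEN conjunct1]
      b[OF C, THEN conjunct2, THEN conjunct2, THEN conjunct2, THEN conjunct1]
    show ?thesis unfolding sum_cnt[OF a b'] R_def
      by (rule sum.cong[OF refl]) (simp only: r2_eq[OF a b'] arg mult.assoc)
  qed
  have r1s: "(\<Sum>C\<in>?CG. real (r1 a (bb C) n)) = real wu * (2 ^ card PF * real (num_ideals_genus D G n))" if n: "n > 0" for n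
  proof -
    have "real (r1 a (bb C) n) = real wu * real (card (ideals_of_norm (cls (prd Q a) \<otimes>\<^bsub>class_group D\<^esub> (C \<otimes>\<^bsub>class_group D\<^esub> C)) n))" if C: "C \<in> ?CG" for C
    proof -
      note b' = b[OF C, THEN conjunct1] b[OF C, THEN conjunct2, THEN conjunct1] b[OF C, THEN conjunct2, THEN conjunct2, THEN conjunct1]
        b[OF C, THEN conjunct2, THEN conjunct2, THEN conjunct2, THEN conjunct1]
      have "cls (prd (prd Q a) (prd (bb C) (bb C))) = cls (prd Q a) \<otimes>\<^bsub>class_group D\<^esub> (C \<otimes>\<^bsub>class_group D\<^esub> C)"
        using b[OF C] fr_prd Q(1) a(1) by (simp add: cls_mult[symmetric])
      then show ?thesis unfolding r1_pos[OF a b' n] by simp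
    qed
    then have "(\<Sum>C\<in>?CG. real (r1 a (bb C) n)) = real wu * (\<Sum>C\<in>?CG. real (card (ideals_of_norm (cls (prd Q a) \<otimes>\<^bsub>class_group D\<^esub> (C \<otimes>\<^bsub>class_group D\<^esub> C)) n)))"
      by (simp add: sum_distrib_left)
    also have "(\<Sum>C\<in>?CG. real (card (ideals_of_norm (cls (prd Q a) \<otimes>\<^bsub>class_group D\<^esub> (C \<otimes>\<^bsub>class_group D\<^esub> C)) n))) = 2 ^ card PF * real (num_ideals_genus D G n)"
      unfolding finite_comm_group_sum_squares[OF comm_group_classes finite_classes hC, of "\<lambda>X. real (card (ideals_of_norm X n))"]
        card_two_torsion num_ideals_genus_eq[OF finG] unfolding Ggen by simp
    finally show ?thesis .
  qed
  have r10: "(\<Sum>C\<in>?CG. real (r1 a (bb C) 0)) = real (class_number D)"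
  proof -
    have "real (r1 a (bb C) 0) = 1" if C: "C \<in> ?CG" for C
    proof -
      note b' = b[OF C, THEN conjunct1] b[OF C, THEN conjunct2, THEN conjunct1] b[OF C, THEN conjunct2, THEN conjunct2, THEN conjunct1]
        b[OF C, THEN conjunct2, THEN conjunct2, THEN conjunct2, THEN conjunct1]
      show ?thesis using r1_0[OF a b'] by simp
    qed
    then show ?thesis by (simp add: class_number_def Coset.order_def)
  qed
  \<comment> \<open>For m > 0 this is the invariance under multiplication by sqrt D; for m = 0 both
    arguments are 0.\<close>
  have R0: "R (m * nat \<bar>D\<bar> - pn ^ 2 * 0) = R m"
  proof (cases "m = 0")
    case False
    have "nat \<bar>D\<bar> = nat (- D)" using D_neg by simp
    then show ?thesis using card_ideals_times_D[OF a(1), of m] False D_neg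
      unfolding R_def num_ideals_def ideals_of_norm_eq[symmetric] cls_def[symmetric] by (simp add: mult.commute)
  qed simp
  have N0: "0 \<in> ?N" using E_pos by simp
  have Npos: "?N - {0} = {n. 1 \<le> n \<and> real n \<le> real_of_int \<bar>D\<bar> * real m / real pn ^ 2}"
  proof -
    have "p * int n \<le> E * int m \<longleftrightarrow> real n \<le> real_of_int \<bar>D\<bar> * real m / real pn ^ 2" for n
    proof -
      have "p * int n \<le> E * int m \<longleftrightarrow> p * (p * int n) \<le> p * (E * int m)" using p_pos by simp
      also have "\<dots> \<longleftrightarrow> real_of_int (p * (p * int n)) \<le> of_int (p * (E * int m))" by (simp only: of_int_le_iff)
      also have "real_of_int (p * (p * int n)) = real n * real pn ^ 2" using pn by (simp add: power2_eq_square)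
      also have "real_of_int (p * (E * int m)) = real_of_int \<bar>D\<bar> * real m" using D_pE p_pos E_pos by (simp add: abs_mult)
      also have "real n * real pn ^ 2 \<le> real_of_int \<bar>D\<bar> * real m \<longleftrightarrow> real n \<le> real_of_int \<bar>D\<bar> * real m / real pn ^ 2"
        using pr(2) by (simp add: pos_le_divide_eq)
      finally show ?thesis .
    qed
    then show ?thesis by auto
  qed
  have "(\<Sum>C\<in>?CG. \<Sum>S\<in>Pow PF. real (cnt a (bb C) na (nb C) S m)) =
    (\<Sum>C\<in>?CG. \<Sum>n\<in>?N. ?d n * (real wu * R (m * nat \<bar>D\<bar> - pn ^ 2 * n)) * real (r1 a (bb C) n))"
    by (rule sum.cong[OF refl]) (rule inner)
  also have "\<dots> = (\<Sum>n\<in>?N. ?d n * (real wu * R (m * nat \<bar>D\<bar> - pn ^ 2 * n)) * (\<Sum>C\<in>?CG. real (r1 a (bb C) n)))"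
    by (subst sum.swap) (simp add: sum_distrib_left)
  also have "\<dots> = ?d 0 * (real wu * R m) * real (class_number D)
     + (\<Sum>n\<in>?N - {0}. ?d n * (real wu * R (m * nat \<bar>D\<bar> - pn ^ 2 * n)) * (\<Sum>C\<in>?CG. real (r1 a (bb C) n)))"
    unfolding sum.remove[OF finN N0] r10 R0 by simp
  also have "(\<Sum>n\<in>?N - {0}. ?d n * (real wu * R (m * nat \<bar>D\<bar> - pn ^ 2 * n)) * (\<Sum>C\<in>?CG. real (r1 a (bb C) n)))
    = 2 ^ card PF * (real wu)\<^sup>2 * (\<Sum>n\<in>?N - {0}. real (delta D pn n) * R (m * nat \<bar>D\<bar> - pn ^ 2 * n) * real (num_ideals_genus D G n))"
    unfolding sum_distrib_left[of "2 ^ card PF * (real wu)\<^sup>2"]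
  proof (rule sum.cong[OF refl])
    fix n assume "n \<in> ?N - {0}"
    then have n: "n > 0" by simp
    show "?d n * (real wu * R (m * nat \<bar>D\<bar> - pn ^ 2 * n)) * (\<Sum>C\<in>?CG. real (r1 a (bb C) n)) =
      2 ^ card PF * (real wu)\<^sup>2 * (real (delta D pn n) * R (m * nat \<bar>D\<bar> - pn ^ 2 * n) * real (num_ideals_genus D G n))"
      unfolding r1s[OF n] using n by (simp add: delta_eq[OF D0] power2_eq_square)
  qed
  finally have lhs: "(\<Sum>C\<in>?CG. \<Sum>S\<in>Pow PF. real (cnt a (bb C) na (nb C) S m)) =
    2 ^ card PF * real wu * R m * real (class_number D) +
    2 ^ card PF * (real wu)\<^sup>2 * (\<Sum>n\<in>?N - {0}. real (delta D pn n) * R (m * nat \<bar>D\<bar> - pn ^ 2 * n) * real (num_ideals_genus D G n))"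
    by simp
  \<comment> \<open>As p divides D, the local factor of the symbol at p vanishes.\<close>
  have kron: "kronecker D (pn ^ 2 * nat (gcd (int pn ^ 2) D)) = 0"
  proof -
    have "int pn dvd gcd (int pn ^ 2) D" using dvd_D(1) pn by simp
    then have "int pn dvd int (nat (gcd (int pn ^ 2) D))" by simp
    then have "pn dvd nat (gcd (int pn ^ 2) D)" by (simp only: int_dvd_int_iff)
    have "gcd (int pn ^ 2) D > 0" using D_neg unfolding gcd_pos_int by simp
    then have "nat (gcd (int pn ^ 2) D) > 0" by (simp only: zero_less_nat_eq)
    then have "pn ^ 2 * nat (gcd (int pn ^ 2) D) > 0" using pr(2) by (intro mult_pos_pos zero_less_power) auto
    then have "pn ^ 2 * nat (gcd (int pn ^ 2) D) \<noteq> 0" by (simp only: neq0_conv)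
    with \<open>pn dvd _\<close> have "pn \<in># prime_factorization (pn ^ 2 * nat (gcd (int pn ^ 2) D))"
      using pr(1) by (simp add: in_prime_factors_iff)
    moreover have "kronecker_prime D pn = 0" unfolding kronecker_prime_def Legendre_def
      using pr(2) dvd_D(1) pn by (simp add: cong_0_iff)
    ultimately show ?thesis unfolding kronecker_def by (auto simp: prod_mset_zero_iff image_iff)
  qed
  have "b_coeff D pn (cls a) m = real (class_number D) / real wu * R m
    + (\<Sum>n\<in>?N - {0}. real (delta D pn n) * R (m * nat \<bar>D\<bar> - pn ^ 2 * n) * real (num_ideals_genus D G n))"
    unfolding b_coeff_def Let_def kron genera_Q_eq[OF pn D0] Npos R_def G_def wu_unit_half by simp
  then have b: "b_coeff D pn (cls a) m = real (class_number D) / real wu * R m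
    + (\<Sum>n\<in>?N - {0}. real (delta D pn n) * R (m * nat \<bar>D\<bar> - pn ^ 2 * n) * real (num_ideals_genus D G n))" (is "_ = _ + ?s") .
  have "w * R m * h + w\<^sup>2 * s = w\<^sup>2 * (h / w * R m + s)" if "w > 0" for w h s :: real
    using that by (simp add: field_simps power2_eq_square)
  from this[of "real wu" "real (class_number D)" ?s]
  show ?thesis unfolding lhs b using wu_pos by (simp only: of_nat_0_less_iff mult.assoc distrib_left[symmetric] simp_thms)
qed

text \<open>Representatives are exchanged for ideals of norm prime to E, which leaves the left
  classes unchanged. For each set S of primes, translation by its ramified ideal permutes the
  classes, so summing over all S multiplies the sum of the phi by 2^t; this cancels the 2^t of
  \<open>coefficient_identity\<close>.\<close>

theorem theta_identity:
  fixes pn :: nat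
  assumes pn: "p = int pn" and D0: "\<bar>D_zero D pn\<bar> = E" and pr: "prime pn" "pn > 2"
    and a: "fr a" and rep: "\<And>C. C \<in> carrier (class_group D) \<Longrightarrow> fr (rep C) \<and> cls (rep C) = C"
    and z: "Im z > 0"
  shows "g_series D pn (cls a) z = 1 / (2 * of_real (unit_half D) ^ 2) *
      (\<Sum>C\<in>carrier (class_group D).
         phi D q (left_class D q (extend_ideal D q Ot (rep C))) (left_class D q (extend_ideal D q Ot (prd a (rep C)))) z)"
proof -
  let ?CG = "carrier (class_group D)"
  define F where "F = (\<lambda>C. phi D q (left_class D q (extend_ideal D q Ot (rep C))) (left_class D q (extend_ideal D q Ot (prd a (rep C)))) z)"
  have E0: "E \<noteq> 0" using E_pos by simp
  obtain a0 na where a0: "fr a0" "a0 \<subseteq> OK" "cls a0 = cls a" "fnorm a0 = of_int na" "coprime na E"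
    using coprime_rep[OF a E0] by metis
  have "\<exists>B n. fr B \<and> B \<subseteq> OK \<and> fnorm B = of_int n \<and> coprime n E \<and> cls B = C" if "C \<in> ?CG" for C
    using coprime_rep[of "rep C" E] rep[OF that] E0 by metis
  then obtain bb nb where b: "\<And>C. C \<in> ?CG \<Longrightarrow> fr (bb C) \<and> bb C \<subseteq> OK \<and> fnorm (bb C) = of_int (nb C) \<and> coprime (nb C) E \<and> cls (bb C) = C"
    by metis
  \<comment> \<open>A change of the representatives of either class multiplies both ideals by
    scalars only.\<close>
  have F_eq: "F (cls B) = phi D q (left_class D q (extend_ideal D q Ot B)) (left_class D q (extend_ideal D q Ot (prd a0 B))) z" if B: "fr B" for B
  proof -
    have rB: "fr (rep (cls B))" "cls (rep (cls B)) = cls B" using rep[of "cls B"] B by auto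
    obtain k where k: "k \<in> Kx" "B = sc k (rep (cls B))" using cls_eq_iff[OF rB(1) B] rB(2) by auto
    obtain l where l: "l \<in> Kx" "a0 = sc l a" using cls_eq_iff[OF a a0(1)] a0(3) by auto
    have "prd a0 B = sc (k * l) (prd a (rep (cls B)))"
      by (subst k(2), subst l(2)) (simp only: prd_sc_right sc_sc flip: sc_prd)
    then have "left_class D q (extend_ideal D q Ot (prd a0 B)) = left_class D q (extend_ideal D q Ot (prd a (rep (cls B))))"
      using left_class_extend_sc[OF Kx_mult[OF k(1) l(1)]] by simp
    moreover have "left_class D q (extend_ideal D q Ot B) = left_class D q (extend_ideal D q Ot (rep (cls B)))"
      using left_class_extend_sc[OF k(1), of Ot "rep (cls B)"] k(2) by simp
    ultimately show ?thesis unfolding F_def by simp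
  qed
  have ddS: "fr (dd (\<Prod>S))" if "S \<in> Pow PF" for S
    using that PF_prod(2)[of S] dvd_D(2) by (intro dd_fr) (metis PowD dvd_trans dvd_triv_right)
  have shift: "(\<Sum>C\<in>?CG. F (C \<otimes>\<^bsub>class_group D\<^esub> cls (dd (\<Prod>S)))) = (\<Sum>C\<in>?CG. F C)" if S: "S \<in> Pow PF" for S
  proof -
    have t: "cls (dd (\<Prod>S)) \<in> ?CG" using ddS[OF S] by simp
    have "bij_betw (\<lambda>C. C \<otimes>\<^bsub>class_group D\<^esub> cls (dd (\<Prod>S))) ?CG ?CG"
      using t by (intro bij_betw_byWitness[where f' = "\<lambda>C. C \<otimes>\<^bsub>class_group D\<^esub> inv\<^bsub>class_group D\<^esub> (cls (dd (\<Prod>S)))"])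
        (auto simp: CG.m_assoc)
    then show ?thesis by (rule sum.reindex_bij_betw)
  qed
  have Fsums: "(\<lambda>m. of_nat (cnt a0 (bb C) na (nb C) S m) / 2 * exp (2 * of_real pi * \<i> * of_nat m * z)) sums
    F (C \<otimes>\<^bsub>class_group D\<^esub> cls (dd (\<Prod>S)))" if C: "C \<in> ?CG" and S: "S \<in> Pow PF" for C S
  proof -
    note b' = b[OF C, THEN conjunct1] b[OF C, THEN conjunct2, THEN conjunct1] b[OF C, THEN conjunct2, THEN conjunct2, THEN conjunct1]
      b[OF C, THEN conjunct2, THEN conjunct2, THEN conjunct2, THEN conjunct1]
    have "C \<otimes>\<^bsub>class_group D\<^esub> cls (dd (\<Prod>S)) = cls (prd (bb C) (dd (\<Prod>S)))"
      using cls_mult[OF b'(1) ddS[OF S]] b[OF C] by simp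
    then have "F (C \<otimes>\<^bsub>class_group D\<^esub> cls (dd (\<Prod>S))) =
      phi D q (left_class D q (extend_ideal D q Ot (prd (bb C) (dd (\<Prod>S))))) (left_class D q (extend_ideal D q Ot (prd a0 (prd (bb C) (dd (\<Prod>S)))))) z"
      using F_eq[OF fr_prd[OF b'(1) ddS[OF S]]] by simp
    then show ?thesis using phi_sums[OF a0(1,2,4,5) b' _ z, of S] S by simp
  qed
  have tot: "(\<Sum>C\<in>?CG. \<Sum>S\<in>Pow PF. F (C \<otimes>\<^bsub>class_group D\<^esub> cls (dd (\<Prod>S)))) = 2 ^ card PF * (\<Sum>C\<in>?CG. F C)"
    by (subst sum.swap) (simp add: shift card_Pow)
  have "(\<lambda>m. \<Sum>C\<in>?CG. \<Sum>S\<in>Pow PF. of_nat (cnt a0 (bb C) na (nb C) S m) / 2 * exp (2 * of_real pi * \<i> * of_nat m * z)) sums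
    (\<Sum>C\<in>?CG. \<Sum>S\<in>Pow PF. F (C \<otimes>\<^bsub>class_group D\<^esub> cls (dd (\<Prod>S))))"
    by (intro sums_sum Fsums)
  moreover have "(\<Sum>C\<in>?CG. \<Sum>S\<in>Pow PF. of_nat (cnt a0 (bb C) na (nb C) S m) / 2 * exp (2 * of_real pi * \<i> * of_nat m * z)) =
    2 ^ card PF * (of_nat wu)\<^sup>2 / 2 * (of_real (b_coeff D pn (cls a) m) * exp (2 * of_real pi * \<i> * of_nat m * z))" for m
  proof -
    have "(\<Sum>C\<in>?CG. \<Sum>S\<in>Pow PF. of_nat (cnt a0 (bb C) na (nb C) S m) / 2 * exp (2 * of_real pi * \<i> * of_nat m * z)) =
      of_real (\<Sum>C\<in>?CG. \<Sum>S\<in>Pow PF. real (cnt a0 (bb C) na (nb C) S m)) * (exp (2 * of_real pi * \<i> * of_nat m * z) / 2)"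
      by (simp add: sum_distrib_right sum_divide_distrib)
    also have "(\<Sum>C\<in>?CG. \<Sum>S\<in>Pow PF. real (cnt a0 (bb C) na (nb C) S m)) = 2 ^ card PF * (real wu)\<^sup>2 * b_coeff D pn (cls a) m"
      using coefficient_identity[OF pn D0 pr a0(1,2,4,5) b] unfolding a0(3) .
    finally show ?thesis by simp
  qed
  ultimately have "(\<lambda>m. 2 ^ card PF * (of_nat wu)\<^sup>2 / 2 * (of_real (b_coeff D pn (cls a) m) * exp (2 * of_real pi * \<i> * of_nat m * z))) sums
    (2 ^ card PF * (\<Sum>C\<in>?CG. F C))" unfolding tot by (simp only:)
  then have "(\<lambda>m. 2 / (2 ^ card PF * (of_nat wu)\<^sup>2) * (2 ^ card PF * (of_nat wu)\<^sup>2 / 2 * (of_real (b_coeff D pn (cls a) m) * exp (2 * of_real pi * \<i> * of_nat m * z)))) sums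
    (2 / (2 ^ card PF * (of_nat wu)\<^sup>2) * (2 ^ card PF * (\<Sum>C\<in>?CG. F C)))" by (rule sums_mult)
  then have "(\<lambda>m. of_real (b_coeff D pn (cls a) m) * exp (2 * of_real pi * \<i> * of_nat m * z)) sums
    (2 / (of_nat wu)\<^sup>2 * (\<Sum>C\<in>?CG. F C))" using wu_pos by simp
  then have "g_series D pn (cls a) z = 2 / (of_nat wu)\<^sup>2 * (\<Sum>C\<in>?CG. F C)"
    unfolding g_series_def by (rule sums_unique[symmetric])
  \<comment> \<open>The numerator 2 undoes the factor 1/2 of the theta series, and \<open>wu\<close>
    is 2 u_D.\<close>
  also have "2 / (of_nat wu :: complex)\<^sup>2 = 1 / (2 * of_real (unit_half D) ^ 2)"
    unfolding wu_unit_half using wu_pos by (simp add: power_divide)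
  finally show ?thesis unfolding F_def .
qed

end

section \<open>The identity for the data of the statement\<close>

theorem corollary3p9:
  fixes p q :: nat and D :: int
    and D\<^sub>0_ideal p_ideal q_ideal a :: "complex set"
    and A :: "complex set set"
    and rep :: "complex set set \<Rightarrow> complex set"
    and z :: complex
  assumes "prime p" "p > 2"
    and "D < 0" "odd D" "fundamental_discriminant D" "int p dvd D"
    and "prime q" "\<not> int q dvd 2 * D" "Legendre (- int q) (int p) = - 1"
      "[int q = - 1] (mod D_zero D p)"
    and "nonzero_ideal D q_ideal" "ideal_norm D q_ideal = q"
    and "nonzero_ideal D D\<^sub>0_ideal" "ideal_norm D D\<^sub>0_ideal = nat \<bar>D_zero D p\<bar>"
    and "nonzero_ideal D p_ideal" "ideal_norm D p_ideal = p"
    and "nonzero_ideal D a" "ideal_class D a = A"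
    and "\<And>C. C \<in> carrier (class_group D) \<Longrightarrow> nonzero_ideal D (rep C) \<and> ideal_class D (rep C) = C"
    and "Im z > 0"
  defines "Ot \<equiv> O_tilde D q D\<^sub>0_ideal p_ideal q_ideal"
  shows "g_series D p A z =
    1 / (2 * of_real (unit_half D) ^ 2) *
      (\<Sum>C\<in>carrier (class_group D).
         phi D q (left_class D q (extend_ideal D q Ot (rep C)))
               (left_class D q (extend_ideal D q Ot (a \<otimes>\<^bsub>ideal_group D\<^esub> rep C))) z)"
proof -
  interpret imag_quad D by unfold_locales (use assms in auto)
  define E where "E = \<bar>D_zero D p\<bar>"
  \<comment> \<open>Whatever the sign of \<open>p_star p\<close>, this gives |D| = p |D_0|, which is
    all that the locale needs.\<close>
  have ps: "p_star p = int p \<or> p_star p = - int p"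
    using Legendre_minus_1[OF assms(1,2)] by (cases "even ((p - 1) div 2)") (auto simp: p_star_def)
  then have "p_star p dvd D" using assms(6) by auto
  then have "D = p_star p * D_zero D p" unfolding D_zero_def by simp
  then have "\<bar>D\<bar> = \<bar>p_star p\<bar> * E" unfolding E_def by (metis abs_mult)
  moreover have "\<bar>p_star p\<bar> = int p" using ps by auto
  ultimately have DE: "D = - (int p * E)" using assms(3) by simp
  have Epos: "E > 0" using DE assms(3) by (simp add: zero_less_mult_iff)
  have pD: "int p dvd D" "E dvd D" using DE by auto
  have ideals: "fr q_ideal" "q_ideal \<subseteq> OK" "fnorm q_ideal = real q" "fr a"
    "D\<^sub>0_ideal = dd E" "p_ideal = dd (int p)"
  proof -
    show "fr q_ideal" "q_ideal \<subseteq> OK" "fr a" using assms nonzero_ideal_iff by auto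
    show "fnorm q_ideal = real q" using ideal_norm_eq[OF assms(11)] assms(12) by simp
    \<comment> \<open>An integral ideal whose norm divides D is determined by that norm, so the
      given ideals are the explicit ones.\<close>
    show "D\<^sub>0_ideal = dd E"
      using ideal_norm_eq[OF assms(13)] assms(13,14) nonzero_ideal_iff Epos by (intro dd_unique pD) (auto simp: E_def)
    show "p_ideal = dd (int p)"
      using ideal_norm_eq[OF assms(15)] assms(15,16) nonzero_ideal_iff assms(2) by (intro dd_unique pD) auto
  qed
  have qE: "E dvd int q + 1" using assms(10) unfolding E_def by (simp add: cong_iff_dvd_diff)
  have qD: "coprime (int q) D"
    using assms(7,8) by (intro prime_imp_coprime) auto
  note order_eq = Ot_def
  interpret quat_order D q "int p" E q_ideal
    by unfold_locales (use DE assms(1,2,7) qE qD ideals prime_gt_0_nat in auto)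
  have rep: "fr (rep C) \<and> cls (rep C) = C" if "C \<in> carrier (class_group D)" for C
    using assms(19)[OF that] nonzero_ideal_iff unfolding cls_def by auto
  have "A = cls a" using assms(18) by (simp add: cls_def)
  then show ?thesis unfolding order_eq ideals(5,6) O_tilde_eq
    using theta_identity[OF refl E_def[symmetric] assms(1,2) ideals(4) rep assms(20)] by (simp add: idl_sel)
qed

end
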